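(* Let \[ N_*:=\min\bigl\{|\Lambda|:\ \Lambda\subset\mathbb R^2 \text{ finite},\ \exists\,0\ne f\in L^2(\mathbb R)\text{ such that the family }(W(z)f)_{z\in\Lambda}\text{ is linearly dependent over }\mathbb C\bigr\}. \] Then $N_*=4$. Moreover, the same minimum $4$ is obtained if $f$ is required to be a nonzero element of the Schwartz space $\mathcal S(\mathbb R)$.
   Context: For $(a,b)\in\mathbb R^2$, the Weyl time--frequency shift $W(a,b)$ is the operator on $L^2(\mathbb R)$ (complex-valued functions) given by \[ (W(a,b)f)(t)=e^{2\pi i b(t-a/2)}f(t-a). \] The family $(W(z)f)_{z\in\Lambda}$ is indexed by the (distinct) points $z$ of $\Lambda$; linear dependence means that some nontrivial complex linear combination vanishes in $L^2(\mathbb R)$. *)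

theory Defs
  imports "HOL-Analysis.Analysis"
begin

definition weyl_shift :: "real \<times> real \<Rightarrow> (real \<Rightarrow> complex) \<Rightarrow> real \<Rightarrow> complex" where
  "weyl_shift = (\<lambda>(a, b) f t. exp (\<i> * complex_of_real (2 * pi * b * (t - a / 2))) * f (t - a))"

text \<open>
  Elements of \<open>L\<^sup>2(\<real>)\<close> are represented by Borel functions, with equality almost everywhere as
  equality in \<open>L\<^sup>2(\<real>)\<close>. Every Lebesgue measurable function agrees almost everywhere with a Borel one.
\<close>

definition L2_real :: "(real \<Rightarrow> complex) set" where
  "L2_real = {f. f \<in> borel_measurable lborel \<and> integrable lborel (\<lambda>x. (cmod (f x))\<^sup>2)}"

definition L2_zero :: "(real \<Rightarrow> complex) \<Rightarrow> bool" where
  "L2_zero f \<longleftrightarrow> (AE x in lborel. f x = 0)"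

definition schwartz_space :: "(real \<Rightarrow> complex) set" where
  "schwartz_space = {f. \<exists>D :: nat \<Rightarrow> real \<Rightarrow> complex. D 0 = f
      \<and> (\<forall>k x. (D k has_vector_derivative D (Suc k) x) (at x))
      \<and> (\<forall>j k. bounded (range (\<lambda>x. x ^ j *\<^sub>R D k x)))}"

text \<open>
  The coefficients are indexed by the points of \<open>\<Lambda>\<close>, so that a coincidence of
  \<open>weyl_shift z f\<close> and \<open>weyl_shift w f\<close> for distinct points counts as a dependence.
  For infinite \<open>\<Lambda>\<close> the sum is a junk value; only finite \<open>\<Lambda>\<close> are considered below.
\<close>

definition weyl_dependent :: "(real \<Rightarrow> complex) \<Rightarrow> (real \<times> real) set \<Rightarrow> bool" where
  "weyl_dependent f \<Lambda> \<longleftrightarrow>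
     (\<exists>c :: real \<times> real \<Rightarrow> complex. (\<exists>z\<in>\<Lambda>. c z \<noteq> 0) \<and>
        L2_zero (\<lambda>t. \<Sum>z\<in>\<Lambda>. c z * weyl_shift z f t))"

text \<open>
  On \<^typ>\<open>nat\<close>, \<^const>\<open>Inf\<close> of a nonempty set is its minimum, and \<^const>\<open>Inf\<close> of the empty set
  is \<open>0\<close>. A positive value therefore entails that the minimum exists and is attained.
\<close>

definition min_dependent_card :: "(real \<Rightarrow> complex) set \<Rightarrow> nat" where
  "min_dependent_card F =
     Inf {card \<Lambda> | \<Lambda>. finite \<Lambda> \<and> (\<exists>f\<in>F. weyl_dependent f \<Lambda>)}"

definition N_star :: nat where
  "N_star = min_dependent_card {f \<in> L2_real. \<not> L2_zero f}"

definition N_star_schwartz :: nat where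
  "N_star_schwartz = min_dependent_card {f \<in> schwartz_space. f \<noteq> (\<lambda>_. 0)}"

end

theory Submission
  imports Defs "HOL-Complex_Analysis.Complex_Analysis" "HOL-Probability.Probability"
begin

text \<open>
  Four dependent shifts. On the Zak side a three-term operator \<open>R\<close> with shift vectors close to
  \<open>(-1/6, -1/3)\<close> has a cube \<open>H\<close> that acts, over each pair of points \<open>t\<close>, \<open>t - 1/2\<close>, as a transfer matrix of
  skew-product type over the small translation by \<open>(a, b)\<close>. At \<open>a = b = 0\<close> these matrices are uniformly
  dominated, so for small \<open>(a, b)\<close> they have a holomorphic invariant line field; a theta function shows
  that the corresponding line bundle is trivial with the right quasi-periodicity. This yields a section
  \<open>\<phi>\<close> with \<open>H \<phi> = q \<phi>\<close> and \<open>Re q > 0\<close>. For \<open>(a, b) = (\<surd>2, \<surd>3) / K\<close> the small divisors are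
  polynomially bounded, so \<open>log q\<close> is cohomologous to a constant, and \<open>\<phi>\<close> can be corrected to an
  eigenfunction of \<open>H\<close>. Integrating over the frequency variable gives an exponentially decaying
  holomorphic eigenfunction of the cube of an operator on the line, hence one of the operator itself.

  Three independent shifts. If two of the points share their time coordinate, then \<open>p |f|\<^sup>2\<close> is a
  constant multiple of a proper translate of \<open>|f|\<^sup>2\<close>, with \<open>p\<close> periodic and nonzero almost everywhere. The quotient of
  \<open>|f|\<^sup>2\<close> by its periodization is then translation invariant and integrable, so it vanishes. The general case
  reduces to this one by a chirp and a Fourier transform.
\<close>

section \<open>The operator on the Zak side\<close>

text \<open>A continuous quasi-periodic function on the real plane always has zeros, so no single
  function can carry the argument; the pair of its values at \<open>t\<close> and
  \<open>t - 1/2\<close> can avoid 0. This dictates the shift: three steps of (-1/6, -1/3) make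
  (-1/2, -1), which swaps the members of the pair and is a full period in \<open>x\<close>. The
  phases \<open>c1\<close>, \<open>c2\<close> give the resulting 2 by 2 matrix the constant trace 6
  sqrt 3 while its determinant has modulus at most 6; this is the whole source of domination. Two
  topological obstructions remain: the dominant line field might have no global section of the
  required quasi-periodicity, and the multiplier q of a section might wind around 0. The image of
  the theta pair under one cube removes both. Its angle with every line of the field stays away from
  a right angle, so pairing with it normalizes sections, and with this normalization q stays within
  2 of 6 sqrt 3. Joint irrationality of (a, b) enters only when log q is straightened to a
  constant.\<close>

definition ee :: "complex \<Rightarrow> complex" where "ee z = exp (2 * of_real pi * \<i> * z)"

lemma ee_add: "ee (a + b) = ee a * ee b"
  by (simp add: ee_def exp_add algebra_simps)

lemma ee_diff: "ee (a - b) = ee a * ee (- b)"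
  by (metis ee_add uminus_add_conv_diff add.commute)

lemma ee_0 [simp]: "ee 0 = 1" by (simp add: ee_def)

lemma ee_minus: "ee (- a) = inverse (ee a)"
  by (simp add: ee_def exp_minus)

lemma ee_nonzero [simp]: "ee a \<noteq> 0" by (simp add: ee_def)

lemma ee_int [simp]: "ee (of_int n) = 1"
  unfolding ee_def using exp_integer_2pi[of "of_int n"] by (simp add: mult_ac)

lemma ee_1 [simp]: "ee 1 = 1" using ee_int[of 1] by simp

lemma ee_half [simp]: "ee (1 / 2) = -1"
  by (simp add: ee_def)

lemma ee_power: "ee a ^ n = ee (of_nat n * a)"
  by (simp add: ee_def exp_of_nat_mult[symmetric] mult_ac)

lemma norm_ee: "norm (ee z) = exp (- 2 * pi * Im z)"
  by (simp add: ee_def norm_exp_eq_Re)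

lemma norm_ee_of_real [simp]: "norm (ee (of_real x)) = 1"
  by (simp add: norm_ee)

lemma cnj_ee: "cnj (ee z) = ee (- cnj z)"
  by (simp add: ee_def exp_cnj)

lemma ee_12: "ee (1 / 12) = (of_real (sqrt 3) + \<i>) / 2"
proof -
  have "ee (1/12) = cis (pi / 6)"
    unfolding ee_def cis_conv_exp by (simp add: field_simps)
  then show ?thesis by (simp add: complex_eq_iff cos_30 sin_30)
qed

text \<open>The phases are fixed by what the cube does with them: \<open>c1\<close>^2
  \<open>c2\<close> = 1, \<open>c1\<close> \<open>c2\<close>^2 = e(1/12) and \<open>c2\<close>^3 =
  e(1/6). All coefficients at a = b = 0 then lie in the ring generated by a twelfth root of unity,
  and the diagonal entry gets the real constant term 3 sqrt 3.\<close>

definition c1 :: complex where "c1 = ee (- (1/36))"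
definition c2 :: complex where "c2 = ee (1/18)"

text \<open>The Zak transform sum_k f(t + k) e(-k x) turns translation by \<alpha> into a shift of
  \<open>t\<close>, and modulation by \<beta> into the factor e(\<beta> t) together with a shift of
  \<open>x\<close>. So this is the image of a combination of the time-frequency shifts by (\<alpha>,
  \<beta>), (\<alpha>, \<beta> + 1) and (\<alpha> + 1/2, \<beta>); on the line it appears again as
  \<open>rop\<close>.\<close>

definition Rop :: "real \<Rightarrow> real \<Rightarrow> (complex \<Rightarrow> complex \<Rightarrow> complex) \<Rightarrow> complex \<Rightarrow> complex \<Rightarrow> complex" where
  "Rop \<alpha> \<beta> G t x = ee (of_real \<beta> * t) * ((c1 + c2 * ee t) * G (t - of_real \<alpha>) (x - of_real \<beta>)
      + c2 * G (t - of_real \<alpha> - 1/2) (x - of_real \<beta>))"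

definition quasi_periodic :: "(complex \<Rightarrow> complex \<Rightarrow> complex) \<Rightarrow> bool" where
  "quasi_periodic G \<longleftrightarrow> (\<forall>t x. G (t + 1) x = ee x * G t x) \<and> (\<forall>t x. G t (x + 1) = G t x)"

lemma quasi_periodicD:
  assumes "quasi_periodic G"
  shows "G (t + 1) x = ee x * G t x" "G t (x + 1) = G t x" "G (t - 1) x = ee (- x) * G t x"
    "G (t + 1/2) x = ee x * G (t - 1/2) x"
proof -
  show 1: "G (t + 1) x = ee x * G t x" for t x using assms by (auto simp: quasi_periodic_def)
  show "G t (x + 1) = G t x" using assms by (auto simp: quasi_periodic_def)
  show "G (t - 1) x = ee (- x) * G t x" using 1[of "t - 1" x] by (simp add: ee_minus field_simps)
  show "G (t + 1/2) x = ee x * G (t - 1/2) x" using 1[of "t - 1/2" x] by (simp add: algebra_simps)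
qed

lemma quasi_periodic_Rop:
  assumes "quasi_periodic G" shows "quasi_periodic (Rop \<alpha> \<beta> G)"
proof -
  have 1: "G (t + 1 - a) x = ee x * G (t - a) x" for t a x
    using quasi_periodicD(1)[OF assms, of "t - a" x] by (simp add: algebra_simps)
  have q1: "G (t + 1 - a - b) x = ee x * G (t - a - b) x" for t a b x
    using quasi_periodicD(1)[OF assms, of "t - a - b" x] by (simp add: algebra_simps)
  have 2: "G t (x + 1 - b) = G t (x - b)" for t x b
    using quasi_periodicD(2)[OF assms, of t "x - b"] by (simp add: algebra_simps)
  have 3: "ee (x - b) = ee x * inverse (ee b)" for x b by (metis ee_diff ee_minus)
  show ?thesis unfolding quasi_periodic_def Rop_def 1 q1 2
    by (auto simp: ee_add distrib_left 3 field_simps)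
qed

definition Hop :: "real \<Rightarrow> real \<Rightarrow> (complex \<Rightarrow> complex \<Rightarrow> complex) \<Rightarrow> complex \<Rightarrow> complex \<Rightarrow> complex" where
  "Hop a b G = Rop (a/3 - 1/6) (b/3 - 1/3) (Rop (a/3 - 1/6) (b/3 - 1/3) (Rop (a/3 - 1/6) (b/3 - 1/3) G))"

lemma quasi_periodic_Hop: "quasi_periodic G \<Longrightarrow> quasi_periodic (Hop a b G)"
  by (simp add: Hop_def quasi_periodic_Rop)

text \<open>The cube expands into eight words. A word with j half steps shifts \<open>t\<close> by a
  - 1/2 + j/2, which modulo 1 is a for odd j and a - 1/2 for even j; \<open>Pc\<close> collects j =
  1, 3 and \<open>Qc\<close> collects j = 0, 2. The factors \<open>ee (of_real b - x)\<close> and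
  \<open>ee (x - of_real b)\<close> come from the full period in \<open>t\<close> picked up for j =
  3 and for j = 0.\<close>

definition Pc :: "real \<Rightarrow> real \<Rightarrow> complex \<Rightarrow> complex \<Rightarrow> complex" where
  "Pc a b t x = (let \<alpha> = of_real (a/3 - 1/6); \<beta> = of_real (b/3 - 1/3) in
     ee (- t - 3 * \<beta> * \<alpha>) *
      (c2 * ((c1 - c2 * ee (t - \<alpha>)) * (c1 - c2 * ee (t - 2*\<alpha>)) * ee (- \<beta>)
          + (c1 + c2 * ee t) * (c1 - c2 * ee (t - 2*\<alpha>)) * ee (- (\<beta>/2))
          + (c1 + c2 * ee t) * (c1 + c2 * ee (t - \<alpha>)))
        + c2^3 * ee (- (3/2 * \<beta>)) * ee (of_real b - x)))"

definition Qc :: "real \<Rightarrow> real \<Rightarrow> complex \<Rightarrow> complex \<Rightarrow> complex" where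
  "Qc a b t x = (let \<alpha> = of_real (a/3 - 1/6); \<beta> = of_real (b/3 - 1/3) in
     ee (- t - 3 * \<beta> * \<alpha>) *
      ((c1 + c2 * ee t) * (c1 + c2 * ee (t - \<alpha>)) * (c1 + c2 * ee (t - 2*\<alpha>)) * ee (x - of_real b)
        + c2^2 * ((c1 + c2 * ee (t - 2*\<alpha>)) * ee (- (3/2 * \<beta>))
                + (c1 - c2 * ee (t - \<alpha>)) * ee (- \<beta>)
                + (c1 + c2 * ee t) * ee (- (\<beta>/2)))))"

lemma Hop_eq:
  assumes "quasi_periodic G"
  shows "Hop a b G t x = ee (of_real b * t) *
     (Pc a b t x * G (t - of_real a) (x - of_real b) + Qc a b t x * G (t - of_real a - 1/2) (x - of_real b))"
proof -
  define \<alpha> :: complex where "\<alpha> = of_real (a/3 - 1/6)"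
  define \<beta> :: complex where "\<beta> = of_real (b/3 - 1/3)"
  have a: "of_real a = 3 * \<alpha> + 1/2" and b: "of_real b = 3 * \<beta> + 1" by (auto simp: \<alpha>_def \<beta>_def)
  define y where "y = x - of_real b"
  have y: "x - \<beta> - \<beta> - \<beta> = y + 1" by (simp add: y_def b)
  have xb: "x - of_real b = y" by (simp add: y_def)
  have xn: "of_real b - x = - y" by (simp add: y_def)
  define g0 where "g0 = G (t - of_real a) y"
  define g1 where "g1 = G (t - of_real a - 1/2) y"
  note qp = quasi_periodicD[OF assms]
  have G0: "G (t - \<alpha> - \<alpha> - \<alpha>) y = ee y * g1"
    using qp(1)[of "t - of_real a - 1/2" y] unfolding g1_def a by (simp add: algebra_simps)
  have G1: "G (t - \<alpha> - \<alpha> - \<alpha> - 1/2) y = g0"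
    unfolding g0_def a by (simp add: algebra_simps)
  have G2: "G (t - \<alpha> - \<alpha> - \<alpha> - 1) y = g1"
    unfolding g1_def a by (simp add: algebra_simps)
  have G3: "G (t - \<alpha> - \<alpha> - \<alpha> - 3/2) y = ee (-y) * g0"
    using qp(3)[of "t - of_real a" y] unfolding g0_def a by (simp add: algebra_simps)
  have arg: "t - \<alpha> - 1/2 - \<alpha> - \<alpha> = t - \<alpha> - \<alpha> - \<alpha> - 1/2" "t - \<alpha> - \<alpha> - 1/2 - \<alpha> = t - \<alpha> - \<alpha> - \<alpha> - 1/2"
    "t - \<alpha> - 1/2 - \<alpha> - 1/2 - \<alpha> = t - \<alpha> - \<alpha> - \<alpha> - 1"
    "t - \<alpha> - \<alpha> - \<alpha> - 1/2 - 1/2 = t - \<alpha> - \<alpha> - \<alpha> - 1"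
    "t - \<alpha> - \<alpha> - \<alpha> - 1 - 1/2 = t - \<alpha> - \<alpha> - \<alpha> - 3/2" by (simp_all add: algebra_simps)
  have E1: "ee (t - 1/2) = - ee t" "ee (t - \<alpha> - 1/2) = - ee (t - \<alpha>)" "ee (t - \<alpha> - 1/2 - \<alpha>) = - ee (t - \<alpha> - \<alpha>)"
    "ee (t - \<alpha> - \<alpha> - 1/2) = - ee (t - \<alpha> - \<alpha>)" "ee (t - \<alpha> - 1/2 - \<alpha> - 1/2) = ee (t - \<alpha> - \<alpha>)" for t
    by (simp_all add: ee_diff ee_minus)
  \<comment> \<open>All exponentials containing \<beta> become monomials in \<open>Z\<close>,
    \<open>B\<close> and \<open>C\<close>, so the expansion of the cube is a polynomial
    identity.\<close>
  define Z where "Z = ee (\<beta> * t)"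
  define B where "B = ee (- (\<beta> / 2))"
  define C where "C = ee (- (\<beta> * \<alpha>))"
  have B2: "ee (- \<beta>) = B^2" "ee (- (3/2*\<beta>)) = B^3" unfolding B_def ee_power by (simp_all add: field_simps)
  have Zs: "ee (\<beta> * (t - \<alpha>)) = Z * C" "ee (\<beta> * (t - \<alpha> - 1/2)) = Z * C * B"
    "ee (\<beta> * (t - \<alpha> - \<alpha>)) = Z * C^2" "ee (\<beta> * (t - \<alpha> - 1/2 - \<alpha>)) = Z * C^2 * B"
    "ee (\<beta> * (t - \<alpha> - \<alpha> - 1/2)) = Z * C^2 * B" "ee (\<beta> * (t - \<alpha> - 1/2 - \<alpha> - 1/2)) = Z * C^2 * B^2"
    unfolding Z_def B_def C_def ee_power ee_add[symmetric] by (simp_all add: algebra_simps)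
  have pre: "ee (of_real b * t) * ee (- t - 3 * \<beta> * \<alpha>) = Z^3 * C^3"
    unfolding Z_def C_def ee_power ee_add[symmetric] b by (simp add: algebra_simps)
  have 2: "t - 2 * \<alpha> = t - \<alpha> - \<alpha>" by simp
  define T0 where "T0 = ee t"
  define T1 where "T1 = ee (t - \<alpha>)"
  define T2 where "T2 = ee (t - \<alpha> - \<alpha>)"
  have "Hop a b G t x = Z^3*C^3 * ((c2 * ((c1 - c2 * ee (t - \<alpha>)) * (c1 - c2 * ee (t - 2*\<alpha>)) * B^2
          + (c1 + c2 * ee t) * (c1 - c2 * ee (t - 2*\<alpha>)) * B
          + (c1 + c2 * ee t) * (c1 + c2 * ee (t - \<alpha>)))
        + c2^3 * B^3 * ee (- y)) * g0
    + ((c1 + c2 * ee t) * (c1 + c2 * ee (t - \<alpha>)) * (c1 + c2 * ee (t - 2*\<alpha>)) * ee y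
        + c2^2 * ((c1 + c2 * ee (t - 2*\<alpha>)) * B^3
                + (c1 - c2 * ee (t - \<alpha>)) * B^2
                + (c1 + c2 * ee t) * B)) * g1)"
    unfolding Hop_def Rop_def \<alpha>_def[symmetric] \<beta>_def[symmetric] arg y qp(2) G0 G1 G2 G3 Zs E1 Z_def[symmetric] 2
    unfolding T0_def[symmetric] T1_def[symmetric] T2_def[symmetric]
    by algebra
  also have "\<dots> = ee (of_real b * t) * (Pc a b t x * g0 + Qc a b t x * g1)"
    unfolding Pc_def Qc_def Let_def \<alpha>_def[symmetric] \<beta>_def[symmetric] B2 xb xn B_def[symmetric]
    unfolding pre[symmetric] by algebra
  finally show ?thesis by (simp add: g0_def g1_def y_def)
qed


definition A0 :: "complex \<Rightarrow> complex \<Rightarrow> complex" where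
  "A0 t x = 3 * of_real (sqrt 3) + 2 * ee t + 2 * ee (- t) - ee (- t - x)"

definition B0 :: "complex \<Rightarrow> complex \<Rightarrow> complex" where
  "B0 t x = 2 + 2 * \<i> * ee (- t) + ee x * (2 + 2 * \<i> * ee t - \<i> * ee (- t) - ee t ^ 2)"

text \<open>A primitive twelfth root of unity satisfies y^4 = y^2 - 1, y^3 = i and y + 1/y = sqrt 3.
  The powers are kept as products involving \<open>y ^ 2\<close> so that the square can later be
  replaced by a single symbol.\<close>

lemma ee_12_facts:
  defines "y \<equiv> ee (1/12)"
  shows "y ^ 2 * y ^ 2 = y ^ 2 - 1" "y * y ^ 2 = \<i>" "of_real (sqrt 3) = 2 * y - \<i>"
proof -
  have y: "y = (of_real (sqrt 3) + \<i>) / 2" using ee_12 by (simp add: y_def)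
  have s3: "(of_real (sqrt 3) :: complex)^2 = 3"
    by (metis of_real_power of_real_numeral real_sqrt_pow2 zero_le_numeral)
  have s3': "of_real (sqrt 3) * of_real (sqrt 3) = (3 :: complex)" using s3 by (simp only: power2_eq_square)
  have s4: "of_real (sqrt 3) * (of_real (sqrt 3) * w) = 3 * w" for w :: complex by (simp only: mult.assoc[symmetric] s3')
  have y2: "y^2 = (1 + of_real (sqrt 3) * \<i>) / 2"
    unfolding y by (simp add: power_divide power2_sum s3)
  show "y ^ 2 * y ^ 2 = y ^ 2 - 1"
    unfolding power2_eq_square[of "y^2", symmetric] y2 power_divide power2_sum power_mult_distrib s3
    using s3' s4 by (simp add: field_simps power2_eq_square)
  have "y * y ^ 2 = (of_real (sqrt 3) + (of_real (sqrt 3))^2 * \<i> + \<i> - of_real (sqrt 3)) / 4"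
    unfolding y2 y using s3' s4 by (simp add: field_simps power2_eq_square)
  then show "y * y ^ 2 = \<i>" unfolding s3 by simp
  show "of_real (sqrt 3) = 2 * y - \<i>" unfolding y by (simp add: field_simps)
qed

lemma base_consts:
  defines "y \<equiv> ee (1/12)"
  shows "c1 * c1 * c1 = y - y * y\<^sup>2" "c1 * c1 * c2 = 1" "c1 * c2 * c2 = y" "c2 * c2 * c2 = y\<^sup>2"
    "ee (1/6) = y\<^sup>2" "ee (1/3) = y\<^sup>2 - 1" "ee (- (1/6)) = 1 - y\<^sup>2" 
proof -
  note f = ee_12_facts[folded y_def]
  have y2: "ee (1/6) = y\<^sup>2" unfolding y_def ee_power by simp
  then show "ee (1/6) = y\<^sup>2" .
  have "y\<^sup>2 * y\<^sup>2 = ee (1/3)" unfolding y_def ee_power ee_add[symmetric] by simp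
  with f(1) show "ee (1/3) = y\<^sup>2 - 1" by simp
  have inv: "inverse a = b" if "a * b = 1" for a b :: complex using that by (simp add: inverse_unique)
  show "ee (- (1/6)) = 1 - y\<^sup>2" unfolding ee_minus y2 by (rule inv) (simp only: right_diff_distrib f(1), simp)
  show "c1 * c1 * c2 = 1" "c1 * c2 * c2 = y" "c2 * c2 * c2 = y\<^sup>2"
    unfolding c1_def c2_def y_def ee_power ee_add[symmetric] by simp_all
  have "c1 * c1 * c1 = ee (- (1/12))" unfolding c1_def ee_add[symmetric] by simp
  also have "\<dots> = inverse y" by (simp add: ee_minus y_def)
  also have "\<dots> = y - y * y\<^sup>2"
  proof (rule inv)
    have "y * (y - y * y\<^sup>2) = y\<^sup>2 - y\<^sup>2 * y\<^sup>2" by algebra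
    then show "y * (y - y * y\<^sup>2) = 1" unfolding f(1) by simp
  qed
  finally show "c1 * c1 * c1 = y - y * y\<^sup>2" .
qed

text \<open>After the monomials in \<open>c1\<close>, \<open>c2\<close> are evaluated, everything is
  polynomial in \<open>y\<close> and \<open>Y\<close> = y^2 with Y^2 = Y - 1. The penultimate form
  is arranged around \<open>Y - Y * Y\<close> and \<open>1 - Y * Y\<close>, which this relation
  turns into 1 and 2 - Y; the constant term is then 3 (2 y - y^3) = 3 sqrt 3.\<close>

lemma Pc_base: "Pc 0 0 t x = A0 t x"
proof -
  define y where "y = ee (1/12)"
  define Y where "Y = y\<^sup>2"
  define u where "u = ee t"
  define u' where "u' = ee (- t)"
  define v where "v = ee (- x)"
  have uu: "u' * u = 1" by (simp add: u_def u'_def ee_minus)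
  note f = ee_12_facts[folded y_def] and c = base_consts[folded y_def]
  note f = f[folded Y_def] and c = c[folded Y_def]
  have e: "ee (- t - 1/6) = u' * (1 - Y)" "ee (t + 1/6) = u * Y" "ee (t + 1/3) = u * (Y - 1)"
    "ee (- t - x) = u' * v"
    using c by (simp_all add: u_def u'_def v_def ee_diff ee_add)
  have "Pc 0 0 t x = u' * (1 - Y) *
      (c2 * ((c1 - c2 * (u * Y)) * (c1 - c2 * (u * (Y - 1))) * (Y - 1)
          + (c1 + c2 * u) * (c1 - c2 * (u * (Y - 1))) * Y
          + (c1 + c2 * u) * (c1 + c2 * (u * Y)))
        - c2 * c2 * c2 * v)"
    unfolding Pc_def Let_def by (simp add: c e u_def[symmetric] v_def[symmetric] power3_eq_cube)
  also have "\<dots> = (1 - Y) * (u' * (c1 * c1 * c2) * (2 * Y)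
     + (u' * u) * (c1 * c2 * c2) * (1 + Y + Y * (2 - Y) - (Y - 1) * (2 * Y - 1))
     + (u' * u) * u * (c2 * c2 * c2) * (Y * (Y - 1) * (Y - 1) - Y * (Y - 1) + Y) - u' * v * (c2 * c2 * c2))"
    by algebra
  also have "\<dots> = (1 - Y) * (u' * (2 * Y) + y * (1 + Y + Y * (2 - Y) - (Y - 1) * (2 * Y - 1))
     + u * Y * (Y * (Y - 1) * (Y - 1) - Y * (Y - 1) + Y) - u' * v * Y)"
    unfolding c uu by simp
  also have "\<dots> = u' * (2 * (Y - Y * Y)) + y * (3 * (1 - Y * Y)) + u * (2 * (Y - Y * Y)) - u' * v * (Y - Y * Y)"
    using f(1) by algebra
  also have "\<dots> = 2 * u' + 3 * (2 * y - y * Y) + 2 * u - u' * v"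
    unfolding f(1) by (simp add: algebra_simps)
  finally show ?thesis unfolding A0_def e f(2,3) by (simp add: u_def u'_def)
qed

lemma Qc_base: "Qc 0 0 t x = B0 t x"
proof -
  define y where "y = ee (1/12)"
  define Y where "Y = y\<^sup>2"
  define u where "u = ee t"
  define u' where "u' = ee (- t)"
  define v where "v = ee x"
  have uu: "u' * u = 1" by (simp add: u_def u'_def ee_minus)
  note f = ee_12_facts[folded y_def] and c = base_consts[folded y_def]
  note f = f[folded Y_def] and c = c[folded Y_def]
  have e: "ee (- t - 1/6) = u' * (1 - Y)" "ee (t + 1/6) = u * Y" "ee (t + 1/3) = u * (Y - 1)"
    using c by (simp_all add: u_def u'_def v_def ee_diff ee_add)
  have "Qc 0 0 t x = u' * (1 - Y) *
      ((c1 + c2 * u) * (c1 + c2 * (u * Y)) * (c1 + c2 * (u * (Y - 1))) * v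
        + c2 * c2 * (- (c1 + c2 * (u * (Y - 1)))
                + (c1 - c2 * (u * Y)) * (Y - 1)
                + (c1 + c2 * u) * Y))"
    unfolding Qc_def Let_def by (simp add: c e u_def[symmetric] v_def[symmetric] power2_eq_square)
  also have "\<dots> = (1 - Y) * (v * (u' * (c1 * c1 * c1) + (u' * u) * (c1 * c1 * c2) * (2 * Y)
       + (u' * u) * u * (c1 * c2 * c2) * (2 * Y - 1 + Y * (Y - 1)) + (u' * u) * u * u * (c2 * c2 * c2) * (Y * (Y - 1)))
      + u' * (c1 * c2 * c2) * (2 * Y - 2) + (u' * u) * (c2 * c2 * c2) * (1 - Y * (Y - 1)))"
    by algebra
  also have "\<dots> = (1 - Y) * (v * (u' * (y - y * Y) + 2 * Y
       + u * y * (2 * Y - 1 + Y * (Y - 1)) + u * u * Y * (Y * (Y - 1)))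
      + u' * y * (2 * Y - 2) + Y * (1 - Y * (Y - 1)))"
    unfolding c uu by simp
  also have "\<dots> = v * (u' * (y * (1 - 2 * Y + Y * Y)) + 2 * (Y - Y * Y)
       + u * (- 2 * y * (1 - 2 * Y + Y * Y)) - u * u * (Y - Y * Y))
      + u' * (- 2 * y * (1 - 2 * Y + Y * Y)) + 2 * (Y - Y * Y)"
    using f(1) by algebra
  also have "\<dots> = v * (2 - u' * (y * Y) + 2 * (u * (y * Y)) - u * u) + 2 * (u' * (y * Y)) + 2"
    unfolding f(1) by (simp add: algebra_simps)
  finally show ?thesis unfolding B0_def e f(2) by (simp add: u_def u'_def v_def algebra_simps power2_eq_square)
qed

definition D0 :: "complex \<Rightarrow> complex \<Rightarrow> complex" where
  "D0 t x = A0 t x * A0 (t - 1/2) x - B0 t x * (ee (- x) * B0 (t - 1/2) x)"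

text \<open>All exponentials in \<open>A0\<close> are odd in e(t) and cancel against their values
  half a period away, so the trace of the unperturbed matrix is constant. Since \<open>D0\<close>
  has modulus at most 6 on real points, the two roots of z^2 - 6 sqrt 3 z + D0 never have equal
  modulus: their sum would then be at most 2 sqrt 6.\<close>

lemma A0_trace: "A0 t x + A0 (t - 1/2) x = 6 * of_real (sqrt 3)"
proof -
  have "ee (t - 1/2) = - ee t" "ee (- (t - 1/2)) = - ee (- t)" "ee (- (t - 1/2) - x) = - ee (- t - x)"
    by (simp_all add: ee_diff ee_minus ee_add[of _ "1/2", simplified])
  then show ?thesis by (simp add: A0_def)
qed

text \<open>Only four terms of the expanded determinant survive, and on real arguments their moduli
  add up to 3 + 1 + 1 + 1. This is the origin of the bound 6.\<close>

lemma D0_eq: "D0 t x = 3 - ee x * ee (- t) ^ 2 - ee x * ee t ^ 4 - ee (- x) ^ 2 * ee (- t) ^ 2"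
proof -
  define s where "s = (of_real (sqrt 3) :: complex)"
  have s: "s^2 = 3" unfolding s_def by (metis of_real_power of_real_numeral real_sqrt_pow2 zero_le_numeral)
  define u where "u = ee t"
  define u' where "u' = ee (- t)"
  define v where "v = ee x"
  define v' where "v' = ee (- x)"
  have uu: "u * u' = 1" "v * v' = 1" by (simp_all add: u_def u'_def v_def v'_def ee_minus)
  have i2: "\<i>^2 = -1" by simp
  have e: "ee (t - 1/2) = - u" "ee (- (t - 1/2)) = - u'" "ee (- (t - 1/2) - x) = - u' * v'" "ee (- t - x) = u' * v'"
    by (simp_all add: ee_diff ee_minus ee_add[of _ "1/2", simplified] u_def u'_def v'_def)
  show ?thesis unfolding D0_def A0_def B0_def e u_def[symmetric] u'_def[symmetric] v_def[symmetric] v'_def[symmetric] s_def[symmetric]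
    using uu i2 s by algebra
qed

section \<open>The two-dimensional transfer matrices\<close>

text \<open>The common source of the perturbation estimates: \<open>p\<close> is a real base point,
  while imaginary parts and small parameters are collected in \<sigma>. At \<sigma> = 0 the explicit
  bounds hold, and uniform continuity on \<open>K\<close> times a closed ball makes the
  neighbourhood independent of \<open>p\<close>.\<close>

lemma unif_close:
  fixes F :: "'p::metric_space \<Rightarrow> 's::euclidean_space \<Rightarrow> 'c::metric_space"
  assumes "continuous_on UNIV (\<lambda>(p, \<sigma>). F p \<sigma>)" "compact K" "0 < \<delta>"
  shows "\<exists>\<rho>>0. \<forall>p\<in>K. \<forall>\<sigma>. norm \<sigma> < \<rho> \<longrightarrow> dist (F p \<sigma>) (F p 0) < \<delta>"
proof -
  have "compact (K \<times> cball (0::'s) 1)" using assms(2) by (intro compact_Times) auto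
  moreover have "continuous_on (K \<times> cball (0::'s) 1) (\<lambda>(p, \<sigma>). F p \<sigma>)"
    using assms(1) continuous_on_subset by blast
  ultimately have "uniformly_continuous_on (K \<times> cball (0::'s) 1) (\<lambda>(p, \<sigma>). F p \<sigma>)"
    by (rule compact_uniformly_continuous[rotated])
  then obtain d where d: "d > 0" "\<And>q q'. q \<in> K \<times> cball (0::'s) 1 \<Longrightarrow> q' \<in> K \<times> cball (0::'s) 1 \<Longrightarrow> dist q' q < d \<Longrightarrow>
      dist ((\<lambda>(p, \<sigma>). F p \<sigma>) q') ((\<lambda>(p, \<sigma>). F p \<sigma>) q) < \<delta>"
    using assms(3) unfolding uniformly_continuous_on_def by metis
  show ?thesis
  proof (intro exI[of _ "min d 1"] conjI ballI allI impI)
    show "0 < min d 1" using d by simp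
    fix p and \<sigma> :: 's assume "p \<in> K" "norm \<sigma> < min d 1"
    then show "dist (F p \<sigma>) (F p 0) < \<delta>"
      using d(2)[of "(p, 0)" "(p, \<sigma>)"] by (auto simp: dist_Pair_Pair dist_norm)
  qed
qed

section \<open>Inner product, wedge product and matrices on C^2\<close>

type_synonym vec2 = "complex \<times> complex"

definition mapp :: "complex \<times> complex \<times> complex \<times> complex \<Rightarrow> vec2 \<Rightarrow> vec2" where
  "mapp = (\<lambda>(a, b, c, d) v. (a * fst v + b * snd v, c * fst v + d * snd v))"

definition cscale :: "complex \<Rightarrow> vec2 \<Rightarrow> vec2" (infixr "*\<^sub>C" 75) where
  "c *\<^sub>C v = (c * fst v, c * snd v)"

definition cin :: "vec2 \<Rightarrow> vec2 \<Rightarrow> complex" where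
  "cin v w = fst v * cnj (fst w) + snd v * cnj (snd w)"

definition wdg :: "vec2 \<Rightarrow> vec2 \<Rightarrow> complex" where
  "wdg v w = fst v * snd w - snd v * fst w"

lemma norm_vec2: "norm (v :: vec2) = sqrt ((norm (fst v))\<^sup>2 + (norm (snd v))\<^sup>2)"
  by (cases v) (simp add: norm_Pair)

lemma norm_fst_vec2: "norm (fst (v :: vec2)) \<le> norm v" by (metis norm_fst_le prod.collapse)
lemma norm_snd_vec2: "norm (snd (v :: vec2)) \<le> norm v" by (metis norm_snd_le prod.collapse)

lemma norm_vec2_le: "norm (v :: vec2) \<le> norm (fst v) + norm (snd v)"
  by (cases v) (simp add: norm_Pair_le)

lemma norm_cscale [simp]: "norm (c *\<^sub>C v) = norm c * norm v"
  by (simp add: norm_vec2 cscale_def norm_mult power_mult_distrib distrib_left[symmetric] real_sqrt_mult)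

lemma cscale_add: "c *\<^sub>C (v + w) = c *\<^sub>C v + c *\<^sub>C w" and cscale_diff: "c *\<^sub>C (v - w) = c *\<^sub>C v - c *\<^sub>C w"
  and cscale_cscale: "c *\<^sub>C d *\<^sub>C v = (c * d) *\<^sub>C v" and cscale_1 [simp]: "1 *\<^sub>C v = v"
  by (auto simp: cscale_def prod_eq_iff algebra_simps)

lemma mapp_cscale: "mapp M (c *\<^sub>C v) = c *\<^sub>C mapp M v"
  by (cases M) (simp add: cscale_def mapp_def algebra_simps)

lemma mapp_add: "mapp M (v + w) = mapp M v + mapp M w"
  by (cases M) (simp add: mapp_def algebra_simps)

lemma mapp_diff_left: "mapp (M - N) v = mapp M v - mapp N v"
  by (cases M; cases N) (simp add: mapp_def algebra_simps)

text \<open>Cosine squared plus sine squared for the angle between two complex lines. It trades a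
  small wedge, which determinants control, for a lower bound on the inner product.\<close>

lemma lagrange_vec2: "(norm (cin v w))\<^sup>2 + (norm (wdg v w))\<^sup>2 = (norm v)\<^sup>2 * (norm w)\<^sup>2"
proof -
  obtain a b where v: "v = (a, b)" by (cases v)
  obtain c d where w: "w = (c, d)" by (cases w)
  have "complex_of_real ((norm (cin v w))\<^sup>2 + (norm (wdg v w))\<^sup>2) = complex_of_real ((norm v)\<^sup>2 * (norm w)\<^sup>2)"
    by (simp add: v w cin_def wdg_def norm_Pair complex_norm_square del: of_real_power) (simp add: algebra_simps)
  then show ?thesis using of_real_eq_iff by blast
qed

lemma norm_cin_le: "norm (cin v w) \<le> norm v * norm w"
proof (rule power2_le_imp_le)
  show "(norm (cin v w))\<^sup>2 \<le> (norm v * norm w)\<^sup>2"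
    unfolding power_mult_distrib lagrange_vec2[of v w, symmetric] by simp
qed simp

lemma norm_wdg_le: "norm (wdg v w) \<le> norm v * norm w"
proof (rule power2_le_imp_le)
  show "(norm (wdg v w))\<^sup>2 \<le> (norm v * norm w)\<^sup>2"
    unfolding power_mult_distrib lagrange_vec2[of v w, symmetric] by simp
qed simp

lemma wdg_mapp: "wdg (mapp (a, b, c, d) v) (mapp (a, b, c, d) w) = (a * d - b * c) * wdg v w"
  by (simp add: wdg_def mapp_def algebra_simps)

lemma wdg_cscale: "wdg (c *\<^sub>C v) (c *\<^sub>C w) = c\<^sup>2 * wdg v w"
  by (simp add: wdg_def cscale_def algebra_simps power2_eq_square)

lemma norm_mapp_le: "norm (mapp (a, b, c, d) v) \<le> (norm a + norm b + norm c + norm d) * norm v"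
proof -
  have "norm (mapp (a, b, c, d) v) \<le> norm (a * fst v + b * snd v) + norm (c * fst v + d * snd v)"
    using norm_vec2_le[of "mapp (a,b,c,d) v"] by (simp add: mapp_def)
  also have "\<dots> \<le> (norm a * norm (fst v) + norm b * norm (snd v)) + (norm c * norm (fst v) + norm d * norm (snd v))"
    by (intro add_mono order_trans[OF norm_triangle_ineq]) (simp_all add: norm_mult)
  also have "\<dots> \<le> (norm a * norm v + norm b * norm v) + (norm c * norm v + norm d * norm v)"
    by (intro add_mono mult_left_mono norm_fst_vec2 norm_snd_vec2) simp_all
  finally show ?thesis by (simp add: algebra_simps)
qed

text \<open>Compensates the modulus exp(-2 pi Im x) of the quasi-periodicity factor e(x): a weighted
  pair is multiplied by a unimodular number under integer translations, so its norm is periodic. For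
  real \<open>x\<close> the weight is 1.\<close>

definition wt :: "complex \<Rightarrow> complex \<Rightarrow> complex" where
  "wt t x = of_real (exp (2 * pi * Im x * Re t))"

definition tv :: "(complex \<Rightarrow> complex \<Rightarrow> complex) \<Rightarrow> complex \<Rightarrow> complex \<Rightarrow> vec2" where
  "tv G t x = (wt t x * G t x, wt (t - 1/2) x * G (t - 1/2) x)"

text \<open>The matrix of the cube on weighted pairs, with the scalar \<open>sfac\<close> split off.
  That scalar contains e(b t), which is not periodic in \<open>t\<close>; what remains is periodic
  in both variables, so estimates reduce to a unit square. The weights survive only as exp(pi Im x)
  and its inverse off the diagonal.\<close>

definition Mat :: "real \<Rightarrow> real \<Rightarrow> complex \<Rightarrow> complex \<Rightarrow> complex \<times> complex \<times> complex \<times> complex" where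
  "Mat a b t x = (Pc a b t x, Qc a b t x * of_real (exp (pi * Im x)),
     ee (- (of_real b / 2)) * Qc a b (t - 1/2) x * ee (of_real b - x) * of_real (exp (- (pi * Im x))),
     ee (- (of_real b / 2)) * Pc a b (t - 1/2) x)"

definition sfac :: "real \<Rightarrow> real \<Rightarrow> complex \<Rightarrow> complex \<Rightarrow> complex" where
  "sfac a b t x = ee (of_real b * t) * of_real (exp (2 * pi * a * Im x))"

lemma tv_Hop:
  assumes "quasi_periodic G"
  shows "tv (Hop a b G) t x = sfac a b t x *\<^sub>C mapp (Mat a b t x) (tv G (t - of_real a) (x - of_real b))"
proof -
  define g0 where "g0 = G (t - of_real a) (x - of_real b)"
  define g1 where "g1 = G (t - of_real a - 1/2) (x - of_real b)"
  have g0: "G (t - 1/2 - of_real a - 1/2) (x - of_real b) = ee (of_real b - x) * g0"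
    using quasi_periodicD(3)[OF assms, of "t - of_real a" "x - of_real b"]
    by (simp add: g0_def algebra_simps)
  have g1: "G (t - 1/2 - of_real a) (x - of_real b) = g1" by (simp add: g1_def algebra_simps)
  have w0: "wt t x = of_real (exp (2 * pi * a * Im x)) * wt (t - of_real a) (x - of_real b)"
    "wt t x = of_real (exp (2 * pi * a * Im x)) * of_real (exp (pi * Im x)) * wt (t - of_real a - 1/2) (x - of_real b)"
    "wt (t - 1/2) x = of_real (exp (2 * pi * a * Im x)) * wt (t - of_real a - 1/2) (x - of_real b)"
    "wt (t - 1/2) x = of_real (exp (2 * pi * a * Im x)) * of_real (exp (- (pi * Im x))) * wt (t - of_real a) (x - of_real b)"
    unfolding wt_def of_real_mult[symmetric] exp_add[symmetric] by (simp_all add: algebra_simps)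
  have eb: "ee (of_real b * (t - 1/2)) = ee (of_real b * t) * ee (- (of_real b / 2))"
    unfolding ee_add[symmetric] by (simp add: algebra_simps)
  have 1: "wt t x * Hop a b G t x = fst (sfac a b t x *\<^sub>C mapp (Mat a b t x) (tv G (t - of_real a) (x - of_real b)))"
    unfolding Hop_eq[OF assms] cscale_def mapp_def Mat_def tv_def sfac_def g0_def[symmetric] g1_def[symmetric] prod.case fst_conv snd_conv
    unfolding distrib_left
    by (rule arg_cong2[where f="(+)"], subst w0(1), simp, subst w0(2), simp)
  have 2: "wt (t - 1/2) x * Hop a b G (t - 1/2) x = snd (sfac a b t x *\<^sub>C mapp (Mat a b t x) (tv G (t - of_real a) (x - of_real b)))"
    unfolding Hop_eq[OF assms] cscale_def mapp_def Mat_def tv_def sfac_def g0_def[symmetric] g1_def[symmetric] g0 g1 prod.case fst_conv snd_conv eb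
    unfolding distrib_left add.commute[of "_ * (_ * (Pc _ _ _ _ * _))"]
    by (rule arg_cong2[where f="(+)"], subst w0(4), simp, subst w0(3), simp)
  show ?thesis unfolding tv_def[of "Hop a b G"] 1 2 by simp
qed

definition H0 :: "real \<Rightarrow> real \<Rightarrow> complex \<times> complex \<times> complex \<times> complex" where
  "H0 \<tau> \<xi> = (A0 \<tau> \<xi>, B0 \<tau> \<xi>, ee (- \<xi>) * B0 (\<tau> - 1/2) \<xi>, A0 (\<tau> - 1/2) \<xi>)"

lemma Mat_base: "Mat 0 0 (of_real \<tau>) (of_real \<xi>) = H0 \<tau> \<xi>"
  by (simp add: Mat_def H0_def Pc_base Qc_base)

lemma H0_bounds:
  "norm (A0 (of_real \<tau>) (of_real \<xi>)) \<le> 10.2" "norm (B0 (of_real \<tau>) (of_real \<xi>)) \<le> 10"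
  "norm (D0 (of_real \<tau>) (of_real \<xi>)) \<le> 6"
proof -
  have n: "norm (ee (of_real \<tau>)) = 1" "norm (ee (- of_real \<tau>)) = 1" "norm (ee (of_real \<xi>)) = 1" 
     "norm (ee (- of_real \<xi>)) = 1" "norm (ee (- of_real \<tau> - of_real \<xi>)) = 1"
    by (simp_all add: norm_ee)
  have s3: "sqrt 3 \<le> 1.733" by (rule real_le_lsqrt) (auto simp: power2_eq_square)
  have t4: "norm (p + q + r - s) \<le> norm p + norm q + norm r + norm s" for p q r s :: complex
    using norm_triangle_ineq4[of "p + q + r" s] norm_triangle_ineq[of "p + q" r] norm_triangle_ineq[of p q] by linarith
  have t4b: "norm (p - q - r - s) \<le> norm p + norm q + norm r + norm s" for p q r s :: complex
    using norm_triangle_ineq4[of "p - q - r" s] norm_triangle_ineq4[of "p - q" r] norm_triangle_ineq4[of p q] by linarith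
  show "norm (A0 (of_real \<tau>) (of_real \<xi>)) \<le> 10.2"
    unfolding A0_def using s3 by (intro order_trans[OF t4]) (simp add: norm_mult n)
  have t4c: "norm (p + q - r - s) \<le> norm p + norm q + norm r + norm s" for p q r s :: complex
    using t4b[of p "-q" r s] by simp
  have "norm (B0 (of_real \<tau>) (of_real \<xi>)) \<le> norm (2 + 2 * \<i> * ee (- of_real \<tau>)) +
     norm (ee (of_real \<xi>) * (2 + 2 * \<i> * ee (of_real \<tau>) - \<i> * ee (- of_real \<tau>) - ee (of_real \<tau>) ^ 2))"
    unfolding B0_def by (rule norm_triangle_ineq)
  also have "\<dots> \<le> (norm (2::complex) + norm (2 * \<i> * ee (- of_real \<tau>))) + (norm (2::complex) + norm (2 * \<i> * ee (of_real \<tau>))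
     + norm (\<i> * ee (- of_real \<tau>)) + norm (ee (of_real \<tau>) ^ 2))"
    unfolding norm_mult[of "ee (of_real \<xi>)"] n mult_1_left
    by (intro add_mono[OF norm_triangle_ineq t4c])
  also have "\<dots> \<le> 10" by (simp add: norm_mult n norm_power)
  finally show "norm (B0 (of_real \<tau>) (of_real \<xi>)) \<le> 10" .
  show "norm (D0 (of_real \<tau>) (of_real \<xi>)) \<le> 6"
    unfolding D0_eq by (intro order_trans[OF t4b]) (simp add: norm_mult n norm_power)
qed

lemma norm_mapp_H0: "norm (mapp (H0 \<tau> \<xi>) v) \<le> 41 * norm v"
proof -
  have "norm (mapp (H0 \<tau> \<xi>) v) \<le> (norm (A0 (of_real \<tau>) (of_real \<xi>)) + norm (B0 (of_real \<tau>) (of_real \<xi>))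
     + norm (ee (- of_real \<xi>) * B0 (of_real \<tau> - 1/2) (of_real \<xi>)) + norm (A0 (of_real \<tau> - 1/2) (of_real \<xi>))) * norm v"
    using norm_mapp_le[of "A0 (of_real \<tau>) (of_real \<xi>)"] by (simp add: H0_def)
  also have "\<dots> \<le> (10.2 + 10 + 10 + 10.2) * norm v"
    using H0_bounds[of \<tau> \<xi>] H0_bounds[of "\<tau> - 1/2" \<xi>] 
    by (intro mult_right_mono add_mono) (auto simp: norm_mult norm_ee)
  also have "\<dots> \<le> 41 * norm v" by (intro mult_right_mono) auto
  finally show ?thesis .
qed

text \<open>Cayley-Hamilton for \<open>H0\<close>, with the constant value of the trace
  inserted.\<close>

lemma mapp_H0_H0:
  "mapp (H0 \<tau> \<xi>) (mapp (H0 \<tau> \<xi>) v) = (6 * of_real (sqrt 3)) *\<^sub>C mapp (H0 \<tau> \<xi>) v - D0 (of_real \<tau>) (of_real \<xi>) *\<^sub>C v"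
  unfolding A0_trace[of "of_real \<tau>" "of_real \<xi>", symmetric]
  by (simp add: H0_def mapp_def cscale_def D0_def prod_eq_iff algebra_simps)


lemma norm_mapp_le4: "norm (mapp M v) \<le> 4 * norm M * norm v"
proof -
  obtain a b c d where M: "M = (a, b, c, d)" by (cases M)
  have "norm a \<le> norm M" "norm (b, c, d) \<le> norm M" "norm b \<le> norm (b, c, d)" "norm (c, d) \<le> norm (b, c, d)"
    "norm c \<le> norm (c, d)" "norm d \<le> norm (c, d)"
    unfolding M by (rule norm_fst_le norm_snd_le)+
  then have "norm a + norm b + norm c + norm d \<le> 4 * norm M" by linarith
  then show ?thesis
    using norm_mapp_le[of a b c d v] mult_right_mono[of _ _ "norm v"] unfolding M by force
qed

lemma sqrt3_bounds: "1.732 \<le> sqrt 3" "sqrt 3 \<le> 1.7321"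
  by (rule real_le_rsqrt, simp add: power2_eq_square) (rule real_le_lsqrt, auto simp: power2_eq_square)

text \<open>Both matrices are close to the same \<open>H0\<close>, so Cayley-Hamilton gives a
  three-term recurrence y2 = s2 T y1 - s2 s1 D y0 with constant T = 6 sqrt 3, up to the
  perturbations \<open>e1\<close> and \<open>e2\<close>. The number 6.05 is the determinant bound 6
  enlarged by the contributions of \<open>e1\<close> and of the scalars.\<close>

lemma two_steps:
  assumes M: "norm (M1 - H0 \<tau> \<xi>) \<le> 1/10000" "norm (M2 - H0 \<tau> \<xi>) \<le> 1/10000"
    and s: "norm s1 \<le> 1.0001" "norm s2 \<le> 1.0001"
    and y1: "y1 = s1 *\<^sub>C mapp M1 y0" and y2: "y2 = s2 *\<^sub>C mapp M2 y1"
  shows "norm (y2 - (s2 * (6 * of_real (sqrt 3))) *\<^sub>C y1) \<le> 6.05 * norm y0 + 0.001 * norm y1"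
proof -
  define H where "H = H0 \<tau> \<xi>"
  define T where "T = (6 * of_real (sqrt 3) :: complex)"
  define d where "d = D0 (of_real \<tau>) (of_real \<xi>)"
  define e1 where "e1 = mapp (M1 - H) y0"
  define e2 where "e2 = mapp (M2 - H) y1"
  have nT: "norm T \<le> 10.4" unfolding T_def using sqrt3_bounds by (simp add: norm_mult)
  have nd: "norm d \<le> 6" unfolding d_def by (rule H0_bounds)
  have ne1: "norm e1 \<le> 4 * (1/10000) * norm y0" unfolding e1_def H_def
    by (rule order_trans[OF norm_mapp_le4]) (intro mult_right_mono mult_left_mono M, auto)
  have ne2: "norm e2 \<le> 4 * (1/10000) * norm y1" unfolding e2_def H_def
    by (rule order_trans[OF norm_mapp_le4]) (intro mult_right_mono mult_left_mono M, auto)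
  have y1': "y1 = s1 *\<^sub>C (mapp H y0 + e1)" unfolding y1 e1_def mapp_diff_left by simp
  have y2': "y2 = s2 *\<^sub>C (mapp H y1 + e2)" unfolding y2 e2_def mapp_diff_left by simp
  have "mapp H y1 = s1 *\<^sub>C (T *\<^sub>C mapp H y0 - d *\<^sub>C y0 + mapp H e1)"
    unfolding y1' mapp_cscale mapp_add H_def mapp_H0_H0 T_def d_def ..
  also have "\<dots> = T *\<^sub>C y1 - s1 *\<^sub>C (T *\<^sub>C e1 + d *\<^sub>C y0 - mapp H e1)"
    unfolding y1' by (simp add: cscale_add cscale_diff cscale_cscale mult.commute algebra_simps)
  finally have "y2 - (s2 * T) *\<^sub>C y1 = s2 *\<^sub>C (e2 - s1 *\<^sub>C (T *\<^sub>C e1 + d *\<^sub>C y0 - mapp H e1))"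
    unfolding y2' by (simp add: cscale_add cscale_diff cscale_cscale[symmetric])
  then have "norm (y2 - (s2 * T) *\<^sub>C y1) = norm s2 * norm (e2 - s1 *\<^sub>C (T *\<^sub>C e1 + d *\<^sub>C y0 - mapp H e1))" by simp
  also have "\<dots> \<le> 1.0001 * (norm e2 + 1.0001 * (10.4 * norm e1 + 6 * norm y0 + 41 * norm e1))"
  proof (intro mult_mono s)
    have "norm (T *\<^sub>C e1 + d *\<^sub>C y0 - mapp H e1) \<le> norm (T *\<^sub>C e1) + norm (d *\<^sub>C y0) + norm (mapp H e1)"
      by (rule order_trans[OF norm_triangle_ineq4]) (intro add_right_mono norm_triangle_ineq)
    also have "\<dots> \<le> 10.4 * norm e1 + 6 * norm y0 + 41 * norm e1"
      unfolding norm_cscale H_def by (intro add_mono mult_right_mono nT nd norm_mapp_H0) auto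
    finally have "norm s1 * norm (T *\<^sub>C e1 + d *\<^sub>C y0 - mapp H e1) \<le> 1.0001 * (10.4 * norm e1 + 6 * norm y0 + 41 * norm e1)"
      by (intro mult_mono s) auto
    then show "norm (e2 - s1 *\<^sub>C (T *\<^sub>C e1 + d *\<^sub>C y0 - mapp H e1)) \<le> norm e2 + 1.0001 * (10.4 * norm e1 + 6 * norm y0 + 41 * norm e1)"
      by (intro order_trans[OF norm_triangle_ineq4]) simp
  qed auto
  also have "\<dots> \<le> 6.05 * norm y0 + 0.001 * norm y1"
  proof -
    have *: "1.0001 * (E2 + 1.0001 * (10.4 * E1 + 6 * Y0 + 41 * E1)) \<le> 6.05 * Y0 + 0.001 * Y1"
      if "E1 \<le> Y0 / 2500" "E2 \<le> Y1 / 2500" "0 \<le> Y0" "0 \<le> Y1" for E1 E2 Y0 Y1 :: real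
      using that by (simp add: field_simps)
    show ?thesis by (rule *) (use ne1 ne2 in simp_all)
  qed
  finally show ?thesis unfolding T_def .
qed

text \<open>The wedge is multiplied by s^2 det M. The determinant differs from \<open>D0\<close>
  only by terms of first and second order in the entries, and the margin from 6 to 6.05 covers these
  and the factor s^2.\<close>

lemma det_bound:
  assumes M: "norm (M - H0 \<tau> \<xi>) \<le> 1/10000" and s: "norm s \<le> 1.0001" and y: "y' = s *\<^sub>C mapp M y" and z: "z' = s *\<^sub>C mapp M z"
  shows "norm (wdg y' z') \<le> 6.05 * norm (wdg y z)"
proof -
  obtain a b c d where Me: "M = (a, b, c, d)" by (cases M)
  obtain a' b' c' d' where He: "H0 \<tau> \<xi> = (a', b', c', d')" by (cases "H0 \<tau> \<xi>")
  have "norm (a - a') \<le> norm (M - H0 \<tau> \<xi>)" "norm (b - b', c - c', d - d') \<le> norm (M - H0 \<tau> \<xi>)"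
    "norm (b - b') \<le> norm (b - b', c - c', d - d')" "norm (c - c', d - d') \<le> norm (b - b', c - c', d - d')"
    "norm (c - c') \<le> norm (c - c', d - d')" "norm (d - d') \<le> norm (c - c', d - d')"
    unfolding Me He by (auto intro: norm_fst_le norm_snd_le simp: diff_Pair)
  then have ds: "norm (a - a') \<le> 1/10000" "norm (b - b') \<le> 1/10000" "norm (c - c') \<le> 1/10000" "norm (d - d') \<le> 1/10000"
    using M by linarith+
  have hs: "norm a' \<le> 10.2" "norm b' \<le> 10" "norm c' \<le> 10" "norm d' \<le> 10.2" 
    using He H0_bounds[of \<tau> \<xi>] H0_bounds[of "\<tau> - 1/2" \<xi>] by (auto simp: H0_def norm_mult norm_ee)
  have D: "a' * d' - b' * c' = D0 (of_real \<tau>) (of_real \<xi>)" using He by (auto simp: H0_def D0_def)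
  have "a * d - b * c - D0 (of_real \<tau>) (of_real \<xi>) = (a - a') * (d - d') + a' * (d - d') + (a - a') * d' - ((b - b') * (c - c') + b' * (c - c') + (b - b') * c')"
    unfolding D[symmetric] by (simp add: algebra_simps)
  also have "norm \<dots> \<le> norm ((a - a') * (d - d')) + norm (a' * (d - d')) + norm ((a - a') * d') + (norm ((b - b') * (c - c')) + norm (b' * (c - c')) + norm ((b - b') * c'))"
    by (rule order_trans[OF norm_triangle_ineq4]) (intro add_mono order_trans[OF norm_triangle_ineq] norm_triangle_ineq order_refl)
  also have "\<dots> \<le> (1/10000*(1/10000) + 10.2*(1/10000) + 1/10000*10.2) + (1/10000*(1/10000) + 10*(1/10000) + 1/10000*10)"
    unfolding norm_mult by (intro add_mono mult_mono ds hs norm_ge_zero) auto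
  also have "\<dots> \<le> 0.01" by simp
  finally have "norm (a * d - b * c) \<le> 6.01"
    using H0_bounds(3)[of \<tau> \<xi>] norm_triangle_ineq2[of "a * d - b * c" "D0 (of_real \<tau>) (of_real \<xi>)"] by simp
  moreover have "(norm s)\<^sup>2 \<le> 1.0001\<^sup>2" using s by (intro power_mono) auto
  ultimately have "(norm s)\<^sup>2 * norm (a * d - b * c) \<le> 1.0001\<^sup>2 * 6.01" by (intro mult_mono) auto
  then have "(norm s)\<^sup>2 * norm (a * d - b * c) * norm (wdg y z) \<le> 6.05 * norm (wdg y z)"
    by (intro mult_right_mono) (auto simp: power2_eq_square)
  then show ?thesis unfolding y z wdg_cscale Me wdg_mapp by (simp add: norm_mult norm_power mult.assoc)
qed

lemma continuous_on_ee [continuous_intros]: "continuous_on S f \<Longrightarrow> continuous_on S (\<lambda>z. ee (f z))"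
  unfolding ee_def by (intro continuous_intros)

lemma ee_periodic: "ee (t + 1) = ee t" "ee (t + of_int n) = ee t"
  by (simp_all add: ee_add)

lemma Pc_periodic: "Pc a b (t + of_int n) x = Pc a b t x" "Pc a b t (x + of_int n) = Pc a b t x"
  and Qc_periodic: "Qc a b (t + of_int n) x = Qc a b t x" "Qc a b t (x + of_int n) = Qc a b t x"
proof -
  have e: "ee (t + of_int n - w) = ee (t - w)" "ee (- (t + of_int n) - w) = ee (- t - w)" "ee (w - (t + of_int n)) = ee (w - t)" for t w
    using ee_periodic(2)[of "t - w" n] ee_periodic(2)[of "- t - w" "-n"] ee_periodic(2)[of "w - t" "-n"] by (simp_all add: algebra_simps)
  show "Pc a b (t + of_int n) x = Pc a b t x" "Pc a b t (x + of_int n) = Pc a b t x"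
     "Qc a b (t + of_int n) x = Qc a b t x" "Qc a b t (x + of_int n) = Qc a b t x"
    unfolding Pc_def Qc_def Let_def e ee_periodic by simp_all
qed

lemma Mat_periodic: "Mat a b (t + of_int n) (x + of_int m) = Mat a b t x"
proof -
  have "t + of_int n - 1/2 = (t - 1/2) + of_int n" "ee (of_real b - (x + of_int m)) = ee (of_real b - x)"
    using ee_periodic(2)[of "of_real b - x" "-m"] by (simp_all add: algebra_simps)
  then show ?thesis unfolding Mat_def by (simp only: Pc_periodic Qc_periodic) simp
qed

text \<open>Periodicity reduces the real parts to the unit square, where compactness applies. The
  parameters \<open>a'\<close>, \<open>b'\<close> allow a comparison with the unperturbed matrix at
  a displaced base point, which is needed to measure two consecutive steps against one
  matrix.\<close>

lemma Mat_close:
  assumes "0 < \<delta>"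
  shows "\<exists>\<rho>>0. \<forall>t x a b a' b'. \<bar>Im t\<bar> < \<rho> \<longrightarrow> \<bar>Im x\<bar> < \<rho> \<longrightarrow> \<bar>a\<bar> < \<rho> \<longrightarrow> \<bar>b\<bar> < \<rho> \<longrightarrow> \<bar>a'\<bar> < \<rho> \<longrightarrow> \<bar>b'\<bar> < \<rho> \<longrightarrow>
    norm (Mat a b t x - H0 (Re t - a') (Re x - b')) < \<delta>"
proof -
  define F :: "real \<times> real \<Rightarrow> real \<times> real \<times> real \<times> real \<times> real \<times> real \<Rightarrow> complex \<times> complex \<times> complex \<times> complex" where
    "F = (\<lambda>(\<tau>, \<xi>) (s, z, a, b, a', b'). Mat a b (Complex \<tau> s) (Complex \<xi> z) - Mat 0 0 (of_real (\<tau> - a')) (of_real (\<xi> - b')))"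
  have Ceq: "Complex u v = of_real u + \<i> * of_real v" for u v by (simp add: complex_eq_iff)
  have "continuous_on UNIV (\<lambda>(p, \<sigma>). F p \<sigma>)"
    unfolding F_def split_beta Mat_def Pc_def Qc_def Let_def Ceq
    by (intro continuous_intros) (auto simp: Ceq)
  moreover have "compact ({0..1::real} \<times> {0..1::real})" by (intro compact_Times) auto
  ultimately obtain \<rho> where \<rho>: "\<rho> > 0" "\<And>p \<sigma>. p \<in> {0..1} \<times> {0..1} \<Longrightarrow> norm \<sigma> < \<rho> \<Longrightarrow> dist (F p \<sigma>) (F p 0) < \<delta>"
    using unif_close[of F _ \<delta>] assms by metis
  have nle: "norm (s, z, a, b, a', b') \<le> \<bar>s\<bar> + \<bar>z\<bar> + \<bar>a\<bar> + \<bar>b\<bar> + \<bar>a'\<bar> + \<bar>b'\<bar>" for s z a b a' b' :: real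
    using norm_Pair_le[of s "(z, a, b, a', b')"] norm_Pair_le[of z "(a, b, a', b')"] norm_Pair_le[of a "(b, a', b')"]
      norm_Pair_le[of b "(a', b')"] norm_Pair_le[of a' b'] by simp
  show ?thesis
  proof (intro exI[of _ "\<rho>/6"] conjI allI impI)
    show "0 < \<rho>/6" using \<rho> by simp
    fix t x :: complex and a b a' b' :: real
    assume *: "\<bar>Im t\<bar> < \<rho>/6" "\<bar>Im x\<bar> < \<rho>/6" "\<bar>a\<bar> < \<rho>/6" "\<bar>b\<bar> < \<rho>/6" "\<bar>a'\<bar> < \<rho>/6" "\<bar>b'\<bar> < \<rho>/6"
    define n m where "n = \<lfloor>Re t\<rfloor>" and "m = \<lfloor>Re x\<rfloor>"
    define \<tau> \<xi> where "\<tau> = Re t - n" and "\<xi> = Re x - m"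
    have in01: "(\<tau>, \<xi>) \<in> {0..1} \<times> {0..1}"
      unfolding \<tau>_def \<xi>_def n_def m_def by (auto intro: less_imp_le) linarith+
    have t: "t = Complex \<tau> (Im t) + of_int n" "x = Complex \<xi> (Im x) + of_int m"
      by (auto simp: complex_eq_iff \<tau>_def \<xi>_def)
    have r: "of_real (Re t - a') = (of_real (\<tau> - a') :: complex) + of_int n" "of_real (Re x - b') = (of_real (\<xi> - b') :: complex) + of_int m"
      by (auto simp: complex_eq_iff \<tau>_def \<xi>_def)
    have "Mat a b t x - H0 (Re t - a') (Re x - b') = F (\<tau>, \<xi>) (Im t, Im x, a, b, a', b')"
      unfolding F_def prod.case Mat_base[symmetric] r
      by (subst t(1), subst t(2)) (simp add: Mat_periodic)
    moreover have "F (\<tau>, \<xi>) 0 = 0" unfolding F_def zero_prod_def by (simp add: complex_of_real_def zero_prod_def)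
    moreover have "norm (Im t, Im x, a, b, a', b') < \<rho>" using nle[of "Im t" "Im x" a b a' b'] * by linarith
    ultimately show "norm (Mat a b t x - H0 (Re t - a') (Re x - b')) < \<delta>"
      using \<rho>(2)[OF in01, of "(Im t, Im x, a, b, a', b')"] by (simp add: dist_norm)
  qed
qed

section \<open>Uniform growth on a strip\<close>

lemma wt_nonzero [simp]: "wt t x \<noteq> 0" by (simp add: wt_def)

lemma quasi_periodic_int:
  assumes "quasi_periodic G"
  shows "G (t + of_int n) x = ee (of_int n * x) * G t x" "G t (x + of_int n) = G t x"
proof -
  have 1: "G (t + of_nat k) x = ee (of_nat k * x) * G t x" for t k
  proof (induction k)
    case (Suc k)
    then show ?case using quasi_periodicD(1)[OF assms, of "t + of_nat k" x]
      by (simp add: ee_add algebra_simps)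
  qed simp
  have 2: "G t (x + of_nat k) = G t x" for x k
  proof (induction k)
    case (Suc k)
    then show ?case using quasi_periodicD(2)[OF assms, of t "x + of_nat k"] by (simp add: algebra_simps)
  qed simp
  show "G (t + of_int n) x = ee (of_int n * x) * G t x"
  proof (cases n rule: int_cases2)
    case (nonneg k) then show ?thesis using 1 by simp
  next
    case (nonpos k) then show ?thesis using 1[of "t - of_nat k" k] by (simp add: ee_minus field_simps)
  qed
  show "G t (x + of_int n) = G t x"
  proof (cases n rule: int_cases2)
    case (nonneg k) then show ?thesis using 2 by simp
  next
    case (nonpos k) then show ?thesis using 2[of "x - of_nat k" k] by simp
  qed
qed

lemma tv_periodic:
  assumes "quasi_periodic G"
  shows "tv G (t + of_int n) (x + of_int m) = ee (of_int n * of_real (Re x)) *\<^sub>C tv G t x"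
proof -
  have w: "wt (t + of_int n) (x + of_int m) * ee (of_int n * x) = wt t x * ee (of_int n * of_real (Re x))" for t
  proof -
    have x: "of_int n * x = of_int n * of_real (Re x) + of_int n * (\<i> * of_real (Im x))"
      by (simp add: complex_eq_iff)
    have "ee (of_int n * (\<i> * of_real (Im x))) = of_real (exp (- (2 * pi * Im x * n)))"
    proof -
      have "2 * of_real pi * \<i> * (of_int n * (\<i> * of_real (Im x))) = of_real (- (2 * pi * Im x * n))"
        by (simp add: complex_eq_iff)
      then show ?thesis unfolding ee_def by (simp only: exp_of_real)
    qed
    moreover have "exp (2 * pi * Im x * (Re t + n)) * exp (- (2 * pi * Im x * n)) = exp (2 * pi * Im x * Re t)"
      unfolding exp_add[symmetric] by (simp add: algebra_simps)
    ultimately show ?thesis unfolding x ee_add wt_def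
      by (simp add: mult.commute mult.left_commute flip: of_real_mult)
  qed
  have h: "t + of_int n - 1/2 = t - 1/2 + of_int n" by simp
  show ?thesis unfolding tv_def cscale_def h quasi_periodic_int[OF assms] using w[of t] w[of "t - 1/2"]
    by (simp add: mult.assoc[symmetric])
qed

text \<open>What the theta function has to supply. The factor 1.6 keeps the real pair away from the
  contracted direction of \<open>H0\<close>; it exceeds the 1.5 used after perturbation so that the
  bound survives a small change of all parameters.\<close>

locale seed =
  fixes \<psi> :: "complex \<Rightarrow> complex \<Rightarrow> complex"
  assumes qp: "quasi_periodic \<psi>"
    and cont: "continuous_on UNIV (\<lambda>(t, x). \<psi> t x)"
    and hol_t: "(\<lambda>t. \<psi> t x) holomorphic_on UNIV"
    and hol_x: "(\<lambda>x. \<psi> t x) holomorphic_on UNIV"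
    and low: "norm (mapp (H0 \<tau> \<xi>) (tv \<psi> (of_real \<tau>) (of_real \<xi>))) \<ge> 1.6 * norm (tv \<psi> (of_real \<tau>) (of_real \<xi>))"
    and nz: "tv \<psi> (of_real \<tau>) (of_real \<xi>) \<noteq> 0"
begin

lemma cont_comp [continuous_intros]:
  "continuous_on S f \<Longrightarrow> continuous_on S g \<Longrightarrow> continuous_on S (\<lambda>z. \<psi> (f z) (g z))"
  using continuous_on_compose2[OF cont, of S "\<lambda>z. (f z, g z)"] by (simp add: continuous_on_Pair)

end

text \<open>\<open>Mat1\<close> at the earlier point and \<open>Mat2\<close> at the later one refer
  to the same \<open>H0\<close>, as \<open>two_steps\<close> requires. \<open>V_cnj\<close> is there
  because a holomorphic pairing has to use the conjugate point. The last two conditions are limited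
  to 0 \<le> Re t \<le> 1: translating \<open>t\<close> by n multiplies the two vectors in
  \<open>V_shift\<close> by e(n (Re x - b)) and e(n Re x), and \<open>sfac\<close> by e(b n), so for
  large n closeness is lost.\<close>

locale dyn = seed +
  fixes a b \<rho> m :: real
  assumes \<rho>_pos: "0 < \<rho>" and m_pos: "0 < m"
    and Mat1: "\<bar>Im t\<bar> < \<rho> \<Longrightarrow> \<bar>Im x\<bar> < \<rho> \<Longrightarrow> norm (Mat a b t x - H0 (Re t) (Re x)) \<le> 1/10000"
    and Mat2: "\<bar>Im t\<bar> < \<rho> \<Longrightarrow> \<bar>Im x\<bar> < \<rho> \<Longrightarrow> norm (Mat a b t x - H0 (Re t - a) (Re x - b)) \<le> 1/10000"
    and sf: "\<bar>Im t\<bar> < \<rho> \<Longrightarrow> \<bar>Im x\<bar> < \<rho> \<Longrightarrow> \<bar>norm (sfac a b t x) - 1\<bar> \<le> 1/10000"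
    and V_low: "\<bar>Im t\<bar> < \<rho> \<Longrightarrow> \<bar>Im x\<bar> < \<rho> \<Longrightarrow>
        norm (tv (Hop a b \<psi>) t x) \<ge> 1.5 * norm (tv \<psi> (t - of_real a) (x - of_real b))"
    and V_cnj: "\<bar>Im t\<bar> < \<rho> \<Longrightarrow> \<bar>Im x\<bar> < \<rho> \<Longrightarrow>
        norm (tv (Hop a b \<psi>) (cnj t) (cnj x) - tv (Hop a b \<psi>) t x) \<le> 0.01 * norm (tv (Hop a b \<psi>) t x)"
    and psi_low: "\<bar>Im t\<bar> < \<rho> \<Longrightarrow> \<bar>Im x\<bar> < \<rho> \<Longrightarrow> norm (tv \<psi> t x) \<ge> m"
    and V_shift: "\<bar>Im t\<bar> < \<rho> \<Longrightarrow> \<bar>Im x\<bar> < \<rho> \<Longrightarrow> 0 \<le> Re t \<Longrightarrow> Re t \<le> 1 \<Longrightarrow>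
        norm (tv (Hop a b \<psi>) (t - of_real a) (x - of_real b) - tv (Hop a b \<psi>) t x) \<le> 0.01 * norm (tv (Hop a b \<psi>) t x)"
    and sf_shift: "\<bar>Im t\<bar> < \<rho> \<Longrightarrow> \<bar>Im x\<bar> < \<rho> \<Longrightarrow> 0 \<le> Re t \<Longrightarrow> Re t \<le> 1 \<Longrightarrow> norm (sfac a b t x - 1) \<le> 0.01"

lemma continuous_on_Rop_param:
  assumes "continuous_on UNIV (\<lambda>(a, b, t, x). G a b t x)"
  shows "continuous_on UNIV (\<lambda>(a, b, t, x). Rop (a/3 - 1/6) (b/3 - 1/3) (G a b) t x)"
proof -
  have G: "continuous_on UNIV (\<lambda>z. G (f1 z) (f2 z) (f3 z) (f4 z))"
    if "continuous_on UNIV f1" "continuous_on UNIV f2" "continuous_on UNIV f3" "continuous_on UNIV f4"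
    for f1 f2 :: "real \<times> real \<times> complex \<times> complex \<Rightarrow> real" and f3 f4
    using continuous_on_compose2[OF assms continuous_on_Pair[OF that(1) continuous_on_Pair[OF that(2) continuous_on_Pair[OF that(3,4)]]]]
    by simp
  show ?thesis unfolding Rop_def split_beta
    by (intro continuous_intros G) auto
qed

context seed
begin

lemma cont_Hop: "continuous_on UNIV (\<lambda>(a, b, t, x). Hop a b \<psi> t x)"
proof -
  have "continuous_on UNIV (\<lambda>(a::real, b::real, t, x). \<psi> t x)"
    unfolding split_beta by (intro continuous_intros)
  from continuous_on_Rop_param[OF continuous_on_Rop_param[OF continuous_on_Rop_param[OF this]]]
  show ?thesis unfolding Hop_def .
qed

lemma cont_Hop_comp [continuous_intros]:
  assumes "continuous_on S f1" "continuous_on S f2" "continuous_on S f3" "continuous_on S f4"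
  shows "continuous_on S (\<lambda>z. Hop (f1 z) (f2 z) \<psi> (f3 z) (f4 z))"
  using continuous_on_compose2[OF cont_Hop continuous_on_Pair[OF assms(1) continuous_on_Pair[OF assms(2) continuous_on_Pair[OF assms(3,4)]]]]
  by simp

lemma norm4: "norm (s, z, a, b) \<le> \<bar>s\<bar> + \<bar>z\<bar> + \<bar>a\<bar> + \<bar>b\<bar>" for s z a b :: real
  using norm_Pair_le[of s "(z, a, b)"] norm_Pair_le[of z "(a, b)"] norm_Pair_le[of a b] by simp

lemma unif4:
  fixes F :: "real \<times> real \<Rightarrow> real \<times> real \<times> real \<times> real \<Rightarrow> 'c::metric_space"
  assumes "continuous_on UNIV (\<lambda>(p, \<sigma>). F p \<sigma>)" "0 < \<delta>"
  shows "\<exists>\<rho>>0. \<forall>\<rho>'\<le>\<rho>. \<forall>p\<in>{0..1}\<times>{0..1}. \<forall>s z a b. \<bar>s\<bar> < \<rho>' \<longrightarrow> \<bar>z\<bar> < \<rho>' \<longrightarrow> \<bar>a\<bar> < \<rho>' \<longrightarrow> \<bar>b\<bar> < \<rho>' \<longrightarrow> dist (F p (s, z, a, b)) (F p (0, 0, 0, 0)) < \<delta>"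
proof -
  have K: "compact ({0..1::real} \<times> {0..1::real})" by (intro compact_Times) auto
  obtain r where r: "r > 0" "\<And>p \<sigma>. p \<in> {0..1} \<times> {0..1} \<Longrightarrow> norm \<sigma> < r \<Longrightarrow> dist (F p \<sigma>) (F p 0) < \<delta>"
    using unif_close[OF assms(1) K assms(2)] by metis
  show ?thesis
  proof (intro exI[of _ "r/4"] conjI allI impI ballI)
    show "0 < r/4" using r by simp
    fix \<rho>' :: real and p :: "real \<times> real" and s z a b :: real assume *: "\<rho>' \<le> r/4" "p \<in> {0..1} \<times> {0..1}" "\<bar>s\<bar> < \<rho>'" "\<bar>z\<bar> < \<rho>'" "\<bar>a\<bar> < \<rho>'" "\<bar>b\<bar> < \<rho>'"
    have "norm (s, z, a, b) < r" using norm4[of s z a b] * by linarith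
    then show "dist (F p (s, z, a, b)) (F p (0, 0, 0, 0)) < \<delta>" using r(2)[OF *(2)] by (simp add: zero_prod_def del: norm_Pair)
  qed
qed

text \<open>At a = b = 0 and real points every condition holds with room to spare, the pair being
  bounded below on the compact unit square. Closeness within m/1000 preserves the conditions for
  small imaginary parts and small (a, b), and quasi-periodicity carries them to all real parts,
  since the factors \<open>e\<close> and \<open>e'\<close> have modulus 1.\<close>

lemma dyn_exists: "\<exists>\<rho>>0. \<exists>m. \<forall>a b. \<bar>a\<bar> < \<rho> \<longrightarrow> \<bar>b\<bar> < \<rho> \<longrightarrow> dyn \<psi> a b \<rho> m"
proof -
  define K where "K = {0..1::real} \<times> {0..1::real}"
  have K: "compact K" "K \<noteq> {}" unfolding K_def by (auto intro!: compact_Times)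
  have Ceq: "Complex u v = of_real u + \<i> * of_real v" for u v by (simp add: complex_eq_iff)
  define P where "P = (\<lambda>(\<tau>::real, \<xi>::real). tv \<psi> (of_real \<tau>) (of_real \<xi>))"
  have "continuous_on K (\<lambda>p. norm (P p))"
    unfolding P_def split_beta tv_def wt_def by (intro continuous_intros) auto
  then obtain p0 where p0: "p0 \<in> K" "\<And>p. p \<in> K \<Longrightarrow> norm (P p0) \<le> norm (P p)"
    using continuous_attains_inf[OF K] by blast
  define m where "m = norm (P p0)"
  have m: "m > 0" using nz unfolding m_def P_def by (simp add: split_beta)
  define F1 where "F1 = (\<lambda>(\<tau>, \<xi>) (s, z, a, b). tv (Hop a b \<psi>) (Complex \<tau> s) (Complex \<xi> z))"
  define F2 where "F2 = (\<lambda>(\<tau>, \<xi>) (s, z, a, b). tv (Hop a b \<psi>) (Complex \<tau> (-s)) (Complex \<xi> (-z)))"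
  define F3 where "F3 = (\<lambda>(\<tau>, \<xi>) (s, z, a, b). tv \<psi> (Complex \<tau> s - of_real a) (Complex \<xi> z - of_real b))"
  define F4 where "F4 = (\<lambda>(\<tau>, \<xi>) (s, z, a, b). tv (Hop a b \<psi>) (Complex \<tau> s - of_real a) (Complex \<xi> z - of_real b))"
  define F5 where "F5 = (\<lambda>(\<tau>, \<xi>) (s, z, a::real, b::real). tv \<psi> (Complex \<tau> s) (Complex \<xi> z))"
  define F6 where "F6 = (\<lambda>(\<tau>, \<xi>) (s, z, a, b). sfac a b (Complex \<tau> s) (Complex \<xi> z))"
  have c: "continuous_on UNIV (\<lambda>(p, \<sigma>). F1 p \<sigma>)" "continuous_on UNIV (\<lambda>(p, \<sigma>). F2 p \<sigma>)"
    "continuous_on UNIV (\<lambda>(p, \<sigma>). F3 p \<sigma>)" "continuous_on UNIV (\<lambda>(p, \<sigma>). F4 p \<sigma>)"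
    "continuous_on UNIV (\<lambda>(p, \<sigma>). F5 p \<sigma>)" "continuous_on UNIV (\<lambda>(p, \<sigma>). F6 p \<sigma>)"
    unfolding F1_def F2_def F3_def F4_def F5_def F6_def split_beta tv_def wt_def sfac_def Ceq
    by ((intro continuous_intros; simp)+)
  have md: "0 < m / 1000" using m by simp
  obtain r1 where r1: "r1 > 0" "\<And>\<rho>' p s z a b. \<rho>' \<le> r1 \<Longrightarrow> p \<in> K \<Longrightarrow> \<bar>s\<bar> < \<rho>' \<Longrightarrow> \<bar>z\<bar> < \<rho>' \<Longrightarrow> \<bar>a\<bar> < \<rho>' \<Longrightarrow> \<bar>b\<bar> < \<rho>' \<Longrightarrow> dist (F1 p (s, z, a, b)) (F1 p (0, 0, 0, 0)) < m/1000"
    using unif4[OF c(1) md] unfolding K_def by metis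
  obtain r2 where r2: "r2 > 0" "\<And>\<rho>' p s z a b. \<rho>' \<le> r2 \<Longrightarrow> p \<in> K \<Longrightarrow> \<bar>s\<bar> < \<rho>' \<Longrightarrow> \<bar>z\<bar> < \<rho>' \<Longrightarrow> \<bar>a\<bar> < \<rho>' \<Longrightarrow> \<bar>b\<bar> < \<rho>' \<Longrightarrow> dist (F2 p (s, z, a, b)) (F2 p (0, 0, 0, 0)) < m/1000"
    using unif4[OF c(2) md] unfolding K_def by metis
  obtain r3 where r3: "r3 > 0" "\<And>\<rho>' p s z a b. \<rho>' \<le> r3 \<Longrightarrow> p \<in> K \<Longrightarrow> \<bar>s\<bar> < \<rho>' \<Longrightarrow> \<bar>z\<bar> < \<rho>' \<Longrightarrow> \<bar>a\<bar> < \<rho>' \<Longrightarrow> \<bar>b\<bar> < \<rho>' \<Longrightarrow> dist (F3 p (s, z, a, b)) (F3 p (0, 0, 0, 0)) < m/1000"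
    using unif4[OF c(3) md] unfolding K_def by metis
  obtain r4 where r4: "r4 > 0" "\<And>\<rho>' p s z a b. \<rho>' \<le> r4 \<Longrightarrow> p \<in> K \<Longrightarrow> \<bar>s\<bar> < \<rho>' \<Longrightarrow> \<bar>z\<bar> < \<rho>' \<Longrightarrow> \<bar>a\<bar> < \<rho>' \<Longrightarrow> \<bar>b\<bar> < \<rho>' \<Longrightarrow> dist (F4 p (s, z, a, b)) (F4 p (0, 0, 0, 0)) < m/1000"
    using unif4[OF c(4) md] unfolding K_def by metis
  obtain r5 where r5: "r5 > 0" "\<And>\<rho>' p s z a b. \<rho>' \<le> r5 \<Longrightarrow> p \<in> K \<Longrightarrow> \<bar>s\<bar> < \<rho>' \<Longrightarrow> \<bar>z\<bar> < \<rho>' \<Longrightarrow> \<bar>a\<bar> < \<rho>' \<Longrightarrow> \<bar>b\<bar> < \<rho>' \<Longrightarrow> dist (F5 p (s, z, a, b)) (F5 p (0, 0, 0, 0)) < m/1000"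
    using unif4[OF c(5) md] unfolding K_def by metis
  have sd: "0 < (1/100000 :: real)" by simp
  obtain r6 where r6: "r6 > 0" "\<And>\<rho>' p s z a b. \<rho>' \<le> r6 \<Longrightarrow> p \<in> K \<Longrightarrow> \<bar>s\<bar> < \<rho>' \<Longrightarrow> \<bar>z\<bar> < \<rho>' \<Longrightarrow> \<bar>a\<bar> < \<rho>' \<Longrightarrow> \<bar>b\<bar> < \<rho>' \<Longrightarrow> dist (F6 p (s, z, a, b)) (F6 p (0, 0, 0, 0)) < 1/100000"
    using unif4[OF c(6) sd] unfolding K_def by metis
  have sd': "(0::real) < 1/10000" by simp
  define r7 where "r7 = (SOME \<rho>. 0 < \<rho> \<and> (\<forall>t x a b a' b'. \<bar>Im t\<bar> < \<rho> \<longrightarrow> \<bar>Im x\<bar> < \<rho> \<longrightarrow> \<bar>a\<bar> < \<rho> \<longrightarrow> \<bar>b\<bar> < \<rho> \<longrightarrow> \<bar>a'\<bar> < \<rho> \<longrightarrow> \<bar>b'\<bar> < \<rho> \<longrightarrow>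
    norm (Mat a b t x - H0 (Re t - a') (Re x - b')) < 1/10000))"
  note r7 = someI_ex[OF Mat_close[OF sd'], folded r7_def]
  note r7 = conjunct1[OF r7] conjunct2[OF r7, rule_format]
  define \<rho> where "\<rho> = Min {r1, r2, r3, r4, r5, r6, r7}"
  have \<rho>: "\<rho> > 0" "\<rho> \<le> r1" "\<rho> \<le> r2" "\<rho> \<le> r3" "\<rho> \<le> r4" "\<rho> \<le> r5" "\<rho> \<le> r6" "\<rho> \<le> r7"
  proof -
    show "\<rho> > 0" using r1(1) r2(1) r3(1) r4(1) r5(1) r6(1) r7(1) unfolding \<rho>_def by simp
  qed (unfold \<rho>_def, (rule Min_le; simp)+)
  have C0: "Complex \<tau> 0 = of_real \<tau>" for \<tau> by (simp add: complex_eq_iff)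
  have sf0: "sfac 0 0 t x = 1" for t x by (simp add: sfac_def)
  have F0: "F1 p (0,0,0,0) = tv (Hop 0 0 \<psi>) (of_real (fst p)) (of_real (snd p))" "F2 p (0,0,0,0) = F1 p (0,0,0,0)"
    "F4 p (0,0,0,0) = F1 p (0,0,0,0)" "F3 p (0,0,0,0) = P p" "F5 p (0,0,0,0) = P p" "F6 p (0,0,0,0) = 1" for p
    by (auto simp: F1_def F2_def F3_def F4_def F5_def F6_def P_def split_beta C0 sf0)
  have V0: "F1 p (0,0,0,0) = mapp (H0 (fst p) (snd p)) (P p)" for p
    unfolding F0 tv_Hop[OF qp] sf0 by (simp add: Mat_base P_def split_beta)
  have V0l: "norm (F1 p (0,0,0,0)) \<ge> 1.6 * norm (P p)" for p
    unfolding V0 using low[of "fst p" "snd p"] by (simp add: P_def split_beta)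
  have Pm: "norm (P p) \<ge> m" if "p \<in> K" for p using p0(2)[OF that] by (simp add: m_def)
  have "dyn \<psi> a b \<rho> (m/2)" if ab: "\<bar>a\<bar> < \<rho>" "\<bar>b\<bar> < \<rho>" for a b
  proof unfold_locales
    show "0 < \<rho>" "0 < m/2" using \<rho> m by auto
    fix t x :: complex assume im: "\<bar>Im t\<bar> < \<rho>" "\<bar>Im x\<bar> < \<rho>"
    show "norm (Mat a b t x - H0 (Re t) (Re x)) \<le> 1/10000"
      using r7(2)[of t x a b 0 0] im ab \<rho>(8) r7(1) by simp
    show "norm (Mat a b t x - H0 (Re t - a) (Re x - b)) \<le> 1/10000"
      using r7(2)[of t x a b a b] im ab \<rho>(8) by simp
    define n k where "n = \<lfloor>Re t\<rfloor>" and "k = \<lfloor>Re x\<rfloor>"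
    define \<tau> \<xi> where "\<tau> = Re t - n" and "\<xi> = Re x - k"
    define s z where "s = Im t" and "z = Im x"
    define p where "p = (\<tau>, \<xi>)"
    have pK: "p \<in> K"
      unfolding K_def p_def \<tau>_def \<xi>_def n_def k_def by (auto intro: less_imp_le) linarith+
    have t: "t = Complex \<tau> s + of_int n" "x = Complex \<xi> z + of_int k"
      "cnj t = Complex \<tau> (-s) + of_int n" "cnj x = Complex \<xi> (-z) + of_int k"
      "t - of_real a = Complex \<tau> s - of_real a + of_int n" "x - of_real b = Complex \<xi> z - of_real b + of_int k"
      by (auto simp: complex_eq_iff \<tau>_def \<xi>_def s_def z_def)
    note im' = im[folded s_def z_def]
    define e where "e = ee (of_int n * of_real \<xi>)"
    define e' where "e' = ee (of_int n * of_real (\<xi> - b))"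
    have ne: "norm e = 1" "norm e' = 1" unfolding e_def e'_def by (auto simp: norm_ee)
    have qH: "quasi_periodic (Hop a b \<psi>)" by (rule quasi_periodic_Hop[OF qp])
    have f1: "tv (Hop a b \<psi>) t x = e *\<^sub>C F1 p (s,z,a,b)" unfolding F1_def p_def prod.case
      by (subst t(1), subst t(2)) (simp add: tv_periodic[OF qH] e_def)
    have f2: "tv (Hop a b \<psi>) (cnj t) (cnj x) = e *\<^sub>C F2 p (s,z,a,b)" unfolding F2_def p_def prod.case
      by (subst t(3), subst t(4)) (simp add: tv_periodic[OF qH] e_def)
    have f3: "tv \<psi> (t - of_real a) (x - of_real b) = e' *\<^sub>C F3 p (s,z,a,b)" unfolding F3_def p_def prod.case
      by (subst t(5), subst t(6)) (simp add: tv_periodic[OF qp] e'_def)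
    have f5: "tv \<psi> t x = e *\<^sub>C F5 p (s,z,a,b)" unfolding F5_def p_def prod.case
      by (subst t(1), subst t(2)) (simp add: tv_periodic[OF qp] e_def)
    have d1: "norm (F1 p (s,z,a,b) - F1 p (0,0,0,0)) < m/1000" using r1(2)[OF \<rho>(2) pK im' ab] by (simp add: dist_norm)
    have d2: "norm (F2 p (s,z,a,b) - F1 p (0,0,0,0)) < m/1000" using r2(2)[OF \<rho>(3) pK im' ab] by (simp add: dist_norm F0(2))
    have d3: "norm (F3 p (s,z,a,b) - P p) < m/1000" using r3(2)[OF \<rho>(4) pK im' ab] by (simp add: dist_norm F0)
    have d4: "norm (F4 p (s,z,a,b) - F1 p (0,0,0,0)) < m/1000" using r4(2)[OF \<rho>(5) pK im' ab] by (simp add: dist_norm F0(3))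
    have d5: "norm (F5 p (s,z,a,b) - P p) < m/1000" using r5(2)[OF \<rho>(6) pK im' ab] by (simp add: dist_norm F0)
    have d6: "norm (F6 p (s,z,a,b) - 1) < 1/100000" using r6(2)[OF \<rho>(7) pK im' ab] by (simp add: dist_norm F0)
    have g1: "norm (F1 p (s,z,a,b)) \<ge> 1.6 * norm (P p) - m/1000"
      using V0l[of p] d1 norm_triangle_ineq2[of "F1 p (0,0,0,0)" "F1 p (s,z,a,b)"] by (simp add: norm_minus_commute)
    have g3: "norm (F3 p (s,z,a,b)) \<le> norm (P p) + m/1000"
      using d3 norm_triangle_ineq2[of "F3 p (s,z,a,b)" "P p"] by simp
    have g5: "norm (F5 p (s,z,a,b)) \<ge> norm (P p) - m/1000"
      using d5 norm_triangle_ineq2[of "P p" "F5 p (s,z,a,b)"] by (simp add: norm_minus_commute)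
    note Pm = Pm[OF pK]
    have dd: "norm (F2 p (s,z,a,b) - F1 p (s,z,a,b)) < 2 * (m/1000)" "norm (F4 p (s,z,a,b) - F1 p (s,z,a,b)) < 2 * (m/1000)"
      using d1 d2 d4 norm_triangle_ineq4[of "F2 p (s,z,a,b) - F1 p (0,0,0,0)" "F1 p (s,z,a,b) - F1 p (0,0,0,0)"]
        norm_triangle_ineq4[of "F4 p (s,z,a,b) - F1 p (0,0,0,0)" "F1 p (s,z,a,b) - F1 p (0,0,0,0)"] by simp_all
    have nsf: "norm (sfac a b t x) = norm (F6 p (s,z,a,b))"
      unfolding F6_def p_def prod.case sfac_def norm_mult norm_ee s_def z_def by simp
    show "\<bar>norm (sfac a b t x) - 1\<bar> \<le> 1/10000" unfolding nsf
      using d6 norm_triangle_ineq3[of "F6 p (s,z,a,b)" 1] by simp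
    show "norm (tv (Hop a b \<psi>) t x) \<ge> 1.5 * norm (tv \<psi> (t - of_real a) (x - of_real b))"
      unfolding f1 f3 norm_cscale ne mult_1_left using g1 g3 Pm m by simp
    show "norm (tv (Hop a b \<psi>) (cnj t) (cnj x) - tv (Hop a b \<psi>) t x) \<le> 0.01 * norm (tv (Hop a b \<psi>) t x)"
      unfolding f1 f2 cscale_diff[symmetric] norm_cscale ne mult_1_left using g1 dd Pm m by simp
    show "m/2 \<le> norm (tv \<psi> t x)" unfolding f5 norm_cscale ne mult_1_left using g5 Pm m by simp
    assume re: "0 \<le> Re t" "Re t \<le> 1"
    \<comment> \<open>Only \<open>x\<close> is reduced modulo 1 here; reducing \<open>t\<close> as
      well would produce two different phases at x and x - b.\<close>
    define p' where "p' = (Re t, \<xi>)"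
    have p'K: "p' \<in> K" using re pK by (auto simp: p'_def p_def K_def)
    have e1: "norm (F1 p' (s,z,a,b) - F1 p' (0,0,0,0)) < m/1000" using r1(2)[OF \<rho>(2) p'K im' ab] by (simp add: dist_norm)
    have e4: "norm (F4 p' (s,z,a,b) - F1 p' (0,0,0,0)) < m/1000" using r4(2)[OF \<rho>(5) p'K im' ab] by (simp add: dist_norm F0(3))
    have e6: "norm (F6 p' (s,z,a,b) - 1) < 1/100000" using r6(2)[OF \<rho>(7) p'K im' ab] by (simp add: dist_norm F0)
    have t': "t = Complex (Re t) s" by (simp add: s_def)
    have h1: "tv (Hop a b \<psi>) t x = F1 p' (s,z,a,b)" unfolding F1_def p'_def prod.case t'[symmetric]
      by (subst t(2)) (use tv_periodic[OF qH, of t 0] in simp)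
    have h4: "tv (Hop a b \<psi>) (t - of_real a) (x - of_real b) = F4 p' (s,z,a,b)" unfolding F4_def p'_def prod.case t'[symmetric]
      by (subst t(6)) (use tv_periodic[OF qH, of "t - of_real a" 0] in simp)
    have k1: "norm (F1 p' (s,z,a,b)) \<ge> 1.6 * m - m/1000"
      using V0l[of p'] p0(2)[OF p'K] e1 norm_triangle_ineq2[of "F1 p' (0,0,0,0)" "F1 p' (s,z,a,b)"] by (simp add: norm_minus_commute m_def)
    have "norm (F4 p' (s,z,a,b) - F1 p' (s,z,a,b)) < 2 * (m/1000)"
      using e1 e4 norm_triangle_ineq4[of "F4 p' (s,z,a,b) - F1 p' (0,0,0,0)" "F1 p' (s,z,a,b) - F1 p' (0,0,0,0)"] by simp
    then show "norm (tv (Hop a b \<psi>) (t - of_real a) (x - of_real b) - tv (Hop a b \<psi>) t x) \<le> 0.01 * norm (tv (Hop a b \<psi>) t x)"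
      unfolding h1 h4 using k1 m by simp
    have "sfac a b t x = F6 p' (s,z,a,b)" unfolding F6_def p'_def prod.case t'[symmetric] sfac_def by (simp add: z_def)
    then show "norm (sfac a b t x - 1) \<le> 0.01" using e6 by simp
  qed
  then show ?thesis using \<rho>(1) by blast
qed

end


section \<open>Iterates of the seed: growth, shrinking angles, transversality\<close>

context dyn
begin

definition v :: "nat \<Rightarrow> complex \<Rightarrow> complex \<Rightarrow> complex" where "v k = (Hop a b ^^ k) \<psi>"

lemma v_0: "v 0 = \<psi>" and v_Suc: "v (Suc k) = Hop a b (v k)" by (simp_all add: v_def)

lemma qp_v: "quasi_periodic (v k)"
  by (induction k) (auto simp: v_0 v_Suc qp quasi_periodic_Hop)

definition y :: "nat \<Rightarrow> complex \<Rightarrow> complex \<Rightarrow> vec2" where "y k = tv (v k)"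

lemma y_Suc: "y (Suc k) t x = sfac a b t x *\<^sub>C mapp (Mat a b t x) (y k (t - of_real a) (x - of_real b))"
  unfolding y_def v_Suc by (rule tv_Hop[OF qp_v])

definition strip :: "complex \<Rightarrow> bool" where "strip z \<longleftrightarrow> \<bar>Im z\<bar> < \<rho>"

lemma strip_simps [simp]: "strip (z - of_real c) = strip z" "strip (z + of_real c) = strip z"
  "strip (z + 1) = strip z" "strip (z - 1/2) = strip z" "strip (z + 1/2) = strip z" "strip (cnj z) = strip z" "strip (of_real c)"
  "strip (z + of_int n) = strip z"
  using \<rho>_pos by (auto simp: strip_def)

lemma sf_le: "strip t \<Longrightarrow> strip x \<Longrightarrow> norm (sfac a b t x) \<le> 1.0001" "strip t \<Longrightarrow> strip x \<Longrightarrow> norm (sfac a b t x) \<ge> 0.9999"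
proof -
  have *: "n \<le> 1 + 1/10000" "n \<ge> 1 - 1/10000" if "\<bar>n - 1\<bar> \<le> 1/10000" for n :: real using that by linarith+
  show "strip t \<Longrightarrow> strip x \<Longrightarrow> norm (sfac a b t x) \<le> 1.0001" "strip t \<Longrightarrow> strip x \<Longrightarrow> norm (sfac a b t x) \<ge> 0.9999"
    using *[OF sf[of t x]] by (simp_all add: strip_def)
qed

lemma rel:
  assumes "strip t" "strip x"
  shows "norm (y (Suc (Suc k)) t x - (sfac a b t x * (6 * of_real (sqrt 3))) *\<^sub>C y (Suc k) (t - of_real a) (x - of_real b))
    \<le> 6.05 * norm (y k (t - of_real a - of_real a) (x - of_real b - of_real b)) + 0.001 * norm (y (Suc k) (t - of_real a) (x - of_real b))"
proof (rule two_steps)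
  show "norm (Mat a b (t - of_real a) (x - of_real b) - H0 (Re t - a) (Re x - b)) \<le> 1/10000"
    using Mat1[of "t - of_real a" "x - of_real b"] assms by (simp add: strip_def)
  show "norm (Mat a b t x - H0 (Re t - a) (Re x - b)) \<le> 1/10000" using Mat2 assms by (simp add: strip_def)
  show "norm (sfac a b (t - of_real a) (x - of_real b)) \<le> 1.0001" "norm (sfac a b t x) \<le> 1.0001"
    using sf_le(1) assms by simp_all
qed (rule y_Suc)+

lemma y1_low: "strip t \<Longrightarrow> strip x \<Longrightarrow> norm (y 1 t x) \<ge> 1.5 * norm (y 0 (t - of_real a) (x - of_real b))"
  using V_low[of t x] by (simp add: strip_def y_def v_0 v_Suc)

text \<open>The recurrence makes growth self-improving: a factor 1.5 in one step yields at least
  0.9999 * 6 * 1.732 - 0.001 - 6.05 / 1.5 > 6 in the next. Hence only the very first step may be as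
  weak as 1.5.\<close>

lemma y_growth:
  assumes "strip t" "strip x"
  shows "norm (y (Suc (Suc k)) t x) \<ge> 6 * norm (y (Suc k) (t - of_real a) (x - of_real b))"
  using assms
proof (induction k arbitrary: t x)
  have step: "norm (y (Suc (Suc k)) t x) \<ge> 6 * norm (y (Suc k) (t - of_real a) (x - of_real b))"
    if st: "strip t" "strip x" and g: "norm (y (Suc k) (t - of_real a) (x - of_real b)) \<ge> 1.5 * norm (y k (t - of_real a - of_real a) (x - of_real b - of_real b))"
    for k t x
  proof -
    define Y1 where "Y1 = norm (y (Suc k) (t - of_real a) (x - of_real b))"
    define Y0 where "Y0 = norm (y k (t - of_real a - of_real a) (x - of_real b - of_real b))"
    define c where "c = norm (sfac a b t x)"
    have s: "0.9999 \<le> c" unfolding c_def using sf_le(2)[OF st] .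
    have "c * (6 * sqrt 3) * Y1 = norm ((sfac a b t x * (6 * of_real (sqrt 3))) *\<^sub>C y (Suc k) (t - of_real a) (x - of_real b))"
      by (simp add: norm_mult Y1_def c_def)
    also have "\<dots> \<le> norm (y (Suc (Suc k)) t x) + (6.05 * Y0 + 0.001 * Y1)"
      using rel[OF st, of k] norm_triangle_ineq3[of "y (Suc (Suc k)) t x"] unfolding Y0_def Y1_def by (smt (verit))
    finally have 1: "c * (6 * sqrt 3) * Y1 \<le> norm (y (Suc (Suc k)) t x) + (6.05 * Y0 + 0.001 * Y1)" .
    have "0.9999 * (6 * 1.732) * Y1 \<le> c * (6 * sqrt 3) * Y1"
      using s sqrt3_bounds(1) by (intro mult_right_mono mult_mono) (auto simp: Y1_def)
    from order_trans[OF this 1] g have "6 * Y1 \<le> norm (y (Suc (Suc k)) t x)" unfolding Y0_def[symmetric] Y1_def[symmetric]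
      using norm_ge_zero[of "y (Suc k) (t - of_real a) (x - of_real b)", folded Y1_def] by simp
    then show ?thesis by (simp add: Y1_def)
  qed
  {
    case 0
    show ?case by (rule step[OF 0]) (use y1_low[of "t - of_real a" "x - of_real b"] 0 in simp)
  next
    case (Suc k)
    show ?case
    proof (rule step[OF Suc.prems])
      have "norm (y (Suc (Suc k)) (t - of_real a) (x - of_real b)) \<ge> 6 * norm (y (Suc k) (t - of_real a - of_real a) (x - of_real b - of_real b))"
        by (rule Suc.IH) (use Suc.prems in simp_all)
      then show "norm (y (Suc (Suc k)) (t - of_real a) (x - of_real b)) \<ge> 1.5 * norm (y (Suc k) (t - of_real a - of_real a) (x - of_real b - of_real b))"
        using norm_ge_zero[of "y (Suc k) (t - of_real a - of_real a) (x - of_real b - of_real b)"] by linarith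
    qed
  }
qed

lemma wedge_step:
  assumes "strip t" "strip x"
  shows "norm (wdg (y (Suc k) t x) (y (Suc l) t x)) \<le> 6.05 * norm (wdg (y k (t - of_real a) (x - of_real b)) (y l (t - of_real a) (x - of_real b)))"
  by (rule det_bound[of "Mat a b t x" "Re t" "Re x" "sfac a b t x"])
    (use Mat1 assms sf_le y_Suc in \<open>auto simp: strip_def\<close>)

lemma y_pos: 
  assumes "strip t" "strip x" shows "norm (y (Suc k) t x) \<ge> m"
  using assms
proof (induction k arbitrary: t x)
  case 0
  have "norm (y 0 (t - of_real a) (x - of_real b)) \<ge> m" 
    using psi_low[of "t - of_real a" "x - of_real b"] 0 by (simp add: y_def v_0 strip_def)
  then show ?case using y1_low[OF 0] m_pos by simp
next
  case (Suc k)
  have "norm (y (Suc k) (t - of_real a) (x - of_real b)) \<ge> m" by (rule Suc.IH) (use Suc.prems in auto)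
  then show ?case using y_growth[OF Suc.prems, of k] m_pos by linarith
qed

text \<open>One step multiplies the wedge by at most 6.05 and each of the two norms by at least 6,
  and 6.05 / 36 < 1/5. So consecutive iterates approach a common line geometrically, uniformly on
  the strip.\<close>

lemma wedge_decay:
  assumes "strip t" "strip x"
  shows "norm (wdg (y (Suc k) t x) (y (Suc (Suc k)) t x)) \<le> (1/5)^k * (norm (y (Suc k) t x) * norm (y (Suc (Suc k)) t x))"
  using assms
proof (induction k arbitrary: t x)
  case 0 show ?case using norm_wdg_le by simp
next
  case (Suc k)
  let ?t = "t - of_real a" and ?x = "x - of_real b"
  have st: "strip ?t" "strip ?x" using Suc.prems by auto
  have "norm (wdg (y (Suc (Suc k)) t x) (y (Suc (Suc (Suc k))) t x)) \<le> 6.05 * norm (wdg (y (Suc k) ?t ?x) (y (Suc (Suc k)) ?t ?x))"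
    by (rule wedge_step[OF Suc.prems])
  also have "\<dots> \<le> 6.05 * ((1/5)^k * (norm (y (Suc k) ?t ?x) * norm (y (Suc (Suc k)) ?t ?x)))"
    using Suc.IH[OF st] by simp
  also have "\<dots> \<le> 6.05 * ((1/5)^k * ((norm (y (Suc (Suc k)) t x) / 6) * (norm (y (Suc (Suc (Suc k))) t x) / 6)))"
    using y_growth[OF Suc.prems, of k] y_growth[OF Suc.prems, of "Suc k"] by (intro mult_left_mono mult_mono) auto
  also have "\<dots> = (6.05/36) * ((1/5)^k * (norm (y (Suc (Suc k)) t x) * norm (y (Suc (Suc (Suc k))) t x)))" by simp
  also have "\<dots> \<le> (1/5) * ((1/5)^k * (norm (y (Suc (Suc k)) t x) * norm (y (Suc (Suc (Suc k))) t x)))"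
    by (intro mult_right_mono) auto
  finally show ?case by simp
qed

text \<open>Undo one step: the wedge of the iterates k and 0 is at most the product of their norms,
  and the step gains factors 6 and 1.5 on these norms. So the sine of the angle is at most 6.05 / 9
  < 0.6723 and, by Lagrange's identity, the cosine is at least 0.74, uniformly in k.\<close>

lemma aligned:
  assumes "strip t" "strip x"
  shows "norm (cin (y (Suc k) t x) (y 1 t x)) \<ge> 0.74 * (norm (y (Suc k) t x) * norm (y 1 t x))"
proof -
  define N where "N = norm (y (Suc k) t x) * norm (y 1 t x)"
  have N: "N \<ge> 0" by (simp add: N_def)
  have w: "norm (wdg (y (Suc k) t x) (y 1 t x)) \<le> 0.6723 * N"
  proof (cases k)
    case 0
    then have "wdg (y (Suc k) t x) (y 1 t x) = 0" by (simp add: wdg_def)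
    then show ?thesis using N by simp
  next
    case (Suc l)
    let ?t = "t - of_real a" and ?x = "x - of_real b"
    have "norm (wdg (y (Suc k) t x) (y (Suc 0) t x)) \<le> 6.05 * norm (wdg (y k ?t ?x) (y 0 ?t ?x))" by (rule wedge_step[OF assms])
    also have "\<dots> \<le> 6.05 * (norm (y k ?t ?x) * norm (y 0 ?t ?x))" using norm_wdg_le by simp
    also have "\<dots> \<le> 6.05 * ((norm (y (Suc k) t x) / 6) * (norm (y 1 t x) / 1.5))"
      using y_growth[OF assms, of l] y1_low[OF assms] Suc by (intro mult_left_mono mult_mono) auto
    also have "\<dots> = (6.05/9) * N" by (simp add: N_def)
    also have "\<dots> \<le> 0.6723 * N" using N by (intro mult_right_mono) auto
    finally show ?thesis by simp
  qed
  have "(norm (wdg (y (Suc k) t x) (y 1 t x)))\<^sup>2 \<le> (0.6723 * N)\<^sup>2" by (rule power_mono[OF w]) simp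
  then have "(norm (cin (y (Suc k) t x) (y 1 t x)))\<^sup>2 \<ge> N\<^sup>2 - (0.6723 * N)\<^sup>2"
  proof -
    have "(norm (cin (y (Suc k) t x) (y 1 t x)))\<^sup>2 + (norm (wdg (y (Suc k) t x) (y 1 t x)))\<^sup>2 = N\<^sup>2"
      using lagrange_vec2[of "y (Suc k) t x" "y 1 t x"] by (simp add: N_def power_mult_distrib)
    with \<open>_ \<le> (0.6723 * N)\<^sup>2\<close> show ?thesis by linarith
  qed
  moreover have "N\<^sup>2 - (0.6723 * N)\<^sup>2 \<ge> (0.74 * N)\<^sup>2"
    by (simp add: power_mult_distrib) (simp add: power2_eq_square)
  ultimately have "(0.74 * N)\<^sup>2 \<le> (norm (cin (y (Suc k) t x) (y 1 t x)))\<^sup>2" by linarith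
  then show ?thesis unfolding N_def by (rule power2_le_imp_le) simp
qed

text \<open>The inner product is conjugate linear in its second slot; evaluating that slot at the
  conjugate point makes the result holomorphic in both variables. The first iterate is used instead
  of the seed because \<open>aligned\<close> controls the angle with it.\<close>

definition ac :: "nat \<Rightarrow> complex \<Rightarrow> complex \<Rightarrow> complex" where
  "ac k t x = cin (y k t x) (y 1 (cnj t) (cnj x))"

definition th :: "complex \<Rightarrow> complex \<Rightarrow> complex" where
  "th t x = cnj (v 1 (cnj t) (cnj x))"

definition pair :: "(complex \<Rightarrow> complex \<Rightarrow> complex) \<Rightarrow> complex \<Rightarrow> complex \<Rightarrow> complex" where
  "pair G t x = th t x * G t x + th (t - 1/2) x * G (t - 1/2) x"

lemma wt_cnj: "wt t x * wt (cnj t) (cnj x) = 1" "cnj (wt t x) = wt t x" "cnj (wt t x) * wt (cnj t) (cnj x) = 1"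
  by (simp_all add: wt_def flip: of_real_mult exp_add)

text \<open>Conjugation changes the sign of Im x, so the weights at a point and at its conjugate are
  reciprocal. The pairing is therefore an unweighted sum of products of holomorphic
  functions.\<close>

lemma pair_eq: "pair G t x = cin (tv G t x) (y 1 (cnj t) (cnj x))"
proof -
  have "cnj (t - 1/2) = cnj t - 1/2" by simp
  then have "wt (t - 1/2) x * cnj (wt (cnj t - 1/2) (cnj x)) = 1" using wt_cnj(1)[of "t - 1/2" x] wt_cnj(2)[of "cnj t - 1/2" "cnj x"] by simp
  moreover have "wt t x * cnj (wt (cnj t) (cnj x)) = 1" using wt_cnj(1)[of t x] wt_cnj(2)[of "cnj t" "cnj x"] by simp
  moreover have "cin (tv G t x) (y 1 (cnj t) (cnj x)) = (wt t x * cnj (wt (cnj t) (cnj x))) * (th t x * G t x)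
    + (wt (t - 1/2) x * cnj (wt (cnj t - 1/2) (cnj x))) * (th (t - 1/2) x * G (t - 1/2) x)"
    unfolding cin_def tv_def y_def th_def by simp
  ultimately show ?thesis unfolding pair_def by simp
qed

lemma ac_eq: "ac k t x = pair (v k) t x" unfolding ac_def pair_eq y_def ..

lemma V_cnj': 
  assumes "strip t" "strip x"
  shows "norm (y 1 (cnj t) (cnj x) - y 1 t x) \<le> 0.01 * norm (y 1 t x)" "norm (y 1 (cnj t) (cnj x)) \<le> 1.01 * norm (y 1 t x)"
proof -
  show 1: "norm (y 1 (cnj t) (cnj x) - y 1 t x) \<le> 0.01 * norm (y 1 t x)"
    using V_cnj[of t x] assms by (simp add: y_def v_Suc v_0 strip_def)
  show "norm (y 1 (cnj t) (cnj x)) \<le> 1.01 * norm (y 1 t x)"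
    using 1 norm_triangle_ineq2[of "y 1 (cnj t) (cnj x)" "y 1 t x"] by simp
qed

lemma cin_diff: "cin u w - cin u w' = cin u (w - w')" "cin u w - cin u' w = cin (u - u') w"
  by (simp_all add: cin_def algebra_simps)

lemma cin_cscale: "cin (c *\<^sub>C u) w = c * cin u w"
  by (simp add: cin_def cscale_def algebra_simps)

lemma ac_low:
  assumes "strip t" "strip x"
  shows "norm (ac (Suc k) t x) \<ge> 0.73 * (norm (y (Suc k) t x) * norm (y 1 t x))"
proof -
  have "norm (ac (Suc k) t x - cin (y (Suc k) t x) (y 1 t x)) \<le> norm (y (Suc k) t x) * (0.01 * norm (y 1 t x))"
    unfolding ac_def cin_diff by (rule order_trans[OF norm_cin_le]) (intro mult_left_mono V_cnj' assms, simp)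
  then show ?thesis using aligned[OF assms, of k] norm_triangle_ineq2[of "cin (y (Suc k) t x) (y 1 t x)" "ac (Suc k) t x"]
    by (simp add: norm_minus_commute)
qed

text \<open>The purpose of the seed: its first iterate is a global covector that vanishes on none of
  the iterates, uniformly enough to pass to their limit line, which excludes any twisting of the
  line field.\<close>

lemma ac_nonzero: "strip t \<Longrightarrow> strip x \<Longrightarrow> ac (Suc k) t x \<noteq> 0"
proof -
  assume st: "strip t" "strip x"
  have "0 < norm (y (Suc k) t x) * norm (y 1 t x)" using y_pos[OF st, of k] y_pos[OF st, of 0] m_pos by (intro mult_pos_pos) auto
  then show ?thesis using ac_low[OF st, of k] by (auto simp: mult.commute)
qed

end

section \<open>The invariant line\<close>

lemma holomorphic_on_shift:
  fixes f :: "complex \<Rightarrow> complex"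
  assumes "f holomorphic_on S" "\<And>z. z \<in> S \<Longrightarrow> z - c \<in> S"
  shows "(\<lambda>z. f (z - c)) holomorphic_on S"
proof -
  have "(f \<circ> (\<lambda>z. z - c)) holomorphic_on S"
    by (rule holomorphic_on_compose_gen[OF _ assms(1)]) (use assms(2) in \<open>auto intro: holomorphic_intros\<close>)
  then show ?thesis by (simp add: o_def)
qed

lemma holomorphic_Rop_t:
  assumes "\<And>x. (\<lambda>t. G t x) holomorphic_on S" "\<And>c z. z - of_real c \<in> S \<longleftrightarrow> z \<in> S"
  shows "(\<lambda>t. Rop \<alpha> \<beta> G t x) holomorphic_on S"
proof -
  have 1: "(\<lambda>t. G (t - of_real c) y) holomorphic_on S" for c y
    by (rule holomorphic_on_shift) (use assms in auto)
  have "(\<lambda>t. G (t - of_real \<alpha> - 1/2) y) holomorphic_on S" for y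
    using 1[of "\<alpha> + 1/2" y] by (simp add: algebra_simps)
  then show ?thesis unfolding Rop_def ee_def by (intro holomorphic_intros 1)
qed

lemma holomorphic_Rop_x:
  assumes "\<And>t. (\<lambda>x. G t x) holomorphic_on S" "\<And>c z. z - of_real c \<in> S \<longleftrightarrow> z \<in> S"
  shows "(\<lambda>x. Rop \<alpha> \<beta> G t x) holomorphic_on S"
proof -
  have 1: "(\<lambda>x. G t (x - of_real c)) holomorphic_on S" for c t
    by (rule holomorphic_on_shift) (use assms in auto)
  then show ?thesis unfolding Rop_def ee_def by (intro holomorphic_intros 1)
qed

lemma continuous_Rop:
  assumes "continuous_on (S \<times> S) (\<lambda>(t, x). G t x)" "\<And>c z. z - of_real c \<in> S \<longleftrightarrow> z \<in> S"
  shows "continuous_on (S \<times> S) (\<lambda>(t, x). Rop \<alpha> \<beta> G t x)"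
proof -
  have G: "continuous_on (S \<times> S) (\<lambda>z. G (f z) (g z))"
    if "continuous_on (S \<times> S) f" "continuous_on (S \<times> S) g" "\<And>z. z \<in> S \<times> S \<Longrightarrow> f z \<in> S \<and> g z \<in> S" for f g
    using continuous_on_compose2[OF assms(1) continuous_on_Pair[OF that(1,2)]] that(3) by auto
  have 2: "t - of_real \<alpha> - 1/2 \<in> S \<longleftrightarrow> t \<in> S" for t
    using assms(2)[of t "\<alpha> + 1/2"] by (simp add: algebra_simps)
  show ?thesis unfolding Rop_def split_beta
    by (intro continuous_intros G) (auto simp: assms(2) 2)
qed

context dyn
begin

definition SS :: "complex set" where "SS = {z. strip z}"

lemma SS_shift: "z - of_real c \<in> SS \<longleftrightarrow> z \<in> SS" by (simp add: SS_def)

lemma open_SS: "open SS" and convex_SS: "convex SS"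
proof -
  have e: "SS = {z. - \<rho> < Im z} \<inter> {z. Im z < \<rho>}" by (auto simp: SS_def strip_def abs_less_iff)
  show "open SS" unfolding e by (intro open_Int open_halfspace_Im_gt open_halfspace_Im_lt)
  show "convex SS" unfolding e by (intro convex_Int convex_halfspace_Im_gt convex_halfspace_Im_lt)
qed

lemma hol_v: "(\<lambda>t. v k t x) holomorphic_on UNIV" "(\<lambda>x. v k t x) holomorphic_on UNIV" "continuous_on UNIV (\<lambda>(t, x). v k t x)"
proof -
  have "(\<forall>x. (\<lambda>t. v k t x) holomorphic_on UNIV) \<and> (\<forall>t. (\<lambda>x. v k t x) holomorphic_on UNIV) \<and> continuous_on UNIV (\<lambda>(t, x). v k t x)"
  proof (induction k)
    case 0 then show ?case using hol_t hol_x cont by (simp add: v_0)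
  next
    case (Suc k)
    have "continuous_on (UNIV \<times> UNIV) (\<lambda>(t, x). Hop a b (v k) t x)"
      unfolding Hop_def using Suc by (intro continuous_Rop) auto
    moreover have "(\<lambda>t. Hop a b (v k) t x) holomorphic_on UNIV" "(\<lambda>x. Hop a b (v k) t x) holomorphic_on UNIV" for t x
      unfolding Hop_def using Suc by (intro holomorphic_Rop_t holomorphic_Rop_x; simp)+
    ultimately show ?case by (simp add: v_Suc)
  qed
  then show "(\<lambda>t. v k t x) holomorphic_on UNIV" "(\<lambda>x. v k t x) holomorphic_on UNIV" "continuous_on UNIV (\<lambda>(t, x). v k t x)" by auto
qed

lemma cont_v [continuous_intros]:
  "continuous_on S f \<Longrightarrow> continuous_on S g \<Longrightarrow> continuous_on S (\<lambda>z. v k (f z) (g z))"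
  using continuous_on_compose2[OF hol_v(3), of S "\<lambda>z. (f z, g z)"] by (simp add: continuous_on_Pair)

lemma hol_th: "(\<lambda>t. th t x) holomorphic_on UNIV" "(\<lambda>x. th t x) holomorphic_on UNIV"
proof -
  have 1: "(cnj \<circ> f \<circ> cnj) holomorphic_on UNIV" if "f holomorphic_on UNIV" for f
    
  proof -
    have "range cnj = UNIV" by (metis complex_cnj_cnj surjI)
    then show ?thesis using holomorphic_on_compose_cnj_cnj[of f UNIV] that by simp
  qed
  show "(\<lambda>t. th t x) holomorphic_on UNIV" "(\<lambda>x. th t x) holomorphic_on UNIV"
    using 1[OF hol_v(1), of 1 "cnj x"] 1[OF hol_v(2), of 1 "cnj t"] by (simp_all add: th_def o_def)
qed

lemma cont_th [continuous_intros]: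
  "continuous_on S f \<Longrightarrow> continuous_on S g \<Longrightarrow> continuous_on S (\<lambda>z. th (f z) (g z))"
  unfolding th_def by (intro continuous_intros)

lemma th_periodic: "th (t + 1) x = ee (- x) * th t x" "th t (x + 1) = th t x" 
  using quasi_periodicD(1,2)[OF qp_v, of 1] by (simp_all add: th_def cnj_ee)

text \<open>A half step exchanges the two summands, and the factors e(x) and e(-x) cancel.
  Everything built from pairings thus has period 1/2 in \<open>t\<close>.\<close>

lemma pair_periodic:
  assumes "\<And>t. G (t + 1) x = ee x * G t x" shows "pair G (t + 1/2) x = pair G t x"
proof -
  have e: "t + 1/2 = (t - 1/2) + 1" "t + 1/2 - 1/2 = t" by simp_all
  show ?thesis unfolding pair_def e(2) unfolding e(1) th_periodic assms by (simp add: ee_minus)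
qed

lemma pair_periodic_x:
  assumes "\<And>t. G t (x + 1) = G t x" shows "pair G t (x + 1) = pair G t x"
  by (simp add: pair_def th_periodic assms)

lemma ac_periodic: "ac k (t + 1/2) x = ac k t x" "ac k (t + 1) x = ac k t x" "ac k (t - 1/2) x = ac k t x" "ac k t (x + 1) = ac k t x"
proof -
  show 1: "ac k (t + 1/2) x = ac k t x" for t x unfolding ac_eq by (rule pair_periodic) (rule quasi_periodicD(1)[OF qp_v])
  show "ac k (t + 1) x = ac k t x" using 1[of "t + 1/2" x] 1[of t x] by (simp add: add.assoc)
  show "ac k (t - 1/2) x = ac k t x" using 1[of "t - 1/2" x] by simp
  show "ac k t (x + 1) = ac k t x" unfolding ac_eq by (rule pair_periodic_x) (rule quasi_periodicD(2)[OF qp_v])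
qed

lemma hol_pair:
  assumes "\<And>x. x \<in> SS \<Longrightarrow> (\<lambda>t. G t x) holomorphic_on SS"
  shows "x \<in> SS \<Longrightarrow> (\<lambda>t. pair G t x) holomorphic_on SS"
proof -
  assume x: "x \<in> SS"
  have sh: "(\<lambda>t. f (t - 1/2)) holomorphic_on SS" if "f holomorphic_on SS" for f :: "complex \<Rightarrow> complex"
    by (rule holomorphic_on_shift) (use that SS_shift[of _ "1/2"] in auto)
  have t: "(\<lambda>t. th t x) holomorphic_on SS" using hol_th(1) holomorphic_on_subset by blast
  show ?thesis unfolding pair_def by (intro holomorphic_intros t assms x sh[OF t] sh[OF assms[OF x]])
qed

lemma hol_pair_x:
  assumes "\<And>t. t \<in> SS \<Longrightarrow> (\<lambda>x. G t x) holomorphic_on SS"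
  shows "t \<in> SS \<Longrightarrow> (\<lambda>x. pair G t x) holomorphic_on SS"
  using SS_shift[of _ "1/2"] hol_th(2) unfolding pair_def
  by (intro holomorphic_intros assms) (auto intro: holomorphic_on_subset)

lemma cont_pair:
  assumes "continuous_on (SS \<times> SS) (\<lambda>(t, x). G t x)"
  shows "continuous_on (SS \<times> SS) (\<lambda>(t, x). pair G t x)"
proof -
  have h: "z - 1/2 \<in> SS" if "z \<in> SS" for z using that SS_shift[of z "1/2"] by simp
  have 1: "continuous_on (SS \<times> SS) (\<lambda>z. G (fst z) (snd z))"
    using assms by (simp add: split_beta)
  have 2: "continuous_on (SS \<times> SS) (\<lambda>z. G (fst z - 1/2) (snd z))"
  proof -
    have c: "continuous_on (SS \<times> SS) (\<lambda>z. (fst z - 1/2 :: complex, snd z :: complex))"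
      by (intro continuous_on_Pair continuous_on_fst continuous_on_snd continuous_on_id continuous_on_diff continuous_on_const)
    have "(\<lambda>z. (fst z - 1/2, snd z)) ` (SS \<times> SS) \<subseteq> SS \<times> SS" using h by auto
    from continuous_on_compose2[OF assms c this] show ?thesis by simp
  qed
  show ?thesis unfolding pair_def split_beta
    by (intro continuous_on_add continuous_on_mult 1 2 cont_th continuous_on_fst continuous_on_snd continuous_on_id continuous_on_diff continuous_on_const)
qed

lemma ac_props: "x \<in> SS \<Longrightarrow> (\<lambda>t. ac k t x) holomorphic_on SS" "t \<in> SS \<Longrightarrow> (\<lambda>x. ac k t x) holomorphic_on SS"
  "continuous_on (SS \<times> SS) (\<lambda>(t, x). ac k t x)"
proof -
  have 1: "(\<lambda>t. v k t x) holomorphic_on SS" "(\<lambda>x. v k t x) holomorphic_on SS" for t x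
    by (rule holomorphic_on_subset[OF hol_v(1)], simp) (rule holomorphic_on_subset[OF hol_v(2)], simp)
  have 2: "continuous_on (SS \<times> SS) (\<lambda>(t, x). v k t x)" by (rule continuous_on_subset[OF hol_v(3)]) simp
  show "x \<in> SS \<Longrightarrow> (\<lambda>t. ac k t x) holomorphic_on SS" unfolding ac_eq by (rule hol_pair[OF 1(1)])
  show "t \<in> SS \<Longrightarrow> (\<lambda>x. ac k t x) holomorphic_on SS" unfolding ac_eq by (rule hol_pair_x[OF 1(2)])
  show "continuous_on (SS \<times> SS) (\<lambda>(t, x). ac k t x)" unfolding ac_eq by (rule cont_pair[OF 2])
qed

text \<open>The iterate rescaled so that it pairs to 1 with the first iterate. Only the line is
  recorded, so convergence is possible although the iterates grow; the denominator is periodic, so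
  quasi-periodicity is kept.\<close>

definition phi :: "nat \<Rightarrow> complex \<Rightarrow> complex \<Rightarrow> complex" where
  "phi k t x = v (Suc k) t x / ac (Suc k) t x"

lemma phi_props: "x \<in> SS \<Longrightarrow> (\<lambda>t. phi k t x) holomorphic_on SS" "t \<in> SS \<Longrightarrow> (\<lambda>x. phi k t x) holomorphic_on SS"
  "continuous_on (SS \<times> SS) (\<lambda>(t, x). phi k t x)" 
proof -
  show "x \<in> SS \<Longrightarrow> (\<lambda>t. phi k t x) holomorphic_on SS"
    unfolding phi_def by (intro holomorphic_intros ac_props holomorphic_on_subset[OF hol_v(1)]) (auto simp: SS_def ac_nonzero)
  show "t \<in> SS \<Longrightarrow> (\<lambda>x. phi k t x) holomorphic_on SS"
    unfolding phi_def by (intro holomorphic_intros ac_props holomorphic_on_subset[OF hol_v(2)]) (auto simp: SS_def ac_nonzero)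
  show "continuous_on (SS \<times> SS) (\<lambda>(t, x). phi k t x)" 
  proof -
    have "continuous_on (SS \<times> SS) (\<lambda>z. v (Suc k) (fst z) (snd z))"
      using continuous_on_subset[OF hol_v(3)] by (simp add: split_beta)
    moreover have "continuous_on (SS \<times> SS) (\<lambda>z. ac (Suc k) (fst z) (snd z))"
      using ac_props(3) by (simp add: split_beta)
    ultimately show ?thesis unfolding phi_def split_beta
      by (rule continuous_on_divide) (auto simp: SS_def ac_nonzero)
  qed
qed

lemma pair_phi: "strip t \<Longrightarrow> strip x \<Longrightarrow> pair (phi k) t x = 1"
  unfolding pair_def phi_def ac_periodic
  using ac_nonzero[of t x k] by (simp add: ac_eq pair_def add_divide_distrib[symmetric])

lemma phi_qp: "phi k (t + 1) x = ee x * phi k t x" "phi k t (x + 1) = phi k t x"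
  unfolding phi_def ac_periodic quasi_periodicD(1,2)[OF qp_v] by simp_all

text \<open>Two vectors of C^2 with the same pairing against a covector differ by an element of its
  kernel, and the multiple is their wedge. Here the difference is th(t - 1/2, x) times the wedge of
  two iterates over the product of the denominators, up to sign and weights;
  \<open>wedge_decay\<close> and \<open>ac_low\<close> bound it, with 1.01 / 0.73^2 < 2.\<close>

lemma phi_diff:
  assumes "strip t" "strip x"
  shows "norm (wt t x) * norm (phi (Suc k) t x - phi k t x) \<le> (2 / m) * (1/5)^k"
proof -
  let ?a = "ac (Suc k) t x" and ?b = "ac (Suc (Suc k)) t x"
  note st = assms
  have a: "?a = th t x * v (Suc k) t x + th (t - 1/2) x * v (Suc k) (t - 1/2) x"
    and b: "?b = th t x * v (Suc (Suc k)) t x + th (t - 1/2) x * v (Suc (Suc k)) (t - 1/2) x"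
    by (simp_all add: ac_eq pair_def)
  have nz: "?a \<noteq> 0" "?b \<noteq> 0" using ac_nonzero[OF st] by auto
  have "phi (Suc k) t x - phi k t x = (v (Suc (Suc k)) t x * ?a - v (Suc k) t x * ?b) / (?a * ?b)"
    unfolding phi_def using nz by (simp add: field_simps)
  also have "v (Suc (Suc k)) t x * ?a - v (Suc k) t x * ?b
     = - th (t - 1/2) x * (v (Suc k) t x * v (Suc (Suc k)) (t - 1/2) x - v (Suc k) (t - 1/2) x * v (Suc (Suc k)) t x)"
    unfolding a b by (simp add: algebra_simps)
  finally have d: "phi (Suc k) t x - phi k t x = - th (t - 1/2) x * (v (Suc k) t x * v (Suc (Suc k)) (t - 1/2) x - v (Suc k) (t - 1/2) x * v (Suc (Suc k)) t x) / (?a * ?b)" .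
  define w where "w = wdg (y (Suc k) t x) (y (Suc (Suc k)) t x)"
  have w: "w = wt t x * wt (t - 1/2) x * (v (Suc k) t x * v (Suc (Suc k)) (t - 1/2) x - v (Suc k) (t - 1/2) x * v (Suc (Suc k)) t x)"
    unfolding w_def wdg_def y_def tv_def by (simp add: algebra_simps)
  have "cnj (t - 1/2) = cnj t - 1/2" by simp
  then have th: "th (t - 1/2) x = wt (t - 1/2) x * cnj (snd (y 1 (cnj t) (cnj x)))"
    using wt_cnj(1)[of "t - 1/2" x] wt_cnj(2)[of "cnj t - 1/2" "cnj x"] unfolding th_def y_def tv_def by simp
  have eq: "wt t x * (phi (Suc k) t x - phi k t x) = - cnj (snd (y 1 (cnj t) (cnj x))) * w / (?a * ?b)"
    unfolding d w th by simp
  define N1 N2 M where "N1 = norm (y (Suc k) t x)" and "N2 = norm (y (Suc (Suc k)) t x)" and "M = norm (y 1 t x)"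
  have pos: "m \<le> N1" "m \<le> N2" "m \<le> M" unfolding N1_def N2_def M_def using y_pos[OF st] by (auto simp: One_nat_def[symmetric] simp del: One_nat_def intro: y_pos[OF st, of 0, unfolded One_nat_def[symmetric]])
  then have pos': "0 < N1" "0 < N2" "0 < M" using m_pos by auto
  have "norm (cnj (snd (y 1 (cnj t) (cnj x)))) \<le> 1.01 * M"
    using order_trans[OF norm_snd_vec2 V_cnj'(2)[OF st]] by (simp add: M_def)
  moreover have "norm w \<le> (1/5)^k * (N1 * N2)" unfolding w_def N1_def N2_def by (rule wedge_decay[OF st])
  ultimately have num: "norm (cnj (snd (y 1 (cnj t) (cnj x))) * w) \<le> 1.01 * M * ((1/5)^k * (N1 * N2))"
    unfolding norm_mult using pos' by (intro mult_mono) auto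
  have den: "(0.73 * (N1 * M)) * (0.73 * (N2 * M)) \<le> norm (?a * ?b)"
    unfolding norm_mult N1_def N2_def M_def by (intro mult_mono ac_low[OF st]) auto
  have "norm (wt t x * (phi (Suc k) t x - phi k t x)) = norm (cnj (snd (y 1 (cnj t) (cnj x))) * w) / norm (?a * ?b)"
    unfolding eq by (simp add: norm_divide norm_mult)
  also have "\<dots> \<le> (1.01 * M * ((1/5)^k * (N1 * N2))) / ((0.73 * (N1 * M)) * (0.73 * (N2 * M)))"
    by (rule frac_le[OF _ num _ den]) (use pos' in auto)
  also have "\<dots> = (1.01 / (0.73 * 0.73)) / M * (1/5)^k" using pos' by (simp add: field_simps)
  also have "\<dots> \<le> 2 / m * (1/5)^k"
  proof (intro mult_right_mono frac_le)
  qed (use pos m_pos in auto)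
  finally show ?thesis by (simp add: norm_mult)
qed

text \<open>The limit of the \<open>phi k\<close>, written as a telescoping series. Outside the
  strip no convergence is claimed; the value 0 there keeps the quasi-periodicity relations valid for
  all complex arguments.\<close>

definition PH :: "complex \<Rightarrow> complex \<Rightarrow> complex" where
  "PH t x = (if strip t \<and> strip x then phi 0 t x + (\<Sum>i. phi (Suc i) t x - phi i t x) else 0)"

definition box :: "real \<Rightarrow> (complex \<times> complex) set" where
  "box R = {(t, x). strip t \<and> strip x \<and> \<bar>Re t\<bar> \<le> R}"

text \<open>The bound on consecutive differences carries the weight \<open>wt\<close>, which is
  bounded below only while Re t stays bounded. This is why convergence is uniform on boxes and not
  on the whole strip.\<close>

lemma phi_unif: "uniform_limit (box R) (\<lambda>k (t, x). phi k t x) (\<lambda>(t, x). PH t x) sequentially"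
proof -
  define C where "C = exp (2 * pi * \<rho> * R)"
  have bd: "norm (phi (Suc k) t x - phi k t x) \<le> C * ((2 / m) * (1/5)^k)" if "(t, x) \<in> box R" for k t x
  proof -
    have st: "strip t" "strip x" "\<bar>Re t\<bar> \<le> R" using that by (auto simp: box_def)
    have "- (Im x * Re t) \<le> \<bar>Im x * Re t\<bar>" by linarith
    also have "\<dots> = \<bar>Im x\<bar> * \<bar>Re t\<bar>" by (rule abs_mult)
    also have "\<dots> \<le> \<rho> * R" using st \<rho>_pos by (intro mult_mono) (auto simp: strip_def)
    finally have "2 * pi * (- (Im x * Re t)) \<le> 2 * pi * (\<rho> * R)" by (intro mult_left_mono) auto
    then have "C * exp (2 * pi * Im x * Re t) \<ge> 1" unfolding C_def exp_add[symmetric] by (simp add: algebra_simps)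
    then have Cw: "1 \<le> C * norm (wt t x)" by (simp add: wt_def)
    have "norm (phi (Suc k) t x - phi k t x) \<le> (C * norm (wt t x)) * norm (phi (Suc k) t x - phi k t x)"
      using mult_right_mono[OF Cw norm_ge_zero[of "phi (Suc k) t x - phi k t x"]] by simp
    also have "\<dots> = C * (norm (wt t x) * norm (phi (Suc k) t x - phi k t x))" by simp
    also have "\<dots> \<le> C * ((2 / m) * (1/5)^k)" by (intro mult_left_mono phi_diff st) (simp add: C_def)
    finally show ?thesis .
  qed
  have sm: "summable (\<lambda>k. C * ((2 / m) * (1/5)^k))" by (intro summable_mult summable_geometric) simp
  have "uniform_limit (box R) (\<lambda>n z. \<Sum>i<n. (\<lambda>(t, x). phi (Suc i) t x - phi i t x) z) (\<lambda>z. \<Sum>i. (\<lambda>(t, x). phi (Suc i) t x - phi i t x) z) sequentially"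
    by (rule Weierstrass_m_test[OF _ sm]) (use bd in auto)
  then have "uniform_limit (box R) (\<lambda>n z. (\<lambda>(t, x). phi 0 t x) z + (\<Sum>i<n. (\<lambda>(t, x). phi (Suc i) t x - phi i t x) z))
     (\<lambda>z. (\<lambda>(t, x). phi 0 t x) z + (\<Sum>i. (\<lambda>(t, x). phi (Suc i) t x - phi i t x) z)) sequentially"
    by (intro uniform_limit_intros)
  then show ?thesis
    by (rule uniform_limit_cong'[THEN iffD1, rotated 2])
      (auto simp: box_def PH_def sum_lessThan_telescope[of "\<lambda>k. phi k _ _"] split_beta)
qed

lemma phi_lim: "strip t \<Longrightarrow> strip x \<Longrightarrow> (\<lambda>k. phi k t x) \<longlonglongrightarrow> PH t x"
  using tendsto_uniform_limitI[OF phi_unif[of "\<bar>Re t\<bar>"], of "(t, x)"] by (simp add: box_def)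

lemma PH_cont: "continuous_on (SS \<times> SS) (\<lambda>(t, x). PH t x)"
proof -
  have op: "open ((SS \<inter> {t. \<bar>Re t\<bar> < R}) \<times> SS)" for R
  proof -
    have "{t. \<bar>Re t\<bar> < R} = {t. Re t < R} \<inter> {t. Re t > - R}" by auto
    then show ?thesis by (simp add: open_Times open_Int open_SS open_halfspace_Re_gt open_halfspace_Re_lt)
  qed
  have "continuous_on (\<Union>n::nat. (SS \<inter> {t. \<bar>Re t\<bar> < real n}) \<times> SS) (\<lambda>(t, x). PH t x)"
  proof (rule continuous_on_open_UN)
    fix n :: nat
    show "continuous_on ((SS \<inter> {t. \<bar>Re t\<bar> < real n}) \<times> SS) (\<lambda>(t, x). PH t x)"
    proof (rule uniform_limit_theorem[OF _ uniform_limit_on_subset[OF phi_unif[of "real n"]]])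
      show "\<forall>\<^sub>F k in sequentially. continuous_on ((SS \<inter> {t. \<bar>Re t\<bar> < real n}) \<times> SS) (\<lambda>(t, x). phi k t x)"
        by (intro always_eventually allI continuous_on_subset[OF phi_props(3)]) auto
    qed (auto simp: box_def SS_def)
  qed (rule op)
  moreover have "(\<Union>n::nat. (SS \<inter> {t. \<bar>Re t\<bar> < real n}) \<times> SS) = SS \<times> SS"
  proof -
    have "\<exists>n. \<bar>Re t\<bar> < real n" for t using reals_Archimedean2 by blast
    then show ?thesis by auto
  qed
  ultimately show ?thesis by simp
qed

lemma PH_hol_t: assumes "x \<in> SS" shows "(\<lambda>t. PH t x) holomorphic_on SS"
proof (rule holomorphic_uniform_sequence[OF open_SS phi_props(1)[OF assms]])
  fix t assume "t \<in> SS"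
  then obtain d where d: "d > 0" "cball t d \<subseteq> SS" using open_SS open_contains_cball by blast
  have "bounded (cball t d)" by simp
  then obtain R where R: "\<And>z. z \<in> cball t d \<Longrightarrow> norm z \<le> R" unfolding bounded_iff by blast
  have "uniform_limit (cball t d) (\<lambda>k t. phi k t x) (\<lambda>t. PH t x) sequentially"
    using phi_unif[of R] unfolding uniform_limit_iff
  proof (intro allI impI)
    fix e :: real assume *: "\<forall>e>0. \<forall>\<^sub>F n in sequentially. \<forall>z\<in>box R. dist (case z of (t, x) \<Rightarrow> phi n t x) (case z of (t, x) \<Rightarrow> PH t x) < e" "e > 0"
    then have "\<forall>\<^sub>F n in sequentially. \<forall>z\<in>box R. dist (case z of (t, x) \<Rightarrow> phi n t x) (case z of (t, x) \<Rightarrow> PH t x) < e" by blast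
    then show "\<forall>\<^sub>F n in sequentially. \<forall>t\<in>cball t d. dist (phi n t x) (PH t x) < e"
    proof (rule eventually_mono, intro ballI)
      fix n s assume h: "\<forall>z\<in>box R. dist (case z of (t, x) \<Rightarrow> phi n t x) (case z of (t, x) \<Rightarrow> PH t x) < e" and s: "s \<in> cball t d"
      have "(s, x) \<in> box R" using d(2) s assms R[OF s] abs_Re_le_cmod[of s] by (auto simp: box_def SS_def)
      with h show "dist (phi n s x) (PH s x) < e" by force
    qed
  qed
  then show "\<exists>d>0. cball t d \<subseteq> SS \<and> uniform_limit (cball t d) (\<lambda>k t. phi k t x) (\<lambda>t. PH t x) sequentially"
    using d by blast
qed

lemma PH_hol_x: assumes "t \<in> SS" shows "(\<lambda>x. PH t x) holomorphic_on SS"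
proof (rule holomorphic_uniform_sequence[OF open_SS phi_props(2)[OF assms]])
  fix x assume "x \<in> SS"
  then obtain d where d: "d > 0" "cball x d \<subseteq> SS" using open_SS open_contains_cball by blast
  have "uniform_limit (cball x d) (\<lambda>k x. phi k t x) (\<lambda>x. PH t x) sequentially"
    using phi_unif[of "\<bar>Re t\<bar>"] unfolding uniform_limit_iff
  proof (intro allI impI)
    fix e :: real assume *: "\<forall>e>0. \<forall>\<^sub>F n in sequentially. \<forall>z\<in>box \<bar>Re t\<bar>. dist (case z of (t, x) \<Rightarrow> phi n t x) (case z of (t, x) \<Rightarrow> PH t x) < e" "e > 0"
    then have "\<forall>\<^sub>F n in sequentially. \<forall>z\<in>box \<bar>Re t\<bar>. dist (case z of (t, x) \<Rightarrow> phi n t x) (case z of (t, x) \<Rightarrow> PH t x) < e" by blast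
    then show "\<forall>\<^sub>F n in sequentially. \<forall>x\<in>cball x d. dist (phi n t x) (PH t x) < e"
    proof (rule eventually_mono, intro ballI)
      fix n s assume h: "\<forall>z\<in>box \<bar>Re t\<bar>. dist (case z of (t, x) \<Rightarrow> phi n t x) (case z of (t, x) \<Rightarrow> PH t x) < e" and s: "s \<in> cball x d"
      have "(t, s) \<in> box \<bar>Re t\<bar>" using d(2) s assms by (auto simp: box_def SS_def)
      with h show "dist (phi n t s) (PH t s) < e" by force
    qed
  qed
  then show "\<exists>d>0. cball x d \<subseteq> SS \<and> uniform_limit (cball x d) (\<lambda>k x. phi k t x) (\<lambda>x. PH t x) sequentially"
    using d by blast
qed

lemma PH_qp: "quasi_periodic PH"
proof -
  have "PH (t + 1) x = ee x * PH t x" for t x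
  proof (cases "strip t \<and> strip x")
    case True
    then have "(\<lambda>k. ee x * phi k t x) \<longlonglongrightarrow> ee x * PH t x" "(\<lambda>k. phi k (t + 1) x) \<longlonglongrightarrow> PH (t + 1) x"
      by (auto intro!: tendsto_intros phi_lim)
    then show ?thesis unfolding phi_qp by (rule LIMSEQ_unique[rotated])
  qed (auto simp: PH_def)
  moreover have "PH t (x + 1) = PH t x" for t x by (simp add: PH_def phi_qp)
  ultimately show ?thesis by (simp add: quasi_periodic_def)
qed

lemma pair_PH: assumes "strip t" "strip x" shows "pair PH t x = 1"
proof -
  have "(\<lambda>k. pair (phi k) t x) \<longlonglongrightarrow> pair PH t x"
    unfolding pair_def using assms by (intro tendsto_intros phi_lim) auto
  then have "(\<lambda>k. 1) \<longlonglongrightarrow> pair PH t x" using pair_phi[OF assms] by simp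
  then show ?thesis by (simp add: LIMSEQ_const_iff)
qed

text \<open>Since \<open>PH\<close> pairs to 1, pairing its image under the cube with the same
  covector extracts the multiplier without any division.\<close>

definition qq :: "complex \<Rightarrow> complex \<Rightarrow> complex" where "qq t x = pair (Hop a b PH) t x"

definition rr :: "nat \<Rightarrow> complex \<Rightarrow> complex \<Rightarrow> complex" where
  "rr k t x = ac (Suc (Suc k)) t x / ac (Suc k) (t - of_real a) (x - of_real b)"

text \<open>Exact before any limit: the cube sends a normalized iterate to a multiple of the next
  one, because it sends \<open>v (Suc k)\<close> to \<open>v (Suc (Suc k))\<close> and the scalar
  denominators pass through both terms. In the limit both sides involve the same section.\<close>

lemma Hop_phi:
  assumes "strip t" "strip x"
  shows "Hop a b (phi k) t x = rr k t x * phi (Suc k) t x"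
proof -
  have q: "quasi_periodic (phi k)" using phi_qp by (simp add: quasi_periodic_def)
  let ?c = "ac (Suc k) (t - of_real a) (x - of_real b)"
  have "Hop a b (phi k) t x = Hop a b (v (Suc k)) t x / ?c"
    unfolding Hop_eq[OF q] Hop_eq[OF qp_v] phi_def ac_periodic by (simp add: algebra_simps add_divide_distrib)
  also have "\<dots> = rr k t x * phi (Suc k) t x"
    using ac_nonzero[OF assms, of "Suc k"] by (simp add: rr_def phi_def v_Suc)
  finally show ?thesis .
qed

lemma Hop_PH_lim:
  assumes "strip t" "strip x"
  shows "(\<lambda>k. Hop a b (phi k) t x) \<longlonglongrightarrow> Hop a b PH t x"
proof -
  have q: "quasi_periodic (phi k)" for k using phi_qp by (simp add: quasi_periodic_def)
  show ?thesis unfolding Hop_eq[OF q] Hop_eq[OF PH_qp] using assms by (intro tendsto_intros phi_lim) auto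
qed

lemma rr_lim:
  assumes "strip t" "strip x"
  shows "(\<lambda>k. rr k t x) \<longlonglongrightarrow> qq t x"
proof -
  have st: "strip (t - 1/2)" using assms by simp
  have "rr k (t - 1/2) x = rr k t x" for k
  proof -
    have "t - 1/2 - of_real a = t - of_real a - 1/2" by simp
    then show ?thesis by (simp only: rr_def ac_periodic)
  qed
  then have "pair (Hop a b (phi k)) t x = rr k t x * pair (phi (Suc k)) t x" for k
    unfolding pair_def Hop_phi[OF assms] Hop_phi[OF st assms(2)] by (simp add: algebra_simps)
  then have e: "pair (Hop a b (phi k)) t x = rr k t x" for k using pair_phi[OF assms] by simp
  have "(\<lambda>k. pair (Hop a b (phi k)) t x) \<longlonglongrightarrow> qq t x"
    unfolding qq_def pair_def using assms by (intro tendsto_intros Hop_PH_lim) auto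
  then show ?thesis unfolding e .
qed

lemma Hop_PH:
  assumes "strip t" "strip x"
  shows "Hop a b PH t x = qq t x * PH t x"
proof (rule LIMSEQ_unique[OF Hop_PH_lim[OF assms]])
  show "(\<lambda>k. Hop a b (phi k) t x) \<longlonglongrightarrow> qq t x * PH t x"
    unfolding Hop_phi[OF assms] by (intro tendsto_intros rr_lim assms LIMSEQ_Suc phi_lim)
qed

lemma qq_periodic: "qq (t + 1/2) x = qq t x" "qq t (x + 1) = qq t x"
  unfolding qq_def
  using quasi_periodicD[OF quasi_periodic_Hop[OF PH_qp]] by (intro pair_periodic pair_periodic_x; simp)+

lemma qq_props: "x \<in> SS \<Longrightarrow> (\<lambda>t. qq t x) holomorphic_on SS" "t \<in> SS \<Longrightarrow> (\<lambda>x. qq t x) holomorphic_on SS"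
  "continuous_on (SS \<times> SS) (\<lambda>(t, x). qq t x)" 
proof -
  have z: "(\<lambda>t. PH t x) holomorphic_on SS" "(\<lambda>t. PH x t) holomorphic_on SS" for x
  proof -
    have "PH t x = 0" "PH x t = 0" if "x \<notin> SS" for t using that by (auto simp: PH_def SS_def)
    then show "(\<lambda>t. PH t x) holomorphic_on SS" "(\<lambda>t. PH x t) holomorphic_on SS"
      using PH_hol_t[of x] PH_hol_x[of x] by (cases "x \<in> SS"; simp)+
  qed
  have h: "(\<lambda>t. Hop a b PH t x) holomorphic_on SS" "(\<lambda>x. Hop a b PH t x) holomorphic_on SS" for t x
    unfolding Hop_def by (intro holomorphic_Rop_t holomorphic_Rop_x z SS_shift)+
  show "x \<in> SS \<Longrightarrow> (\<lambda>t. qq t x) holomorphic_on SS" unfolding qq_def by (rule hol_pair[OF h(1)])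
  show "t \<in> SS \<Longrightarrow> (\<lambda>x. qq t x) holomorphic_on SS" unfolding qq_def by (rule hol_pair_x[OF h(2)])
  show "continuous_on (SS \<times> SS) (\<lambda>(t, x). qq t x)" 
    unfolding qq_def Hop_def by (intro cont_pair continuous_Rop PH_cont SS_shift)
qed

text \<open>By the recurrence the numerator of \<open>rr\<close> is 6 sqrt 3 times its denominator
  up to an error of twice the modulus of the denominator, so the real part stays above 10.39 - 2.
  The comparison needs 0 \<le> Re t \<le> 1, and the period 1/2 covers the rest. Positivity makes a
  periodic logarithm available.\<close>

lemma Re_qq: assumes "strip t" "strip x" shows "Re (qq t x) > 0"
proof -
  have base: "Re (qq t x) \<ge> 1" if st: "strip t" "strip x" and re: "0 \<le> Re t" "Re t \<le> 1" for t
  proof -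
    \<comment> \<open>The index starts one step late: then the preceding step already grows by 6
      instead of 1.5, and the determinant term is only about \<open>norm Y\<close>.\<close>
    have "Re (rr (Suc k) t x) \<ge> 1" for k
    proof -
      let ?t = "t - of_real a" and ?x = "x - of_real b"
      define T where "T = 6 * sqrt 3"
      define Y where "Y = y (Suc (Suc k)) ?t ?x"
      define e where "e = y (Suc (Suc (Suc k))) t x - (sfac a b t x * of_real T) *\<^sub>C Y"
      define W where "W = y 1 (cnj t) (cnj x)"
      define W' where "W' = y 1 (cnj ?t) (cnj ?x)"
      define A where "A = cin Y W'"
      define s where "s = sfac a b t x"
      have st': "strip ?t" "strip ?x" using st by auto
      have n6: "6 * norm (y (Suc k) (?t - of_real a) (?x - of_real b)) \<le> norm Y"
        unfolding Y_def by (rule y_growth) (use st in auto)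
      have e: "norm e \<le> 1.01 * norm Y"
      proof -
        have "norm e \<le> 6.05 * norm (y (Suc k) (?t - of_real a) (?x - of_real b)) + 0.001 * norm Y"
          using rel[OF st, of "Suc k"] unfolding e_def T_def Y_def by simp
        also have "\<dots> \<le> 6.05 * (norm Y / 6) + 0.001 * norm Y" using n6 by (intro add_right_mono mult_left_mono) auto
        also have "\<dots> \<le> 1.01 * norm Y" by simp
        finally show ?thesis .
      qed
      have A_ac: "A = ac (Suc (Suc k)) ?t ?x" by (simp add: A_def ac_def Y_def W'_def)
      have W1: "norm (y 1 ?t ?x - y 1 t x) \<le> 0.01 * norm (y 1 t x)"
        using V_shift[of t x] st re by (simp add: strip_def y_def v_Suc v_0)
      have W2: "norm (y 1 (cnj ?t) (cnj ?x) - y 1 (cnj t) (cnj x)) \<le> 0.01 * norm (y 1 (cnj t) (cnj x))"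
        using V_shift[of "cnj t" "cnj x"] st re by (simp add: strip_def y_def v_Suc v_0)
      define L where "L = norm (y 1 ?t ?x)"
      have WL: "norm W' \<le> 1.01 * L" unfolding W'_def L_def by (rule V_cnj'[OF st'])
      have W2': "norm (W' - W) \<le> 0.01 * norm W" using W2 unfolding W'_def W_def .
      have "norm W \<le> norm W' + norm (W' - W)" using norm_triangle_ineq4[of W' "W' - W"] by simp
      with W2' WL have Wn: "norm W \<le> 1.03 * L" using norm_ge_zero[of "y 1 ?t ?x", folded L_def] by simp
      have AL: "0.73 * (norm Y * L) \<le> norm A" unfolding A_ac Y_def L_def by (rule ac_low[OF st'])
      have WW: "norm (W - W') \<le> 0.0103 * L" using W2' Wn by (simp add: norm_minus_commute)
      have dA: "norm (cin Y W - A) \<le> norm Y * (0.0103 * L)" unfolding A_def cin_diff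
        by (rule order_trans[OF norm_cin_le]) (intro mult_left_mono WW, simp)
      have num: "ac (Suc (Suc (Suc k))) t x = s * of_real T * cin Y W + cin e W"
        unfolding ac_def W_def[symmetric] s_def cin_cscale[symmetric] e_def by (simp add: cin_diff(2)[symmetric])
      define N where "N = norm Y * L"
      have Apos: "A \<noteq> 0" unfolding A_ac by (rule ac_nonzero[OF st'])
      have Ns: "N \<le> norm A / 0.73" using AL by (simp add: N_def)
      have ew: "norm (cin e W) \<le> 1.05 * N" 
      proof -
        have "norm (cin e W) \<le> (1.01 * norm Y) * (1.03 * L)"
          by (rule order_trans[OF norm_cin_le]) (intro mult_mono e Wn, auto)
        also have "\<dots> = 1.0403 * N" by (simp add: N_def)
        also have "\<dots> \<le> 1.05 * N" by (intro mult_right_mono) (auto simp: N_def L_def)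
        finally show ?thesis .
      qed
      have T: "10.39 \<le> T" "T \<le> 10.4" unfolding T_def using sqrt3_bounds by auto
      have s1: "norm (s - 1) \<le> 0.01" unfolding s_def using sf_shift st re by (simp add: strip_def)
      have sn: "norm s \<le> 1.0001" unfolding s_def by (rule sf_le(1)[OF st])
      \<comment> \<open>Three sources of error: the covector is taken at the later point instead of
        the earlier one, the scalar \<open>sfac\<close> is not exactly 1, and the recurrence has the
        remainder \<open>e\<close>.\<close>
      have dec: "ac (Suc (Suc (Suc k))) t x - of_real T * A = of_real T * s * (cin Y W - A) + of_real T * (s - 1) * A + cin e W"
        unfolding num by (simp add: algebra_simps)
      have "norm (of_real T * s * (cin Y W - A) + of_real T * (s - 1) * A + cin e W) \<le>
         10.4 * 1.0001 * (0.0103 * N) + 10.4 * 0.01 * norm A + 1.05 * N"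
      proof (intro norm_triangle_le add_mono)
        show "norm (of_real T * s * (cin Y W - A)) \<le> 10.4 * 1.0001 * (0.0103 * N)"
          unfolding norm_mult using T sn dA by (intro mult_mono) (auto simp: N_def)
        show "norm (of_real T * (s - 1) * A) \<le> 10.4 * 0.01 * norm A"
          unfolding norm_mult using T s1 by (intro mult_mono) auto
      qed (rule ew)
      also have "\<dots> \<le> 2 * norm A"
      proof -
        have lin: "10.4 * 1.0001 * (0.0103 * n) + 10.4 * 0.01 * c + 1.05 * n \<le> 2 * c" if "n \<le> c / 0.73" "0 \<le> c" for n c :: real
          using that by (simp add: field_simps)
        show ?thesis by (rule lin) (use Ns in auto)
      qed
      finally have "norm (ac (Suc (Suc (Suc k))) t x - of_real T * A) \<le> 2 * norm A" unfolding dec .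
      then have "norm (rr (Suc k) t x - of_real T) \<le> 2"
      proof -
        assume h: "norm (ac (Suc (Suc (Suc k))) t x - of_real T * A) \<le> 2 * norm A"
        have "rr (Suc k) t x - of_real T = (ac (Suc (Suc (Suc k))) t x - of_real T * A) / A"
          unfolding rr_def A_ac[symmetric] using Apos by (simp add: field_simps)
        then have "norm (rr (Suc k) t x - of_real T) = norm (ac (Suc (Suc (Suc k))) t x - of_real T * A) / norm A"
          by (simp only: norm_divide)
        then show ?thesis using h Apos by (simp add: divide_le_eq)
      qed
      then show ?thesis using abs_Re_le_cmod[of "rr (Suc k) t x - of_real T"] T by simp
    qed
    moreover have "(\<lambda>k. Re (rr (Suc k) t x)) \<longlonglongrightarrow> Re (qq t x)"
      by (intro tendsto_Re LIMSEQ_Suc rr_lim st)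
    ultimately show ?thesis by (intro LIMSEQ_le_const) auto
  qed
  have per: "qq (t + of_int n) x = qq t x" for t n
  proof -
    have n: "qq (t + of_nat k) x = qq t x" for t k
    proof (induction k)
      case (Suc k)
      have "qq (t + of_nat k + 1/2 + 1/2) x = qq (t + of_nat k) x" by (simp only: qq_periodic)
      then show ?case using Suc by (simp add: algebra_simps)
    qed simp
    show ?thesis
    proof (cases n rule: int_cases2)
      case (nonneg k) then show ?thesis using n by simp
    next
      case (nonpos k) then show ?thesis using n[of "t - of_nat k" k] by simp
    qed
  qed
  have "Re (qq (t - of_int \<lfloor>Re t\<rfloor>) x) \<ge> 1"
  proof (rule base)
    show "strip (t - of_int \<lfloor>Re t\<rfloor>)" using assms by (simp add: strip_def)
    show "0 \<le> Re (t - of_int \<lfloor>Re t\<rfloor>)" "Re (t - of_int \<lfloor>Re t\<rfloor>) \<le> 1" by (auto, linarith+)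
  qed (rule assms)
  then show ?thesis using per[of "t - of_int \<lfloor>Re t\<rfloor>" "\<lfloor>Re t\<rfloor>"] by simp
qed

end

section \<open>A theta function as seed\<close>

text \<open>The M-test gives uniform convergence on small closed balls along the net of finite
  partial sums, and holomorphy passes to such limits.\<close>

lemma infsum_holomorphic:
  fixes f :: "'i \<Rightarrow> complex \<Rightarrow> complex"
  assumes hol: "\<And>i. i \<in> I \<Longrightarrow> f i holomorphic_on S" and "open S"
    and bd: "\<And>z. z \<in> S \<Longrightarrow> \<exists>d>0. \<exists>M. cball z d \<subseteq> S \<and> M summable_on I \<and> (\<forall>i\<in>I. \<forall>w\<in>cball z d. norm (f i w) \<le> M i)"
  shows "(\<lambda>z. infsum (\<lambda>i. f i z) I) holomorphic_on S"
proof -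
  have "\<exists>d>0. (\<lambda>z. infsum (\<lambda>i. f i z) I) holomorphic_on ball z d" if z: "z \<in> S" for z
  proof -
    obtain d M where d: "d > 0" "cball z d \<subseteq> S" "M summable_on I" "\<And>i w. i \<in> I \<Longrightarrow> w \<in> cball z d \<Longrightarrow> norm (f i w) \<le> M i"
      using bd[OF z] by blast
    have ul: "uniform_limit (cball z d) (\<lambda>X y. \<Sum>i\<in>X. f i y) (\<lambda>y. infsum (\<lambda>i. f i y) I) (finite_subsets_at_top I)"
      by (rule Weierstrass_m_test_general) (use d in auto)
    have h: "(\<lambda>y. \<Sum>i\<in>X. f i y) holomorphic_on S" if "X \<subseteq> I" for X
      using hol that by (intro holomorphic_intros) auto
    have "\<forall>\<^sub>F X in finite_subsets_at_top I. continuous_on (cball z d) (\<lambda>y. \<Sum>i\<in>X. f i y) \<and> (\<lambda>y. \<Sum>i\<in>X. f i y) holomorphic_on ball z d"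
    proof (rule eventually_finite_subsets_at_top_weakI)
      fix X assume X: "finite X" "X \<subseteq> I"
      show "continuous_on (cball z d) (\<lambda>y. \<Sum>i\<in>X. f i y) \<and> (\<lambda>y. \<Sum>i\<in>X. f i y) holomorphic_on ball z d"
      proof
        have h': "(\<lambda>y. \<Sum>i\<in>X. f i y) holomorphic_on cball z d"
          by (rule holomorphic_on_subset[OF h[OF X(2)] d(2)])
        then show "continuous_on (cball z d) (\<lambda>y. \<Sum>i\<in>X. f i y)" by (rule holomorphic_on_imp_continuous_on)
        show "(\<lambda>y. \<Sum>i\<in>X. f i y) holomorphic_on ball z d" by (rule holomorphic_on_subset[OF h' ball_subset_cball])
      qed
    qed
    from holomorphic_uniform_limit[OF this ul finite_subsets_at_top_neq_bot] d(1) show ?thesis by blast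
  qed
  then have "\<forall>z\<in>S. (\<lambda>z. infsum (\<lambda>i. f i z) I) field_differentiable at z"
    using holomorphic_on_imp_differentiable_at[OF _ open_ball] centre_in_ball by blast
  then show ?thesis unfolding holomorphic_on_def using field_differentiable_at_within by blast
qed

lemma infsum_continuous:
  fixes f :: "'i \<Rightarrow> 'a::metric_space \<Rightarrow> complex"
  assumes c: "\<And>i. i \<in> I \<Longrightarrow> continuous_on S (f i)"
    and bd: "\<And>z. z \<in> S \<Longrightarrow> \<exists>V M. open V \<and> z \<in> V \<and> M summable_on I \<and> (\<forall>i\<in>I. \<forall>w\<in>V \<inter> S. norm (f i w) \<le> M i)"
  shows "continuous_on S (\<lambda>z. infsum (\<lambda>i. f i z) I)"
proof -
  have "continuous (at z within S) (\<lambda>z. infsum (\<lambda>i. f i z) I)" if z: "z \<in> S" for z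
  proof -
    obtain V M where V: "open V" "z \<in> V" "M summable_on I" "\<And>i w. i \<in> I \<Longrightarrow> w \<in> V \<inter> S \<Longrightarrow> norm (f i w) \<le> M i"
      using bd[OF z] by blast
    have ul: "uniform_limit (V \<inter> S) (\<lambda>X y. \<Sum>i\<in>X. f i y) (\<lambda>y. infsum (\<lambda>i. f i y) I) (finite_subsets_at_top I)"
      by (rule Weierstrass_m_test_general) (use V in auto)
    have "continuous_on (V \<inter> S) (\<lambda>z. infsum (\<lambda>i. f i z) I)"
    proof (rule uniform_limit_theorem[OF _ ul])
      show "\<forall>\<^sub>F X in finite_subsets_at_top I. continuous_on (V \<inter> S) (\<lambda>y. \<Sum>i\<in>X. f i y)"
        by (rule eventually_finite_subsets_at_top_weakI) (use c in \<open>auto intro!: continuous_intros intro: continuous_on_subset\<close>)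
    qed simp
    then have "continuous (at z within S \<inter> V) (\<lambda>z. infsum (\<lambda>i. f i z) I)"
      using V z by (simp add: continuous_on_eq_continuous_within Int_commute)
    moreover have "at z within S \<inter> V = at z within S" by (rule at_within_nhd[OF V(2,1)]) auto
    ultimately show ?thesis by simp
  qed
  then show ?thesis by (simp add: continuous_on_eq_continuous_within)
qed

lemma geometric_int_has_sum:
  fixes r :: real assumes "0 \<le> r" "r < 1"
  shows "((\<lambda>m::int. r ^ nat \<bar>m\<bar>) has_sum ((1 + r) / (1 - r))) UNIV"
proof -
  have g: "((\<lambda>k::nat. r ^ k) has_sum (1 / (1 - r))) UNIV"
    using assms by (intro norm_summable_imp_has_sum geometric_sums) (auto simp: norm_power intro: summable_geometric)
  have 1: "((\<lambda>m::int. r ^ nat \<bar>m\<bar>) has_sum (1 / (1 - r))) (range int)"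
    using g by (subst has_sum_reindex) (auto simp: o_def)
  have 2: "((\<lambda>m::int. r ^ nat \<bar>m\<bar>) has_sum (r * (1 / (1 - r)))) (range (\<lambda>k. - int k - 1))"
  proof (subst has_sum_reindex)
    show "inj (\<lambda>k. - int k - 1)" by (auto simp: inj_on_def)
    have "nat \<bar>- int k - 1\<bar> = Suc k" for k by simp
    then show "((\<lambda>m. r ^ nat \<bar>m\<bar>) \<circ> (\<lambda>k. - int k - 1) has_sum r * (1 / (1 - r))) UNIV"
      using has_sum_cmult_right[OF g, of r] by (simp add: o_def)
  qed
  have "range int \<inter> range (\<lambda>k. - int k - 1) = {}" by auto
  moreover have "range int \<union> range (\<lambda>k. - int k - 1) = UNIV"
  proof -
    have "m \<in> range int \<or> m \<in> range (\<lambda>k. - int k - 1)" for m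
    proof (cases "m \<ge> 0")
      case True then have "m = int (nat m)" by simp
      then show ?thesis by blast
    next
      case False then have "m = - int (nat (- m - 1)) - 1" by simp
      then show ?thesis by blast
    qed
    then show ?thesis by blast
  qed
  ultimately show ?thesis using has_sum_Un_disjoint[OF 1 2] assms by (simp add: add_divide_distrib)
qed

lemma geometric_int_summable: "0 \<le> r \<Longrightarrow> r < (1::real) \<Longrightarrow> (\<lambda>m::int. r ^ nat \<bar>m\<bar>) summable_on A"
  using geometric_int_has_sum summable_on_subset_banach[of _ UNIV A] has_sum_imp_summable by blast

lemma exp_neg_abs_summable: "(\<lambda>m::int. C * exp (- \<bar>real_of_int m\<bar>)) summable_on A"
proof -
  have "exp (- \<bar>real_of_int m\<bar>) = exp (-1) ^ nat \<bar>m\<bar>" for m by (simp add: exp_of_nat_mult[symmetric])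
  then show ?thesis using geometric_int_summable[of "exp (-1)"] by (auto intro!: summable_on_cmult_right)
qed

text \<open>Terms of the Zak transform of the Gaussian exp(-8 pi t^2), so \<open>psi\<close> is a
  theta function. The Gaussian is narrow: for real t between -1/4 and 1/4 one term dominates in
  \<open>psi t\<close> and two terms, m = 0 and m = 1, in \<open>psi (t - 1/2)\<close>.\<close>

definition gt :: "int \<Rightarrow> complex \<Rightarrow> complex \<Rightarrow> complex" where
  "gt m t x = exp (- (of_real (8 * pi) * (t + of_int m)\<^sup>2)) * ee (- (of_int m * x))"

definition psi :: "complex \<Rightarrow> complex \<Rightarrow> complex" where
  "psi t x = infsum (\<lambda>m. gt m t x) UNIV"

lemma norm_gt: "norm (gt m t x) = exp (- (8 * pi * ((Re t + m)\<^sup>2 - (Im t)\<^sup>2)) + 2 * pi * m * Im x)"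
proof -
  have "Re ((t + of_int m)\<^sup>2) = (Re t + m)\<^sup>2 - (Im t)\<^sup>2" by (simp add: power2_eq_square)
  then have "norm (exp (- (of_real (8 * pi) * (t + of_int m)\<^sup>2))) = exp (- (8 * pi * ((Re t + m)\<^sup>2 - (Im t)\<^sup>2)))"
    unfolding norm_exp_eq_Re by simp
  then show ?thesis by (simp add: gt_def norm_mult norm_ee exp_add[symmetric] mult.commute mult.left_commute)
qed


text \<open>Obtained by completing the square. The term linear in the absolute value of m has
  coefficient at most 16 pi R from the cross term of the square plus 2 pi R from Im x; the
  additional 1 in \<open>18 * pi * R + 1\<close> is what leaves the summable factor.\<close>

definition gtM :: "real \<Rightarrow> int \<Rightarrow> real" where
  "gtM R m = exp (8 * pi * R\<^sup>2 + (18 * pi * R + 1)\<^sup>2 / (32 * pi)) * exp (- \<bar>real_of_int m\<bar>)"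

lemma gt_bound:
  assumes "\<bar>Re t\<bar> \<le> R" "\<bar>Im t\<bar> \<le> R" "\<bar>Im x\<bar> \<le> R"
  shows "norm (gt m t x) \<le> gtM R m"
proof -
  define \<mu> where "\<mu> = \<bar>real_of_int m\<bar>"
  define K where "K = 18 * pi * R + 1"
  have mu: "\<mu>\<^sup>2 = (real_of_int m)\<^sup>2" "\<mu> \<ge> 0" by (simp_all add: \<mu>_def)
  have "\<bar>Re t * m\<bar> \<le> R * \<mu>" unfolding abs_mult \<mu>_def using assms by (intro mult_right_mono) auto
  then have 1: "(Re t + m)\<^sup>2 \<ge> \<mu>\<^sup>2 - 2 * (R * \<mu>)"
    unfolding mu power2_sum using zero_le_power2[of "Re t"] by linarith
  have 2: "(Im t)\<^sup>2 \<le> R\<^sup>2" using assms(2) by (rule abs_le_square_iff[THEN iffD1, OF order_trans]) simp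
  have "\<bar>m * Im x\<bar> \<le> \<mu> * R" unfolding abs_mult \<mu>_def using assms by (intro mult_left_mono) auto
  then have 3: "m * Im x \<le> R * \<mu>" by (simp add: mult.commute)
  have sq: "0 \<le> 8 * pi * (\<mu> - K / (16 * pi))\<^sup>2" by simp
  have "8 * pi * (\<mu> - K / (16 * pi))\<^sup>2 = 8 * pi * \<mu>\<^sup>2 - K * \<mu> + K\<^sup>2 / (32 * pi)"
    by (simp add: power2_diff power_divide field_simps power2_eq_square)
  with sq have 4: "K * \<mu> \<le> 8 * pi * \<mu>\<^sup>2 + K\<^sup>2 / (32 * pi)" by linarith
  have "- (8 * pi * ((Re t + m)\<^sup>2 - (Im t)\<^sup>2)) + 2 * pi * m * Im x
      = 8 * pi * ((Im t)\<^sup>2 - (Re t + m)\<^sup>2) + 2 * pi * (m * Im x)" by (simp add: algebra_simps)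
  also have "\<dots> \<le> 8 * pi * (R\<^sup>2 - (\<mu>\<^sup>2 - 2 * (R * \<mu>))) + 2 * pi * (R * \<mu>)"
    using 1 2 3 by (intro add_mono mult_left_mono) auto
  also have "\<dots> = 8 * pi * R\<^sup>2 - 8 * pi * \<mu>\<^sup>2 + K * \<mu> - \<mu>" by (simp add: K_def algebra_simps)
  also have "\<dots> \<le> 8 * pi * R\<^sup>2 + K\<^sup>2 / (32 * pi) - \<mu>" using 4 by linarith
  finally show ?thesis unfolding norm_gt gtM_def K_def[symmetric] \<mu>_def[symmetric] exp_add[symmetric] by simp
qed

lemma gtM_summable: "gtM R summable_on A"
  unfolding gtM_def by (rule exp_neg_abs_summable)

lemma gt_summable: "(\<lambda>m. gt m t x) summable_on A" "(\<lambda>m. norm (gt m t x)) summable_on A"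
proof -
  define R where "R = \<bar>Re t\<bar> + \<bar>Im t\<bar> + \<bar>Im x\<bar>"
  have "norm (gt m t x) \<le> gtM R m" for m by (rule gt_bound) (auto simp: R_def)
  then show "(\<lambda>m. norm (gt m t x)) summable_on A"
    by (intro summable_on_comparison_test[OF gtM_summable]) auto
  then show "(\<lambda>m. gt m t x) summable_on A" by (rule abs_summable_summable)
qed

lemma psi_qp: "quasi_periodic psi"
proof -
  have "gt m (t + 1) x = ee x * gt (m + 1) t x" for m t x
  proof -
    have "t + 1 + of_int m = t + of_int (m + 1)" by simp
    moreover have "ee (- (of_int m * x)) = ee x * ee (- (of_int (m + 1) * x))"
      unfolding ee_add[symmetric] by (simp add: algebra_simps)
    ultimately show ?thesis unfolding gt_def by (simp add: add_ac)
  qed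
  moreover have "infsum (\<lambda>m. ee x * gt (m + 1) t x) UNIV = ee x * infsum (\<lambda>m. gt m t x) UNIV" for t x
  proof -
    have "bij_betw (\<lambda>m::int. m + 1) UNIV UNIV" by (rule bij_betwI[of _ _ _ "\<lambda>m. m - 1"]) auto
    then have "infsum (\<lambda>m. gt (m + 1) t x) UNIV = infsum (\<lambda>m. gt m t x) UNIV" by (rule infsum_reindex_bij_betw)
    then show ?thesis by (simp add: infsum_cmult_right')
  qed
  ultimately have 1: "psi (t + 1) x = ee x * psi t x" for t x unfolding psi_def by simp
  have "gt m t (x + 1) = gt m t x" for m t x
  proof -
    have "ee (- (of_int m * (x + 1))) = ee (- (of_int m * x))"
      using ee_periodic(2)[of "- (of_int m * x)" "- m"] by (simp add: algebra_simps)
    then show ?thesis by (simp add: gt_def)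
  qed
  then have "psi t (x + 1) = psi t x" for t x unfolding psi_def by simp
  with 1 show ?thesis by (simp add: quasi_periodic_def)
qed

lemma psi_hol: "(\<lambda>t. psi t x) holomorphic_on UNIV" "(\<lambda>x. psi t x) holomorphic_on UNIV"
proof -
  show "(\<lambda>t. psi t x) holomorphic_on UNIV" unfolding psi_def
  proof (rule infsum_holomorphic)
    fix z :: complex
    have *: "norm (gt m w x) \<le> gtM (norm z + 1 + norm x) m" if "w \<in> cball z 1" for m w
    proof -
      have "norm w \<le> norm z + 1" using that norm_triangle_ineq2[of w z] by (simp add: dist_norm norm_minus_commute)
      then show ?thesis using abs_Re_le_cmod[of w] abs_Im_le_cmod[of w] abs_Im_le_cmod[of x]
        by (intro gt_bound) (use norm_ge_zero[of x] norm_ge_zero[of z] in linarith)+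
    qed
    show "\<exists>d>0. \<exists>M. cball z d \<subseteq> UNIV \<and> M summable_on (UNIV::int set) \<and> (\<forall>i\<in>UNIV. \<forall>w\<in>cball z d. norm (gt i w x) \<le> M i)"
      by (intro exI[of _ 1] conjI exI[of _ "gtM (norm z + 1 + norm x)"] gtM_summable ballI *) auto
  qed (auto simp: gt_def ee_def intro!: holomorphic_intros)
  show "(\<lambda>x. psi t x) holomorphic_on UNIV" unfolding psi_def
  proof (rule infsum_holomorphic)
    fix z :: complex
    have *: "norm (gt m t w) \<le> gtM (norm z + 1 + norm t) m" if "w \<in> cball z 1" for m w
    proof -
      have "norm w \<le> norm z + 1" using that norm_triangle_ineq2[of w z] by (simp add: dist_norm norm_minus_commute)
      then show ?thesis using abs_Re_le_cmod[of t] abs_Im_le_cmod[of w] abs_Im_le_cmod[of t]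
        by (intro gt_bound) (use norm_ge_zero[of t] norm_ge_zero[of z] in linarith)+
    qed
    show "\<exists>d>0. \<exists>M. cball z d \<subseteq> UNIV \<and> M summable_on (UNIV::int set) \<and> (\<forall>i\<in>UNIV. \<forall>w\<in>cball z d. norm (gt i t w) \<le> M i)"
      by (intro exI[of _ 1] conjI exI[of _ "gtM (norm z + 1 + norm t)"] gtM_summable ballI *) auto
  qed (auto simp: gt_def ee_def intro!: holomorphic_intros)
qed

lemma psi_cont: "continuous_on UNIV (\<lambda>(t, x). psi t x)"
proof -
  have "continuous_on UNIV (\<lambda>z. infsum (\<lambda>m. gt m (fst z) (snd z)) UNIV)"
  proof (rule infsum_continuous)
    fix z :: "complex \<times> complex"
    have *: "norm (gt m (fst w) (snd w)) \<le> gtM (norm z + 1) m" if "w \<in> ball z 1" for m w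
    proof -
      have "norm w \<le> norm z + 1" using that norm_triangle_ineq2[of w z] by (simp add: dist_norm norm_minus_commute)
      moreover have "norm (fst w) \<le> norm w" "norm (snd w) \<le> norm w" by (rule norm_fst_vec2 norm_snd_vec2)+
      ultimately show ?thesis using abs_Re_le_cmod[of "fst w"] abs_Im_le_cmod[of "snd w"] abs_Im_le_cmod[of "fst w"]
        by (intro gt_bound) linarith+
    qed
    show "\<exists>V M. open V \<and> z \<in> V \<and> M summable_on (UNIV::int set) \<and> (\<forall>i\<in>UNIV. \<forall>w\<in>V \<inter> UNIV. norm (gt i (fst w) (snd w)) \<le> M i)"
      by (intro exI[of _ "ball z 1"] conjI exI[of _ "gtM (norm z + 1)"] gtM_summable ballI *) auto
  qed (auto simp: gt_def intro!: continuous_intros)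
  then show ?thesis by (simp add: psi_def split_beta)
qed

lemma r4pi: "exp (- (4 * pi)) \<le> 1/1000"
proof -
  have "(2::real) ^ 12 \<le> exp 1 ^ 12" using exp_ge_add_one_self[of 1] by (intro power_mono) auto
  also have "\<dots> = exp 12" by (simp add: exp_of_nat_mult[symmetric])
  also have "\<dots> \<le> exp (4 * pi)" using pi_gt3 by simp
  finally have "1000 \<le> exp (4 * pi)" by simp
  then show ?thesis by (simp add: exp_minus field_simps)
qed

text \<open>The ratio r = exp(-4 pi) is at most 1/1000, and the geometric series over all nonzero
  integers is 2 r / (1 - r) < 0.0021.\<close>

lemma tail_bound:
  fixes f :: "int \<Rightarrow> complex"
  assumes "\<And>m. m \<in> A \<Longrightarrow> norm (f m) \<le> c * exp (- (4 * pi)) ^ nat \<bar>m\<bar>" "0 \<notin> A" "c \<ge> 0"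
  shows "norm (infsum f A) \<le> c * 0.0021"
proof -
  define r where "r = exp (- (4 * pi))"
  have r: "0 \<le> r" "r \<le> 1/1000" using r4pi by (simp_all add: r_def)
  have "((\<lambda>m::int. r ^ nat \<bar>m\<bar>) has_sum ((1 + r) / (1 - r) - 1)) (UNIV - {0})"
    using has_sum_Diff[OF geometric_int_has_sum[of r], of "{0}" 1] r by (simp add: has_sum_finite_iff)
  then have s: "((\<lambda>m::int. c * r ^ nat \<bar>m\<bar>) has_sum (c * ((1 + r) / (1 - r) - 1))) (UNIV - {0})" by (rule has_sum_cmult_right)
  have sA: "(\<lambda>m::int. c * r ^ nat \<bar>m\<bar>) summable_on A"
    using geometric_int_summable[of r A] r by (auto intro: summable_on_cmult_right)
  have abs: "(\<lambda>m. norm (f m)) summable_on A" by (rule summable_on_comparison_test[OF sA]) (use assms(1) in \<open>auto simp: r_def\<close>)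
  have "norm (infsum f A) \<le> infsum (\<lambda>m. norm (f m)) A" by (rule norm_infsum_bound[OF abs])
  also have "\<dots> \<le> infsum (\<lambda>m. c * r ^ nat \<bar>m\<bar>) A" by (rule infsum_mono[OF abs sA]) (use assms(1) in \<open>auto simp: r_def\<close>)
  also have "\<dots> \<le> infsum (\<lambda>m. c * r ^ nat \<bar>m\<bar>) (UNIV - {0})"
    by (rule infsum_mono2[OF sA has_sum_imp_summable[OF s]]) (use assms(2,3) r in auto)
  also have "\<dots> = c * ((1 + r) / (1 - r) - 1)" by (rule infsumI[OF s])
  also have "(1 + r) / (1 - r) - 1 = 2 * r / (1 - r)" using r by (simp add: field_simps)
  also have "c * (2 * r / (1 - r)) \<le> c * 0.0021" 
  proof (rule mult_left_mono[OF _ assms(3)])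
    have "2 * r / (1 - r) \<le> 2 * (1/1000) / (1 - 1/1000)" using r by (intro frac_le) auto
    then show "2 * r / (1 - r) \<le> 0.0021" by simp
  qed
  finally show ?thesis .
qed


lemma norm_1_minus_ee: "norm (1 - ee (of_real u)) \<le> 2 * pi * \<bar>u\<bar>"
proof -
  have e: "1 - ee (of_real u) = - (2 * \<i>) * of_real (sin (pi * u)) * cis (pi * u)"
  proof -
    have s: "sin (2 * (pi * u)) = 2 * sin (pi * u) * cos (pi * u)" and c: "cos (2 * (pi * u)) = 1 - 2 * (sin (pi * u))\<^sup>2"
      by (simp_all add: sin_double cos_double_sin)
    have "ee (of_real u) = cis (2 * (pi * u))" by (simp add: ee_def cis_conv_exp mult_ac)
    then show ?thesis by (simp add: complex_eq_iff s c power2_eq_square)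
  qed
  have "norm (1 - ee (of_real u)) = 2 * \<bar>sin (pi * u)\<bar>" unfolding e by (simp add: norm_mult)
  also have "\<dots> \<le> 2 * \<bar>pi * u\<bar>" using abs_sin_x_le_abs_x[of "pi * u"] by simp
  finally show ?thesis by (simp add: abs_mult)
qed

lemma z_exp_bound: "0 \<le> (z::real) \<Longrightarrow> z * exp (- z) \<le> 1/2"
proof -
  assume z: "0 \<le> z"
  have "1 + z + z\<^sup>2 / 2 \<le> exp z" using exp_lower_Taylor_quadratic[OF z] .
  moreover have "0 \<le> (z - 1)\<^sup>2" by simp
  ultimately have "2 * z \<le> exp z" by (simp add: power2_eq_square algebra_simps)
  then show ?thesis by (simp add: exp_minus field_simps)
qed

lemma ee_real: "ee (of_real u) = Complex (cos (2 * pi * u)) (sin (2 * pi * u))"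
proof -
  have "ee (of_real u) = cis (2 * pi * u)" by (simp add: ee_def cis_conv_exp mult_ac)
  then show ?thesis by (simp add: complex_eq_iff)
qed

text \<open>Up to small tails, psi(\<tau>) is g and psi(\<tau> - 1/2) is g (\<open>\<rho>m\<close> +
  \<open>\<rho>p\<close> e(-x)), where \<open>\<rho>m\<close> is large only near the right end and
  \<open>\<rho>p\<close> only near the left end. Writing \<open>B0\<close> = b1 + e(x) b2, the
  products b1 \<open>\<rho>m\<close> and b2 \<open>\<rho>p\<close> have almost nonnegative real
  part, while in the other two products the coefficient vanishes exactly where the Gaussian factor
  is 1. The total loss is at most 1 against Re A0 \<ge> 4.196.\<close>

lemma psi_low_quarter:
  assumes "- (1/4) \<le> \<tau>" "\<tau> \<le> 1/4"
  shows "norm (A0 (of_real \<tau>) (of_real \<xi>) * psi (of_real \<tau>) (of_real \<xi>) + B0 (of_real \<tau>) (of_real \<xi>) * psi (of_real \<tau> - 1/2) (of_real \<xi>))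
    \<ge> 1.6 * norm (psi (of_real \<tau>) (of_real \<xi>), psi (of_real \<tau> - 1/2) (of_real \<xi>))"
    and "psi (of_real \<tau>) (of_real \<xi>) \<noteq> 0"
proof -
  define g where "g = exp (- (8 * pi * \<tau>\<^sup>2))"
  define \<rho>p \<rho>m where "\<rho>p = exp (- (8 * pi * (1/4 + \<tau>)))" and "\<rho>m = exp (- (8 * pi * (1/4 - \<tau>)))"
  define x where "x = (of_real \<xi> :: complex)"
  define t where "t = (of_real \<tau> :: complex)"
  have g: "g > 0" by (simp add: g_def)
  have \<rho>: "0 \<le> \<rho>p" "\<rho>p \<le> 1" "0 \<le> \<rho>m" "\<rho>m \<le> 1" using assms by (auto simp: \<rho>p_def \<rho>m_def)
  have prod: "\<rho>p * \<rho>m = exp (- (4 * pi))" unfolding \<rho>p_def \<rho>m_def exp_add[symmetric] by (simp add: algebra_simps)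
  have sum1: "\<rho>p + \<rho>m \<le> 1.001"
  proof -
    have "0 \<le> (1 - \<rho>p) * (1 - \<rho>m)" using \<rho> by (intro mult_nonneg_nonneg) auto
    then have "\<rho>p + \<rho>m \<le> 1 + \<rho>p * \<rho>m" by (simp add: algebra_simps)
    then show ?thesis using prod r4pi by simp
  qed
  have ngt: "norm (gt m (of_real s) x) = exp (- (8 * pi * (s + m)\<^sup>2))" for m s
    unfolding norm_gt by (simp add: x_def)
  have powr: "exp (- (4 * pi)) ^ nat \<bar>m\<bar> = exp (- (4 * pi * \<bar>real_of_int m\<bar>))" for m
    unfolding exp_of_nat_mult[symmetric] by simp
  define E0 where "E0 = infsum (\<lambda>m. gt m t x) (UNIV - {0}) / g"
  define E1 where "E1 = infsum (\<lambda>m. gt m (t - 1/2) x) (UNIV - {0, 1}) / g"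
  have E0: "norm E0 \<le> 0.0021"
  proof -
    have "norm (infsum (\<lambda>m. gt m t x) (UNIV - {0})) \<le> g * 0.0021"
    proof (rule tail_bound)
      fix m :: int assume m: "m \<in> UNIV - {0}"
      have m1: "1 \<le> \<bar>real_of_int m\<bar>" using m by auto
      have m2: "\<bar>real_of_int m\<bar> \<le> (real_of_int m)\<^sup>2" using mult_right_mono[OF m1, of "\<bar>real_of_int m\<bar>"] by (simp add: power2_eq_square)
      have "\<bar>m * \<tau>\<bar> \<le> \<bar>real_of_int m\<bar> * (1/4)" unfolding abs_mult using assms by (intro mult_left_mono) auto
      then have "m * \<tau> \<ge> - (\<bar>real_of_int m\<bar> / 4)" by linarith
      then have "(\<tau> + m)\<^sup>2 \<ge> \<tau>\<^sup>2 + \<bar>real_of_int m\<bar> / 2" using m2 unfolding power2_sum by (simp add: mult.commute)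
      then have "8 * pi * (\<tau>\<^sup>2 + \<bar>real_of_int m\<bar> / 2) \<le> 8 * pi * (\<tau> + m)\<^sup>2" by (intro mult_left_mono) auto
      then show "norm (gt m t x) \<le> g * exp (- (4 * pi)) ^ nat \<bar>m\<bar>"
        unfolding t_def ngt powr g_def exp_add[symmetric] by (simp add: algebra_simps)
    qed (use g in auto)
    then show ?thesis using g by (simp add: E0_def norm_divide field_simps)
  qed
  have E1: "norm E1 \<le> 0.0021"
  proof -
    have "norm (infsum (\<lambda>m. gt m (t - 1/2) x) (UNIV - {0, 1})) \<le> g * 0.0021"
    proof (rule tail_bound)
      fix m :: int assume m: "m \<in> UNIV - {0, 1}"
      define j where "j = real_of_int m - 1/2"
      \<comment> \<open>Here \<open>j\<close> is the offset from the centre 1/2. The excluded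
        indices m = 0 and m = 1, with offsets -1/2 and 1/2, are the two leading terms.\<close>
      have jm: "j\<^sup>2 - \<bar>j\<bar> / 2 \<ge> \<bar>real_of_int m\<bar> / 2"
      proof (cases "m \<ge> 2")
        case True
        then have "real_of_int m \<ge> 2" by linarith
        then have "0 \<le> (real_of_int m - 2) * (real_of_int m)" by (intro mult_nonneg_nonneg) auto
        moreover have "j\<^sup>2 - \<bar>j\<bar> / 2 - \<bar>real_of_int m\<bar> / 2 = (real_of_int m - 2) * (real_of_int m) + 1/2"
          using True by (simp add: j_def power2_eq_square field_simps)
        ultimately show ?thesis by linarith
      next
        case False
        then have "real_of_int m \<le> -1" using m by auto
        moreover then have "0 \<le> (- real_of_int m) * (- real_of_int m - 1)" by (intro mult_nonneg_nonneg) auto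
        ultimately show ?thesis by (simp add: j_def power2_eq_square field_simps)
      qed
      have "\<bar>j * \<tau>\<bar> \<le> \<bar>j\<bar> * (1/4)" unfolding abs_mult using assms by (intro mult_left_mono) auto
      then have "j * \<tau> \<ge> - (\<bar>j\<bar> / 4)" by linarith
      then have "(\<tau> + j)\<^sup>2 \<ge> \<tau>\<^sup>2 + \<bar>real_of_int m\<bar> / 2" using jm unfolding power2_sum by (simp add: mult.commute)
      then have "8 * pi * (\<tau>\<^sup>2 + \<bar>real_of_int m\<bar> / 2) \<le> 8 * pi * (\<tau> + j)\<^sup>2" by (intro mult_left_mono) auto
      moreover have "t - 1/2 = of_real (\<tau> - 1/2)" by (simp add: t_def)
      moreover have "\<tau> - 1/2 + m = \<tau> + j" by (simp add: j_def)
      ultimately show "norm (gt m (t - 1/2) x) \<le> g * exp (- (4 * pi)) ^ nat \<bar>m\<bar>"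
        unfolding powr g_def exp_add[symmetric] by (simp only: ngt) (simp add: algebra_simps)
    qed (use g in auto)
    then show ?thesis using g by (simp add: E1_def norm_divide field_simps)
  qed
  have gt0: "gt 0 t x = of_real g" by (simp add: gt_def g_def t_def exp_of_real[symmetric])
  have p0: "psi t x = of_real g * (1 + E0)"
  proof -
    have "psi t x = infsum (\<lambda>m. gt m t x) ({0} \<union> (UNIV - {0}))" unfolding psi_def by simp
    also have "\<dots> = gt 0 t x + infsum (\<lambda>m. gt m t x) (UNIV - {0})"
      by (subst infsum_Un_disjoint) (auto intro: gt_summable)
    finally show ?thesis using g by (simp add: gt0 E0_def algebra_simps)
  qed
  have gm: "gt 0 (t - 1/2) x = of_real (g * \<rho>m)" "gt 1 (t - 1/2) x = of_real (g * \<rho>p) * ee (- x)"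
  proof -
    have 1: "- (of_real (8 * pi) * (t - 1/2 + of_int 0)\<^sup>2) = of_real (- (8 * pi * \<tau>\<^sup>2) + - (8 * pi * (1/4 - \<tau>)))"
      by (simp add: t_def power2_eq_square algebra_simps)
    have 2: "- (of_real (8 * pi) * (t - 1/2 + of_int 1)\<^sup>2) = of_real (- (8 * pi * \<tau>\<^sup>2) + - (8 * pi * (1/4 + \<tau>)))"
      by (simp add: t_def power2_eq_square algebra_simps)
    show "gt 0 (t - 1/2) x = of_real (g * \<rho>m)" unfolding gt_def 1 exp_of_real exp_add g_def \<rho>m_def by simp
    show "gt 1 (t - 1/2) x = of_real (g * \<rho>p) * ee (- x)" unfolding gt_def 2 exp_of_real exp_add g_def \<rho>p_def by simp
  qed
  have p1: "psi (t - 1/2) x = of_real g * (of_real \<rho>m + of_real \<rho>p * ee (- x) + E1)"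
  proof -
    have "UNIV = {0, 1} \<union> (UNIV - {0, 1 :: int})" by auto
    then have "psi (t - 1/2) x = infsum (\<lambda>m. gt m (t - 1/2) x) ({0, 1} \<union> (UNIV - {0, 1}))" unfolding psi_def by simp
    also have "\<dots> = infsum (\<lambda>m. gt m (t - 1/2) x) {0, 1} + infsum (\<lambda>m. gt m (t - 1/2) x) (UNIV - {0, 1})"
      by (subst infsum_Un_disjoint) (auto intro: gt_summable)
    finally show ?thesis using g by (simp add: gm E1_def algebra_simps)
  qed
  \<comment> \<open>Splitting by the power of e(x): b1 vanishes at \<tau> = -1/4 and b2 at \<tau> =
    1/4, where e(t) is -i and i.\<close>
  define b1 where "b1 = 2 + 2 * \<i> * ee (- t)"
  define b2 where "b2 = 2 + 2 * \<i> * ee t - \<i> * ee (- t) - ee t ^ 2"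
  have B: "B0 t x = b1 + ee x * b2" by (simp add: B0_def b1_def b2_def)
  define c s where "c = cos (2 * pi * \<tau>)" and "s = sin (2 * pi * \<tau>)"
  have et: "ee t = Complex c s" "ee (- t) = Complex c (- s)"
    using ee_real[of \<tau>] ee_real[of "- \<tau>"] by (simp_all add: t_def c_def s_def)
  have cs: "c\<^sup>2 = 1 - s\<^sup>2" by (simp add: c_def s_def cos_squared_eq)
  have c0: "c \<ge> 0"
  proof -
    have "pi * (- (1/4)) \<le> pi * \<tau>" "pi * \<tau> \<le> pi * (1/4)" using assms by (intro mult_left_mono; simp)+
    then show ?thesis unfolding c_def by (intro cos_ge_zero) simp_all
  qed
  have s1: "-1 \<le> s" unfolding s_def by (rule sin_ge_minus_one)
  then have Rb1: "Re b1 \<ge> 0" by (simp add: b1_def et)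
  \<comment> \<open>In terms of s, Re b2 = 2 s^2 - 3 s + 1 = ((4 s - 3)^2 - 1) / 8.\<close>
  have "0 \<le> (4 * s - 3)\<^sup>2" by simp
  then have Rb2: "Re b2 \<ge> - (1/8)" using cs by (simp add: b2_def et power2_eq_square algebra_simps)
  have y: "\<i> * ee (- t) = - ee (- (of_real (\<tau> + 1/4)))" "ee t = \<i> * ee (- of_real (1/4 - \<tau>))" "ee (- t) = - \<i> * ee (of_real (1/4 - \<tau>))"
  proof -
    have q: "ee (1/4) = \<i>" "ee (- (1/4)) = - \<i>" 
      using ee_real[of "1/4"] ee_real[of "- (1/4)"] by (simp_all add: complex_eq_iff mult.commute[of pi])
    have "- (of_real (\<tau> + 1/4)) = - t - (1/4 :: complex)" "- of_real (1/4 - \<tau>) = t - (1/4 :: complex)" "of_real (1/4 - \<tau>) = - t + (1/4 :: complex)"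
      by (simp_all add: t_def)
    then show "\<i> * ee (- t) = - ee (- (of_real (\<tau> + 1/4)))" "ee t = \<i> * ee (- of_real (1/4 - \<tau>))" "ee (- t) = - \<i> * ee (of_real (1/4 - \<tau>))"
      by (simp_all only: ee_diff ee_add q) (simp_all add: complex_eq_iff)
  qed
  \<comment> \<open>With z = 8 pi (1/4 + \<tau>) the zero of b1 gives the bound z/2 and the Gaussian
    factor is exp(-z), so z exp(-z) \<le> 1/2 finishes. For b2 the same works from the other end,
    with 5 z / 4 in place of z/2.\<close>
  have nb1: "norm b1 * \<rho>p \<le> 1/4"
  proof -
    have "b1 = 2 * (1 - ee (of_real (- (\<tau> + 1/4))))" unfolding b1_def mult.assoc y(1) by simp
    then have "norm b1 = 2 * norm (1 - ee (of_real (- (\<tau> + 1/4))))" by (simp only: norm_mult) simp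
    also have "\<dots> \<le> 2 * (2 * pi * \<bar>- (\<tau> + 1/4)\<bar>)" by (intro mult_left_mono norm_1_minus_ee) simp
    finally have "norm b1 \<le> (8 * pi * (1/4 + \<tau>)) / 2" using assms by simp
    then have "norm b1 * \<rho>p \<le> (8 * pi * (1/4 + \<tau>)) / 2 * \<rho>p" using \<rho> by (intro mult_right_mono) auto
    also have "\<dots> = (8 * pi * (1/4 + \<tau>)) * exp (- (8 * pi * (1/4 + \<tau>))) / 2" by (simp add: \<rho>p_def)
    also have "\<dots> \<le> (1/2) / 2" using z_exp_bound[of "8 * pi * (1/4 + \<tau>)"] assms by (intro divide_right_mono) auto
    finally show ?thesis by simp
  qed
  have nb2: "norm b2 * \<rho>m \<le> 5/8"
  proof -
    define w where "w = ee (of_real (1/4 - \<tau>))"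
    define w' where "w' = ee (of_real (- (1/4 - \<tau>)))"
    have nw: "norm w' = 1" "norm w = 1" by (simp_all only: w_def w'_def norm_ee_of_real)
    have b2: "b2 = 2 * (1 - w') + (1 - w) - (1 - w') * (1 + w')"
    proof -
      have w2: "ee (- of_real (1/4 - \<tau>)) = w'" by (simp only: w'_def of_real_minus)
      show ?thesis unfolding b2_def y(2,3) w_def[symmetric] w2 by (simp add: power2_eq_square algebra_simps)
    qed
    have n1: "norm (1 - w) \<le> 2 * pi * (1/4 - \<tau>)" "norm (1 - w') \<le> 2 * pi * (1/4 - \<tau>)"
      using norm_1_minus_ee[of "1/4 - \<tau>"] norm_1_minus_ee[of "- (1/4 - \<tau>)"] assms by (simp_all only: w_def w'_def) simp_all
    have "norm b2 \<le> norm (2 * (1 - w')) + norm (1 - w) + norm ((1 - w') * (1 + w'))"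
      unfolding b2 by (rule order_trans[OF norm_triangle_ineq4]) (intro add_right_mono norm_triangle_ineq)
    also have "\<dots> \<le> 2 * (2 * pi * (1/4 - \<tau>)) + 2 * pi * (1/4 - \<tau>) + 2 * pi * (1/4 - \<tau>) * 2"
    proof (intro add_mono)
      show "norm (2 * (1 - w')) \<le> 2 * (2 * pi * (1/4 - \<tau>))" unfolding norm_mult using n1(2) by simp
      show "norm (1 - w) \<le> 2 * pi * (1/4 - \<tau>)" by (rule n1(1))
      have "norm (1 + w') \<le> 2" using norm_triangle_ineq[of 1 w'] nw by simp
      then show "norm ((1 - w') * (1 + w')) \<le> 2 * pi * (1/4 - \<tau>) * 2" unfolding norm_mult using n1 assms by (intro mult_mono) auto
    qed
    finally have "norm b2 \<le> (8 * pi * (1/4 - \<tau>)) * (5/4)" by simp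
    then have "norm b2 * \<rho>m \<le> (8 * pi * (1/4 - \<tau>)) * (5/4) * \<rho>m" using \<rho> by (intro mult_right_mono) auto
    also have "\<dots> = (8 * pi * (1/4 - \<tau>)) * exp (- (8 * pi * (1/4 - \<tau>))) * (5/4)" by (simp add: \<rho>m_def)
    also have "\<dots> \<le> (1/2) * (5/4)" using z_exp_bound[of "8 * pi * (1/4 - \<tau>)"] assms by (intro mult_right_mono) auto
    finally show ?thesis by simp
  qed
  have nx: "norm (ee x) = 1" "norm (ee (- x)) = 1" "ee x * ee (- x) = 1" by (simp_all add: x_def ee_minus norm_inverse)
  define main where "main = b1 * of_real \<rho>m + b2 * of_real \<rho>p + (ee (- x) * (b1 * of_real \<rho>p) + ee x * (b2 * of_real \<rho>m))"
  have "Re main \<ge> -1"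
  proof -
    have "norm (ee (- x) * (b1 * of_real \<rho>p) + ee x * (b2 * of_real \<rho>m)) \<le> 1/4 + 5/8"
      using nb1 nb2 \<rho> by (intro norm_triangle_le add_mono) (auto simp: norm_mult nx)
    then have "Re (ee (- x) * (b1 * of_real \<rho>p) + ee x * (b2 * of_real \<rho>m)) \<ge> - (7/8)"
      using abs_Re_le_cmod[of "ee (- x) * (b1 * of_real \<rho>p) + ee x * (b2 * of_real \<rho>m)"] by linarith
    moreover have "Re (b1 * of_real \<rho>m) \<ge> 0" using Rb1 \<rho> by simp
    moreover have "Re (b2 * of_real \<rho>p) \<ge> - (1/8)"
    proof -
      have "Re b2 * \<rho>p \<ge> - (1/8) * \<rho>p" using Rb2 \<rho> by (intro mult_right_mono) auto
      moreover have "(1/8) * \<rho>p \<le> 1/8" using \<rho> by simp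
      ultimately show ?thesis by simp
    qed
    ultimately show ?thesis unfolding main_def plus_complex.sel by linarith
  qed
  moreover have "Re (A0 t x) \<ge> 4.196"
  proof -
    have "Re (ee (- t - x)) \<le> 1" using complex_Re_le_cmod[of "ee (- t - x)"] by (simp add: t_def x_def norm_ee)
    then show ?thesis using sqrt3_bounds c0 by (simp add: A0_def et)
  qed
  moreover have Bm: "B0 t x * (of_real \<rho>m + of_real \<rho>p * ee (- x)) = main"
  proof -
    have "B0 t x * (of_real \<rho>m + of_real \<rho>p * ee (- x)) = b1 * of_real \<rho>m + (ee x * ee (- x)) * (b2 * of_real \<rho>p) + (ee (- x) * (b1 * of_real \<rho>p) + ee x * (b2 * of_real \<rho>m))"
      unfolding B by (simp add: algebra_simps)
    then show ?thesis by (simp add: nx main_def)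
  qed
  ultimately have lowm: "3.196 \<le> norm (A0 t x + main)"
    using complex_Re_le_cmod[of "A0 t x + main"] by simp
  have err: "norm (A0 t x * E0 + B0 t x * E1) \<le> 0.05"
  proof -
    have "norm (A0 t x * E0 + B0 t x * E1) \<le> 10.2 * 0.0021 + 10 * 0.0021"
    proof (intro norm_triangle_le add_mono)
      have h: "norm (A0 t x) \<le> 10.2" "norm (B0 t x) \<le> 10" using H0_bounds[of \<tau> \<xi>] by (simp_all add: t_def x_def)
      show "norm (A0 t x * E0) \<le> 10.2 * 0.0021" unfolding norm_mult by (rule mult_mono[OF h(1) E0]) auto
      show "norm (B0 t x * E1) \<le> 10 * 0.0021" unfolding norm_mult by (rule mult_mono[OF h(2) E1]) auto
    qed
    then show ?thesis by simp
  qed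
  have "A0 t x * psi t x + B0 t x * psi (t - 1/2) x = of_real g * ((A0 t x + main) + (A0 t x * E0 + B0 t x * E1))"
    unfolding p0 p1 Bm[symmetric] by (simp add: algebra_simps)
  then have "norm (A0 t x * psi t x + B0 t x * psi (t - 1/2) x) = g * norm ((A0 t x + main) + (A0 t x * E0 + B0 t x * E1))"
    using g by (simp add: norm_mult)
  also have "\<dots> \<ge> g * 3.1"
  proof -
    have "3.1 \<le> norm ((A0 t x + main) + (A0 t x * E0 + B0 t x * E1))"
      using lowm err norm_diff_ineq[of "A0 t x + main" "A0 t x * E0 + B0 t x * E1"] by simp
    then show ?thesis using g by simp
  qed
  finally have lo: "g * 3.1 \<le> norm (A0 t x * psi t x + B0 t x * psi (t - 1/2) x)" .
  have n0: "norm (psi t x) \<le> g * 1.0021" unfolding p0 norm_mult using g E0 norm_triangle_ineq[of 1 E0] by simp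
  have n1: "norm (psi (t - 1/2) x) \<le> g * 1.0031"
  proof -
    have "norm (of_real \<rho>m + of_real \<rho>p * ee (- x) + E1) \<le> \<rho>m + \<rho>p + 0.0021"
      using E1 \<rho> by (intro norm_triangle_le add_mono) (auto simp: norm_mult nx)
    then have "norm (of_real \<rho>m + of_real \<rho>p * ee (- x) + E1) \<le> 1.0031" using sum1 by simp
    then show ?thesis unfolding p1 norm_mult using g by simp
  qed
  have "(norm (psi t x, psi (t - 1/2) x))\<^sup>2 = (norm (psi t x))\<^sup>2 + (norm (psi (t - 1/2) x))\<^sup>2"
    by (simp add: norm_Pair)
  also have "\<dots> \<le> (g * 1.0021)\<^sup>2 + (g * 1.0031)\<^sup>2" by (intro add_mono power_mono n0 n1) auto
  also have "\<dots> \<le> (g * 1.5)\<^sup>2" unfolding power_mult_distrib distrib_left[symmetric] by (intro mult_left_mono) (auto simp: power2_eq_square)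
  finally have "norm (psi t x, psi (t - 1/2) x) \<le> g * 1.5" by (rule power2_le_imp_le) (use g in simp)
  then show "norm (A0 (of_real \<tau>) (of_real \<xi>) * psi (of_real \<tau>) (of_real \<xi>) + B0 (of_real \<tau>) (of_real \<xi>) * psi (of_real \<tau> - 1/2) (of_real \<xi>))
    \<ge> 1.6 * norm (psi (of_real \<tau>) (of_real \<xi>), psi (of_real \<tau> - 1/2) (of_real \<xi>))"
    using lo g unfolding t_def x_def by simp
  have "1 + E0 \<noteq> 0"
  proof
    assume "1 + E0 = 0" then have "E0 = -1" by (simp add: add_eq_0_iff)
    then show False using E0 by simp
  qed
  then show "psi (of_real \<tau>) (of_real \<xi>) \<noteq> 0" using p0 g unfolding t_def x_def by simp
qed

lemma norm_tv_half:
  assumes "quasi_periodic G"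
  shows "norm (tv G (of_real (\<tau> + 1/2)) (of_real \<xi>)) = norm (tv G (of_real \<tau>) (of_real \<xi>))"
proof -
  have "G (of_real \<tau> + 1/2) (of_real \<xi>) = ee (of_real \<xi>) * G (of_real \<tau> - 1/2) (of_real \<xi>)"
    by (rule quasi_periodicD(4)[OF assms])
  then show ?thesis by (simp add: tv_def wt_def norm_Pair norm_mult norm_ee add.commute)
qed

lemma tv_real: "tv G (of_real \<tau>) (of_real \<xi>) = (G (of_real \<tau>) (of_real \<xi>), G (of_real \<tau> - 1/2) (of_real \<xi>))"
  by (simp add: tv_def wt_def)

lemma periodic_half_cases:
  fixes P :: "real \<Rightarrow> bool"
  assumes "\<And>\<tau>. P (\<tau> + 1/2) = P \<tau>" "\<And>\<tau>. - (1/4) \<le> \<tau> \<Longrightarrow> \<tau> \<le> 1/4 \<Longrightarrow> P \<tau>"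
  shows "P \<tau>"
proof -
  have n: "P (\<tau> + real k / 2) = P \<tau>" for k \<tau>
  proof (induction k)
    case (Suc k)
    have "P (\<tau> + real k / 2 + 1/2) = P (\<tau> + real k / 2)" by (rule assms)
    then show ?case using Suc by (simp add: add_divide_distrib algebra_simps)
  qed simp
  define z where "z = \<lfloor>2 * \<tau> + 1/2\<rfloor>"
  have "P (\<tau> - real_of_int z / 2)"
    by (rule assms(2)) (use floor_correct[of "2 * \<tau> + 1/2"] in \<open>auto simp: z_def field_simps\<close>)
  moreover have "P (\<tau> - real_of_int z / 2) = P \<tau>"
  proof (cases z rule: int_cases2)
    case (nonneg k) then show ?thesis using n[of "\<tau> - real k / 2" k] by simp
  next
    case (nonpos k) then show ?thesis using n[of \<tau> k] by simp
  qed
  ultimately show ?thesis by simp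
qed

text \<open>The norm of the weighted pair has period 1/2 in the real variable, so the interval from
  -1/4 to 1/4 suffices; there the first component alone gives the lower bound, since 3.1 > 1.6 *
  1.5.\<close>

lemma seed_psi: "seed psi"
proof unfold_locales
  show "quasi_periodic psi" by (rule psi_qp)
  show "continuous_on UNIV (\<lambda>(t, x). psi t x)" by (rule psi_cont)
  show "(\<lambda>t. psi t x) holomorphic_on UNIV" "(\<lambda>x. psi t x) holomorphic_on UNIV" for t x by (rule psi_hol)+
  fix \<tau> \<xi> :: real
  have Hv: "mapp (H0 \<tau> \<xi>) (tv psi (of_real \<tau>) (of_real \<xi>)) = tv (Hop 0 0 psi) (of_real \<tau>) (of_real \<xi>)" for \<tau> \<xi>
    unfolding tv_Hop[OF psi_qp] by (simp add: sfac_def Mat_base)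
  have "norm (tv (Hop 0 0 psi) (of_real \<tau>) (of_real \<xi>)) \<ge> 1.6 * norm (tv psi (of_real \<tau>) (of_real \<xi>))"
  proof (rule periodic_half_cases[of _ \<tau>])
    fix \<tau> :: real assume "- (1/4) \<le> \<tau>" "\<tau> \<le> 1/4"
    note psi_low_quarter(1)[OF this, of \<xi>]
    also have "norm (A0 (of_real \<tau>) (of_real \<xi>) * psi (of_real \<tau>) (of_real \<xi>) + B0 (of_real \<tau>) (of_real \<xi>) * psi (of_real \<tau> - 1/2) (of_real \<xi>))
       = norm (fst (mapp (H0 \<tau> \<xi>) (tv psi (of_real \<tau>) (of_real \<xi>))))"
      by (simp add: mapp_def H0_def tv_real)
    also have "\<dots> \<le> norm (mapp (H0 \<tau> \<xi>) (tv psi (of_real \<tau>) (of_real \<xi>)))" by (rule norm_fst_vec2)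
    finally show "norm (tv (Hop 0 0 psi) (of_real \<tau>) (of_real \<xi>)) \<ge> 1.6 * norm (tv psi (of_real \<tau>) (of_real \<xi>))"
      unfolding Hv[symmetric] tv_real[of psi] .
  qed (simp only: norm_tv_half[OF psi_qp] norm_tv_half[OF quasi_periodic_Hop[OF psi_qp]])
  then show "1.6 * norm (tv psi (of_real \<tau>) (of_real \<xi>)) \<le> norm (mapp (H0 \<tau> \<xi>) (tv psi (of_real \<tau>) (of_real \<xi>)))"
    unfolding Hv .
  have "norm (tv psi (of_real \<tau>) (of_real \<xi>)) \<noteq> 0"
    by (rule periodic_half_cases[of _ \<tau>]) (simp_all only: norm_tv_half[OF psi_qp], use psi_low_quarter(2) in \<open>simp add: tv_real zero_prod_def\<close>)
  then show "tv psi (of_real \<tau>) (of_real \<xi>) \<noteq> 0" by simp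
qed

section \<open>Fourier uniqueness\<close>

definition hstrip :: "real \<Rightarrow> complex set" where "hstrip r = {z. \<bar>Im z\<bar> < r}"

lemma open_hstrip: "open (hstrip r)" and convex_hstrip: "convex (hstrip r)"
proof -
  have e: "hstrip r = {z. - r < Im z} \<inter> {z. Im z < r}" by (auto simp: hstrip_def abs_less_iff)
  show "open (hstrip r)" unfolding e by (intro open_Int open_halfspace_Im_gt open_halfspace_Im_lt)
  show "convex (hstrip r)" unfolding e by (intro convex_Int convex_halfspace_Im_gt convex_halfspace_Im_lt)
qed

lemma hstrip_add_real [simp]: "z + of_real c \<in> hstrip r \<longleftrightarrow> z \<in> hstrip r" "z - of_real c \<in> hstrip r \<longleftrightarrow> z \<in> hstrip r"
   "z + 1 \<in> hstrip r \<longleftrightarrow> z \<in> hstrip r" "z - 1 \<in> hstrip r \<longleftrightarrow> z \<in> hstrip r"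
  by (auto simp: hstrip_def)

lemma of_real_hstrip [simp]: "of_real c \<in> hstrip r \<longleftrightarrow> 0 < r" by (simp add: hstrip_def)

lemma hstrip_cball: assumes "z \<in> hstrip r" shows "\<exists>d>0. cball z d \<subseteq> hstrip r"
  using open_hstrip[of r] assms open_contains_cball by blast

lemma hstrip_mono: "r \<le> r' \<Longrightarrow> hstrip r \<subseteq> hstrip r'" by (auto simp: hstrip_def)

lemma continuous_on_horizontal:
  assumes "continuous_on (hstrip r) F" "w \<in> hstrip r"
  shows "continuous_on A (\<lambda>x::real. F (w + of_real x))"
  by (rule continuous_on_compose2[OF assms(1)]) (use assms(2) in \<open>auto intro!: continuous_intros\<close>)

text \<open>With a primitive P, the integral over a horizontal unit segment starting at z is P(z +
  1) - P(z), and this has derivative 0 by periodicity.\<close>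

lemma integral_horizontal:
  assumes F: "F holomorphic_on hstrip r" and per: "\<And>z. z \<in> hstrip r \<Longrightarrow> F (z + 1) = F z" and w: "w \<in> hstrip r" and r: "0 < r"
  shows "integral {0..1} (\<lambda>x. F (w + of_real x)) = integral {0..1} (\<lambda>x. F (of_real x))"
proof -
  have "\<exists>P. \<forall>z\<in>hstrip r. (P has_field_derivative F z) (at z within hstrip r)"
    by (rule holomorphic_convex_primitive'[OF convex_hstrip open_hstrip F]) blast
  then obtain P where P0: "\<forall>z\<in>hstrip r. (P has_field_derivative F z) (at z within hstrip r)" ..
  have P: "(P has_field_derivative F z) (at z)" if "z \<in> hstrip r" for z
    using bspec[OF P0 that] unfolding at_within_open[OF that open_hstrip] .
  have I: "integral {0..1} (\<lambda>x. F (z + of_real x)) = P (z + 1) - P z" if z: "z \<in> hstrip r" for z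
  proof -
    have "((\<lambda>x. F (z + of_real x)) has_integral (P (z + of_real 1) - P (z + of_real 0))) {0..1}"
    proof (rule fundamental_theorem_of_calculus)
      fix x :: real
      have "((\<lambda>u. P (u + z)) has_field_derivative F (of_real x + z)) (at (of_real x))"
        unfolding DERIV_shift[symmetric] by (rule P) (use z in \<open>simp add: add.commute\<close>)
      from has_vector_derivative_real_field[OF this]
      show "((\<lambda>x. P (z + of_real x)) has_vector_derivative F (z + of_real x)) (at x within {0..1})" by (simp add: add.commute)
    qed simp
    then show ?thesis by (simp add: integral_unique)
  qed
  have "(\<lambda>z. P (z + 1) - P z) constant_on hstrip r"
  proof (rule has_field_derivative_0_imp_constant_on)
    fix z assume z: "z \<in> hstrip r"
    have "((\<lambda>z. P (z + 1)) has_field_derivative F (z + 1)) (at z)"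
      using P[of "z + 1"] z unfolding DERIV_shift by simp
    from DERIV_diff[OF this P[OF z]] show "((\<lambda>z. P (z + 1) - P z) has_field_derivative 0) (at z)" using per[OF z] by simp
  qed (auto simp: open_hstrip convex_hstrip convex_connected)
  then obtain C where C: "\<And>z. z \<in> hstrip r \<Longrightarrow> P (z + 1) - P z = C" unfolding constant_on_def by blast
  have "P (w + 1) - P w = P (0 + 1) - P 0" using C[OF w] C[of 0] r by (simp add: hstrip_def)
  then show ?thesis using I[OF w] I[of 0] r by (simp add: hstrip_def)
qed

text \<open>The powers of sin^2(pi x) concentrate at 1/2. If H(1/2) were nonzero, the product of its
  conjugate with H would have positive real part near 1/2; the inner half of that neighbourhood
  contributes at least a multiple of \<open>q' ^ k\<close>, the complement of the neighbourhood at
  most \<open>M * q ^ k\<close>, and q < q' contradicts the vanishing for large k.\<close>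

lemma fourier_peak:
  fixes H :: "real \<Rightarrow> complex"
  assumes c: "continuous_on {0..1} H" and z: "\<And>k. integral {0..1} (\<lambda>x. H x * of_real ((sin (pi * x))\<^sup>2 ^ k)) = 0"
  shows "H (1/2) = 0"
proof (rule ccontr)
  assume nz: "H (1/2) \<noteq> 0"
  define h where "h x = Re (cnj (H (1/2)) * H x)" for x
  define c0 where "c0 = h (1/2)"
  have "c0 = (norm (H (1/2)))\<^sup>2" unfolding cmod_power2 by (simp add: c0_def h_def power2_eq_square)
  then have c0: "c0 > 0" using nz by simp
  have ch: "continuous_on {0..1} h" unfolding h_def by (intro continuous_intros c)
  have "\<exists>d>0. \<forall>x\<in>{0..1}. dist x (1/2) < d \<longrightarrow> dist (h x) (h (1/2)) < c0 / 2"
    by (rule bspec[OF ch[unfolded continuous_on_iff], THEN spec, THEN mp]) (use c0 in auto)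
  then obtain d where d: "d > 0" "\<And>x. x \<in> {0..1} \<Longrightarrow> dist x (1/2) < d \<Longrightarrow> dist (h x) (h (1/2)) < c0 / 2" by blast
  define \<delta> where "\<delta> = min (d/2) (1/4)"
  have \<delta>: "0 < \<delta>" "\<delta> \<le> 1/4" "\<delta> < d" using d(1) by (auto simp: \<delta>_def)
  have near: "h x \<ge> c0 / 2" if "x \<in> {0..1}" "\<bar>x - 1/2\<bar> \<le> \<delta>" for x
  proof -
    have "dist (h x) (h (1/2)) < c0 / 2" by (rule d(2)) (use that \<delta> in \<open>auto simp: dist_real_def\<close>)
    then show ?thesis unfolding dist_real_def c0_def by linarith
  qed
  have "bounded (h ` {0..1})" by (intro compact_imp_bounded compact_continuous_image ch) simp
  then obtain M where "\<forall>y\<in>h ` {0..1}. norm y \<le> M" unfolding bounded_iff by blast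
  then have M: "\<And>x. x \<in> {0..1} \<Longrightarrow> \<bar>h x\<bar> \<le> M" by (simp del: atLeastAtMost_iff)
  have M0: "0 \<le> M" using M[of 0] by simp
  define s where "s x = (sin (pi * x))\<^sup>2" for x :: real
  have s_cos: "s x = (cos (pi * \<bar>x - 1/2\<bar>))\<^sup>2" for x
  proof -
    have "sin (pi * x) = cos (pi * (x - 1/2))" by (simp add: cos_diff right_diff_distrib)
    also have "\<dots> = cos (pi * \<bar>x - 1/2\<bar>)" by (cases "x - 1/2 \<ge> 0") (simp_all add: abs_if flip: cos_minus[of "pi * (x - 1/2)"] mult_minus_right)
    finally show ?thesis by (simp add: s_def)
  qed
  define q q' where "q = (cos (pi * \<delta>))\<^sup>2" and "q' = (cos (pi * (\<delta>/2)))\<^sup>2"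
  have pm: "pi * u \<le> pi * v" if "u \<le> v" for u v using that by simp
  have cpos: "0 \<le> cos (pi * u)" if "0 \<le> u" "u \<le> 1/2" for u
  proof (rule cos_ge_zero)
    show "pi * u \<le> pi / 2" using pm[OF that(2)] by simp
    show "- (pi / 2) \<le> pi * u" using mult_nonneg_nonneg[OF pi_ge_zero that(1)] pi_ge_zero by linarith
  qed
  have cmono: "(cos (pi * v))\<^sup>2 \<le> (cos (pi * u))\<^sup>2" if "0 \<le> u" "u \<le> v" "v \<le> 1/2" for u v
  proof (rule power_mono)
    show "cos (pi * v) \<le> cos (pi * u)" by (rule cos_monotone_0_pi_le) (use that pm[of v 1] in auto)
  qed (use cpos that in auto)
  have q: "0 \<le> q" "q < q'" 
  proof -
    have "cos (pi * \<delta>) < cos (pi * (\<delta>/2))" by (rule cos_monotone_0_pi) (use \<delta> pm[of \<delta> 1] in auto)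
    then show "q < q'" unfolding q_def q'_def using cpos[of \<delta>] \<delta> by (intro power_strict_mono) auto
  qed (simp add: q_def)
  have bound: "h x * s x ^ k \<ge> (if x \<in> {1/2 - \<delta>/2..1/2 + \<delta>/2} then (c0/2) * q' ^ k else 0) - M * q ^ k"
    if x: "x \<in> {0..1}" for x k
  proof (cases "\<bar>x - 1/2\<bar> \<le> \<delta>")
    case True
    have hx: "h x \<ge> c0/2" using near[OF x True] .
    have s0: "0 \<le> s x ^ k" by (simp add: s_def)
    have "(if x \<in> {1/2 - \<delta>/2..1/2 + \<delta>/2} then (c0/2) * q' ^ k else 0) \<le> h x * s x ^ k"
    proof (cases "x \<in> {1/2 - \<delta>/2..1/2 + \<delta>/2}")
      case True
      then have "\<bar>x - 1/2\<bar> \<le> \<delta>/2" by (auto simp: abs_if split: if_splits)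
      then have "q' \<le> s x" unfolding q'_def s_cos using \<delta> by (intro cmono) auto
      then have "q' ^ k \<le> s x ^ k" by (intro power_mono) (auto simp: q'_def)
      then have "(c0/2) * q' ^ k \<le> h x * s x ^ k" by (rule mult_mono[OF hx]) (use hx c0 in \<open>auto simp: q'_def\<close>)
      then show ?thesis using True by simp
    qed (use hx c0 s0 in auto)
    moreover have "0 \<le> M * q ^ k" using M0 q by simp
    ultimately show ?thesis by linarith
  next
    case False
    then have ni: "x \<notin> {1/2 - \<delta>/2..1/2 + \<delta>/2}" using \<delta> by (auto simp: abs_if split: if_splits)
    have "s x \<le> q" unfolding q_def s_cos using False \<delta> x by (intro cmono) (auto simp: abs_if split: if_splits)
    then have "s x ^ k \<le> q ^ k" by (intro power_mono) (auto simp: s_def)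
    then have "\<bar>h x\<bar> * s x ^ k \<le> M * q ^ k" using M[OF x] M0 by (intro mult_mono) (auto simp: s_def)
    moreover have "h x * s x ^ k \<ge> - (\<bar>h x\<bar> * s x ^ k)"
    proof -
      have "- \<bar>h x\<bar> * s x ^ k \<le> h x * s x ^ k" by (intro mult_right_mono) (auto simp: s_def)
      then show ?thesis by simp
    qed
    ultimately show ?thesis unfolding if_not_P[OF ni] by linarith
  qed
  have key: "(c0/2) * q' ^ k * \<delta> \<le> M * q ^ k" for k
  proof -
    have i1: "((\<lambda>x. (c0/2) * q' ^ k) has_integral ((c0/2) * q' ^ k * \<delta>)) {1/2 - \<delta>/2..1/2 + \<delta>/2}"
      using has_integral_const_real[of "(c0/2) * q' ^ k" "1/2 - \<delta>/2" "1/2 + \<delta>/2"] \<delta> by (simp add: mult_ac)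
    have "((\<lambda>x. if x \<in> {1/2 - \<delta>/2..1/2 + \<delta>/2} then (c0/2) * q' ^ k else 0) has_integral ((c0/2) * q' ^ k * \<delta>)) {0..1}"
      by (subst has_integral_restrict) (use \<delta> i1 in auto)
    from has_integral_diff[OF this has_integral_const_real[of "M * q^k" 0 1]]
    have i: "((\<lambda>x. (if x \<in> {1/2 - \<delta>/2..1/2 + \<delta>/2} then (c0/2) * q' ^ k else 0) - M * q ^ k) has_integral ((c0/2) * q' ^ k * \<delta> - M * q ^ k)) {0..1}"
      by simp
    have ci: "(\<lambda>x. H x * of_real (s x ^ k)) integrable_on {0..1}"
      by (intro integrable_continuous_real continuous_intros c) (auto simp: s_def intro!: continuous_intros)
    have "((\<lambda>x. H x * of_real (s x ^ k)) has_integral 0) {0..1}"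
      using z[of k] integrable_integral[OF ci] by (simp add: s_def)
    from has_integral_mult_right[OF this, of "cnj (H (1/2))"]
    have "((\<lambda>x. cnj (H (1/2)) * (H x * of_real (s x ^ k))) has_integral 0) {0..1}" by simp
    from has_integral_linear[OF this bounded_linear_Re]
    have j: "((\<lambda>x. h x * s x ^ k) has_integral 0) {0..1}" 
      by (simp add: o_def h_def mult.assoc[symmetric] del: of_real_power)
    show ?thesis using has_integral_le[OF i j] bound by simp
  qed
  have "(\<lambda>k. M * (q / q') ^ k) \<longlonglongrightarrow> M * 0"
    by (intro tendsto_intros LIMSEQ_power_zero) (use q in \<open>auto simp: divide_less_eq_1\<close>)
  moreover have "(c0/2) * \<delta> \<le> M * (q / q') ^ k" for k
    using key[of k] q by (simp add: power_divide field_simps)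
  ultimately have "(c0/2) * \<delta> \<le> M * 0" by (intro LIMSEQ_le_const) auto
  then show False using mult_pos_pos[OF c0 \<delta>(1)] by simp
qed

text \<open>Translation moves x0 to 1/2. As sin^2(pi x) is a combination of 1, e(x) and e(-x),
  multiplication by it preserves the vanishing of all Fourier coefficients, so
  \<open>fourier_peak\<close> applies.\<close>

lemma fourier_unique:
  assumes F: "F holomorphic_on hstrip r" and per: "\<And>z. z \<in> hstrip r \<Longrightarrow> F (z + 1) = F z" and r: "0 < r"
    and z: "\<And>n::int. integral {0..1} (\<lambda>x. F (of_real x) * ee (of_int n * of_real x)) = 0"
  shows "F (of_real x0) = 0"
proof -
  define w where "w = (of_real (x0 - 1/2) :: complex)"
  have w: "w \<in> hstrip r" using r by (simp add: w_def hstrip_def)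
  define H where "H x = F (w + of_real x)" for x :: real
  have cF: "continuous_on (hstrip r) F" by (rule holomorphic_on_imp_continuous_on[OF F])
  have cH: "continuous_on A H" for A unfolding H_def by (rule continuous_on_horizontal[OF cF w])
  have coef: "integral {0..1} (\<lambda>x. H x * ee (of_int n * of_real x)) = 0" for n :: int
  proof -
    define E where "E z = F z * ee (of_int n * z)" for z
    have pe: "ee (of_int n * (z + 1)) = ee (of_int n * z)" for z by (simp add: distrib_left ee_add)
    have "integral {0..1} (\<lambda>x. E (w + of_real x)) = integral {0..1} (\<lambda>x. E (of_real x))"
      by (rule integral_horizontal[of _ r]) (use F per w r pe in \<open>auto simp: E_def ee_def intro!: holomorphic_intros\<close>)
    also have "\<dots> = 0" using z by (simp add: E_def)
    finally have "integral {0..1} (\<lambda>x. ee (of_int n * w) * (H x * ee (of_int n * of_real x))) = 0"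
      by (simp add: E_def H_def distrib_left ee_add mult.left_commute mult.assoc)
    then show ?thesis by simp
  qed
  define Z where "Z = (\<lambda>K. continuous_on {0..1} K \<and> (\<forall>n::int. integral {0..1} (\<lambda>x. K x * ee (of_int n * of_real x)) = (0::complex)))"
  have step: "Z (\<lambda>x. K x * of_real ((sin (pi * x))\<^sup>2))" if K: "Z K" for K
  proof -
    have cK: "continuous_on {0..1} K" and iK: "\<And>n::int. integral {0..1} (\<lambda>x. K x * ee (of_int n * of_real x)) = 0"
      using K by (auto simp: Z_def)
    have s: "of_real ((sin (pi * x))\<^sup>2) = 1/2 - ee (of_real x) / 4 - ee (- of_real x) / 4" for x
    proof -
      have "ee (of_real x) + ee (- of_real x) = of_real (2 * cos (2 * pi * x))"
        by (simp add: ee_def complex_eq_iff Re_exp Im_exp mult.commute[of 2])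
      moreover have "cos (2 * pi * x) = 1 - 2 * (sin (pi * x))\<^sup>2"
        using cos_double_sin[of "pi * x"] by (simp add: mult.assoc)
      ultimately have e: "ee (of_real x) + ee (- of_real x) = 2 - 4 * of_real ((sin (pi * x))\<^sup>2)" by simp
      have "of_real ((sin (pi * x))\<^sup>2) = (2 - (ee (of_real x) + ee (- of_real x))) / 4" unfolding e by simp
      then show ?thesis by (simp add: diff_divide_distrib add_divide_distrib)
    qed
    have "integral {0..1} (\<lambda>x. K x * of_real ((sin (pi * x))\<^sup>2) * ee (of_int n * of_real x)) = 0" for n :: int
    proof -
      have e: "K x * of_real ((sin (pi * x))\<^sup>2) * ee (of_int n * of_real x)
        = (1/2) * (K x * ee (of_int n * of_real x)) - (1/4) * (K x * ee (of_int (n + 1) * of_real x)) - (1/4) * (K x * ee (of_int (n - 1) * of_real x))" for x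
        unfolding s by (simp add: distrib_right left_diff_distrib ee_add ee_diff algebra_simps)
      have i: "((\<lambda>x. K x * ee (of_int m * of_real x)) has_integral 0) {0..1}" for m :: int
      proof -
        have "(\<lambda>x. K x * ee (of_int m * of_real x)) integrable_on {0..1}"
          by (intro integrable_continuous_real continuous_intros cK)
        from integrable_integral[OF this] show ?thesis using iK by simp
      qed
      from has_integral_diff[OF has_integral_diff[OF has_integral_mult_right[OF i[of n], of "1/2"]
          has_integral_mult_right[OF i[of "n + 1"], of "1/4"]] has_integral_mult_right[OF i[of "n - 1"], of "1/4"]]
      show ?thesis unfolding e by (intro integral_unique) simp
    qed
    moreover have "continuous_on {0..1} (\<lambda>x. K x * of_real ((sin (pi * x))\<^sup>2))" by (intro continuous_intros cK)
    ultimately show ?thesis by (simp add: Z_def)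
  qed
  have "Z (\<lambda>x. H x * of_real ((sin (pi * x))\<^sup>2 ^ k))" for k
  proof (induction k)
    case 0 show ?case using cH coef by (simp add: Z_def)
  next
    case (Suc k) from step[OF this] show ?case by (simp add: mult_ac del: of_real_power)
  qed
  then have zn: "integral {0..1} (\<lambda>x. H x * of_real ((sin (pi * x))\<^sup>2 ^ k) * ee (of_int n * of_real x)) = 0" for k and n :: int
    unfolding Z_def by blast
  have "integral {0..1} (\<lambda>x. H x * of_real ((sin (pi * x))\<^sup>2 ^ k)) = 0" for k
    using zn[of k 0] by simp
  then have "H (1/2) = 0" by (rule fourier_peak[OF cH])
  then show ?thesis by (simp add: H_def w_def)
qed

section \<open>Small divisors and coefficient bounds\<close>

text \<open>For y \<noteq> 0 the prime p would divide the left side to an even power and the right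
  side to an odd power.\<close>

lemma int_square_prime:
  fixes w y c p :: int
  assumes p: "prime p" and c: "\<not> p dvd c" and e: "c * w\<^sup>2 = p * y\<^sup>2"
  shows "y = 0"
proof (rule ccontr)
  assume y: "y \<noteq> 0"
  have pe: "prime_elem p" and p0: "p \<noteq> 0" using p by auto
  have c0: "c \<noteq> 0" using c by auto
  have w: "w \<noteq> 0"
  proof
    assume "w = 0"
    then have "p * y\<^sup>2 = 0" using e by simp
    then show False using p0 y by simp
  qed
  have "multiplicity p (c * w\<^sup>2) = multiplicity p c + 2 * multiplicity p w"
    using pe c0 w by (simp add: prime_elem_multiplicity_mult_distrib prime_elem_multiplicity_power_distrib)
  moreover have "multiplicity p c = 0" using c by (rule not_dvd_imp_multiplicity_0)
  moreover have "multiplicity p (p * y\<^sup>2) = multiplicity p p + 2 * multiplicity p y"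
    using pe p0 y by (simp add: prime_elem_multiplicity_mult_distrib prime_elem_multiplicity_power_distrib)
  moreover have "multiplicity p p = 1" using pe p0 by (intro multiplicity_self) auto
  ultimately have "2 * multiplicity p w = 1 + 2 * multiplicity p y" using e by simp
  then show False by presburger
qed

text \<open>The product of the four conjugates of \<open>k + p \<surd>2 + q \<surd>3\<close> is a nonzero integer.\<close>

lemma sqrt_form_lower:
  fixes k p q :: int assumes pq: "p \<noteq> 0 \<or> q \<noteq> 0"
  shows "\<bar>real_of_int k + of_int p * sqrt 2 + of_int q * sqrt 3\<bar> \<ge> 1 / (4 * (\<bar>real_of_int p\<bar> + \<bar>of_int q\<bar> + 1)) ^ 3"
proof -
  define u v where "u = real_of_int p * sqrt 2" and "v = real_of_int q * sqrt 3"
  define K P Q where "K = \<bar>real_of_int k\<bar>" and "P = \<bar>real_of_int p\<bar>" and "Q = \<bar>real_of_int q\<bar>"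
  define S where "S = 4 * (P + Q + 1)"
  define X where "X = real_of_int k + u + v"
  define R where "R = (real_of_int k + u - v) * (real_of_int k - u + v) * (real_of_int k - u - v)"
  define N where "N = (k\<^sup>2 + 2 * p\<^sup>2 - 3 * q\<^sup>2)\<^sup>2 - 8 * (k * p)\<^sup>2"
  have P0: "0 \<le> P" "0 \<le> Q" by (simp_all add: P_def Q_def)
  have uv2: "u\<^sup>2 = 2 * (of_int p)\<^sup>2" "v\<^sup>2 = 3 * (of_int q)\<^sup>2" by (simp_all add: u_def v_def power_mult_distrib)
  have "X * R = ((real_of_int k)\<^sup>2 + u\<^sup>2 - v\<^sup>2)\<^sup>2 - 4 * (real_of_int k)\<^sup>2 * u\<^sup>2"
    unfolding X_def R_def by (simp add: power2_eq_square algebra_simps)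
  then have XR: "X * R = of_int N" unfolding uv2 N_def by (simp add: power_mult_distrib)
  have "N \<noteq> 0"
  proof
    assume N0: "N = 0"
    \<comment> \<open>The irrationality of sqrt 2 forces k p = 0; the remaining cases are the
      irrationality of sqrt 6 and of sqrt 3.\<close>
    then have "1 * (k\<^sup>2 + 2 * p\<^sup>2 - 3 * q\<^sup>2)\<^sup>2 = 2 * (2 * (k * p))\<^sup>2" by (simp add: N_def power_mult_distrib)
    then have "2 * (k * p) = 0" by (rule int_square_prime[rotated 2]) auto
    then have kp: "k = 0 \<or> p = 0" by simp
    have A: "k\<^sup>2 + 2 * p\<^sup>2 - 3 * q\<^sup>2 = 0" using N0 kp by (auto simp: N_def)
    show False using kp
    proof
      assume "k = 0"
      then have e: "3 * q\<^sup>2 = 2 * p\<^sup>2" using A by simp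
      have "p = 0" by (rule int_square_prime[OF _ _ e]) auto
      then show False using e pq by simp
    next
      assume p: "p = 0"
      then have e: "1 * k\<^sup>2 = 3 * q\<^sup>2" using A by simp
      have "prime (3 :: int)" by (simp add: prime_int_numeral_eq)
      then have "q = 0" by (rule int_square_prime[OF _ _ e]) auto
      then show False using p pq by simp
    qed
  qed
  then have "\<bar>real_of_int N\<bar> \<ge> 1" by linarith
  then have one: "1 \<le> \<bar>X\<bar> * \<bar>R\<bar>" by (simp flip: abs_mult add: XR)
  have s: "sqrt 2 \<le> 2" "sqrt 3 \<le> 2" by (auto intro!: real_le_lsqrt)
  have uv: "\<bar>u\<bar> \<le> 2 * P" "\<bar>v\<bar> \<le> 2 * Q"
    using mult_left_mono[OF s(1) P0(1)] mult_left_mono[OF s(2) P0(2)] by (auto simp: u_def v_def abs_mult P_def Q_def)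
  have S: "1 \<le> S" using P0 by (simp add: S_def)
  have "1 / S ^ 3 \<le> \<bar>X\<bar>"
  \<comment> \<open>If X is small, k is controlled by p and q, hence so are the other three
    conjugates; if not, the bound is trivial.\<close>
  proof (cases "\<bar>X\<bar> \<le> 1")
    case True
    then have k: "\<bar>real_of_int k\<bar> \<le> 1 + 2 * P + 2 * Q" using uv by (simp add: X_def)
    have t: "\<rho> \<le> S" if "\<rho> \<le> \<bar>real_of_int k\<bar> + \<bar>u\<bar> + \<bar>v\<bar>" for \<rho>
    proof -
      have *: "\<rho> \<le> 4 * (P + Q + 1)" if "\<rho> \<le> x + y + z" "x \<le> 1 + 2 * P + 2 * Q" "y \<le> 2 * P" "z \<le> 2 * Q" for x y z
        using that P0 by (simp add: distrib_left)
      show ?thesis unfolding S_def by (rule *[OF that k uv])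
    qed
    have f: "\<bar>real_of_int k + u - v\<bar> \<le> S" "\<bar>real_of_int k - u + v\<bar> \<le> S" "\<bar>real_of_int k - u - v\<bar> \<le> S"
      by (rule t, linarith)+
    have "\<bar>R\<bar> \<le> S * S * S" unfolding R_def abs_mult by (intro mult_mono f) (use S in auto)
    then have "\<bar>X\<bar> * \<bar>R\<bar> \<le> \<bar>X\<bar> * S ^ 3" by (intro mult_left_mono) (auto simp: power3_eq_cube)
    then have "1 \<le> \<bar>X\<bar> * S ^ 3" using one by linarith
    then show ?thesis using S by (simp add: field_simps)
  next
    case False
    have "1 / S ^ 3 \<le> 1" using S by simp
    then show ?thesis using False by linarith
  qed
  then show ?thesis by (simp add: X_def u_def v_def S_def P_def Q_def)
qed

text \<open>Up to the angle pi/3 the imaginary part suffices, as the sine is then at least half the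
  angle; beyond it the real part is at least 1/2.\<close>

lemma norm_1_ee_lower: assumes d: "\<bar>\<delta>\<bar> \<le> 1/2" shows "norm (1 - ee (of_real \<delta>)) \<ge> \<bar>\<delta>\<bar>"
proof -
  define y where "y = 2 * pi * \<bar>\<delta>\<bar>"
  have y: "0 \<le> y" "y \<le> pi" using d mult_left_mono[OF d, of "2 * pi"] by (auto simp: y_def)
  have e: "ee (of_real \<bar>\<delta>\<bar>) = Complex (cos y) (sin y)" by (simp only: ee_real y_def)
  have n: "norm (1 - ee (of_real \<delta>)) = norm (1 - ee (of_real \<bar>\<delta>\<bar>))"
  proof (cases "\<delta> \<ge> 0")
    case False
    have "1 - ee (of_real \<bar>\<delta>\<bar>) = cnj (1 - ee (of_real \<delta>))" using False by (simp add: cnj_ee)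
    then show ?thesis by (simp only: complex_mod_cnj)
  qed simp
  show ?thesis
  proof (cases "y \<le> pi / 3")
    case True
    have "y / 2 \<le> sin y"
    proof (cases "y = 0")
      case False
      then obtain z where z: "0 < z" "z < y" "sin y - sin 0 = (y - 0) * cos z"
        using MVT2[of 0 y sin cos] y DERIV_sin by fastforce
      have "cos (pi / 3) \<le> cos z" by (rule cos_monotone_0_pi_le) (use z True in auto)
      then have "y * (1/2) \<le> y * cos z" by (intro mult_left_mono) (use y in \<open>auto simp: cos_60\<close>)
      then show ?thesis using z by simp
    qed simp
    also have "\<dots> \<le> norm (1 - ee (of_real \<bar>\<delta>\<bar>))" using abs_Im_le_cmod[of "1 - ee (of_real \<bar>\<delta>\<bar>)"] unfolding e by simp
    finally have "pi * \<bar>\<delta>\<bar> \<le> norm (1 - ee (of_real \<delta>))" by (simp add: n y_def)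
    moreover have "1 * \<bar>\<delta>\<bar> \<le> pi * \<bar>\<delta>\<bar>" by (intro mult_right_mono) (use pi_gt3 in auto)
    ultimately show ?thesis by simp
  next
    case False
    have "cos y \<le> cos (pi / 3)" by (rule cos_monotone_0_pi_le) (use y False in auto)
    then have "1/2 \<le> Re (1 - ee (of_real \<bar>\<delta>\<bar>))" unfolding e by (simp add: cos_60)
    also have "\<dots> \<le> norm (1 - ee (of_real \<delta>))" unfolding n by (rule complex_Re_le_cmod)
    finally show ?thesis using d by linarith
  qed
qed

text \<open>The first frequency is doubled because the cohomological equation is solved in the
  variable 2 t. Multiplying the distance to the nearest integer by K gives a linear form in 1, sqrt
  2, sqrt 3; the number 512 is 8^3, from 4 (2 \<bar>m\<bar> + \<bar>n\<bar> + 1) \<le> 8 (1 +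
  \<bar>m\<bar> + \<bar>n\<bar>).\<close>

lemma small_divisors:
  fixes m n :: int and K :: nat
  assumes K: "0 < K" and mn: "(m, n) \<noteq> (0, 0)"
  shows "norm (1 - ee (- of_real (of_int m * (2 * sqrt 2 / K) + of_int n * (sqrt 3 / K))))
    \<ge> (1 / (K * 512)) / (1 + \<bar>real_of_int m\<bar> + \<bar>of_int n\<bar>) ^ 3"
proof -
  define \<theta> where "\<theta> = - (of_int m * (2 * sqrt 2 / K) + of_int n * (sqrt 3 / K))"
  define k where "k = round \<theta>"
  have d: "\<bar>\<theta> - of_int k\<bar> \<le> 1/2" using of_int_round_abs_le[of \<theta>] by (simp add: k_def abs_minus_commute)
  have "ee (of_real \<theta>) = ee (of_real (\<theta> - of_int k))" using ee_periodic(2)[of "of_real (\<theta> - of_int k)" k] by simp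
  then have l: "norm (1 - ee (of_real \<theta>)) \<ge> \<bar>\<theta> - of_int k\<bar>" using norm_1_ee_lower[OF d] by simp
  define X where "X = real_of_int (k * int K) + of_int (2 * m) * sqrt 2 + of_int n * sqrt 3"
  define T where "T = 1 + \<bar>real_of_int m\<bar> + \<bar>of_int n\<bar>"
  have T: "T \<ge> 1" by (simp add: T_def)
  have X: "\<bar>X\<bar> \<ge> 1 / (4 * (\<bar>real_of_int (2 * m)\<bar> + \<bar>of_int n\<bar> + 1)) ^ 3"
    unfolding X_def by (rule sqrt_form_lower) (use mn in auto)
  have "(4 * (\<bar>real_of_int (2 * m)\<bar> + \<bar>of_int n\<bar> + 1)) ^ 3 \<le> (8 * T) ^ 3" by (intro power_mono) (auto simp: T_def)
  then have "1 / (8 * T) ^ 3 \<le> 1 / (4 * (\<bar>real_of_int (2 * m)\<bar> + \<bar>of_int n\<bar> + 1)) ^ 3"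
    by (intro divide_left_mono mult_pos_pos zero_less_power) (use T in auto)
  then have X2: "1 / (8 * T) ^ 3 \<le> \<bar>X\<bar>" using X by linarith
  have "\<theta> - of_int k = - (X / K)" using K by (simp add: \<theta>_def X_def field_simps)
  then have "\<bar>\<theta> - of_int k\<bar> = \<bar>X\<bar> / K" by simp
  moreover have "(1 / (8 * T) ^ 3) / K \<le> \<bar>X\<bar> / K" by (rule divide_right_mono[OF X2]) simp
  moreover have "(1 / (8 * T) ^ 3) / K = (1 / (K * 512)) / T ^ 3" by (simp add: power_mult_distrib field_simps)
  ultimately have "(1 / (K * 512)) / T ^ 3 \<le> norm (1 - ee (of_real \<theta>))" using l by linarith
  then show ?thesis by (simp add: T_def \<theta>_def)
qed

lemma integral_split_grid:
  fixes f :: "real \<Rightarrow> complex"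
  assumes c: "continuous_on {0..1} f" and N: "0 < N" and m: "m \<le> N"
  shows "integral {0..real m / real N} f = (\<Sum>k<m. integral {real k / real N..real (Suc k) / real N} f)"
  using m
proof (induction m)
  case (Suc m)
  have "f integrable_on {0..real (Suc m) / real N}"
    by (intro integrable_continuous_real continuous_on_subset[OF c]) (use Suc.prems N in auto)
  then have "integral {0..real m / real N} f + integral {real m / real N..real (Suc m) / real N} f = integral {0..real (Suc m) / real N} f"
    by (intro Henstock_Kurzweil_Integration.integral_combine) (auto simp: divide_right_mono)
  then show ?case using Suc by simp
qed simp

text \<open>Left-endpoint Riemann sums are holomorphic in the parameter and converge uniformly on
  closed balls, by uniform continuity on ball times interval.\<close>

lemma holomorphic_integral:
  fixes F :: "complex \<Rightarrow> real \<Rightarrow> complex"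
  assumes S: "open S" and c: "continuous_on (S \<times> {0..1}) (\<lambda>(t, x). F t x)"
    and h: "\<And>x. x \<in> {0..1} \<Longrightarrow> (\<lambda>t. F t x) holomorphic_on S"
  shows "(\<lambda>t. integral {0..1} (F t)) holomorphic_on S"
proof (rule holomorphic_uniform_sequence[OF S])
  define A where "A n t = (\<Sum>k<Suc n. F t (real k / real (Suc n)) * of_real (1 / real (Suc n)))" for n t
  show "A n holomorphic_on S" for n unfolding A_def by (intro holomorphic_intros h) auto
  fix t0 assume t0: "t0 \<in> S"
  obtain d where d: "0 < d" "cball t0 d \<subseteq> S" using open_contains_cball S t0 by blast
  have cF: "continuous_on {0..1} (F t)" if "t \<in> S" for t
  proof -
    have "continuous_on {0..1} (\<lambda>x::real. (t, x))" by (intro continuous_intros)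
    from continuous_on_compose2[OF c this] show ?thesis using that by auto
  qed
  have "uniformly_continuous_on (cball t0 d \<times> {0..1}) (\<lambda>(t, x). F t x)"
    by (intro compact_uniformly_continuous continuous_on_subset[OF c] compact_Times) (use d in auto)
  note uc = this[unfolded uniformly_continuous_on_def]
  have "uniform_limit (cball t0 d) A (\<lambda>t. integral {0..1} (F t)) sequentially"
  proof (rule uniform_limitI)
    fix e :: real assume e: "e > 0"
    then have "\<exists>\<eta>>0. \<forall>p\<in>cball t0 d \<times> {0..1}. \<forall>p'\<in>cball t0 d \<times> {0..1}. dist p' p < \<eta> \<longrightarrow> dist (case p' of (t, x) \<Rightarrow> F t x) (case p of (t, x) \<Rightarrow> F t x) < e / 2"
      using uc[rule_format, of "e/2"] by simp
    then obtain \<eta> where \<eta>: "\<eta> > 0" "\<And>p p'. p \<in> cball t0 d \<times> {0..1} \<Longrightarrow> p' \<in> cball t0 d \<times> {0..1} \<Longrightarrow> dist p' p < \<eta> \<Longrightarrow> dist (case p' of (t, x) \<Rightarrow> F t x) (case p of (t, x) \<Rightarrow> F t x) < e / 2"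
      by (elim exE conjE) blast
    have uc2: "norm (F t x - F t x') \<le> e / 2" if "t \<in> cball t0 d" "x \<in> {0..1}" "x' \<in> {0..1}" "\<bar>x - x'\<bar> < \<eta>" for t x x'
      using \<eta>(2)[of "(t, x')" "(t, x)"] that by (simp add: dist_Pair_Pair dist_norm)
    have "\<forall>\<^sub>F n in sequentially. inverse (real (Suc n)) < \<eta>"
      using LIMSEQ_inverse_real_of_nat \<eta>(1) by (rule order_tendstoD)
    then show "\<forall>\<^sub>F n in sequentially. \<forall>t\<in>cball t0 d. dist (A n t) (integral {0..1} (F t)) < e"
    proof (rule eventually_mono, intro ballI)
      fix n t assume n: "inverse (real (Suc n)) < \<eta>" and t: "t \<in> cball t0 d"
      define N where "N = Suc n"
      have N: "0 < N" "1 / real N < \<eta>" using n by (auto simp: N_def inverse_eq_divide)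
      have cFt: "continuous_on {0..1} (F t)" using cF t d by auto
      have piece: "norm (integral {real k / real N..real (Suc k) / real N} (F t) - F t (real k / real N) * of_real (1 / real N)) \<le> (e/2) * (1 / real N)"
        if k: "k < N" for k
      proof -
        define \<alpha> \<beta> where "\<alpha> = real k / real N" and "\<beta> = real (Suc k) / real N"
        have ab: "\<alpha> \<le> \<beta>" "\<beta> - \<alpha> = 1 / real N" "0 \<le> \<alpha>" "\<beta> \<le> 1" using k N
          by (auto simp: \<alpha>_def \<beta>_def divide_right_mono diff_divide_distrib[symmetric])
        have sub: "{\<alpha>..\<beta>} \<subseteq> {0..1}" using ab by auto
        have i: "F t integrable_on {\<alpha>..\<beta>}" by (intro integrable_continuous_real continuous_on_subset[OF cFt sub])
        have "integral {\<alpha>..\<beta>} (\<lambda>x. F t x - F t \<alpha>) = integral {\<alpha>..\<beta>} (F t) - F t \<alpha> * of_real (1 / real N)"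
          using ab by (subst integral_diff[OF i]) (auto simp: scaleR_conv_of_real)
        moreover have "norm (integral {\<alpha>..\<beta>} (\<lambda>x. F t x - F t \<alpha>)) \<le> (e/2) * (\<beta> - \<alpha>)"
        proof (rule integral_bound[OF ab(1)])
          show "continuous_on {\<alpha>..\<beta>} (\<lambda>x. F t x - F t \<alpha>)" by (intro continuous_intros continuous_on_subset[OF cFt sub])
          fix x assume x: "x \<in> {\<alpha>..\<beta>}"
          show "norm (F t x - F t \<alpha>) \<le> e/2" by (rule uc2) (use x ab N t in auto)
        qed
        ultimately show ?thesis using ab by (simp add: \<alpha>_def \<beta>_def)
      qed
      have "integral {0..1} (F t) = (\<Sum>k<N. integral {real k / real N..real (Suc k) / real N} (F t))"
        using integral_split_grid[OF cFt N(1), of N] N by simp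
      then have "norm (integral {0..1} (F t) - A n t) = norm (\<Sum>k<N. integral {real k / real N..real (Suc k) / real N} (F t) - F t (real k / real N) * of_real (1 / real N))"
        by (simp only: A_def N_def[symmetric] sum_subtractf)
      also have "\<dots> \<le> (\<Sum>k<N. (e/2) * (1 / real N))" by (rule sum_norm_le) (use piece in auto)
      also have "\<dots> = e/2" using N by simp
      finally show "dist (A n t) (integral {0..1} (F t)) < e" using e by (simp add: dist_norm norm_minus_commute)
    qed
  qed
  then show "\<exists>d. 0 < d \<and> cball t0 d \<subseteq> S \<and> uniform_limit (cball t0 d) A (\<lambda>t. integral {0..1} (F t)) sequentially" using d by blast
qed

lemma norm_ee_i: "norm (ee (- (of_int n * (\<i> * of_real \<sigma> + of_real x)))) = exp (2 * pi * (of_int n * \<sigma>))"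
  by (simp add: norm_ee)

lemma ee_int_mult_periodic: "ee (of_int n * (z + 1)) = ee (of_int n * z)" "ee (- (of_int n * (z + 1))) = ee (- (of_int n * z))"
proof -
  have e: "of_int n * (z + 1) = of_int n * z + of_int n" "- (of_int n * (z + 1)) = - (of_int n * z) + of_int (- n)"
    by (simp_all add: distrib_left)
  show "ee (of_int n * (z + 1)) = ee (of_int n * z)" "ee (- (of_int n * (z + 1))) = ee (- (of_int n * z))"
    subgoal unfolding e(1) ee_add ee_int by simp
    subgoal unfolding e(2) ee_add ee_int by simp
    done
qed

text \<open>The line of integration moves down for n \<ge> 0 and up for n < 0, so that the
  exponential always shrinks; periodicity makes the move free of boundary terms.\<close>

lemma coef_bound:
  assumes F: "F holomorphic_on hstrip r" and per: "\<And>z. z \<in> hstrip r \<Longrightarrow> F (z + 1) = F z" and s: "0 < s" "s < r"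
    and M: "\<And>z. \<bar>Im z\<bar> \<le> s \<Longrightarrow> norm (F z) \<le> M"
  shows "norm (integral {0..1} (\<lambda>x. F (of_real x) * ee (- (of_int n * of_real x)))) \<le> M * exp (- (2 * pi * s * \<bar>real_of_int n\<bar>))"
proof -
  define \<sigma> where "\<sigma> = (if n \<ge> 0 then - s else s)"
  define E where "E z = F z * ee (- (of_int n * z))" for z
  define w where "w = \<i> * of_real \<sigma>"
  have w: "w \<in> hstrip r" using s by (auto simp: w_def hstrip_def \<sigma>_def)
  have hE: "E holomorphic_on hstrip r" unfolding E_def ee_def by (intro holomorphic_intros F)
  have "integral {0..1} (\<lambda>x. E (w + of_real x)) = integral {0..1} (\<lambda>x. E (of_real x))"
    by (rule integral_horizontal[OF hE _ w]) (use per s ee_int_mult_periodic in \<open>auto simp: E_def\<close>)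
  moreover have "norm (integral {0..1} (\<lambda>x. E (w + of_real x))) \<le> M * exp (- (2 * pi * s * \<bar>real_of_int n\<bar>)) * (1 - 0)"
  proof (rule integral_bound)
    show "continuous_on {0..1} (\<lambda>x. E (w + of_real x))"
      by (rule continuous_on_horizontal[OF holomorphic_on_imp_continuous_on[OF hE] w])
    fix x :: real
    have "of_int n * \<sigma> = - (s * \<bar>real_of_int n\<bar>)" by (simp add: \<sigma>_def)
    then have "norm (ee (- (of_int n * (w + of_real x)))) = exp (- (2 * pi * s * \<bar>real_of_int n\<bar>))"
      unfolding w_def norm_ee_i by simp
    moreover have "norm (F (w + of_real x)) \<le> M" by (rule M) (use s in \<open>auto simp: w_def \<sigma>_def\<close>)
    ultimately show "norm (E (w + of_real x)) \<le> M * exp (- (2 * pi * s * \<bar>real_of_int n\<bar>))"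
      by (simp add: E_def norm_mult mult_right_mono)
  qed simp
  ultimately show ?thesis by (simp add: E_def)
qed

section \<open>The cohomological equation\<close>

definition bihol :: "real \<Rightarrow> (complex \<Rightarrow> complex \<Rightarrow> complex) \<Rightarrow> bool" where
  "bihol r F \<longleftrightarrow> continuous_on (hstrip r \<times> hstrip r) (\<lambda>(t, x). F t x)
    \<and> (\<forall>x\<in>hstrip r. (\<lambda>t. F t x) holomorphic_on hstrip r) \<and> (\<forall>t\<in>hstrip r. (\<lambda>x. F t x) holomorphic_on hstrip r)"

definition biper :: "real \<Rightarrow> (complex \<Rightarrow> complex \<Rightarrow> complex) \<Rightarrow> bool" where
  "biper r F \<longleftrightarrow> (\<forall>t\<in>hstrip r. \<forall>x\<in>hstrip r. F (t + 1) x = F t x \<and> F t (x + 1) = F t x)"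

definition trig :: "(int \<times> int \<Rightarrow> complex) \<Rightarrow> complex \<Rightarrow> complex \<Rightarrow> complex" where
  "trig c t x = infsum (\<lambda>p. c p * ee (of_int (fst p) * t + of_int (snd p) * x)) UNIV"

definition wsum :: "int \<times> int \<Rightarrow> real" where "wsum p = \<bar>real_of_int (fst p)\<bar> + \<bar>real_of_int (snd p)\<bar>"

definition decay :: "real \<Rightarrow> (int \<times> int \<Rightarrow> complex) \<Rightarrow> bool" where
  "decay s c \<longleftrightarrow> (\<exists>K. \<forall>p. norm (c p) \<le> K * exp (- (2 * pi * s * wsum p)))"

lemma wsum_nonneg [simp]: "0 \<le> wsum p" by (simp add: wsum_def)

lemma exp_wsum_summable: assumes "0 < d" shows "(\<lambda>p. K * exp (- (d * wsum p))) summable_on UNIV"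
proof -
  define q where "q = exp (- d)"
  have q: "0 \<le> q" "q < 1" using assms by (auto simp: q_def)
  have e: "exp (- (d * wsum (m, n))) = q ^ nat \<bar>m\<bar> * q ^ nat \<bar>n\<bar>" for m n
    by (simp add: q_def exp_of_nat_mult[symmetric] exp_add[symmetric] wsum_def algebra_simps)
  have "(\<lambda>p. exp (- (d * wsum p))) summable_on (Sigma UNIV (\<lambda>_. UNIV))"
  proof (rule summable_on_SigmaI)
    fix m :: int
    show "((\<lambda>n. exp (- (d * wsum (m, n)))) has_sum (q ^ nat \<bar>m\<bar> * ((1 + q) / (1 - q)))) UNIV"
      unfolding e by (rule has_sum_cmult_right[OF geometric_int_has_sum[OF q]])
  next
    show "(\<lambda>m. q ^ nat \<bar>m\<bar> * ((1 + q) / (1 - q))) summable_on (UNIV :: int set)"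
      by (rule summable_on_cmult_left[OF geometric_int_summable[OF q]])
  qed simp
  then show ?thesis by (intro summable_on_cmult_right) (simp add: UNIV_Times_UNIV)
qed

lemma trig_term_bound:
  assumes c: "\<And>p. norm (c p) \<le> K * exp (- (2 * pi * s * wsum p))" and t: "\<bar>Im t\<bar> \<le> s'" "\<bar>Im x\<bar> \<le> s'"
  shows "norm (c p * ee (of_int (fst p) * t + of_int (snd p) * x)) \<le> K * exp (- (2 * pi * (s - s') * wsum p))"
proof -
  obtain m n where p: "p = (m, n)" by (cases p)
  have "- (of_int m * Im t) \<le> \<bar>of_int m\<bar> * s'" "- (of_int n * Im x) \<le> \<bar>of_int n\<bar> * s'"
    using mult_left_mono[OF t(1), of "\<bar>real_of_int m\<bar>"] mult_left_mono[OF t(2), of "\<bar>real_of_int n\<bar>"]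
      abs_ge_minus_self[of "of_int m * Im t"] abs_ge_minus_self[of "of_int n * Im x"] unfolding abs_mult by simp_all
  then have "- (of_int m * Im t + of_int n * Im x) \<le> s' * wsum p" by (simp add: wsum_def p algebra_simps)
  then have "(2 * pi) * (- (of_int m * Im t + of_int n * Im x)) \<le> (2 * pi) * (s' * wsum p)" by (intro mult_left_mono) auto
  moreover have "Im (of_int (fst p) * t + of_int (snd p) * x) = of_int m * Im t + of_int n * Im x" by (simp add: p)
  moreover have "- 2 * pi * y = 2 * pi * (- y)" "2 * pi * s' * wsum p = 2 * pi * (s' * wsum p)" for y by simp_all
  ultimately have e: "norm (ee (of_int (fst p) * t + of_int (snd p) * x)) \<le> exp (2 * pi * s' * wsum p)"
    unfolding norm_ee exp_le_cancel_iff by presburger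
  have K0: "0 \<le> K * exp (- (2 * pi * s * wsum p))" using c[of p] norm_ge_zero order_trans by blast
  have "norm (c p * ee (of_int (fst p) * t + of_int (snd p) * x)) \<le> (K * exp (- (2 * pi * s * wsum p))) * exp (2 * pi * s' * wsum p)"
    unfolding norm_mult by (rule mult_mono[OF c e K0]) simp
  also have "\<dots> = K * exp (- (2 * pi * (s - s') * wsum p))" by (simp add: exp_add[symmetric] algebra_simps)
  finally show ?thesis .
qed

lemma trig_summable_real:
  assumes "decay s c" "0 < s"
  shows "(\<lambda>p. c p * ee (of_int (fst p) * of_real t + of_int (snd p) * of_real x)) summable_on UNIV"
proof -
  obtain K where K: "\<And>p. norm (c p) \<le> K * exp (- (2 * pi * s * wsum p))" using assms(1) by (auto simp: decay_def)
  have sm: "(\<lambda>p. K * exp (- (2 * pi * (s - 0) * wsum p))) summable_on UNIV" by (rule exp_wsum_summable) (use assms in simp)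
  show ?thesis
    by (rule abs_summable_summable, rule summable_on_comparison_test[OF sm])
      (use trig_term_bound[OF K, of "of_real t" 0 "of_real x"] in auto)
qed

lemma trig_bihol:
  assumes "decay s c" "0 < s" shows "bihol s (trig c)" "trig c (t + 1) x = trig c t x" "trig c t (x + 1) = trig c t x"
proof -
  obtain K where K: "\<And>p. norm (c p) \<le> K * exp (- (2 * pi * s * wsum p))" using assms(1) by (auto simp: decay_def)
  have sm: "(\<lambda>p. K * exp (- (2 * pi * (s - s') * wsum p))) summable_on UNIV" if "s' < s" for s'
    by (rule exp_wsum_summable) (use that in simp)
  have mid: "\<exists>s'. \<bar>Im t\<bar> < s' \<and> \<bar>Im x\<bar> < s' \<and> s' < s" if "t \<in> hstrip s" "x \<in> hstrip s" for t x
    using that dense[of "max \<bar>Im t\<bar> \<bar>Im x\<bar>" s] by (auto simp: hstrip_def)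
  have ch: "\<exists>d>0. cball t d \<subseteq> hstrip s'" if "\<bar>Im t\<bar> < s'" for t s' using hstrip_cball[of t s'] that by (simp add: hstrip_def)
  have 1: "(\<lambda>t. trig c t x) holomorphic_on hstrip s" if x: "x \<in> hstrip s" for x
    unfolding trig_def
  proof (rule infsum_holomorphic[OF _ open_hstrip])
    fix t assume t: "t \<in> hstrip s"
    obtain s' where s': "\<bar>Im t\<bar> < s'" "\<bar>Im x\<bar> < s'" "s' < s" using mid[OF t x] by blast
    obtain d where d: "d > 0" "cball t d \<subseteq> hstrip s'" using ch[OF s'(1)] by blast
    have "\<forall>p\<in>UNIV. \<forall>w\<in>cball t d. norm (c p * ee (of_int (fst p) * w + of_int (snd p) * x)) \<le> K * exp (- (2 * pi * (s - s') * wsum p))"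
      using d s' by (intro ballI trig_term_bound[OF K]) (auto simp: hstrip_def less_imp_le)
    moreover have "cball t d \<subseteq> hstrip s" using d hstrip_mono[of s' s] s' by auto
    ultimately show "\<exists>d>0. \<exists>M. cball t d \<subseteq> hstrip s \<and> M summable_on UNIV \<and> (\<forall>p\<in>UNIV. \<forall>w\<in>cball t d. norm (c p * ee (of_int (fst p) * w + of_int (snd p) * x)) \<le> M p)"
      using d(1) sm[OF s'(3)] by blast
  qed (auto simp: ee_def intro!: holomorphic_intros)
  have 2: "(\<lambda>x. trig c t x) holomorphic_on hstrip s" if x: "t \<in> hstrip s" for t
    unfolding trig_def
  proof (rule infsum_holomorphic[OF _ open_hstrip])
    fix x assume t: "x \<in> hstrip s"
    obtain s' where s': "\<bar>Im t\<bar> < s'" "\<bar>Im x\<bar> < s'" "s' < s" using mid[OF x t] by blast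
    obtain d where d: "d > 0" "cball x d \<subseteq> hstrip s'" using ch[OF s'(2)] by blast
    have "\<forall>p\<in>UNIV. \<forall>w\<in>cball x d. norm (c p * ee (of_int (fst p) * t + of_int (snd p) * w)) \<le> K * exp (- (2 * pi * (s - s') * wsum p))"
      using d s' by (intro ballI trig_term_bound[OF K]) (auto simp: hstrip_def less_imp_le)
    moreover have "cball x d \<subseteq> hstrip s" using d hstrip_mono[of s' s] s' by auto
    ultimately show "\<exists>d>0. \<exists>M. cball x d \<subseteq> hstrip s \<and> M summable_on UNIV \<and> (\<forall>p\<in>UNIV. \<forall>w\<in>cball x d. norm (c p * ee (of_int (fst p) * t + of_int (snd p) * w)) \<le> M p)"
      using d(1) sm[OF s'(3)] by blast
  qed (auto simp: ee_def intro!: holomorphic_intros)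
  have 3: "continuous_on (hstrip s \<times> hstrip s) (\<lambda>z. trig c (fst z) (snd z))"
    unfolding trig_def
  proof (rule infsum_continuous)
    fix z assume z: "z \<in> hstrip s \<times> hstrip s"
    obtain s' where s': "\<bar>Im (fst z)\<bar> < s'" "\<bar>Im (snd z)\<bar> < s'" "s' < s" using mid[of "fst z" "snd z"] z by auto
    have "open (hstrip s' \<times> hstrip s')" by (intro open_Times open_hstrip)
    moreover have "z \<in> hstrip s' \<times> hstrip s'" using s' by (simp add: hstrip_def mem_Times_iff)
    moreover have "\<forall>p\<in>UNIV. \<forall>w\<in>(hstrip s' \<times> hstrip s') \<inter> (hstrip s \<times> hstrip s). norm (c p * ee (of_int (fst p) * fst w + of_int (snd p) * snd w)) \<le> K * exp (- (2 * pi * (s - s') * wsum p))"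
      by (intro ballI trig_term_bound[OF K]) (auto simp: hstrip_def less_imp_le)
    ultimately show "\<exists>V M. open V \<and> z \<in> V \<and> M summable_on UNIV \<and> (\<forall>p\<in>UNIV. \<forall>w\<in>V \<inter> (hstrip s \<times> hstrip s). norm (c p * ee (of_int (fst p) * fst w + of_int (snd p) * snd w)) \<le> M p)"
      using sm[OF s'(3)] by blast
  qed (intro continuous_intros)
  show "bihol s (trig c)" using 1 2 3 by (simp add: bihol_def case_prod_unfold)
  show "trig c (t + 1) x = trig c t x" "trig c t (x + 1) = trig c t x"
    by (simp_all add: trig_def ee_add ee_int_mult_periodic)
qed

lemma trig_diff:
  assumes "decay s c" "decay s d" "0 < s"
  shows "trig c (of_real t) (of_real x) - trig d (of_real t) (of_real x) = trig (\<lambda>p. c p - d p) (of_real t) (of_real x)"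
proof -
  note a = trig_summable_real[OF assms(1,3), of t x] and b = trig_summable_real[OF assms(2,3), of t x]
  have "infsum (\<lambda>p. c p * ee (of_int (fst p) * of_real t + of_int (snd p) * of_real x) + (- d p) * ee (of_int (fst p) * of_real t + of_int (snd p) * of_real x)) UNIV
     = trig c (of_real t) (of_real x) + - trig d (of_real t) (of_real x)"
    unfolding trig_def using summable_on_uminus[THEN iffD2, OF b]
    by (subst infsum_add[OF a]) (simp_all add: infsum_uminus)
  then show ?thesis unfolding trig_def[of "\<lambda>p. c p - d p"] by (simp add: algebra_simps)
qed

lemma trig_shift: "trig c (t - u) (x - v) = trig (\<lambda>p. c p * ee (- (of_int (fst p) * u + of_int (snd p) * v))) t x"
proof -
  have "ee (of_int m * (t - u) + of_int n * (x - v)) = ee (- (of_int m * u + of_int n * v)) * ee (of_int m * t + of_int n * x)" for m n :: int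
    unfolding ee_add[symmetric] by (simp add: algebra_simps)
  then show ?thesis unfolding trig_def by (simp add: mult.assoc)
qed

lemma trig_single: "trig (\<lambda>p. if p = (0, 0) then e else 0) t x = e"
proof -
  have "trig (\<lambda>p. if p = (0, 0) then e else 0) t x = infsum (\<lambda>p. (if p = (0, 0) then e else 0) * ee (of_int (fst p) * t + of_int (snd p) * x)) {(0, 0)}"
    unfolding trig_def by (rule infsum_cong_neutral) auto
  then show ?thesis by simp
qed

lemma decay_single: "decay s (\<lambda>p. if p = (0, 0) then e else 0)"
  unfolding decay_def by (rule exI[of _ "norm e"]) (auto simp: wsum_def)

lemma infsum_integral:
  fixes f :: "'i \<Rightarrow> real \<Rightarrow> complex"
  assumes c: "\<And>i. continuous_on {0..1} (f i)" and B: "\<And>i x. x \<in> {0..1} \<Longrightarrow> norm (f i x) \<le> B i" "B summable_on UNIV"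
  shows "integral {0..1} (\<lambda>x. infsum (\<lambda>i. f i x) UNIV) = infsum (\<lambda>i. integral {0..1} (f i)) UNIV"
proof -
  have ul: "uniform_limit {0..1} (\<lambda>X x. \<Sum>i\<in>X. f i x) (\<lambda>x. infsum (\<lambda>i. f i x) UNIV) (finite_subsets_at_top UNIV)"
    by (rule Weierstrass_m_test_general) (use B in auto)
  have cs: "continuous_on {0..1} (\<lambda>x. \<Sum>i\<in>X. f i x)" for X by (intro continuous_intros c)
  obtain I J where IJ: "\<And>X. ((\<lambda>x. \<Sum>i\<in>X. f i x) has_integral I X) {0..1}" "((\<lambda>x. infsum (\<lambda>i. f i x) UNIV) has_integral J) {0..1}" "(I \<longlongrightarrow> J) (finite_subsets_at_top UNIV)"
    by (rule uniform_limit_integral[OF ul cs finite_subsets_at_top_neq_bot]) blast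
  have I: "I X = (\<Sum>i\<in>X. integral {0..1} (f i))" if "finite X" for X
    using IJ(1)[of X] integral_sum[OF that, of f "{0..1}"] c by (simp add: integrable_continuous_real integral_unique)
  have "((\<lambda>X. \<Sum>i\<in>X. integral {0..1} (f i)) \<longlongrightarrow> J) (finite_subsets_at_top UNIV)"
    by (rule Lim_transform_eventually[OF IJ(3)]) (auto intro!: eventually_finite_subsets_at_top_weakI I)
  then have "((\<lambda>i. integral {0..1} (f i)) has_sum J) UNIV" by (simp add: has_sum_def)
  then show ?thesis using IJ(2) by (simp add: infsumI integral_unique)
qed

text \<open>Raising the line of integration by i multiplies the integrand by the constant e(k i),
  which is not 1 for k \<noteq> 0, yet leaves the integral unchanged.\<close>

lemma integral_ee: "integral {0..1} (\<lambda>x. ee (of_int k * of_real x)) = (if k = 0 then 1 else 0)"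
proof (cases "k = 0")
  case False
  have "integral {0..1} (\<lambda>x. ee (of_int k * (\<i> + of_real x))) = integral {0..1} (\<lambda>x. ee (of_int k * of_real x))"
  proof (rule integral_horizontal[of _ 2])
    show "(\<lambda>z. ee (of_int k * z)) holomorphic_on hstrip 2" unfolding ee_def by (intro holomorphic_intros)
  qed (auto simp: ee_int_mult_periodic hstrip_def)
  then have "ee (of_int k * \<i>) * integral {0..1} (\<lambda>x. ee (of_int k * of_real x)) = integral {0..1} (\<lambda>x. ee (of_int k * of_real x))"
    by (simp add: distrib_left ee_add)
  moreover have "ee (of_int k * \<i>) \<noteq> 1"
  proof
    assume "ee (of_int k * \<i>) = 1"
    then have "norm (ee (of_int k * \<i>)) = 1" by simp
    then show False using False by (simp add: norm_ee)
  qed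
  ultimately show ?thesis using False by simp
qed simp

text \<open>Fourier coefficients in \<open>x\<close> alone, with \<open>t\<close> as parameter.
  Besides leading to the double coefficients \<open>coef1\<close>, the case n = 0 serves later as
  the inverse Zak transform.\<close>

definition coef2 :: "(complex \<Rightarrow> complex \<Rightarrow> complex) \<Rightarrow> int \<Rightarrow> complex \<Rightarrow> complex" where
  "coef2 F n t = integral {0..1} (\<lambda>x. F t (of_real x) * ee (- (of_int n * of_real x)))"

definition coef1 :: "(complex \<Rightarrow> complex \<Rightarrow> complex) \<Rightarrow> int \<times> int \<Rightarrow> complex" where
  "coef1 F p = integral {0..1} (\<lambda>t. coef2 F (snd p) (of_real t) * ee (- (of_int (fst p) * of_real t)))"

lemma bihol_cont: 
  assumes "bihol r F" "continuous_on A f" "continuous_on A g" "\<And>z. z \<in> A \<Longrightarrow> f z \<in> hstrip r" "\<And>z. z \<in> A \<Longrightarrow> g z \<in> hstrip r"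
  shows "continuous_on A (\<lambda>z. F (f z) (g z))"
  using continuous_on_compose2[of "hstrip r \<times> hstrip r" "\<lambda>(t, x). F t x" A "\<lambda>z. (f z, g z)"] assms
  by (auto simp: bihol_def intro!: continuous_intros)

lemma coef2_props:
  assumes F: "bihol r F" and r: "0 < r"
  shows "coef2 F n holomorphic_on hstrip r"
    "biper r F \<Longrightarrow> t \<in> hstrip r \<Longrightarrow> coef2 F n (t + 1) = coef2 F n t"
    "t \<in> hstrip r \<Longrightarrow> (\<lambda>x. F t (of_real x) * ee (- (of_int n * of_real x))) integrable_on {0..1}"
    "(\<lambda>t. coef2 F n (of_real t) * ee (- (of_int m * of_real t))) integrable_on {0..1}"
proof -
  show 1: "coef2 F n holomorphic_on hstrip r" unfolding coef2_def
  proof (rule holomorphic_integral[OF open_hstrip])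
    show "continuous_on (hstrip r \<times> {0..1}) (\<lambda>(t, x). F t (of_real x) * ee (- (of_int n * of_real x)))"
      unfolding case_prod_unfold by (intro continuous_intros bihol_cont[OF F]) (use r in auto)
    show "(\<lambda>t. F t (of_real x) * ee (- (of_int n * of_real x))) holomorphic_on hstrip r" for x
      by (intro holomorphic_intros) (use F r in \<open>auto simp: bihol_def\<close>)
  qed
  show "coef2 F n (t + 1) = coef2 F n t" if "biper r F" "t \<in> hstrip r"
    using that r by (simp add: coef2_def biper_def)
  show "(\<lambda>x. F t (of_real x) * ee (- (of_int n * of_real x))) integrable_on {0..1}" if "t \<in> hstrip r"
    by (intro integrable_continuous_real continuous_intros bihol_cont[OF F]) (use that r in auto)
  have "continuous_on {0..1} (\<lambda>t::real. coef2 F n (of_real t))"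
    by (rule continuous_on_compose2[OF holomorphic_on_imp_continuous_on[OF 1]]) (use r in \<open>auto intro!: continuous_intros\<close>)
  then show "(\<lambda>t. coef2 F n (of_real t) * ee (- (of_int m * of_real t))) integrable_on {0..1}"
    by (intro integrable_continuous_real continuous_intros)
qed

lemma coef1_trig:
  assumes "decay s c" "0 < s" shows "coef1 (trig c) (j, k) = c (j, k)"
proof -
  obtain K where K: "\<And>p. norm (c p) \<le> K * exp (- (2 * pi * s * wsum p))" using assms(1) by (auto simp: decay_def)
  have sm: "(\<lambda>p. K * exp (- (2 * pi * (s - 0) * wsum p))) summable_on UNIV" by (rule exp_wsum_summable) (use assms in simp)
  have nb: "norm (c p * ee (of_int (fst p) * of_real t + of_int (snd p) * of_real x)) \<le> K * exp (- (2 * pi * (s - 0) * wsum p))" for p t x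
    by (rule trig_term_bound[OF K]) auto
  have nc: "norm (c p) \<le> K * exp (- (2 * pi * (s - 0) * wsum p))" for p using K by simp
  have 1: "coef2 (trig c) k (of_real t) = infsum (\<lambda>p. (c p * (if snd p = k then 1 else 0)) * ee (of_int (fst p) * of_real t)) UNIV" for t
  proof -
    have e: "trig c (of_real t) (of_real x) * ee (- (of_int k * of_real x)) = infsum (\<lambda>p. (c p * ee (of_int (fst p) * of_real t)) * ee (of_int (snd p - k) * of_real x)) UNIV" for x
      unfolding trig_def by (subst infsum_cmult_left'[symmetric]) (simp add: ee_add ee_diff left_diff_distrib mult.assoc)
    have "coef2 (trig c) k (of_real t) = infsum (\<lambda>p. integral {0..1} (\<lambda>x. (c p * ee (of_int (fst p) * of_real t)) * ee (of_int (snd p - k) * of_real x))) UNIV"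
      unfolding coef2_def e
    proof (rule infsum_integral[OF _ _ sm])
      fix p and x :: real
      have "norm (ee (of_int (fst p) * of_real t)) = 1" "norm (ee (of_int (snd p - k) * of_real x)) = 1" by (simp_all add: norm_ee)
      then show "norm ((c p * ee (of_int (fst p) * of_real t)) * ee (of_int (snd p - k) * of_real x)) \<le> K * exp (- (2 * pi * (s - 0) * wsum p))"
        using nc[of p] by (simp only: norm_mult mult_1_right)
    qed (intro continuous_intros)
    also have "\<dots> = infsum (\<lambda>p. (c p * (if snd p = k then 1 else 0)) * ee (of_int (fst p) * of_real t)) UNIV"
      by (intro infsum_cong) (simp only: integral_mult_right integral_ee, simp)
    finally show ?thesis .
  qed
  have e: "coef2 (trig c) k (of_real t) * ee (- (of_int j * of_real t)) = infsum (\<lambda>p. (c p * (if snd p = k then 1 else 0)) * ee (of_int (fst p - j) * of_real t)) UNIV" for t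
    unfolding 1 by (subst infsum_cmult_left'[symmetric]) (simp add: ee_diff left_diff_distrib mult.assoc)
  have "coef1 (trig c) (j, k) = infsum (\<lambda>p. integral {0..1} (\<lambda>t. (c p * (if snd p = k then 1 else 0)) * ee (of_int (fst p - j) * of_real t))) UNIV"
    unfolding coef1_def fst_conv snd_conv e
  proof (rule infsum_integral[OF _ _ sm])
    fix p and x :: real
    have "norm (c p * (if snd p = k then 1 else 0)) \<le> norm (c p)" by simp
    moreover have "norm (ee (of_int (fst p - j) * of_real x)) = 1" by (simp add: norm_ee)
    ultimately show "norm ((c p * (if snd p = k then 1 else 0)) * ee (of_int (fst p - j) * of_real x)) \<le> K * exp (- (2 * pi * (s - 0) * wsum p))"
      using nc[of p] by (simp only: norm_mult mult_1_right)
  qed (intro continuous_intros)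
  also have "\<dots> = infsum (\<lambda>p. (c p * (if snd p = k then 1 else 0)) * (if fst p = j then 1 else 0)) UNIV"
    by (intro infsum_cong) (simp only: integral_mult_right integral_ee, simp)
  also have "\<dots> = infsum (\<lambda>p. (c p * (if snd p = k then 1 else 0)) * (if fst p = j then 1 else 0)) {(j, k)}"
    by (rule infsum_cong_neutral) auto
  finally show ?thesis by simp
qed

lemma periodic_int_strip:
  assumes "\<And>z. z \<in> hstrip r \<Longrightarrow> F (z + 1) = (F z :: complex)" "z \<in> hstrip r"
  shows "F (z + of_int k) = F z"
proof -
  have n: "F (z + of_nat j) = F z" if "z \<in> hstrip r" for j z
  proof (induction j)
    case (Suc j)
    have "z + of_nat j \<in> hstrip r" using that by (simp add: hstrip_def)
    from assms(1)[OF this] show ?case using Suc by (simp add: add_ac)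
  qed simp
  show ?thesis
  proof (cases k rule: int_cases2)
    case (nonneg j) then show ?thesis using n[OF assms(2)] by simp
  next
    case (nonpos j)
    have "z - of_nat j \<in> hstrip r" using assms(2) by (simp add: hstrip_def)
    from n[OF this, of j] show ?thesis using nonpos by simp
  qed
qed

lemma bihol_bounded:
  assumes F: "bihol r F" and per: "biper r F" and s: "s < r"
  shows "\<exists>M. \<forall>t x. \<bar>Im t\<bar> \<le> s \<longrightarrow> \<bar>Im x\<bar> \<le> s \<longrightarrow> norm (F t x) \<le> M"
proof -
  define B where "B = cbox (Complex 0 (- s)) (Complex 1 s)"
  have inB: "z \<in> B \<longleftrightarrow> 0 \<le> Re z \<and> Re z \<le> 1 \<and> \<bar>Im z\<bar> \<le> s" for z
    by (auto simp: B_def in_cbox_complex_iff abs_le_iff)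
  have Bs: "z \<in> B \<Longrightarrow> z \<in> hstrip r" for z using s by (simp add: inB hstrip_def)
  have cB: "compact B" by (simp add: B_def)
  have "compact ((\<lambda>z. F (fst z) (snd z)) ` (B \<times> B))"
    by (intro compact_continuous_image bihol_cont[OF F] continuous_intros compact_Times cB) (auto simp: Bs)
  then obtain M where M: "\<forall>w\<in>(\<lambda>z. F (fst z) (snd z)) ` (B \<times> B). norm w \<le> M" using compact_imp_bounded bounded_iff by metis
  have "norm (F t x) \<le> M" if "\<bar>Im t\<bar> \<le> s" "\<bar>Im x\<bar> \<le> s" for t x
  proof -
    define t' x' where "t' = t - of_int \<lfloor>Re t\<rfloor>" and "x' = x - of_int \<lfloor>Re x\<rfloor>"
    have fl: "0 \<le> u - of_int \<lfloor>u\<rfloor> \<and> u - of_int \<lfloor>u\<rfloor> \<le> 1" for u :: real using floor_correct[of u] by linarith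
    have B: "t' \<in> B" "x' \<in> B" using that fl by (simp_all add: inB t'_def x'_def)
    note B' = Bs[OF B(1)] Bs[OF B(2)]
    have xs: "x \<in> hstrip r" using that s by (simp add: hstrip_def)
    have "F (t' + of_int \<lfloor>Re t\<rfloor>) x = F t' x" by (rule periodic_int_strip[of r "\<lambda>t. F t x"]) (use per B' xs in \<open>auto simp: biper_def\<close>)
    moreover have "F t' (x' + of_int \<lfloor>Re x\<rfloor>) = F t' x'" by (rule periodic_int_strip[of r "\<lambda>x. F t' x"]) (use per B' in \<open>auto simp: biper_def\<close>)
    ultimately have "F t x = F t' x'" by (simp add: t'_def x'_def)
    then show ?thesis using M B by force
  qed
  then show ?thesis by blast
qed

lemma bihol_unique:
  assumes F: "bihol r F" and per: "biper r F" and r: "0 < r" and z: "\<And>p. coef1 F p = 0"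
  shows "F (of_real t) (of_real x) = 0"
proof -
  have c2: "coef2 F n (of_real t) = 0" for n
  proof (rule fourier_unique[OF coef2_props(1)[OF F r] _ r])
    show "coef2 F n (z + 1) = coef2 F n z" if "z \<in> hstrip r" for z by (rule coef2_props(2)[OF F r per that])
    show "integral {0..1} (\<lambda>x. coef2 F n (of_real x) * ee (of_int m * of_real x)) = 0" for m
      using z[of "(- m, n)"] by (simp add: coef1_def)
  qed
  show ?thesis
  proof (rule fourier_unique[of "\<lambda>x. F (of_real t) x" r])
    show "integral {0..1} (\<lambda>x. F (of_real t) (of_real x) * ee (of_int n * of_real x)) = 0" for n
      using c2[of "- n"] by (simp add: coef2_def)
  qed (use F per r in \<open>auto simp: bihol_def biper_def\<close>)
qed

lemma bihol_mono: "bihol r F \<Longrightarrow> s \<le> r \<Longrightarrow> bihol s F"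
  unfolding bihol_def by (meson continuous_on_subset Sigma_mono holomorphic_on_subset hstrip_mono subsetD)

lemma biper_mono: "biper r F \<Longrightarrow> s \<le> r \<Longrightarrow> biper s F" using hstrip_mono[of s r] by (auto simp: biper_def)

text \<open>Two contour shifts, one in each variable, give coefficients decaying at rate
  \<open>s\<close>. The difference of F and the resulting series has only vanishing coefficients, so
  it is 0 at real points by uniqueness.\<close>

lemma trig_expansion:
  assumes F: "bihol r F" and per: "biper r F" and s: "0 < s" "s < r"
  shows "\<exists>c. decay s c \<and> (\<forall>t x::real. F (of_real t) (of_real x) = trig c (of_real t) (of_real x))"
proof -
  have r: "0 < r" using s by simp
  obtain M where M: "\<And>t x. \<bar>Im t\<bar> \<le> s \<Longrightarrow> \<bar>Im x\<bar> \<le> s \<Longrightarrow> norm (F t x) \<le> M" using bihol_bounded[OF F per s(2)] by blast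
  have b2: "norm (coef2 F n t) \<le> M * exp (- (2 * pi * s * \<bar>real_of_int n\<bar>))" if t: "\<bar>Im t\<bar> \<le> s" for n t
    unfolding coef2_def
    by (rule coef_bound[of _ r]) (use F per s M t in \<open>auto simp: bihol_def biper_def hstrip_def\<close>)
  have b1: "norm (coef1 F p) \<le> M * exp (- (2 * pi * s * wsum p))" for p
  proof -
    have "norm (coef1 F p) \<le> (M * exp (- (2 * pi * s * \<bar>real_of_int (snd p)\<bar>))) * exp (- (2 * pi * s * \<bar>real_of_int (fst p)\<bar>))"
      unfolding coef1_def by (rule coef_bound[OF coef2_props(1)[OF F r] coef2_props(2)[OF F r per] s b2])
    also have "\<dots> = M * exp (- (2 * pi * s * wsum p))" by (simp add: wsum_def exp_add[symmetric] algebra_simps)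
    finally show ?thesis .
  qed
  define c where "c = coef1 F"
  have dc: "decay s c" using b1 by (auto simp: decay_def c_def)
  note T = trig_bihol[OF dc s(1)]
  define D where "D t x = F t x - trig c t x" for t x
  have Fs: "bihol s F" using bihol_mono[OF F] s by simp
  have D: "bihol s D" "biper s D"
  proof -
    show "bihol s D" using Fs T(1) unfolding bihol_def D_def case_prod_unfold by (auto intro!: continuous_intros holomorphic_intros)
    show "biper s D" using biper_mono[OF per, of s] s T(2,3) by (auto simp: biper_def D_def)
  qed
  have d2: "coef2 D n t = coef2 F n t - coef2 (trig c) n t" if "t \<in> hstrip s" for n t
    unfolding coef2_def D_def left_diff_distrib
    by (rule integral_diff[OF coef2_props(3)[OF Fs s(1) that] coef2_props(3)[OF T(1) s(1) that]])
  have "coef1 D p = 0" for p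
  proof -
    have "coef1 D p = coef1 F p - coef1 (trig c) p"
      unfolding coef1_def
      by (subst integral_diff[OF coef2_props(4)[OF Fs s(1)] coef2_props(4)[OF T(1) s(1)], symmetric])
        (simp add: d2 s left_diff_distrib)
    then show ?thesis using coef1_trig[OF dc s(1), of "fst p" "snd p"] by (simp add: c_def)
  qed
  from bihol_unique[OF D s(1) this] show ?thesis using dc by (auto simp: D_def)
qed

text \<open>On Fourier coefficients the equation reads d(m, n) (1 - e(-(m a' + n b))) = c(m, n) away
  from the origin, and the mean of L becomes \<open>c0\<close>. The divisors cost a cubic factor,
  which is paid for by halving the width of the strip once more.\<close>

lemma cohomological:
  fixes a' b \<kappa> :: real
  assumes L: "bihol r L" "biper r L" and r: "0 < r" and \<kappa>: "0 < \<kappa>"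
    and small: "\<And>m n. (m, n) \<noteq> (0, 0) \<Longrightarrow> norm (1 - ee (- of_real (of_int m * a' + of_int n * b))) \<ge> \<kappa> / (1 + \<bar>real_of_int m\<bar> + \<bar>of_int n\<bar>) ^ 3"
  shows "\<exists>l s c0. 0 < s \<and> s \<le> r \<and> bihol s l \<and> (\<forall>t x. l (t + 1) x = l t x \<and> l t (x + 1) = l t x)
     \<and> (\<forall>t x::real. l (of_real t - of_real a') (of_real x - of_real b) + L (of_real t) (of_real x) = c0 + l (of_real t) (of_real x))"
proof -
  define s where "s = r / 2"
  have s: "0 < s" "s < r" using r by (auto simp: s_def)
  obtain c where c: "decay s c" "\<And>t x::real. L (of_real t) (of_real x) = trig c (of_real t) (of_real x)"
    using trig_expansion[OF L s] by blast
  define dv where "dv p = 1 - ee (- (of_int (fst p) * of_real a' + of_int (snd p) * of_real b))" for p :: "int \<times> int"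
  have dv: "norm (dv p) \<ge> \<kappa> / (1 + wsum p) ^ 3" if "p \<noteq> (0, 0)" for p
    using small[of "fst p" "snd p"] that by (simp add: dv_def wsum_def add.assoc prod_eq_iff)
  define d where "d p = (if p = (0, 0) then 0 else c p / dv p)" for p
  define d' where "d' p = d p * ee (- (of_int (fst p) * of_real a' + of_int (snd p) * of_real b))" for p :: "int \<times> int"
  define e where "e p = (if p = (0, 0) then c (0, 0) else 0)" for p :: "int \<times> int"
  obtain K where K: "\<And>p. norm (c p) \<le> K * exp (- (2 * pi * s * wsum p))" using c(1) by (auto simp: decay_def)
  have K0: "0 \<le> K" using order_trans[OF norm_ge_zero K[of "(0,0)"]] by (simp add: wsum_def)
  have s2: "0 < s / 2" using s by simp
  \<comment> \<open>Chosen so that q (1 + N) \<le> 1 + (pi s / 3) N \<le> exp(pi s N / 3); the third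
    power bounds the cubic loss by half of the exponential decay.\<close>
  define q where "q = min 1 (pi * s / 3)"
  have q: "0 < q" using s by (simp add: q_def)
  have dd: "decay (s/2) d" unfolding decay_def
  proof (intro exI allI)
    fix p
    define N where "N = wsum p"
    have N: "0 \<le> N" by (simp add: N_def)
    have e1: "(1 + N) ^ 3 \<le> exp (pi * s * N) / q ^ 3"
    proof -
      have "q * (1 + N) \<le> 1 + pi * s / 3 * N"
      proof -
        have "q * 1 \<le> 1" by (simp add: q_def)
        moreover have "q * N \<le> pi * s / 3 * N" by (rule mult_right_mono) (use N in \<open>auto simp: q_def\<close>)
        ultimately show ?thesis by (simp add: distrib_left)
      qed
      also have "\<dots> \<le> exp (pi * s / 3 * N)" by (rule exp_ge_add_one_self)
      finally have "(q * (1 + N)) ^ 3 \<le> exp (pi * s / 3 * N) ^ 3" by (intro power_mono) (use q N in auto)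
      also have "\<dots> = exp (pi * s * N)" by (simp flip: exp_of_nat_mult)
      finally show ?thesis using q by (simp add: pos_le_divide_eq power_mult_distrib mult.commute)
    qed
    show "norm (d p) \<le> (K / (\<kappa> * q ^ 3)) * exp (- (2 * pi * (s/2) * wsum p))"
    proof (cases "p = (0, 0)")
      case False
      have "0 < 1 + wsum p" using wsum_nonneg[of p] by linarith
      then have pos: "0 < \<kappa> / (1 + wsum p) ^ 3" using \<kappa> by (intro divide_pos_pos zero_less_power)
      have "norm (d p) = norm (c p) / norm (dv p)" using False by (simp add: d_def norm_divide)
      also have "\<dots> \<le> (K * exp (- (2 * pi * s * N))) / (\<kappa> / (1 + N) ^ 3)"
        by (rule frac_le) (use K dv[OF False] pos N K0 in \<open>auto simp: N_def intro: order_trans[OF norm_ge_zero K]\<close>)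
      also have "\<dots> = (K * exp (- (2 * pi * s * N)) / \<kappa>) * (1 + N) ^ 3" by simp
      also have "\<dots> \<le> (K * exp (- (2 * pi * s * N)) / \<kappa>) * (exp (pi * s * N) / q ^ 3)"
        by (rule mult_left_mono[OF e1]) (use K0 \<kappa> in auto)
      also have "\<dots> = (K / (\<kappa> * q ^ 3)) * (exp (- (2 * pi * s * N)) * exp (pi * s * N))" by simp
      also have "exp (- (2 * pi * s * N)) * exp (pi * s * N) = exp (- (2 * pi * (s/2) * wsum p))"
        by (simp add: exp_add[symmetric] N_def)
      finally show ?thesis .
    qed (use K0 \<kappa> q in \<open>auto simp: d_def\<close>)
  qed
  have dd': "decay (s/2) d'"
  proof -
    have "norm (ee (- (of_int m * of_real a' + of_int n * of_real b))) = 1" for m n :: int by (simp add: norm_ee)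
    then show ?thesis using dd by (simp add: decay_def d'_def norm_mult)
  qed
  have dc: "decay (s/2) c"
    unfolding decay_def
  proof (intro exI allI)
    fix p
    have "K * exp (- (2 * pi * s * wsum p)) \<le> K * exp (- (2 * pi * (s/2) * wsum p))"
      using K0 s by (intro mult_left_mono) auto
    then show "norm (c p) \<le> K * exp (- (2 * pi * (s/2) * wsum p))" using K[of p] by simp
  qed
  have de: "decay (s/2) e" unfolding e_def by (rule decay_single)
  have "d p - d' p = c p - e p" for p
  proof (cases "p = (0, 0)")
    case False
    have "0 < 1 + wsum p" using wsum_nonneg[of p] by linarith
    then have "0 < \<kappa> / (1 + wsum p) ^ 3" using \<kappa> by (intro divide_pos_pos zero_less_power)
    then have "dv p \<noteq> 0" using dv[OF False] by auto
    moreover have "d p - d' p = d p * dv p" by (simp add: d'_def dv_def algebra_simps)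
    ultimately show ?thesis using False by (simp add: d_def e_def)
  qed (simp add: d_def d'_def e_def)
  then have eq: "(\<lambda>p. d p - d' p) = (\<lambda>p. c p - e p)" by auto
  have "trig d (of_real t - of_real a') (of_real x - of_real b) + L (of_real t) (of_real x) = c (0, 0) + trig d (of_real t) (of_real x)" for t x :: real
  proof -
    have "trig d (of_real t - of_real a') (of_real x - of_real b) = trig d' (of_real t) (of_real x)"
      unfolding trig_shift d'_def ..
    moreover have "trig d (of_real t) (of_real x) - trig d' (of_real t) (of_real x) = trig c (of_real t) (of_real x) - trig e (of_real t) (of_real x)"
      unfolding trig_diff[OF dd dd' s2] trig_diff[OF dc de s2] eq ..
    moreover have "trig e (of_real t) (of_real x) = c (0, 0)" unfolding e_def by (rule trig_single)
    ultimately show ?thesis by (simp add: c(2) algebra_simps)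
  qed
  then show ?thesis using trig_bihol[OF dd s2] s by (intro exI[of _ "trig d"] exI[of _ "s/2"] exI[of _ "c (0,0)"]) auto
qed

section \<open>Four dependent time-frequency shifts\<close>

context dyn
begin

lemma SS_hstrip: "SS = hstrip \<rho>" by (auto simp: SS_def strip_def hstrip_def)

lemma half_SS: "t \<in> SS \<Longrightarrow> t / 2 \<in> SS" using \<rho>_pos by (simp add: SS_def strip_def)

text \<open>The multiplier has period 1/2 in \<open>t\<close>, so halving the argument gives period
  1 in both variables, at the price of doubling the shift to 2 a. The principal branch is
  holomorphic and periodic because the multiplier has positive real part.\<close>

definition LL :: "complex \<Rightarrow> complex \<Rightarrow> complex" where "LL t x = Ln (qq (t / 2) x)"

lemma qq_nonpos: "t \<in> SS \<Longrightarrow> x \<in> SS \<Longrightarrow> qq (t / 2) x \<notin> \<real>\<^sub>\<le>\<^sub>0"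
  using Re_qq[of "t/2" x] half_SS[of t] by (auto simp: SS_def complex_nonpos_Reals_iff)

lemma LL_bihol: "bihol \<rho> LL" "biper \<rho> LL"
proof -
  have 1: "(\<lambda>t. LL t x) holomorphic_on SS" if x: "x \<in> SS" for x
  proof -
    have "((\<lambda>t. qq t x) \<circ> (\<lambda>t. t / 2)) holomorphic_on SS"
      by (rule holomorphic_on_compose_gen[OF _ qq_props(1)[OF x]]) (auto intro!: holomorphic_intros simp: half_SS)
    then show ?thesis unfolding LL_def o_def by (intro holomorphic_on_Ln' qq_nonpos[OF _ x])
  qed
  have 2: "(\<lambda>x. LL t x) holomorphic_on SS" if t: "t \<in> SS" for t
    unfolding LL_def by (intro holomorphic_on_Ln' qq_nonpos[OF t] qq_props(2)[OF half_SS[OF t]])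
  have 3: "continuous_on (SS \<times> SS) (\<lambda>z. LL (fst z) (snd z))"
  proof -
    have "continuous_on (SS \<times> SS) (\<lambda>z. (fst z / 2, snd z))" by (intro continuous_intros) auto
    moreover have "(\<lambda>z. (fst z / 2, snd z)) ` (SS \<times> SS) \<subseteq> SS \<times> SS" by (auto simp: half_SS)
    ultimately have "continuous_on (SS \<times> SS) (\<lambda>z. qq (fst z / 2) (snd z))"
      using continuous_on_compose2[OF qq_props(3)] by fastforce
    then show ?thesis unfolding LL_def by (intro continuous_on_Ln') (auto intro: qq_nonpos[THEN notE])
  qed
  show "bihol \<rho> LL" using 1 2 3 by (simp add: bihol_def SS_hstrip case_prod_unfold)
  have "LL (t + 1) x = LL t x" "LL t (x + 1) = LL t x" for t x
    using qq_periodic(1)[of "t/2" x] by (simp_all add: LL_def qq_periodic(2) add_divide_distrib)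
  then show "biper \<rho> LL" by (simp add: biper_def)
qed

text \<open>For u = exp(l(2 t, x)) the solved equation says u(t - a, x - b) q(t, x) = exp(c0) u(t,
  x). Having period 1/2 in \<open>t\<close>, u takes the same value in both terms of the cube and so
  passes through it as a scalar; it never vanishes, so the corrected section is still
  nonzero.\<close>

lemma eigen_from_small:
  assumes \<kappa>: "0 < \<kappa>" and small: "\<And>m n. (m, n) \<noteq> (0, 0) \<Longrightarrow>
      norm (1 - ee (- of_real (of_int m * (2 * a) + of_int n * b))) \<ge> \<kappa> / (1 + \<bar>real_of_int m\<bar> + \<bar>of_int n\<bar>) ^ 3"
  shows "\<exists>G \<mu> r. 0 < r \<and> bihol r G \<and> quasi_periodic G \<and> (\<forall>t x::real. Hop a b G (of_real t) (of_real x) = \<mu> * G (of_real t) (of_real x))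
     \<and> (\<exists>t x::real. G (of_real t) (of_real x) \<noteq> 0)"
proof -
  obtain l s c0 where s: "0 < s" "s \<le> \<rho>" and l: "bihol s l" and lp: "\<And>t x. l (t + 1) x = l t x \<and> l t (x + 1) = l t x"
    and eq: "\<And>t x::real. l (of_real t - of_real (2 * a)) (of_real x - of_real b) + LL (of_real t) (of_real x) = c0 + l (of_real t) (of_real x)"
    using cohomological[OF LL_bihol \<rho>_pos \<kappa> small] by blast
  define u where "u t x = exp (l (2 * t) x)" for t x
  have up: "u (t + 1/2) x = u t x" "u (t - 1/2) x = u t x" "u (t + 1) x = u t x" "u t (x + 1) = u t x" for t x
  proof -
    show 1: "u (t + 1/2) x = u t x" for t using lp[of "2 * t" x] by (simp add: u_def distrib_left)
    show "u (t - 1/2) x = u t x" using 1[of "t - 1/2"] by simp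
    show "u (t + 1) x = u t x" using 1[of t] 1[of "t + 1/2"] by (simp add: add.assoc)
    show "u t (x + 1) = u t x" using lp by (simp add: u_def)
  qed
  define G where "G t x = u t x * PH t x" for t x
  have qpG: "quasi_periodic G"
    using PH_qp up by (simp add: quasi_periodic_def G_def)
  define r where "r = s / 2"
  have r: "0 < r" "r \<le> \<rho>" using s by (auto simp: r_def)
  have h2: "t \<in> hstrip r \<Longrightarrow> 2 * t \<in> hstrip s" for t by (auto simp: hstrip_def r_def abs_mult)
  have rs: "t \<in> hstrip r \<Longrightarrow> t \<in> hstrip s" "t \<in> hstrip r \<Longrightarrow> t \<in> SS" for t using s by (auto simp: hstrip_def r_def SS_def strip_def)
  have PHb: "bihol r PH"
    by (rule bihol_mono[OF _ r(2)]) (use PH_cont PH_hol_t PH_hol_x in \<open>simp add: bihol_def SS_hstrip\<close>)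
  have ub: "bihol r u"
    unfolding bihol_def case_prod_unfold
  proof (intro conjI ballI)
    show "continuous_on (hstrip r \<times> hstrip r) (\<lambda>z. u (fst z) (snd z))"
      unfolding u_def by (intro continuous_intros bihol_cont[OF l]) (auto intro: h2 rs)
    fix x assume x: "x \<in> hstrip r"
    have "((\<lambda>t. l t x) \<circ> (\<lambda>t. 2 * t)) holomorphic_on hstrip r"
    proof (rule holomorphic_on_compose_gen)
      show "(\<lambda>t. l t x) holomorphic_on hstrip s" using l rs(1)[OF x] by (simp add: bihol_def)
    qed (use h2 in \<open>auto intro!: holomorphic_intros\<close>)
    then show "(\<lambda>t. u t x) holomorphic_on hstrip r" unfolding u_def o_def by (intro holomorphic_intros)
    have "(\<lambda>y. l (2 * x) y) holomorphic_on hstrip s" using l h2[OF x] by (simp add: bihol_def)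
    then have "(\<lambda>y. l (2 * x) y) holomorphic_on hstrip r" by (rule holomorphic_on_subset) (auto intro: rs)
    then show "(\<lambda>y. u x y) holomorphic_on hstrip r" unfolding u_def by (intro holomorphic_intros)
  qed
  have Gb: "bihol r G"
    using ub PHb unfolding bihol_def G_def case_prod_unfold by (auto intro!: continuous_intros holomorphic_intros)
  have eig: "Hop a b G (of_real t) (of_real x) = exp c0 * G (of_real t) (of_real x)" for t x :: real
  proof -
    define T X where "T = (of_real t :: complex)" and "X = (of_real x :: complex)"
    have st: "strip T" "strip X" by (simp_all add: T_def X_def)
    have "Hop a b G T X = u (T - of_real a) (X - of_real b) * Hop a b PH T X"
      unfolding Hop_eq[OF qpG] Hop_eq[OF PH_qp] G_def up by (simp add: algebra_simps)
    also have "\<dots> = (u (T - of_real a) (X - of_real b) * qq T X) * PH T X" by (simp add: Hop_PH[OF st])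
    also have "qq T X = exp (LL (2 * T) X)"
      using Re_qq[OF st] by (simp add: LL_def exp_Ln[of "qq T X"]) (metis exp_Ln less_irrefl zero_complex.sel(1))
    also have "u (T - of_real a) (X - of_real b) * exp (LL (2 * T) X) = exp c0 * u T X"
      unfolding u_def exp_add[symmetric] using eq[of "2 * t" x] by (simp add: T_def X_def right_diff_distrib)
    finally have "Hop a b G T X = exp c0 * (u T X * PH T X)" by (simp only: mult.assoc)
    moreover have "G T X = u T X * PH T X" by (simp add: G_def)
    ultimately show ?thesis by (simp add: T_def X_def)
  qed
  have "pair PH (of_real 0) (of_real 0) = 1" by (rule pair_PH) (use \<rho>_pos in \<open>simp_all add: strip_def\<close>)
  then have "PH (of_real 0) (of_real 0) \<noteq> 0 \<or> PH (of_real (- 1/2)) (of_real 0) \<noteq> 0"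
    unfolding pair_def by auto
  then obtain t0 :: real where "PH (of_real t0) (of_real 0) \<noteq> 0" by blast
  then have "G (of_real t0) (of_real 0) \<noteq> 0" unfolding G_def u_def by simp
  then have "\<exists>t x::real. G (of_real t) (of_real x) \<noteq> 0" by blast
  then show ?thesis using r(1) Gb qpG eig by blast
qed

end

text \<open>The bound on \<open>a\<close> is carried along for the sake of the final four points:
  a/3 - 1/6 and a/3 + 1/3 must not be 0. It follows from K \<ge> 5, while K > 2/\<rho> puts (a, b)
  in the range where the dynamics is controlled.\<close>

lemma zak_eigenfunction:
  "\<exists>a b G \<mu> r. \<bar>a\<bar> < 1/2 \<and> 0 < r \<and> bihol r G \<and> quasi_periodic G \<and> (\<forall>t x::real. Hop a b G (of_real t) (of_real x) = \<mu> * G (of_real t) (of_real x))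
     \<and> (\<exists>t x::real. G (of_real t) (of_real x) \<noteq> 0)"
proof -
  obtain \<rho> m where \<rho>: "\<rho> > 0" and d: "\<And>a b. \<bar>a\<bar> < \<rho> \<Longrightarrow> \<bar>b\<bar> < \<rho> \<Longrightarrow> dyn psi a b \<rho> m"
    using seed.dyn_exists[OF seed_psi] by blast
  obtain K0 :: nat where K0: "2 / \<rho> < real K0" using reals_Archimedean2 by blast
  define K where "K = max K0 5"
  have K: "0 < K" "2 / \<rho> < real K" "5 \<le> real K" using K0 by (auto simp: K_def)
  have s: "0 \<le> sqrt 2" "sqrt 2 \<le> 2" "0 \<le> sqrt 3" "sqrt 3 \<le> 2" by (auto intro!: real_le_lsqrt)
  have lt: "\<bar>y / real K\<bar> < \<rho> \<and> \<bar>y / real K\<bar> < 1/2" if "0 \<le> y" "y \<le> 2" for y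
  proof -
    have "2 < \<rho> * real K" using K \<rho> by (simp add: field_simps)
    then show ?thesis using that K by (simp add: field_simps)
  qed
  interpret dyn psi "sqrt 2 / K" "sqrt 3 / K" \<rho> m by (rule d) (use lt s in auto)
  have \<kappa>: "0 < 1 / (real K * 512)" using K by simp
  have "\<kappa> / (1 + \<bar>real_of_int m\<bar> + \<bar>of_int n\<bar>) ^ 3 \<le> norm (1 - ee (- of_real (of_int m * (2 * (sqrt 2 / K)) + of_int n * (sqrt 3 / K))))"
    if "(m, n) \<noteq> (0, 0)" "\<kappa> = 1 / (real K * 512)" for m n :: int and \<kappa>
    using small_divisors[OF K(1) that(1)] by (simp add: that(2))
  from eigen_from_small[OF \<kappa> this[OF _ refl]] show ?thesis using lt[of "sqrt 2"] s by blast
qed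

section \<open>Back from the Zak side to the line\<close>

definition edecay :: "real \<Rightarrow> (complex \<Rightarrow> complex) \<Rightarrow> bool" where
  "edecay r f \<longleftrightarrow> f holomorphic_on hstrip r \<and> (\<exists>C. \<forall>z\<in>hstrip r. norm (f z) \<le> C * exp (- (r * \<bar>Re z\<bar>)))"

definition rop :: "real \<Rightarrow> real \<Rightarrow> (complex \<Rightarrow> complex) \<Rightarrow> complex \<Rightarrow> complex" where
  "rop \<alpha> \<beta> f t = ee (of_real \<beta> * t) * ((c1 + c2 * ee t) * f (t - of_real \<alpha>) + c2 * f (t - of_real \<alpha> - 1/2))"

lemma edecay_nonneg: "edecay r f \<Longrightarrow> \<exists>C\<ge>0. \<forall>z\<in>hstrip r. norm (f z) \<le> C * exp (- (r * \<bar>Re z\<bar>))"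
proof -
  assume "edecay r f"
  then obtain C where C: "\<forall>z\<in>hstrip r. norm (f z) \<le> C * exp (- (r * \<bar>Re z\<bar>))" by (auto simp: edecay_def)
  have "C * exp y \<le> max C 0 * exp y" for y by (intro mult_right_mono) auto
  then show ?thesis using C by (intro exI[of _ "max C 0"]) (auto intro: order_trans)
qed

lemma edecay_shift: assumes "edecay r f" "0 < r" shows "edecay r (\<lambda>z. f (z - of_real c))"
proof -
  obtain C where C: "C \<ge> 0" "\<And>z. z \<in> hstrip r \<Longrightarrow> norm (f z) \<le> C * exp (- (r * \<bar>Re z\<bar>))" using edecay_nonneg[OF assms(1)] by blast
  have "norm (f (z - of_real c)) \<le> C * exp (r * \<bar>c\<bar>) * exp (- (r * \<bar>Re z\<bar>))" if z: "z \<in> hstrip r" for z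
  proof -
    have "\<bar>Re z\<bar> - \<bar>c\<bar> \<le> \<bar>Re z - c\<bar>" by linarith
    then have "r * (\<bar>Re z\<bar> - \<bar>c\<bar>) \<le> r * \<bar>Re z - c\<bar>" using assms(2) by (intro mult_left_mono) auto
    then have "C * exp (- (r * \<bar>Re z - c\<bar>)) \<le> C * exp (r * \<bar>c\<bar> + - (r * \<bar>Re z\<bar>))"
      using C(1) by (intro mult_left_mono) (auto simp: right_diff_distrib)
    moreover have "norm (f (z - of_real c)) \<le> C * exp (- (r * \<bar>Re z - c\<bar>))"
      using C(2)[of "z - of_real c"] z by simp
    ultimately show ?thesis unfolding exp_add by (simp only: mult.assoc)
  qed
  moreover have "(\<lambda>z. f (z - of_real c)) holomorphic_on hstrip r"
    by (rule holomorphic_on_shift) (use assms in \<open>auto simp: edecay_def\<close>)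
  ultimately show ?thesis by (auto simp: edecay_def)
qed

lemma edecay_mult:
  assumes f: "edecay r f" and g: "g holomorphic_on hstrip r" and b: "\<And>z. z \<in> hstrip r \<Longrightarrow> norm (g z) \<le> M"
  shows "edecay r (\<lambda>z. g z * f z)"
proof -
  obtain C where C: "C \<ge> 0" "\<And>z. z \<in> hstrip r \<Longrightarrow> norm (f z) \<le> C * exp (- (r * \<bar>Re z\<bar>))" using edecay_nonneg[OF f] by blast
  have "norm (g z * f z) \<le> (M * C) * exp (- (r * \<bar>Re z\<bar>))" if z: "z \<in> hstrip r" for z
  proof -
    have "norm (g z * f z) \<le> M * (C * exp (- (r * \<bar>Re z\<bar>)))"
      unfolding norm_mult by (intro mult_mono b[OF z] C(2)[OF z]) (auto intro: order_trans[OF norm_ge_zero b[OF z]])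
    then show ?thesis by (simp add: mult.assoc)
  qed
  then show ?thesis using f g by (auto simp: edecay_def intro!: holomorphic_intros)
qed

lemma edecay_add: assumes "edecay r f" "edecay r g" shows "edecay r (\<lambda>z. f z + g z)"
proof -
  obtain C D where "\<And>z. z \<in> hstrip r \<Longrightarrow> norm (f z) \<le> C * exp (- (r * \<bar>Re z\<bar>))" "\<And>z. z \<in> hstrip r \<Longrightarrow> norm (g z) \<le> D * exp (- (r * \<bar>Re z\<bar>))"
    using assms by (auto simp: edecay_def)
  then have "norm (f z + g z) \<le> (C + D) * exp (- (r * \<bar>Re z\<bar>))" if "z \<in> hstrip r" for z
    unfolding distrib_right using that by (intro norm_triangle_le add_mono)
  then show ?thesis using assms by (auto simp: edecay_def intro!: holomorphic_intros)
qed

lemma edecay_cmult: "edecay r f \<Longrightarrow> edecay r (\<lambda>z. c * f z)"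
  by (rule edecay_mult[of r f "\<lambda>_. c" "norm c"]) auto

lemma edecay_diff: "edecay r f \<Longrightarrow> edecay r g \<Longrightarrow> edecay r (\<lambda>z. f z - c * g z)"
  using edecay_add[of r f "\<lambda>z. (- c) * g z"] edecay_cmult[of r g "- c"] by simp

lemma norm_ee_strip: assumes "z \<in> hstrip r" shows "norm (ee (of_real \<beta> * z)) \<le> exp (2 * pi * (\<bar>\<beta>\<bar> * r))"
proof -
  have "\<bar>\<beta> * Im z\<bar> \<le> \<bar>\<beta>\<bar> * r" unfolding abs_mult by (intro mult_left_mono) (use assms in \<open>auto simp: hstrip_def\<close>)
  then have "- (\<beta> * Im z) \<le> \<bar>\<beta>\<bar> * r" by linarith
  then have "2 * pi * (- (\<beta> * Im z)) \<le> 2 * pi * (\<bar>\<beta>\<bar> * r)" by (intro mult_left_mono) auto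
  then show ?thesis by (simp add: norm_ee)
qed

lemma edecay_rop: assumes f: "edecay r f" and r: "0 < r" shows "edecay r (rop \<alpha> \<beta> f)"
proof -
  have e: "edecay r (\<lambda>z. ee (of_real \<beta> * z) * g z)" if "edecay r g" for g \<beta>
    by (rule edecay_mult[OF that _ norm_ee_strip]) (auto simp: ee_def intro!: holomorphic_intros)
  have s: "edecay r (\<lambda>z. f (z - of_real \<alpha>))" "edecay r (\<lambda>z. f (z - of_real \<alpha> - 1/2))"
    using edecay_shift[OF f r, of \<alpha>] edecay_shift[OF f r, of "\<alpha> + 1/2"] by (simp_all add: algebra_simps)
  have "rop \<alpha> \<beta> f = (\<lambda>z. ee (of_real \<beta> * z) * (c1 * f (z - of_real \<alpha>) + c2 * (ee (of_real 1 * z) * f (z - of_real \<alpha>)) + c2 * f (z - of_real \<alpha> - 1/2)))"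
    by (auto simp: rop_def algebra_simps)
  then show ?thesis by (simp only:) (intro e edecay_add edecay_cmult s)
qed

lemma rop_diff: "rop \<alpha> \<beta> (\<lambda>z. f z - c * g z) = (\<lambda>z. rop \<alpha> \<beta> f z - c * rop \<alpha> \<beta> g z)"
  by (auto simp: rop_def algebra_simps)

lemma bihol_Rop: assumes G: "bihol r G" and r: "0 < r" shows "bihol r (Rop \<alpha> \<beta> G)"
proof -
  have t2: "t - of_real \<alpha> - 1/2 \<in> hstrip r \<longleftrightarrow> t \<in> hstrip r" for t by (simp add: hstrip_def)
  have "(\<lambda>t. Rop \<alpha> \<beta> G t x) holomorphic_on hstrip r" if x: "x \<in> hstrip r" for x
  proof -
    have "(\<lambda>t. G (t - of_real c) (x - of_real \<beta>)) holomorphic_on hstrip r" for c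
      by (rule holomorphic_on_shift[of "\<lambda>t. G t (x - of_real \<beta>)"]) (use G x in \<open>auto simp: bihol_def\<close>)
    from this[of \<alpha>] this[of "\<alpha> + 1/2"] show ?thesis
      unfolding Rop_def ee_def by (intro holomorphic_intros) (simp_all add: algebra_simps)
  qed
  moreover have "(\<lambda>x. Rop \<alpha> \<beta> G t x) holomorphic_on hstrip r" if t: "t \<in> hstrip r" for t
  proof -
    have "(\<lambda>x. G t' (x - of_real \<beta>)) holomorphic_on hstrip r" if "t' \<in> hstrip r" for t'
      by (rule holomorphic_on_shift[of "\<lambda>x. G t' x"]) (use G that in \<open>auto simp: bihol_def\<close>)
    then show ?thesis unfolding Rop_def ee_def by (intro holomorphic_intros) (use t t2 in auto)
  qed
  moreover have "continuous_on (hstrip r \<times> hstrip r) (\<lambda>(t, x). Rop \<alpha> \<beta> G t x)"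
    by (rule continuous_Rop) (use G in \<open>auto simp: bihol_def\<close>)
  ultimately show ?thesis by (simp add: bihol_def)
qed

text \<open>Averaging over a full period of \<open>x\<close> does not see the shift of
  \<open>x\<close> by \<beta>, so the zeroth coefficient intertwines the two operators.\<close>

lemma coef2_Rop:
  assumes G: "bihol r G" and qp: "quasi_periodic G" and r: "0 < r" and t: "t \<in> hstrip r"
  shows "coef2 (Rop \<alpha> \<beta> G) 0 t = rop \<alpha> \<beta> (coef2 G 0) t"
proof -
  have t2: "t - of_real \<alpha> \<in> hstrip r" "t - of_real \<alpha> - 1/2 \<in> hstrip r" using t by (simp_all add: hstrip_def)
  have m: "of_real (- \<beta>) \<in> hstrip r" using r by (simp add: hstrip_def)
  have sh: "((\<lambda>x::real. G t' (of_real x - of_real \<beta>)) has_integral coef2 G 0 t') {0..1}" if t': "t' \<in> hstrip r" for t'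
  proof -
    have hG: "(\<lambda>x. G t' x) holomorphic_on hstrip r" using G t' by (simp add: bihol_def)
    have "(\<lambda>x::real. G t' (of_real (- \<beta>) + of_real x)) integrable_on {0..1}"
      by (intro integrable_continuous_real continuous_on_horizontal[OF holomorphic_on_imp_continuous_on[OF hG] m])
    moreover have "integral {0..1} (\<lambda>x. G t' (of_real (- \<beta>) + of_real x)) = integral {0..1} (\<lambda>x. G t' (of_real x))"
      by (rule integral_horizontal[OF hG _ m r]) (rule quasi_periodicD(2)[OF qp])
    ultimately have "((\<lambda>x::real. G t' (of_real (- \<beta>) + of_real x)) has_integral coef2 G 0 t') {0..1}"
      by (simp add: has_integral_integral coef2_def)
    then show ?thesis by (simp add: add.commute)
  qed
  have "((\<lambda>x::real. Rop \<alpha> \<beta> G t (of_real x)) has_integral rop \<alpha> \<beta> (coef2 G 0) t) {0..1}"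
    unfolding Rop_def rop_def by (intro has_integral_mult_right has_integral_add sh t2)
  then show ?thesis by (simp add: coef2_def[of "Rop \<alpha> \<beta> G"] integral_unique)
qed

lemma coef2_translate:
  assumes "quasi_periodic G" shows "coef2 G 0 (t + of_int n) = coef2 G (- n) t"
  using quasi_periodic_int[OF assms] by (simp add: coef2_def mult.commute)

text \<open>Translating the zeroth coefficient by n yields the coefficient of index -n, and this
  decays exponentially by holomorphy in \<open>x\<close>. Decay along the line is thus analyticity
  in the frequency variable.\<close>

lemma edecay_coef2:
  assumes G: "bihol r G" and qp: "quasi_periodic G" and r: "0 < r"
  shows "edecay (r/2) (coef2 G 0)"
proof -
  define s where "s = r/2"
  have s: "0 < s" "s < r" using r by (auto simp: s_def)
  define B where "B = cbox (Complex 0 (- s)) (Complex 1 s)"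
  have inB: "z \<in> B \<longleftrightarrow> 0 \<le> Re z \<and> Re z \<le> 1 \<and> \<bar>Im z\<bar> \<le> s" for z
    by (auto simp: B_def in_cbox_complex_iff abs_le_iff)
  have Bs: "z \<in> B \<Longrightarrow> z \<in> hstrip r" for z using s by (simp add: inB hstrip_def)
  have cB: "compact B" by (simp add: B_def)
  have "compact ((\<lambda>z. G (fst z) (snd z)) ` (B \<times> B))"
    by (intro compact_continuous_image bihol_cont[OF G] continuous_intros compact_Times cB) (auto simp: Bs)
  then obtain M where M: "\<forall>w\<in>(\<lambda>z. G (fst z) (snd z)) ` (B \<times> B). norm w \<le> M" using compact_imp_bounded bounded_iff by metis
  have fl: "0 \<le> u - of_int \<lfloor>u\<rfloor> \<and> u - of_int \<lfloor>u\<rfloor> \<le> 1" for u :: real using floor_correct[of u] by linarith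
  have MB: "norm (G t x) \<le> M" if t: "t \<in> B" and x: "\<bar>Im x\<bar> \<le> s" for t x
  proof -
    define x' where "x' = x - of_int \<lfloor>Re x\<rfloor>"
    have B: "x' \<in> B" using x fl by (simp add: inB x'_def)
    have "G t (x' + of_int \<lfloor>Re x\<rfloor>) = G t x'"
      by (rule periodic_int_strip[of r "\<lambda>x. G t x"]) (use quasi_periodicD(2)[OF qp] Bs[OF B] in auto)
    then have "G t x = G t x'" by (simp add: x'_def)
    then show ?thesis using M B t by force
  qed
  have M0: "0 \<le> M" using order_trans[OF norm_ge_zero MB[of 0 0]] s by (simp add: inB)
  have "norm (coef2 G 0 z) \<le> (M * exp (2 * pi * s)) * exp (- (s * \<bar>Re z\<bar>))" if z: "z \<in> hstrip s" for z
  proof -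
    define n where "n = \<lfloor>Re z\<rfloor>"
    define t where "t = z - of_int n"
    have tB: "t \<in> B" using z fl[of "Re z"] by (simp add: t_def inB n_def hstrip_def)
    have "norm (coef2 G (- n) t) \<le> M * exp (- (2 * pi * s * \<bar>real_of_int (- n)\<bar>))"
      unfolding coef2_def
    proof (rule coef_bound[OF _ _ s])
      show "(\<lambda>x. G t x) holomorphic_on hstrip r" using G Bs[OF tB] by (simp add: bihol_def)
    qed (use MB[OF tB] quasi_periodicD(2)[OF qp] in auto)
    moreover have "coef2 G 0 z = coef2 G (- n) t" using coef2_translate[OF qp, of t n] by (simp add: t_def)
    moreover have "M * exp (- (2 * pi * s * \<bar>real_of_int (- n)\<bar>)) \<le> (M * exp (2 * pi * s)) * exp (- (s * \<bar>Re z\<bar>))"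
    proof -
      have "\<bar>Re z\<bar> \<le> 1 + \<bar>real_of_int n\<bar>" using fl[of "Re z"] unfolding n_def by linarith
      moreover have "1 \<le> 2 * pi" using pi_gt3 by linarith
      ultimately have "1 * \<bar>Re z\<bar> \<le> (2 * pi) * (1 + \<bar>real_of_int n\<bar>)" by (intro mult_mono) auto
      then have "s * \<bar>Re z\<bar> \<le> s * ((2 * pi) * (1 + \<bar>real_of_int n\<bar>))" using s by simp
      then have "exp (- (2 * pi * s * \<bar>real_of_int (- n)\<bar>)) \<le> exp (2 * pi * s + - (s * \<bar>Re z\<bar>))"
        by (simp add: algebra_simps)
      from mult_left_mono[OF this[unfolded exp_add] M0] show ?thesis by (simp only: mult.assoc)
    qed
    ultimately show ?thesis by simp
  qed
  moreover have "coef2 G 0 holomorphic_on hstrip s"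
    by (rule holomorphic_on_subset[OF coef2_props(1)[OF G r] hstrip_mono]) (use s in simp)
  ultimately show ?thesis unfolding edecay_def s_def by blast
qed

text \<open>If \<open>T\<^sup>3 f = \<mu> f\<close> then one of \<open>f\<close>, \<open>(T - \<lambda>) f\<close>, \<open>(T - \<lambda> \<zeta>) (T - \<lambda>) f\<close> is an eigenfunction of \<open>T\<close>,
  where \<open>\<lambda>\<^sup>3 = \<mu>\<close> and \<open>\<zeta>\<close> is a primitive cube root of unity.\<close>

lemma rop_eigenfunction:
  "\<exists>\<alpha> \<beta> f lam r. \<alpha> \<noteq> 0 \<and> \<alpha> + 1/2 \<noteq> 0 \<and> 0 < r \<and> edecay r f \<and> (\<forall>t::real. rop \<alpha> \<beta> f (of_real t) = lam * f (of_real t)) \<and> (\<exists>t::real. f (of_real t) \<noteq> 0)"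
proof -
  obtain a b G \<mu> r where a: "\<bar>a\<bar> < 1/2" and r: "0 < r" and G: "bihol r G" and qp: "quasi_periodic G"
    and eig: "\<And>t x::real. Hop a b G (of_real t) (of_real x) = \<mu> * G (of_real t) (of_real x)"
    and nz: "\<exists>t x::real. G (of_real t) (of_real x) \<noteq> 0"
    using zak_eigenfunction by blast
  define \<alpha> \<beta> where "\<alpha> = a/3 - 1/6" and "\<beta> = b/3 - 1/3"
  have \<alpha>: "\<alpha> \<noteq> 0" "\<alpha> + 1/2 \<noteq> 0" using a by (auto simp: \<alpha>_def)
  define f where "f = coef2 G 0"
  have f: "edecay (r/2) f" unfolding f_def by (rule edecay_coef2[OF G qp r])
  define T where "T = rop \<alpha> \<beta>"
  have T3: "T (T (T f)) (of_real t) = \<mu> * f (of_real t)" for t :: real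
  proof -
    note b1 = bihol_Rop[OF G r, of \<alpha> \<beta>]
    note b2 = bihol_Rop[OF b1 r, of \<alpha> \<beta>]
    note q1 = quasi_periodic_Rop[OF qp, of \<alpha> \<beta>]
    note q2 = quasi_periodic_Rop[OF q1, of \<alpha> \<beta>]
    have sh: "of_real t - of_real \<alpha> \<in> hstrip r" "of_real t - of_real \<alpha> - 1/2 \<in> hstrip r" for t :: real
      using r by (simp_all add: hstrip_def)
    \<comment> \<open>The intertwining relation is available on the strip only. Since
      \<open>rop\<close> evaluates its argument at points of the same strip, it may be used under
      further applications of \<open>rop\<close>.\<close>
    have ex: "rop \<alpha> \<beta> g (of_real t) = rop \<alpha> \<beta> h (of_real t)" if "\<And>t. t \<in> hstrip r \<Longrightarrow> g t = h t" for g h and t :: real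
      unfolding rop_def using that sh[of t] by simp
    have ex': "rop \<alpha> \<beta> g t = rop \<alpha> \<beta> h t" if "\<And>t. t \<in> hstrip r \<Longrightarrow> g t = h t" "t \<in> hstrip r" for g h t
      unfolding rop_def using that by (simp add: hstrip_def)
    have "T (T (T f)) (of_real t) = coef2 (Hop a b G) 0 (of_real t)"
    proof -
      have "coef2 (Hop a b G) 0 (of_real t) = rop \<alpha> \<beta> (coef2 (Rop \<alpha> \<beta> (Rop \<alpha> \<beta> G)) 0) (of_real t)"
        unfolding Hop_def \<alpha>_def[symmetric] \<beta>_def[symmetric] by (rule coef2_Rop[OF b2 q2 r]) (use r in simp)
      also have "\<dots> = rop \<alpha> \<beta> (rop \<alpha> \<beta> (coef2 (Rop \<alpha> \<beta> G) 0)) (of_real t)"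
        by (rule ex, rule coef2_Rop[OF b1 q1 r])
      also have "\<dots> = rop \<alpha> \<beta> (rop \<alpha> \<beta> (rop \<alpha> \<beta> (coef2 G 0))) (of_real t)"
        by (rule ex, rule ex', rule coef2_Rop[OF G qp r])
      finally show ?thesis by (simp add: T_def f_def)
    qed
    also have "\<dots> = \<mu> * f (of_real t)" by (simp add: coef2_def eig f_def)
    finally show ?thesis .
  qed
  have fnz: "\<exists>t::real. f (of_real t) \<noteq> 0"
  proof (rule ccontr)
    assume "\<not> ?thesis"
    then have z: "f (of_real t) = 0" for t :: real by blast
    have "G (of_real t) (of_real x) = 0" for t x :: real
    proof (rule fourier_unique[OF _ _ r])
      show "(\<lambda>x. G (of_real t) x) holomorphic_on hstrip r" using G r by (simp add: bihol_def)
      fix n :: int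
      have "coef2 G (- n) (of_real t) = f (of_real (t + of_int n))"
        unfolding f_def using coef2_translate[OF qp, of "of_real t" n] by simp
      then show "integral {0..1} (\<lambda>x. G (of_real t) (of_real x) * ee (of_int n * of_real x)) = 0"
        using z[of "t + of_int n"] by (simp add: coef2_def)
    qed (rule quasi_periodicD(2)[OF qp])
    then show False using nz by blast
  qed
  obtain lam where lam: "lam ^ 3 = \<mu>"
  proof (cases "\<mu> = 0")
    case False
    have "exp (Ln \<mu> / 3) ^ 3 = \<mu>" using False by (simp flip: exp_of_nat_mult)
    then show ?thesis by (rule that)
  qed (auto intro: that[of 0])
  define \<zeta> where "\<zeta> = Complex (- 1/2) (sqrt 3 / 2)"
  \<comment> \<open>The third root \<zeta>^2 appears below as -1 - \<zeta>.\<close>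
  have \<zeta>: "\<zeta> * \<zeta> = - 1 - \<zeta>" by (simp add: \<zeta>_def complex_eq_iff real_sqrt_mult_self)
  define g1 g2 where "g1 = (\<lambda>z. T f z - lam * f z)" and "g2 = (\<lambda>z. T g1 z - (lam * \<zeta>) * g1 z)"
  have r2: "0 < r/2" using r by simp
  have g1: "edecay (r/2) g1" unfolding g1_def T_def by (intro edecay_diff edecay_rop f r2)
  have g2: "edecay (r/2) g2" unfolding g2_def T_def by (intro edecay_diff edecay_rop g1 r2)
  note Tlin = rop_diff[of \<alpha> \<beta>, folded T_def]
  \<comment> \<open>The factorization of T^3 - lam^3 into the three linear factors, applied to
    f.\<close>
  have last: "T g2 (of_real t) = (lam * (- 1 - \<zeta>)) * g2 (of_real t)" for t :: real
  proof -
    define F0 F1 F2 where "F0 = f (of_real t)" and "F1 = T f (of_real t)" and "F2 = T (T f) (of_real t)"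
    have "T g2 (of_real t) - (lam * (- 1 - \<zeta>)) * g2 (of_real t)
      = (\<mu> * F0 - lam * F2 - lam * \<zeta> * (F2 - lam * F1)) - lam * (- 1 - \<zeta>) * ((F2 - lam * F1) - lam * \<zeta> * (F1 - lam * F0))"
      by (simp add: g2_def g1_def Tlin T3 F0_def F1_def F2_def)
    also have "\<dots> = (\<mu> - lam ^ 3 * (\<zeta> + \<zeta> * \<zeta>) * (-1)) * F0 + lam\<^sup>2 * (- 1 - \<zeta> - \<zeta> * \<zeta>) * F1"
      by (simp add: algebra_simps power2_eq_square power3_eq_cube)
    also have "\<dots> = 0" unfolding \<zeta> by (simp add: lam)
    finally show ?thesis by simp
  qed
  show ?thesis
  proof (cases "\<exists>t::real. g1 (of_real t) \<noteq> 0")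
    case False
    then have "T f (of_real t) = lam * f (of_real t)" for t :: real by (simp add: g1_def)
    then show ?thesis using \<alpha> r2 f fnz unfolding T_def by blast
  next
    case g1nz: True
    show ?thesis
    proof (cases "\<exists>t::real. g2 (of_real t) \<noteq> 0")
      case False
      then have "T g1 (of_real t) = (lam * \<zeta>) * g1 (of_real t)" for t :: real by (simp add: g2_def)
      then show ?thesis using \<alpha> r2 g1 g1nz unfolding T_def by blast
    next
      case True
      then show ?thesis using \<alpha> r2 g2 last unfolding T_def by blast
    qed
  qed
qed

text \<open>Cauchy's inequality on discs of the fixed radius r/2 gives every derivative the same
  exponential decay, which beats all powers of x.\<close>

lemma edecay_schwartz:
  assumes f: "edecay r f" and r: "0 < r"
  shows "(\<lambda>x::real. f (of_real x)) \<in> schwartz_space"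
proof -
  obtain C where C: "C \<ge> 0" "\<And>z. z \<in> hstrip r \<Longrightarrow> norm (f z) \<le> C * exp (- (r * \<bar>Re z\<bar>))" using edecay_nonneg[OF f] by blast
  have hf: "f holomorphic_on hstrip r" using f by (simp add: edecay_def)
  define D where "D k x = (deriv ^^ k) f (of_real x)" for k and x :: real
  define s where "s = r / 2"
  have s: "0 < s" "s < r" using r by (auto simp: s_def)
  have der: "(D k has_vector_derivative D (Suc k) x) (at x)" for k x
    unfolding D_def funpow.simps o_def
    by (rule has_vector_derivative_real_field holomorphic_derivI[OF holomorphic_higher_deriv[OF hf open_hstrip] open_hstrip])+
      (use r in simp)
  have bd: "norm (D k x) \<le> (fact k * (C * exp (r * s)) / s ^ k) * exp (- (r * \<bar>x\<bar>))" for k x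
  proof -
    have sub: "cball (of_real x) s \<subseteq> hstrip r"
    proof
      fix z assume "z \<in> cball (of_real x :: complex) s"
      then have "norm (z - of_real x) \<le> s" by (simp add: dist_norm norm_minus_commute)
      then show "z \<in> hstrip r" using abs_Im_le_cmod[of "z - of_real x"] s by (simp add: hstrip_def)
    qed
    have "norm ((deriv ^^ k) f (of_real x)) \<le> fact k * (C * exp (r * s + - (r * \<bar>x\<bar>))) / s ^ k"
    proof (rule Cauchy_inequality[OF _ _ s(1)])
      show "f holomorphic_on ball (of_real x) s" using holomorphic_on_subset[OF hf] sub ball_subset_cball by blast
      show "continuous_on (cball (of_real x) s) f" using continuous_on_subset[OF holomorphic_on_imp_continuous_on[OF hf] sub] .
      fix z :: complex assume z: "norm (of_real x - z) = s"
      then have zs: "z \<in> hstrip r" using sub by (auto simp: dist_norm)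
      have "\<bar>x - Re z\<bar> \<le> s" using abs_Re_le_cmod[of "of_real x - z"] z by simp
      then have "\<bar>x\<bar> - s \<le> \<bar>Re z\<bar>" by linarith
      then have "r * (\<bar>x\<bar> - s) \<le> r * \<bar>Re z\<bar>" using r by simp
      then have "C * exp (- (r * \<bar>Re z\<bar>)) \<le> C * exp (r * s + - (r * \<bar>x\<bar>))" using C(1) by (intro mult_left_mono) (auto simp: right_diff_distrib)
      then show "norm (f z) \<le> C * exp (r * s + - (r * \<bar>x\<bar>))" using C(2)[OF zs] by linarith
    qed
    then show ?thesis unfolding exp_add D_def by (simp add: mult_ac)
  qed
  have "bounded (range (\<lambda>x. x ^ j *\<^sub>R D k x))" for j k
  proof -
    define A where "A = fact k * (C * exp (r * s)) / s ^ k"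
    have A: "0 \<le> A" using C s by (simp add: A_def)
    have pw: "\<bar>x\<bar> ^ j * exp (- (r * \<bar>x\<bar>)) \<le> (real (Suc j) / r) ^ j" for x
    proof -
      \<comment> \<open>Dividing by j + 1 instead of j keeps the case j = 0 meaningful.\<close>
      define y where "y = r * \<bar>x\<bar> / real (Suc j)"
      have y: "0 \<le> y" using r by (simp add: y_def)
      have x: "\<bar>x\<bar> = (real (Suc j) / r) * y" using r by (simp add: y_def)
      have "y \<le> exp y" using exp_ge_add_one_self[of y] by linarith
      then have "y ^ j \<le> exp y ^ j" using y by (intro power_mono)
      also have "\<dots> = exp (real j * y)" by (simp add: exp_of_nat_mult)
      also have "\<dots> \<le> exp (r * \<bar>x\<bar>)"
      proof -
        have "real j * y \<le> real (Suc j) * y" using y by (intro mult_right_mono) auto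
        then show ?thesis by (simp add: y_def)
      qed
      finally have "y ^ j * exp (- (r * \<bar>x\<bar>)) \<le> exp (r * \<bar>x\<bar>) * exp (- (r * \<bar>x\<bar>))" by (intro mult_right_mono) auto
      then have "y ^ j * exp (- (r * \<bar>x\<bar>)) \<le> 1" by (simp flip: exp_add)
      then have "(real (Suc j) / r) ^ j * (y ^ j * exp (- (r * \<bar>x\<bar>))) \<le> (real (Suc j) / r) ^ j * 1" using r by (intro mult_left_mono) auto
      moreover have "\<bar>x\<bar> ^ j = (real (Suc j) / r) ^ j * y ^ j" unfolding power_mult_distrib[symmetric] x[symmetric] ..
      ultimately show ?thesis by (simp only: mult.assoc mult_1_right)
    qed
    have "norm (x ^ j *\<^sub>R D k x) \<le> A * (real (Suc j) / r) ^ j" for x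
    proof -
      have "norm (x ^ j *\<^sub>R D k x) \<le> \<bar>x\<bar> ^ j * (A * exp (- (r * \<bar>x\<bar>)))"
        using mult_left_mono[OF bd[of k x, folded A_def], of "\<bar>x\<bar> ^ j"] by (simp add: power_abs)
      also have "\<dots> = A * (\<bar>x\<bar> ^ j * exp (- (r * \<bar>x\<bar>)))" by simp
      also have "\<dots> \<le> A * (real (Suc j) / r) ^ j" by (rule mult_left_mono[OF pw A])
      finally show ?thesis .
    qed
    then show ?thesis by (auto simp: bounded_iff)
  qed
  then show ?thesis unfolding schwartz_space_def using der by (auto intro!: exI[of _ D] simp: D_def)
qed

theorem four_points_schwartz:
  "\<exists>f\<in>schwartz_space. f \<noteq> (\<lambda>_. 0) \<and> (\<exists>\<Lambda>. finite \<Lambda> \<and> card \<Lambda> = 4 \<and> weyl_dependent f \<Lambda>)"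
proof -
  obtain \<alpha> \<beta> F lam r where \<alpha>: "\<alpha> \<noteq> 0" "\<alpha> + 1/2 \<noteq> 0" and r: "0 < r" and F: "edecay r F"
    and eig: "\<And>t::real. rop \<alpha> \<beta> F (of_real t) = lam * F (of_real t)" and nz: "\<exists>t::real. F (of_real t) \<noteq> 0"
    using rop_eigenfunction by blast
  define f where "f x = F (of_real x)" for x :: real
  define p0 p1 p2 p3 where "p0 = (0 :: real, 0 :: real)" and "p1 = (\<alpha>, \<beta>)" and "p2 = (\<alpha>, \<beta> + 1)" and "p3 = (\<alpha> + 1/2, \<beta>)"
  have ne: "p0 \<noteq> p1" "p0 \<noteq> p2" "p0 \<noteq> p3" "p1 \<noteq> p2" "p1 \<noteq> p3" "p2 \<noteq> p3"
    using \<alpha> by (auto simp: p0_def p1_def p2_def p3_def)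
  \<comment> \<open>Each phase is the inverse of the symmetric phase e(-u v / 2) contained in
    \<open>weyl_shift\<close>, so that the combination equals the operator minus \<open>lam\<close>
    times the identity.\<close>
  define c where "c = (\<lambda>_. 0)(p0 := - lam, p1 := c1 * ee (of_real (\<alpha> * \<beta> / 2)), p2 := c2 * ee (of_real (\<alpha> * (\<beta> + 1) / 2)), p3 := c2 * ee (of_real ((\<alpha> + 1/2) * \<beta> / 2)))"
  have W: "weyl_shift (u, v) f t = ee (of_real (v * t)) * ee (of_real (- (u * v / 2))) * f (t - u)" for u v t
    unfolding ee_add[symmetric] by (simp add: weyl_shift_def ee_def algebra_simps)
  have W1: "ee (of_real (u * v / 2)) * (ee (of_real (- (u * v / 2)))) = 1" for u v :: real
    unfolding ee_add[symmetric] by simp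
  have W2: "(c * ee (of_real (u * v / 2))) * weyl_shift (u, v) f t = c * ee (of_real (v * t)) * f (t - u)" for u v t c
  proof -
    have "(c * ee (of_real (u * v / 2))) * weyl_shift (u, v) f t = c * ee (of_real (v * t)) * f (t - u) * (ee (of_real (u * v / 2)) * (ee (of_real (- (u * v / 2)))))"
      unfolding W by (simp only: mult_ac)
    then show ?thesis unfolding W1 by simp
  qed
  have "(\<Sum>z\<in>{p0, p1, p2, p3}. c z * weyl_shift z f t) = 0" for t
  proof -
    have "(\<Sum>z\<in>{p0, p1, p2, p3}. c z * weyl_shift z f t) = - lam * f t + c1 * ee (of_real (\<beta> * t)) * f (t - \<alpha>)
       + c2 * ee (of_real ((\<beta> + 1) * t)) * f (t - \<alpha>) + c2 * ee (of_real (\<beta> * t)) * f (t - (\<alpha> + 1/2))"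
    proof -
      have "weyl_shift p0 f t = f t" by (simp add: p0_def W)
      then have "(\<Sum>z\<in>{p0, p1, p2, p3}. c z * weyl_shift z f t) = - lam * f t + (c1 * ee (of_real (\<alpha> * \<beta> / 2))) * weyl_shift (\<alpha>, \<beta>) f t
        + (c2 * ee (of_real (\<alpha> * (\<beta> + 1) / 2))) * weyl_shift (\<alpha>, \<beta> + 1) f t + (c2 * ee (of_real ((\<alpha> + 1/2) * \<beta> / 2))) * weyl_shift (\<alpha> + 1/2, \<beta>) f t"
        using ne by (simp add: c_def) (simp add: p1_def p2_def p3_def)
      then show ?thesis unfolding W2 .
    qed
    also have "\<dots> = rop \<alpha> \<beta> F (of_real t) - lam * F (of_real t)"
    proof -
      have "ee (of_real ((\<beta> + 1) * t)) = ee (of_real \<beta> * of_real t) * ee (of_real t)" unfolding ee_add[symmetric] by (simp add: algebra_simps)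
      moreover have "complex_of_real (t - (\<alpha> + 1/2)) = of_real t - of_real \<alpha> - 1/2" by simp
      ultimately show ?thesis by (simp add: rop_def f_def algebra_simps)
    qed
    finally show ?thesis using eig by simp
  qed
  \<comment> \<open>The eigenvalue \<open>lam\<close> may be 0, so nontriviality is witnessed by a
    coefficient containing \<open>c2\<close>.\<close>
  moreover have "c p2 \<noteq> 0" using ne by (simp add: c_def c2_def)
  ultimately have "weyl_dependent f {p0, p1, p2, p3}" unfolding weyl_dependent_def L2_zero_def
    by (intro exI[of _ c] conjI bexI[of _ p2]) auto
  moreover have "card {p0, p1, p2, p3} = 4" using ne by simp
  moreover have "f \<in> schwartz_space" unfolding f_def by (rule edecay_schwartz[OF F r])
  moreover have "f \<noteq> (\<lambda>_. 0)" using nz by (auto simp: f_def fun_eq_iff)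
  ultimately show ?thesis by (intro bexI[of _ f] conjI exI[of _ "{p0, p1, p2, p3}"]) auto
qed

section \<open>Periodic multipliers and exponential sums\<close>

lemma nn_integral_lborel_shift:
  assumes [measurable]: "f \<in> borel_measurable borel"
  shows "(\<integral>\<^sup>+x. f (x + c) \<partial>lborel) = (\<integral>\<^sup>+x. f x \<partial>(lborel :: real measure))"
  using nn_integral_real_affine[of f 1 c] by (simp add: add.commute)

lemma AE_lborel_shift:
  assumes [measurable]: "Measurable.pred borel P" and "AE x in lborel. P (x :: real)"
  shows "AE x in lborel. P (x + c)"
proof -
  have "(\<integral>\<^sup>+x. indicator {x. \<not> P x} x \<partial>lborel) = (0::ennreal)"
    by (subst nn_integral_0_iff_AE) (use assms(2) in \<open>auto simp: indicator_def elim: eventually_mono\<close>)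
  then have "(\<integral>\<^sup>+x. indicator {x. \<not> P x} (x + c) \<partial>lborel) = (0::ennreal)"
    by (subst nn_integral_lborel_shift) auto
  then have "AE x in lborel. indicator {x. \<not> P x} (x + c) = (0::ennreal)" by (subst (asm) nn_integral_0_iff_AE) auto
  then show ?thesis by eventually_elim (simp add: indicator_def add.commute split: if_splits)
qed

lemma measurable_nn_int:
  fixes u :: "int \<Rightarrow> real \<Rightarrow> ennreal"
  assumes [measurable]: "\<And>m. u m \<in> borel_measurable borel"
  shows "(\<lambda>t. \<integral>\<^sup>+m. u m t \<partial>count_space UNIV) \<in> borel_measurable borel"
proof -
  have "(\<integral>\<^sup>+m. u m t \<partial>count_space UNIV) = (\<Sum>n. u (int_decode n) t)" for t
    using nn_integral_bij_count_space[of int_decode UNIV UNIV "\<lambda>m. u m t"] bij_int_decode by (simp add: nn_integral_count_space_nat)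
  then show ?thesis by simp
qed

definition psum :: "real \<Rightarrow> (real \<Rightarrow> ennreal) \<Rightarrow> real \<Rightarrow> ennreal" where
  "psum \<tau> h t = (\<integral>\<^sup>+m. h (t + real_of_int m * \<tau>) \<partial>count_space UNIV)"

lemma psum_measurable [measurable]:
  assumes [measurable]: "h \<in> borel_measurable borel" shows "psum \<tau> h \<in> borel_measurable borel"
  unfolding psum_def[abs_def] by (rule measurable_nn_int) measurable

lemma psum_periodic: "psum \<tau> h (t + real_of_int k * \<tau>) = psum \<tau> h t"
proof -
  have "bij (\<lambda>m. m + k)" by (rule bijI') (auto intro: exI[of _ "y - k" for y])
  from nn_integral_bij_count_space[OF this, of "\<lambda>m. h (t + real_of_int m * \<tau>)"]
  show ?thesis by (simp add: psum_def algebra_simps)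
qed

text \<open>Unfolding: the line is tiled by the translates of one period, each of which is moved
  back to the origin.\<close>

lemma nn_integral_psum:
  assumes [measurable]: "h \<in> borel_measurable borel" and \<tau>: "0 < \<tau>"
  shows "(\<integral>\<^sup>+t. h t \<partial>lborel) = (\<integral>\<^sup>+t. psum \<tau> h t * indicator {0..<\<tau>} t \<partial>lborel)"
proof -
  define I where "I m = {real_of_int m * \<tau>..<real_of_int m * \<tau> + \<tau>}" for m
  have I: "indicator (I m) t = (indicator {\<lfloor>t / \<tau>\<rfloor>} m :: ennreal)" for m t
  proof -
    have "t \<in> I m \<longleftrightarrow> m = \<lfloor>t / \<tau>\<rfloor>"
      using \<tau> floor_eq_iff[of "t / \<tau>" m] by (auto simp: I_def field_simps)
    then show ?thesis by (simp add: indicator_def)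
  qed
  have one: "(\<integral>\<^sup>+m. h t * indicator (I m) t \<partial>count_space UNIV) = h t" for t
    unfolding I by (subst nn_integral_cmult) auto
  have "(\<integral>\<^sup>+t. h t \<partial>lborel) = (\<integral>\<^sup>+t. \<integral>\<^sup>+m. h t * indicator (I m) t \<partial>count_space UNIV \<partial>lborel)" unfolding one ..
  also have "\<dots> = (\<integral>\<^sup>+m. \<integral>\<^sup>+t. h t * indicator (I m) t \<partial>lborel \<partial>count_space UNIV)"
    by (rule nn_integral_count_space_nn_integral) (auto simp: I_def)
  also have "(\<lambda>m. \<integral>\<^sup>+t. h t * indicator (I m) t \<partial>lborel) = (\<lambda>m. \<integral>\<^sup>+t. h (t + real_of_int m * \<tau>) * indicator {0..<\<tau>} t \<partial>lborel)"
  proof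
    fix m
    have "(\<integral>\<^sup>+t. h t * indicator (I m) t \<partial>lborel) = (\<integral>\<^sup>+t. h (t + real_of_int m * \<tau>) * indicator (I m) (t + real_of_int m * \<tau>) \<partial>lborel)"
      by (rule nn_integral_lborel_shift[symmetric]) (simp add: I_def)
    also have "\<dots> = (\<integral>\<^sup>+t. h (t + real_of_int m * \<tau>) * indicator {0..<\<tau>} t \<partial>lborel)"
      by (intro nn_integral_cong) (auto simp: I_def indicator_def)
    finally show "(\<integral>\<^sup>+t. h t * indicator (I m) t \<partial>lborel) = (\<integral>\<^sup>+t. h (t + real_of_int m * \<tau>) * indicator {0..<\<tau>} t \<partial>lborel)" .
  qed
  also have "(\<integral>\<^sup>+m. \<integral>\<^sup>+t. h (t + real_of_int m * \<tau>) * indicator {0..<\<tau>} t \<partial>lborel \<partial>count_space UNIV)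
     = (\<integral>\<^sup>+t. \<integral>\<^sup>+m. h (t + real_of_int m * \<tau>) * indicator {0..<\<tau>} t \<partial>count_space UNIV \<partial>lborel)"
    by (rule nn_integral_count_space_nn_integral[symmetric]) auto
  also have "\<dots> = (\<integral>\<^sup>+t. psum \<tau> h t * indicator {0..<\<tau>} t \<partial>lborel)"
    unfolding psum_def by (intro nn_integral_cong nn_integral_multc) auto
  finally show ?thesis .
qed

lemma nn_count_const: "(\<integral>\<^sup>+m. (c::ennreal) \<partial>count_space (UNIV :: int set)) = (if c = 0 then 0 else top)"
proof -
  have "infinite (UNIV :: int set)" by simp
  then show ?thesis by (simp add: ennreal_mult_top)
qed

text \<open>The periodization of g with step \<bar>d\<bar> is infinite wherever g is nonzero,
  whereas its integral over one period is the finite integral of g.\<close>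

lemma shift_invariant_zero:
  fixes g :: "real \<Rightarrow> ennreal" and d :: real
  assumes [measurable]: "g \<in> borel_measurable borel" and d: "d \<noteq> 0" and inv: "AE t in lborel. g (t - d) = g t"
    and fin: "(\<integral>\<^sup>+t. g t \<partial>lborel) < \<infinity>"
  shows "AE t in lborel. g t = (0::ennreal)"
proof -
  define \<tau> where "\<tau> = \<bar>d\<bar>"
  have \<tau>: "0 < \<tau>" using d by (simp add: \<tau>_def)
  have inv': "AE t in lborel. g (t + \<tau>) = g t"
  proof (cases "d > 0")
    case True
    have "AE t in lborel. g (t + d - d) = g (t + d)" by (rule AE_lborel_shift[OF _ inv]) measurable
    then show ?thesis by eventually_elim (use True in \<open>simp add: \<tau>_def\<close>)
  next
    case False
    then have "\<tau> = - d" by (simp add: \<tau>_def)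
    then show ?thesis using inv by simp
  qed
  have "AE t in lborel. \<forall>m::int. g (t + real_of_int m * \<tau> + \<tau>) = g (t + real_of_int m * \<tau>)"
    unfolding AE_all_countable by (intro allI AE_lborel_shift[OF _ inv']) measurable
  then have ps: "AE t in lborel. psum \<tau> g t = (if g t = 0 then 0 else top)"
  proof eventually_elim
    case (elim t)
    have "g (t + real_of_int m * \<tau>) = g t" for m
    proof (induction m rule: int_induct[of _ 0])
      case (step1 m) then show ?case using elim[rule_format, of m] by (simp add: algebra_simps)
    next
      case (step2 m) then show ?case using elim[rule_format, of "m - 1"] by (simp add: algebra_simps)
    qed simp
    then show ?case by (simp add: psum_def nn_count_const)
  qed
  have i: "(\<integral>\<^sup>+t. psum \<tau> g t * indicator {0..<\<tau>} t \<partial>lborel) \<noteq> \<infinity>"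
    using fin nn_integral_psum[OF assms(1) \<tau>] by auto
  have "AE t in lborel. psum \<tau> g t * indicator {0..<\<tau>} t \<noteq> \<infinity>"
    by (rule nn_integral_PInf_AE[OF _ i]) measurable
  then have "AE t in lborel. psum \<tau> g t * indicator {0..<\<tau>} t = 0"
    using ps by eventually_elim (auto simp: indicator_def split: if_splits)
  then have "(\<integral>\<^sup>+t. psum \<tau> g t * indicator {0..<\<tau>} t \<partial>lborel) = 0" by (subst nn_integral_0_iff_AE) auto
  then have "(\<integral>\<^sup>+t. g t \<partial>lborel) = 0" using nn_integral_psum[OF assms(1) \<tau>] by simp
  then show ?thesis by (subst (asm) nn_integral_0_iff_AE) auto
qed

lemma ennreal_mult_div_cancel:
  assumes "x \<noteq> 0" "x \<noteq> (top::ennreal)" shows "(x * a) / (x * b) = a / b"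
proof -
  have "inverse (x * b) = inverse x * inverse b"
    by (rule ennreal_inverse_mult') (use assms in \<open>auto simp: less_top zero_less_iff_neq_zero\<close>)
  then have "(x * a) / (x * b) = (x * inverse x) * (a * inverse b)" by (simp add: divide_ennreal_def mult_ac)
  moreover have "x * inverse x = 1" using assms ennreal_divide_self[of x] by (simp add: divide_ennreal_def less_top)
  ultimately show ?thesis by (simp add: divide_ennreal_def)
qed

text \<open>The ratio of \<open>h\<close> to its periodization is invariant under the shift by \<open>d\<close>, yet integrable.\<close>

lemma periodic_multiplier_zero:
  fixes h p :: "real \<Rightarrow> ennreal" and \<tau> d :: real
  assumes [measurable]: "h \<in> borel_measurable borel" "p \<in> borel_measurable borel" and \<tau>: "0 < \<tau>"
    and per: "\<And>t m. p (t + real_of_int m * \<tau>) = p t" and p: "AE t in lborel. p t \<noteq> 0 \<and> p t \<noteq> top"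
    and C: "C \<noteq> 0" "C \<noteq> top" and d: "d \<noteq> 0" and rel: "AE t in lborel. p t * h t = C * h (t - d)"
    and fin: "(\<integral>\<^sup>+t. h t \<partial>lborel) < \<infinity>"
  shows "AE t in lborel. h t = 0"
proof -
  define \<rho> where "\<rho> = psum \<tau> h"
  have [measurable]: "\<rho> \<in> borel_measurable borel" unfolding \<rho>_def by measurable
  define g where "g t = h t / \<rho> t" for t
  have [measurable]: "g \<in> borel_measurable borel" unfolding g_def by measurable
  have \<rho>p: "\<rho> (t + real_of_int m * \<tau>) = \<rho> t" for t m unfolding \<rho>_def by (rule psum_periodic)
  \<comment> \<open>The sum is exactly 1 where \<rho> is positive and finite. Where \<rho> is 0 or
    infinite, the conventions of the extended reals make it 0.\<close>
  have "psum \<tau> g t \<le> 1" for t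
  proof -
    have "psum \<tau> g t = (\<integral>\<^sup>+m. h (t + real_of_int m * \<tau>) * inverse (\<rho> t) \<partial>count_space UNIV)"
      unfolding psum_def[of \<tau> g] g_def \<rho>p divide_ennreal_def ..
    also have "\<dots> = \<rho> t * inverse (\<rho> t)" unfolding \<rho>_def psum_def by (rule nn_integral_multc) auto
    also have "\<dots> \<le> 1"
    proof (cases "\<rho> t = 0 \<or> \<rho> t = top")
      case False
      then show ?thesis using ennreal_divide_self[of "\<rho> t"] by (simp add: divide_ennreal_def less_top)
    qed auto
    finally show ?thesis .
  qed
  then have "(\<integral>\<^sup>+t. psum \<tau> g t * indicator {0..<\<tau>} t \<partial>lborel) \<le> (\<integral>\<^sup>+t. 1 * indicator {0..<\<tau>} t \<partial>lborel)"
    by (intro nn_integral_mono mult_right_mono) auto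
  also have "\<dots> = ennreal \<tau>" using \<tau> by simp
  finally have "(\<integral>\<^sup>+t. g t \<partial>lborel) \<le> ennreal \<tau>" using nn_integral_psum[of g \<tau>] \<tau> by simp
  then have gfin: "(\<integral>\<^sup>+t. g t \<partial>lborel) < \<infinity>" by (rule le_less_trans) simp
  have i: "(\<integral>\<^sup>+t. psum \<tau> h t * indicator {0..<\<tau>} t \<partial>lborel) \<noteq> \<infinity>"
    using fin nn_integral_psum[OF assms(1) \<tau>] by auto
  have \<rho>0: "AE t in lborel. \<rho> t * indicator {0..<\<tau>} t \<noteq> \<infinity>"
    unfolding \<rho>_def by (rule nn_integral_PInf_AE[OF _ i]) measurable
  \<comment> \<open>The set where the periodization is infinite is periodic and has measure 0 in one
    period, because h is integrable; its own periodization takes only the values 0 and infinity, so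
    it is a null set.\<close>
  define k where "k t = (indicator {t. \<rho> t = \<infinity>} t :: ennreal)" for t
  have [measurable]: "k \<in> borel_measurable borel" unfolding k_def by measurable
  have "k (t + real_of_int m * \<tau>) = k t" for t m by (simp add: k_def \<rho>p indicator_def)
  then have kp: "psum \<tau> k t = (if k t = 0 then 0 else top)" for t by (simp add: psum_def nn_count_const)
  have "AE t in lborel. psum \<tau> k t * indicator {0..<\<tau>} t = 0"
    using \<rho>0 by eventually_elim (auto simp: kp k_def indicator_def split: if_splits)
  then have "(\<integral>\<^sup>+t. psum \<tau> k t * indicator {0..<\<tau>} t \<partial>lborel) = 0" by (subst nn_integral_0_iff_AE) auto
  then have "(\<integral>\<^sup>+t. k t \<partial>lborel) = 0" using nn_integral_psum[of k \<tau>] \<tau> by simp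
  then have "AE t in lborel. k t = 0" by (subst (asm) nn_integral_0_iff_AE) auto
  then have \<rho>fin: "AE t in lborel. \<rho> t \<noteq> \<infinity>" by eventually_elim (auto simp: k_def indicator_def split: if_splits)
  have "AE t in lborel. \<forall>m::int. p (t + real_of_int m * \<tau>) * h (t + real_of_int m * \<tau>) = C * h (t + real_of_int m * \<tau> - d)"
    unfolding AE_all_countable by (intro allI AE_lborel_shift[OF _ rel]) measurable
  then have "AE t in lborel. g (t - d) = g t"
    using p rel
  proof eventually_elim
    case (elim t)
    \<comment> \<open>Summing the relation over all translates by \<tau> pulls the periodic factor
      out, so \<rho> satisfies the same equation as h and the factors cancel in the ratio.\<close>
    have "p t * \<rho> t = (\<integral>\<^sup>+m. p t * h (t + real_of_int m * \<tau>) \<partial>count_space UNIV)"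
      unfolding \<rho>_def psum_def by (rule nn_integral_cmult[symmetric]) auto
    also have "\<dots> = (\<integral>\<^sup>+m. C * h (t - d + real_of_int m * \<tau>) \<partial>count_space UNIV)"
    proof (intro nn_integral_cong)
      fix m :: int
      have "t - d + real_of_int m * \<tau> = t + real_of_int m * \<tau> - d" by simp
      then show "p t * h (t + real_of_int m * \<tau>) = C * h (t - d + real_of_int m * \<tau>)"
        using elim(1)[rule_format, of m] unfolding per by (simp only:)
    qed
    also have "\<dots> = C * \<rho> (t - d)" unfolding \<rho>_def psum_def by (rule nn_integral_cmult) auto
    finally have r: "p t * \<rho> t = C * \<rho> (t - d)" .
    have "g (t - d) = (C * h (t - d)) / (C * \<rho> (t - d))" unfolding g_def using C by (simp add: ennreal_mult_div_cancel)
    also have "\<dots> = (p t * h t) / (p t * \<rho> t)" using r elim by simp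
    also have "\<dots> = g t" unfolding g_def by (rule ennreal_mult_div_cancel) (use elim in auto)
    finally show ?case .
  qed
  from shift_invariant_zero[OF _ d this gfin] have "AE t in lborel. g t = 0" by simp
  then show ?thesis using \<rho>fin by eventually_elim (auto simp: g_def divide_ennreal_def)
qed

text \<open>Dividing by one exponential turns one term into the constant \<open>c j0\<close>. If the
  quotient were constant, its derivative would be an identically vanishing sum over the remaining
  frequencies, which are distinct and nonzero, against the induction hypothesis. A nonconstant
  entire function has countably many zeros.\<close>

lemma exp_sum_zeros_countable:
  fixes b :: "'j \<Rightarrow> real" and c :: "'j \<Rightarrow> complex"
  assumes "finite J" "J \<noteq> {}" "inj_on b J" "\<And>j. j \<in> J \<Longrightarrow> c j \<noteq> 0"
  shows "countable {z::complex. (\<Sum>j\<in>J. c j * exp (\<i> * of_real (b j) * z)) = 0}"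
  using assms
proof (induction J arbitrary: b c rule: finite_ne_induct)
  case (insert j0 J)
  define g where "g z = c j0 + (\<Sum>j\<in>J. c j * exp (\<i> * of_real (b j - b j0) * z))" for z
  have eq: "(\<Sum>j\<in>insert j0 J. c j * exp (\<i> * of_real (b j) * z)) = exp (\<i> * of_real (b j0) * z) * g z" for z
  proof -
    have e: "exp (\<i> * of_real (b j) * z) = exp (\<i> * of_real (b j0) * z) * exp (\<i> * of_real (b j - b j0) * z)" for j
      unfolding exp_add[symmetric] by (simp add: algebra_simps)
    have 1: "(\<Sum>j\<in>J. c j * exp (\<i> * of_real (b j) * z)) = exp (\<i> * of_real (b j0) * z) * (\<Sum>j\<in>J. c j * exp (\<i> * of_real (b j - b j0) * z))"
      unfolding sum_distrib_left by (intro sum.cong refl, subst e) (rule mult.left_commute)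
    have "(\<Sum>j\<in>insert j0 J. c j * exp (\<i> * of_real (b j) * z)) = c j0 * exp (\<i> * of_real (b j0) * z) + (\<Sum>j\<in>J. c j * exp (\<i> * of_real (b j) * z))"
      by (rule sum.insert) (use insert.hyps in auto)
    also have "\<dots> = exp (\<i> * of_real (b j0) * z) * g z" unfolding 1 g_def distrib_left mult.commute[of "c j0"] ..
    finally show ?thesis .
  qed
  have der: "(g has_field_derivative (\<Sum>j\<in>J. (c j * (\<i> * of_real (b j - b j0))) * exp (\<i> * of_real (b j - b j0) * z))) (at z)" for z
    unfolding g_def by (auto intro!: derivative_eq_intros sum.cong)
  have "\<not> g constant_on UNIV"
  proof
    assume "g constant_on UNIV"
    then obtain y where "g = (\<lambda>_. y)" by (auto simp: constant_on_def fun_eq_iff)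
    then have "(g has_field_derivative 0) (at z)" for z by simp
    then have z: "(\<Sum>j\<in>J. (c j * (\<i> * of_real (b j - b j0))) * exp (\<i> * of_real (b j - b j0) * z)) = 0" for z
      using DERIV_unique[OF der] by blast
    have "countable {z::complex. (\<Sum>j\<in>J. (c j * (\<i> * of_real (b j - b j0))) * exp (\<i> * of_real (b j - b j0) * z)) = 0}"
    proof (rule insert.IH)
      show "inj_on (\<lambda>j. b j - b j0) J" using insert.prems(1) by (auto simp: inj_on_def)
      fix j assume j: "j \<in> J"
      then have "b j \<noteq> b j0" using insert.prems(1) insert.hyps by (auto simp: inj_on_def)
      then show "c j * (\<i> * of_real (b j - b j0)) \<noteq> 0" using insert.prems(2)[of j] j by simp
    qed
    then show False using z uncountable_UNIV_complex by simp
  qed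
  moreover have "g holomorphic_on UNIV" using der by (auto simp: holomorphic_on_open)
  moreover have "fsigma (UNIV :: complex set)"
  proof -
    have "fsigma (\<Union>n::nat. (UNIV :: complex set))" by (rule fsigma.intros) simp
    then show ?thesis by simp
  qed
  ultimately have "countable {z\<in>UNIV. g z = 0}" by (intro holomorphic_countable_zeros) auto
  then show ?case unfolding eq by simp
qed simp

lemma exp_sum_AE_nonzero:
  fixes b :: "'j \<Rightarrow> real" and c :: "'j \<Rightarrow> complex"
  assumes "finite J" "J \<noteq> {}" "inj_on b J" "\<And>j. j \<in> J \<Longrightarrow> c j \<noteq> 0"
  shows "AE t in lborel. (\<Sum>j\<in>J. c j * iexp (b j * t)) \<noteq> 0"
proof -
  have "countable {z::complex. (\<Sum>j\<in>J. c j * exp (\<i> * of_real (b j) * z)) = 0}" by (rule exp_sum_zeros_countable) (use assms in auto)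
  then have "countable (of_real ` {t::real. of_real t \<in> {z::complex. (\<Sum>j\<in>J. c j * exp (\<i> * of_real (b j) * z)) = 0}} :: complex set)"
    by (rule countable_subset[rotated]) auto
  then have "countable {t::real. of_real t \<in> {z::complex. (\<Sum>j\<in>J. c j * exp (\<i> * of_real (b j) * z)) = 0}}"
    by (rule countable_image_inj_on) (simp add: inj_on_def)
  then have "AE t in lborel. t \<notin> {t::real. of_real t \<in> {z::complex. (\<Sum>j\<in>J. c j * exp (\<i> * of_real (b j) * z)) = 0}}"
    by (intro AE_not_in countable_imp_null_set_lborel)
  then show ?thesis by eventually_elim (simp add: mult.assoc)
qed

section \<open>The Fourier transform on square-integrable functions\<close>

definition sq :: "(real \<Rightarrow> complex) \<Rightarrow> ennreal" where "sq f = (\<integral>\<^sup>+x. ennreal ((norm (f x))\<^sup>2) \<partial>lborel)"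

definition ft :: "(real \<Rightarrow> complex) \<Rightarrow> real \<Rightarrow> complex" where "ft g \<xi> = (\<integral>t. g t * iexp (- (\<xi> * t)) \<partial>lborel)"

lemma norm_iexp [simp]: "norm (iexp x) = 1" by (simp add: norm_exp_eq_Re)

lemma iexp_add: "iexp (x + y) = iexp x * iexp y" by (simp add: exp_add distrib_left)

lemma sq_finite_integrable: "f \<in> borel_measurable borel \<Longrightarrow> sq f < \<infinity> \<Longrightarrow> integrable lborel (\<lambda>x. (norm (f x))\<^sup>2)"
  unfolding sq_def by (rule integrableI_bounded) auto

lemma integrable_mult_sq:
  assumes [measurable]: "u \<in> borel_measurable borel" "v \<in> borel_measurable borel" and "sq u < \<infinity>" "sq v < \<infinity>"
  shows "integrable lborel (\<lambda>x. u x * v x)"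
proof (rule Bochner_Integration.integrable_bound)
  show "integrable lborel (\<lambda>x. (norm (u x))\<^sup>2 + (norm (v x))\<^sup>2)"
    using assms by (intro Bochner_Integration.integrable_add sq_finite_integrable)
  show "AE x in lborel. norm (u x * v x) \<le> norm ((norm (u x))\<^sup>2 + (norm (v x))\<^sup>2)"
  proof (rule AE_I2)
    fix x
    have "0 \<le> (norm (u x))\<^sup>2" "0 \<le> (norm (v x))\<^sup>2" "0 \<le> (norm (u x) - norm (v x))\<^sup>2" "0 \<le> norm (u x) * norm (v x)" by simp_all
    then show "norm (u x * v x) \<le> norm ((norm (u x))\<^sup>2 + (norm (v x))\<^sup>2)"
      unfolding power2_diff norm_mult real_norm_def by linarith
  qed
qed measurable

text \<open>The inequality between arithmetic and geometric means with a free weight replaces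
  Cauchy-Schwarz: it is linear in \<open>sq\<close>, so no roots of extended reals occur. The weight
  is later 2^k, balancing a small factor against a bounded one.\<close>

lemma norm_integral_mult_sq:
  assumes [measurable]: "u \<in> borel_measurable borel" "v \<in> borel_measurable borel" and "sq u < \<infinity>" "sq v < \<infinity>" and s: "0 < s"
  shows "ennreal (norm (\<integral>x. u x * v x \<partial>lborel)) \<le> ennreal s * sq u + ennreal (1 / s) * sq v"
proof -
  have "ennreal (norm (\<integral>x. u x * v x \<partial>lborel)) \<le> (\<integral>\<^sup>+x. norm (u x * v x) \<partial>lborel)"
    by (rule integral_norm_bound_ennreal[OF integrable_mult_sq[OF assms(1-4)]])
  also have "\<dots> \<le> (\<integral>\<^sup>+x. ennreal s * ennreal ((norm (u x))\<^sup>2) + ennreal (1 / s) * ennreal ((norm (v x))\<^sup>2) \<partial>lborel)"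
  proof (rule nn_integral_mono)
    fix x
    define a b where "a = norm (u x)" and "b = norm (v x)"
    have ab: "0 \<le> a" "0 \<le> b" by (simp_all add: a_def b_def)
    have "0 \<le> (s * a - b)\<^sup>2 / s" using s by simp
    also have "\<dots> = s * a\<^sup>2 - 2 * (a * b) + b\<^sup>2 / s" using s by (simp add: power2_eq_square field_simps)
    finally have "a * b \<le> s * a\<^sup>2 + 1 / s * b\<^sup>2" using ab by simp (smt (verit) mult_nonneg_nonneg)
    then have "ennreal (a * b) \<le> ennreal (s * a\<^sup>2 + 1 / s * b\<^sup>2)" by (rule ennreal_leI)
    also have "\<dots> = ennreal (s * a\<^sup>2) + ennreal (1 / s * b\<^sup>2)" by (rule ennreal_plus) (use s in auto)
    also have "ennreal (s * a\<^sup>2) = ennreal s * ennreal (a\<^sup>2)" by (rule ennreal_mult) (use s in auto)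
    also have "ennreal (1 / s * b\<^sup>2) = ennreal (1 / s) * ennreal (b\<^sup>2)" by (rule ennreal_mult) (use s in auto)
    finally show "ennreal (norm (u x * v x)) \<le> ennreal s * ennreal ((norm (u x))\<^sup>2) + ennreal (1 / s) * ennreal ((norm (v x))\<^sup>2)"
      by (simp add: norm_mult a_def b_def)
  qed
  also have "\<dots> = ennreal s * sq u + ennreal (1 / s) * sq v"
    unfolding sq_def by (simp add: nn_integral_add nn_integral_cmult)
  finally show ?thesis .
qed

lemma sq_diff_le:
  assumes [measurable]: "u \<in> borel_measurable borel" "v \<in> borel_measurable borel"
  shows "sq (\<lambda>x. u x - v x) \<le> 2 * sq u + 2 * sq v"
proof -
  have "sq (\<lambda>x. u x - v x) \<le> (\<integral>\<^sup>+x. 2 * ennreal ((norm (u x))\<^sup>2) + 2 * ennreal ((norm (v x))\<^sup>2) \<partial>lborel)"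
    unfolding sq_def
  proof (rule nn_integral_mono)
    fix x
    have "(norm (u x - v x))\<^sup>2 \<le> (norm (u x) + norm (v x))\<^sup>2" by (intro power_mono norm_triangle_ineq4) auto
    also have "\<dots> \<le> 2 * (norm (u x))\<^sup>2 + 2 * (norm (v x))\<^sup>2"
      using zero_le_power2[of "norm (u x) - norm (v x)"] unfolding power2_diff power2_sum by linarith
    finally have "ennreal ((norm (u x - v x))\<^sup>2) \<le> ennreal (2 * (norm (u x))\<^sup>2 + 2 * (norm (v x))\<^sup>2)" by (rule ennreal_leI)
    also have "\<dots> = 2 * ennreal ((norm (u x))\<^sup>2) + 2 * ennreal ((norm (v x))\<^sup>2)"
      by (subst ennreal_plus) (simp_all add: ennreal_mult)
    finally show "ennreal ((norm (u x - v x))\<^sup>2) \<le> 2 * ennreal ((norm (u x))\<^sup>2) + 2 * ennreal ((norm (v x))\<^sup>2)" .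
  qed
  also have "\<dots> = 2 * sq u + 2 * sq v" unfolding sq_def by (simp add: nn_integral_add nn_integral_cmult)
  finally show ?thesis .
qed

lemma ft_integrable: "integrable lborel g \<Longrightarrow> integrable lborel (\<lambda>t. g t * iexp (x * t))"
  by (rule Bochner_Integration.integrable_bound) (auto simp: norm_mult)

lemma ft_integrable': "integrable lborel g \<Longrightarrow> integrable lborel (\<lambda>t. g t * iexp (- (x * t)))"
  using ft_integrable[of g "- x"] by simp

lemma ft_measurable [measurable]:
  assumes [measurable]: "g \<in> borel_measurable borel" shows "ft g \<in> borel_measurable borel"
proof -
  have "(\<lambda>\<xi>. \<integral>t. g t * iexp (- (\<xi> * t)) \<partial>lborel) \<in> borel_measurable lborel"
    by (rule lborel.borel_measurable_lebesgue_integral) (simp add: case_prod_unfold)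
  then show ?thesis unfolding ft_def[abs_def] by simp
qed

lemma norm_ft_le: assumes "integrable lborel g" shows "norm (ft g \<xi>) \<le> (\<integral>t. norm (g t) \<partial>lborel)"
  unfolding ft_def using integral_norm_bound[of lborel "\<lambda>t. g t * iexp (- (\<xi> * t))"] by (simp add: norm_mult)

lemma integrable_ft_mult:
  assumes "integrable lborel g" "integrable lborel H" shows "integrable lborel (\<lambda>\<xi>. ft g \<xi> * H \<xi>)"
proof (rule Bochner_Integration.integrable_bound)
  show "integrable lborel (\<lambda>\<xi>. (\<integral>t. norm (g t) \<partial>lborel) * norm (H \<xi>))" using assms by simp
  have "norm (ft g \<xi> * H \<xi>) \<le> (\<integral>t. norm (g t) \<partial>lborel) * norm (H \<xi>)" for \<xi>
    unfolding norm_mult by (intro mult_right_mono norm_ft_le assms) simp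
  then show "AE \<xi> in lborel. norm (ft g \<xi> * H \<xi>) \<le> norm ((\<integral>t. norm (g t) \<partial>lborel) * norm (H \<xi>))"
    by (auto intro!: AE_I2 order_trans[OF _ abs_ge_self])
  have [measurable]: "g \<in> borel_measurable borel" "H \<in> borel_measurable borel" using assms by auto
  show "(\<lambda>\<xi>. ft g \<xi> * H \<xi>) \<in> borel_measurable lborel" by measurable
qed

lemma ft_multiplication:
  assumes g: "integrable lborel g" and H: "integrable lborel H"
  shows "(\<integral>\<xi>. ft g \<xi> * H \<xi> \<partial>lborel) = (\<integral>t. g t * ft H t \<partial>lborel)"
proof -
  have [measurable]: "g \<in> borel_measurable borel" "H \<in> borel_measurable borel" using assms by auto
  have int: "integrable (lborel \<Otimes>\<^sub>M lborel) (\<lambda>(\<xi>, t). H \<xi> * (g t * iexp (- (\<xi> * t))))"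
  proof (rule lborel_pair.Fubini_integrable)
    show "(\<lambda>(\<xi>, t). H \<xi> * (g t * iexp (- (\<xi> * t)))) \<in> borel_measurable (lborel \<Otimes>\<^sub>M lborel)" by (simp add: case_prod_unfold)
    have "(\<lambda>\<xi>. \<integral>t. norm (case (\<xi>, t) of (\<xi>, t) \<Rightarrow> H \<xi> * (g t * iexp (- (\<xi> * t)))) \<partial>lborel) = (\<lambda>\<xi>. norm (H \<xi>) * (\<integral>t. norm (g t) \<partial>lborel))"
      by (simp add: norm_mult)
    then show "integrable lborel (\<lambda>\<xi>. \<integral>t. norm (case (\<xi>, t) of (\<xi>, t) \<Rightarrow> H \<xi> * (g t * iexp (- (\<xi> * t)))) \<partial>lborel)" using H by simp
    show "AE \<xi> in lborel. integrable lborel (\<lambda>t. case (\<xi>, t) of (\<xi>, t) \<Rightarrow> H \<xi> * (g t * iexp (- (\<xi> * t))))"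
      using ft_integrable'[OF g] by simp
  qed
  have "(\<integral>\<xi>. ft g \<xi> * H \<xi> \<partial>lborel) = (\<integral>\<xi>. \<integral>t. H \<xi> * (g t * iexp (- (\<xi> * t))) \<partial>lborel \<partial>lborel)"
    unfolding ft_def by (simp add: mult.commute)
  also have "\<dots> = (\<integral>t. \<integral>\<xi>. H \<xi> * (g t * iexp (- (\<xi> * t))) \<partial>lborel \<partial>lborel)"
    by (rule lborel_pair.Fubini_integral[OF int, symmetric])
  also have "\<dots> = (\<integral>t. g t * ft H t \<partial>lborel)"
  proof (rule Bochner_Integration.integral_cong[OF refl])
    fix t
    have "(\<lambda>\<xi>. H \<xi> * (g t * iexp (- (\<xi> * t)))) = (\<lambda>\<xi>. g t * (H \<xi> * iexp (- (t * \<xi>))))" by (auto simp: mult_ac)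
    then show "(\<integral>\<xi>. H \<xi> * (g t * iexp (- (\<xi> * t))) \<partial>lborel) = g t * ft H t" by (simp add: ft_def)
  qed
  finally show ?thesis .
qed

definition gau :: "real \<Rightarrow> complex" where "gau x = of_real (exp (- x\<^sup>2 / 2))"

lemma gau_std: "exp (- x\<^sup>2 / 2) = sqrt (2 * pi) * std_normal_density x"
  by (simp add: std_normal_density_def)

lemma nn_gauss: "(\<integral>\<^sup>+x. ennreal (exp (- x\<^sup>2 / 2)) \<partial>lborel) = ennreal (sqrt (2 * pi))"
proof -
  have "(\<integral>\<^sup>+x. ennreal (std_normal_density x) \<partial>lborel) = 1"
    using prob_space.emeasure_space_1[OF prob_space_normal_density[of 1 0]] by (simp add: emeasure_density)
  then show ?thesis unfolding gau_std by (subst ennreal_mult) (auto simp: nn_integral_cmult)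
qed

lemma gau_measurable [measurable]: "gau \<in> borel_measurable borel" unfolding gau_def[abs_def] by measurable

lemma gau_integrable: "integrable lborel gau"
  by (rule integrableI_bounded) (use nn_gauss in \<open>simp_all add: gau_def\<close>)

lemma gau_char: "(\<integral>x. gau x * iexp (u * x) \<partial>lborel) = of_real (sqrt (2 * pi) * exp (- u\<^sup>2 / 2))"
proof -
  have "of_real (exp (- u\<^sup>2 / 2)) = char std_normal_distribution u" by (simp add: char_std_normal_distribution)
  also have "\<dots> = (\<integral>x. std_normal_density x *\<^sub>R iexp (u * x) \<partial>lborel)"
    unfolding char_def by (rule integral_density) auto
  finally have 1: "of_real (exp (- u\<^sup>2 / 2)) = (\<integral>x. std_normal_density x *\<^sub>R iexp (u * x) \<partial>lborel)" .
  have "(\<integral>x. gau x * iexp (u * x) \<partial>lborel) = (\<integral>x. of_real (sqrt (2 * pi)) * (std_normal_density x *\<^sub>R iexp (u * x)) \<partial>lborel)"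
  proof (intro Bochner_Integration.integral_cong refl)
    fix x :: real
    have "gau x = of_real (sqrt (2 * pi) * std_normal_density x)" unfolding gau_def gau_std ..
    then show "gau x * iexp (u * x) = of_real (sqrt (2 * pi)) * (std_normal_density x *\<^sub>R iexp (u * x))"
      by (simp only: of_real_mult scaleR_conv_of_real mult.assoc)
  qed
  also have "\<dots> = of_real (sqrt (2 * pi)) * (\<integral>x. std_normal_density x *\<^sub>R iexp (u * x) \<partial>lborel)" by (rule integral_mult_right_zero)
  finally show ?thesis unfolding 1[symmetric] by simp
qed

lemma gau_scaled_char:
  assumes N: "0 < N" shows "(\<integral>x. gau (x / N) * iexp (u * x) \<partial>lborel) = of_real (N * sqrt (2 * pi) * exp (- (N * u)\<^sup>2 / 2))"
proof -
  have "(\<integral>x. gau (x / N) * iexp (u * x) \<partial>lborel) = \<bar>N\<bar> *\<^sub>R (\<integral>x. gau ((0 + N * x) / N) * iexp (u * (0 + N * x)) \<partial>lborel)"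
    using N by (intro lborel_integral_real_affine) simp
  also have "(\<lambda>x. gau ((0 + N * x) / N) * iexp (u * (0 + N * x))) = (\<lambda>x. gau x * iexp ((N * u) * x))" using N by (simp add: mult_ac)
  finally show ?thesis using N by (simp only: gau_char) (simp add: scaleR_conv_of_real)
qed

lemma gau_scaled_integrable: assumes N: "0 < N" shows "integrable lborel (\<lambda>x. gau (x / N))"
  using lborel_integrable_real_affine[OF gau_integrable, of "1 / N" 0] N by simp

lemma nn_gauss_scaled:
  assumes N: "0 < N" shows "(\<integral>\<^sup>+t. ennreal (N * sqrt (2 * pi) * exp (- (N * (s - t))\<^sup>2 / 2)) \<partial>lborel) = ennreal (2 * pi)"
proof -
  have "ennreal (sqrt (2 * pi)) = ennreal \<bar>N\<bar> * (\<integral>\<^sup>+t. ennreal (exp (- (- N * s + N * t)\<^sup>2 / 2)) \<partial>lborel)"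
    unfolding nn_gauss[symmetric] using N by (intro nn_integral_real_affine) auto
  moreover have "(- N * s + N * t)\<^sup>2 = (N * (s - t))\<^sup>2" for t by (simp add: power2_eq_square algebra_simps)
  ultimately have e: "ennreal (sqrt (2 * pi)) = ennreal N * (\<integral>\<^sup>+t. ennreal (exp (- (N * (s - t))\<^sup>2 / 2)) \<partial>lborel)" using N by simp
  have "(\<integral>\<^sup>+t. ennreal (N * sqrt (2 * pi) * exp (- (N * (s - t))\<^sup>2 / 2)) \<partial>lborel)
     = ennreal (sqrt (2 * pi)) * (ennreal N * (\<integral>\<^sup>+t. ennreal (exp (- (N * (s - t))\<^sup>2 / 2)) \<partial>lborel))"
    using N by (simp add: ennreal_mult nn_integral_cmult mult_ac)
  also have "\<dots> = ennreal (sqrt (2 * pi)) * ennreal (sqrt (2 * pi))" unfolding e[symmetric] ..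
  also have "\<dots> = ennreal (sqrt (2 * pi) * sqrt (2 * pi))" by (rule ennreal_mult[symmetric]) auto
  also have "sqrt (2 * pi) * sqrt (2 * pi) = 2 * pi" by simp
  finally show ?thesis .
qed

text \<open>Bessel's inequality, by Gaussian regularization of the frequency integral.\<close>

lemma bessel:
  assumes g: "integrable lborel g" shows "sq (ft g) \<le> ennreal (2 * pi) * sq g"
proof -
  have [measurable]: "g \<in> borel_measurable borel" using g by auto
  define w where "w n x = gau (x / real (Suc n))" for n x
  have [measurable]: "w n \<in> borel_measurable borel" for n unfolding w_def by measurable
  have step: "(\<integral>\<^sup>+\<xi>. ennreal ((norm (ft g \<xi>))\<^sup>2 * Re (w n \<xi>)) \<partial>lborel) \<le> ennreal (2 * pi) * sq g" for n
  proof -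
    define N where "N = real (Suc n)"
    have N: "0 < N" by (simp add: N_def)
    \<comment> \<open>The transform of the Gaussian factor \<open>w n\<close>, taken at the
      difference of s and t. Its integral in t is 2 pi, whatever n is.\<close>
    define K where "K s t = N * sqrt (2 * pi) * exp (- (N * (s - t))\<^sup>2 / 2)" for s t
    have K0: "0 \<le> K s t" for s t using N by (simp add: K_def)
    have [measurable]: "(\<lambda>p. K (fst p) (snd p)) \<in> borel_measurable (borel \<Otimes>\<^sub>M borel)" "K s \<in> borel_measurable borel" for s unfolding K_def by measurable
    have wi: "integrable lborel (w n)" unfolding w_def by (rule gau_scaled_integrable) simp
    define H where "H \<xi> = cnj (ft g \<xi>) * w n \<xi>" for \<xi>
    have Hi: "integrable lborel H"
    proof -
      have "cnj (w n \<xi>) = w n \<xi>" for \<xi> by (simp add: w_def gau_def)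
      then have H: "H = (\<lambda>\<xi>. cnj (ft g \<xi> * w n \<xi>))" by (auto simp: H_def)
      show ?thesis unfolding H by (rule integrable_bounded_linear[OF bounded_linear_cnj integrable_ft_mult[OF g wi]])
    qed
    have ftH: "ft H s = cnj (\<integral>t. g t * of_real (K s t) \<partial>lborel)" for s
    proof -
      have wr: "cnj (w n \<xi>) = w n \<xi>" for \<xi> by (simp add: w_def gau_def)
      have ce: "cnj (iexp y) = iexp (- y)" for y by (simp add: exp_cnj)
      have "ft H s = (\<integral>\<xi>. cnj (ft g \<xi> * (w n \<xi> * iexp (s * \<xi>))) \<partial>lborel)"
        unfolding ft_def[of H] H_def by (intro Bochner_Integration.integral_cong refl) (simp only: complex_cnj_mult wr ce mult.assoc)
      also have "\<dots> = cnj (\<integral>\<xi>. ft g \<xi> * (w n \<xi> * iexp (s * \<xi>)) \<partial>lborel)" by (rule Bochner_Integration.integral_cnj)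
      also have "(\<integral>\<xi>. ft g \<xi> * (w n \<xi> * iexp (s * \<xi>)) \<partial>lborel) = (\<integral>t. g t * ft (\<lambda>\<xi>. w n \<xi> * iexp (s * \<xi>)) t \<partial>lborel)"
        by (rule ft_multiplication[OF g ft_integrable[OF wi]])
      also have "\<dots> = (\<integral>t. g t * of_real (K s t) \<partial>lborel)"
      proof (intro Bochner_Integration.integral_cong refl)
        fix t
        have "w n \<xi> * iexp (s * \<xi>) * iexp (- (t * \<xi>)) = gau (\<xi> / N) * iexp ((s - t) * \<xi>)" for \<xi>
          unfolding mult.assoc iexp_add[symmetric] by (simp add: w_def N_def left_diff_distrib)
        then show "g t * ft (\<lambda>\<xi>. w n \<xi> * iexp (s * \<xi>)) t = g t * of_real (K s t)"
          unfolding ft_def K_def by (simp only: gau_scaled_char[OF N])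
      qed
      finally show ?thesis .
    qed
    have nK: "ennreal (norm (ft H s)) \<le> (\<integral>\<^sup>+t. ennreal (norm (g t) * K s t) \<partial>lborel)" for s
    proof -
      have "integrable lborel (\<lambda>t. g t * of_real (K s t))"
      proof (rule Bochner_Integration.integrable_bound)
        show "integrable lborel (\<lambda>t. (N * sqrt (2 * pi)) *\<^sub>R g t)" using g by simp
        have "norm (g t) * K s t \<le> (N * sqrt (2 * pi)) * norm (g t)" for t
        proof -
          have "K s t \<le> N * sqrt (2 * pi) * 1" unfolding K_def using N by (intro mult_left_mono) auto
          then have "norm (g t) * K s t \<le> norm (g t) * (N * sqrt (2 * pi) * 1)" by (rule mult_left_mono) simp
          also have "\<dots> = (N * sqrt (2 * pi)) * norm (g t)" by (simp add: mult_ac)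
          finally show ?thesis .
        qed
        then show "AE t in lborel. norm (g t * of_real (K s t)) \<le> norm ((N * sqrt (2 * pi)) *\<^sub>R g t)"
          using N K0 by (intro AE_I2) (simp add: norm_mult)
      qed measurable
      from integral_norm_bound_ennreal[OF this] show ?thesis using K0 by (simp add: ftH norm_mult)
    qed
    have e: "ft g \<xi> * H \<xi> = of_real ((norm (ft g \<xi>))\<^sup>2 * Re (w n \<xi>))" for \<xi>
    proof -
      have "ft g \<xi> * H \<xi> = (ft g \<xi> * cnj (ft g \<xi>)) * w n \<xi>" by (simp add: H_def)
      also have "ft g \<xi> * cnj (ft g \<xi>) = of_real ((norm (ft g \<xi>))\<^sup>2)" by (rule complex_norm_square[symmetric])
      also have "w n \<xi> = of_real (Re (w n \<xi>))" by (simp add: w_def gau_def)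
      finally show ?thesis by simp
    qed
    have w0: "0 \<le> Re (w n \<xi>)" for \<xi> by (simp add: w_def gau_def)
    have ip: "integrable lborel (\<lambda>\<xi>. ft g \<xi> * H \<xi>)" by (rule integrable_ft_mult[OF g Hi])
    have ip2: "integrable lborel (\<lambda>\<xi>. (norm (ft g \<xi>))\<^sup>2 * Re (w n \<xi>))"
      using integrable_bounded_linear[OF bounded_linear_Re ip] unfolding e Re_complex_of_real .
    have "(\<integral>\<^sup>+\<xi>. ennreal ((norm (ft g \<xi>))\<^sup>2 * Re (w n \<xi>)) \<partial>lborel) = ennreal (\<integral>\<xi>. (norm (ft g \<xi>))\<^sup>2 * Re (w n \<xi>) \<partial>lborel)"
      by (rule nn_integral_eq_integral[OF ip2]) (simp add: w0)
    also have "\<dots> \<le> ennreal (norm (\<integral>\<xi>. ft g \<xi> * H \<xi> \<partial>lborel))"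
      unfolding e integral_bounded_linear[OF bounded_linear_of_real ip2] norm_of_real by (intro ennreal_leI abs_ge_self)
    also have "(\<integral>\<xi>. ft g \<xi> * H \<xi> \<partial>lborel) = (\<integral>s. g s * ft H s \<partial>lborel)" by (rule ft_multiplication[OF g Hi])
    also have "ennreal (norm (\<integral>s. g s * ft H s \<partial>lborel)) \<le> (\<integral>\<^sup>+s. ennreal (norm (g s * ft H s)) \<partial>lborel)"
      using integral_norm_bound_ennreal[OF integrable_ft_mult[OF Hi g]] by (simp add: mult.commute)
    \<comment> \<open>Schur's test for a symmetric positive kernel: the product of the two values is
      at most half the sum of their squares, and in each half the kernel is integrated over the
      variable that the square does not contain.\<close>
    also have "\<dots> \<le> (\<integral>\<^sup>+s. \<integral>\<^sup>+t. (ennreal ((norm (g s))\<^sup>2 * K s t / 2) + ennreal ((norm (g t))\<^sup>2 * K t s / 2)) \<partial>lborel \<partial>lborel)"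
    proof (rule nn_integral_mono)
      fix s
      have "ennreal (norm (g s * ft H s)) \<le> ennreal (norm (g s)) * (\<integral>\<^sup>+t. ennreal (norm (g t) * K s t) \<partial>lborel)"
        unfolding norm_mult by (subst ennreal_mult) (auto intro!: mult_left_mono nK)
      also have "\<dots> = (\<integral>\<^sup>+t. ennreal (norm (g s)) * ennreal (norm (g t) * K s t) \<partial>lborel)"
        by (rule nn_integral_cmult[symmetric]) measurable
      also have "\<dots> \<le> (\<integral>\<^sup>+t. (ennreal ((norm (g s))\<^sup>2 * K s t / 2) + ennreal ((norm (g t))\<^sup>2 * K t s / 2)) \<partial>lborel)"
      proof (rule nn_integral_mono)
        fix t
        have sym: "K t s = K s t" by (simp add: K_def power2_eq_square algebra_simps)
        have "norm (g s) * norm (g t) \<le> ((norm (g s))\<^sup>2 + (norm (g t))\<^sup>2) / 2"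
          using zero_le_power2[of "norm (g s) - norm (g t)"] unfolding power2_diff by simp
        from mult_right_mono[OF this K0[of s t]]
        have "norm (g s) * (norm (g t) * K s t) \<le> (norm (g s))\<^sup>2 * K s t / 2 + (norm (g t))\<^sup>2 * K t s / 2"
          unfolding sym by (simp add: algebra_simps add_divide_distrib)
        from ennreal_leI[OF this] show "ennreal (norm (g s)) * ennreal (norm (g t) * K s t) \<le> ennreal ((norm (g s))\<^sup>2 * K s t / 2) + ennreal ((norm (g t))\<^sup>2 * K t s / 2)"
          using K0 by (simp add: ennreal_mult'[symmetric] ennreal_plus[symmetric] del: ennreal_plus)
      qed
      finally show "ennreal (norm (g s * ft H s)) \<le> (\<integral>\<^sup>+t. (ennreal ((norm (g s))\<^sup>2 * K s t / 2) + ennreal ((norm (g t))\<^sup>2 * K t s / 2)) \<partial>lborel)" .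
    qed
    also have "\<dots> = (\<integral>\<^sup>+s. \<integral>\<^sup>+t. ennreal ((norm (g s))\<^sup>2 * K s t / 2) \<partial>lborel \<partial>lborel) + (\<integral>\<^sup>+s. \<integral>\<^sup>+t. ennreal ((norm (g t))\<^sup>2 * K t s / 2) \<partial>lborel \<partial>lborel)"
    proof -
      have "(\<integral>\<^sup>+s. \<integral>\<^sup>+t. (ennreal ((norm (g s))\<^sup>2 * K s t / 2) + ennreal ((norm (g t))\<^sup>2 * K t s / 2)) \<partial>lborel \<partial>lborel)
        = (\<integral>\<^sup>+s. (\<integral>\<^sup>+t. ennreal ((norm (g s))\<^sup>2 * K s t / 2) \<partial>lborel) + (\<integral>\<^sup>+t. ennreal ((norm (g t))\<^sup>2 * K t s / 2) \<partial>lborel) \<partial>lborel)"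
        by (intro nn_integral_cong nn_integral_add) (unfold K_def, measurable)
      also have "\<dots> = (\<integral>\<^sup>+s. \<integral>\<^sup>+t. ennreal ((norm (g s))\<^sup>2 * K s t / 2) \<partial>lborel \<partial>lborel) + (\<integral>\<^sup>+s. \<integral>\<^sup>+t. ennreal ((norm (g t))\<^sup>2 * K t s / 2) \<partial>lborel \<partial>lborel)"
        by (rule nn_integral_add) (unfold K_def, measurable)
      finally show ?thesis .
    qed
    also have "(\<integral>\<^sup>+s. \<integral>\<^sup>+t. ennreal ((norm (g t))\<^sup>2 * K t s / 2) \<partial>lborel \<partial>lborel) = (\<integral>\<^sup>+t. \<integral>\<^sup>+s. ennreal ((norm (g t))\<^sup>2 * K t s / 2) \<partial>lborel \<partial>lborel)"
      by (rule lborel_pair.Fubini') (simp add: case_prod_unfold K_def)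
    also have "(\<integral>\<^sup>+s. \<integral>\<^sup>+t. ennreal ((norm (g s))\<^sup>2 * K s t / 2) \<partial>lborel \<partial>lborel) = (\<integral>\<^sup>+s. ennreal ((norm (g s))\<^sup>2 / 2) * ennreal (2 * pi) \<partial>lborel)"
    proof (rule nn_integral_cong)
      fix s
      have "(\<integral>\<^sup>+t. ennreal ((norm (g s))\<^sup>2 * K s t / 2) \<partial>lborel) = (\<integral>\<^sup>+t. ennreal ((norm (g s))\<^sup>2 / 2) * ennreal (K s t) \<partial>lborel)"
        using K0 by (intro nn_integral_cong) (simp add: ennreal_mult'[symmetric])
      also have "\<dots> = ennreal ((norm (g s))\<^sup>2 / 2) * (\<integral>\<^sup>+t. ennreal (K s t) \<partial>lborel)" by (rule nn_integral_cmult) measurable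
      also have "(\<integral>\<^sup>+t. ennreal (K s t) \<partial>lborel) = ennreal (2 * pi)" unfolding K_def by (rule nn_gauss_scaled[OF N])
      finally show "(\<integral>\<^sup>+t. ennreal ((norm (g s))\<^sup>2 * K s t / 2) \<partial>lborel) = ennreal ((norm (g s))\<^sup>2 / 2) * ennreal (2 * pi)" .
    qed
    also have "\<dots> = ennreal (1/2) * sq g * ennreal (2 * pi)"
    proof -
      have "ennreal ((norm (g s))\<^sup>2 / 2) = ennreal (1/2) * ennreal ((norm (g s))\<^sup>2)" for s
        by (subst ennreal_mult'[symmetric]) auto
      then show ?thesis by (simp add: sq_def nn_integral_multc nn_integral_cmult)
    qed
    also have "ennreal (1/2) * sq g * ennreal (2 * pi) + ennreal (1/2) * sq g * ennreal (2 * pi) = (ennreal (1/2) + ennreal (1/2)) * (sq g * ennreal (2 * pi))"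
      by (simp only: distrib_right mult.assoc)
    also have "ennreal (1/2) + ennreal (1/2) = 1"
    proof -
      have e: "ennreal (1/2 + 1/2) = ennreal (1/2) + ennreal (1/2)" by (rule ennreal_plus) auto
      have "ennreal (1/2 + 1/2) = 1" by simp
      then show ?thesis by (simp only: e)
    qed
    finally show ?thesis by (simp add: mult.commute)
  qed
  \<comment> \<open>The regularizing factors tend to 1 pointwise, so Fatou's lemma removes
    them.\<close>
  have "sq (ft g) = (\<integral>\<^sup>+\<xi>. liminf (\<lambda>n. ennreal ((norm (ft g \<xi>))\<^sup>2 * Re (w n \<xi>))) \<partial>lborel)"
    unfolding sq_def
  proof (rule nn_integral_cong)
    fix \<xi>
    have A: "(\<lambda>n. \<xi> * inverse (real (Suc n))) \<longlonglongrightarrow> \<xi> * 0" by (intro tendsto_intros LIMSEQ_inverse_real_of_nat)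
    have "(\<lambda>n. exp (- (\<xi> * inverse (real (Suc n)))\<^sup>2 / 2)) \<longlonglongrightarrow> exp (- (\<xi> * 0)\<^sup>2 / 2)"
      by (intro tendsto_exp tendsto_divide tendsto_minus tendsto_power A tendsto_const) simp
    then have B: "(\<lambda>n. exp (- (\<xi> * inverse (real (Suc n)))\<^sup>2 / 2)) \<longlonglongrightarrow> 1" by simp
    have "(\<lambda>n. (norm (ft g \<xi>))\<^sup>2 * exp (- (\<xi> * inverse (real (Suc n)))\<^sup>2 / 2)) \<longlonglongrightarrow> (norm (ft g \<xi>))\<^sup>2 * 1"
      by (rule tendsto_mult[OF tendsto_const B])
    moreover have "Re (w n \<xi>) = exp (- (\<xi> * inverse (real (Suc n)))\<^sup>2 / 2)" for n
      by (simp only: w_def gau_def Re_complex_of_real divide_inverse)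
    ultimately have "(\<lambda>n. (norm (ft g \<xi>))\<^sup>2 * Re (w n \<xi>)) \<longlonglongrightarrow> (norm (ft g \<xi>))\<^sup>2" by (simp only: mult_1_right)
    then have "(\<lambda>n. ennreal ((norm (ft g \<xi>))\<^sup>2 * Re (w n \<xi>))) \<longlonglongrightarrow> ennreal ((norm (ft g \<xi>))\<^sup>2)"
      by (rule tendsto_ennrealI)
    then show "ennreal ((norm (ft g \<xi>))\<^sup>2) = liminf (\<lambda>n. ennreal ((norm (ft g \<xi>))\<^sup>2 * Re (w n \<xi>)))"
      by (intro lim_imp_Liminf[symmetric]) auto
  qed
  also have "\<dots> \<le> liminf (\<lambda>n. \<integral>\<^sup>+\<xi>. ennreal ((norm (ft g \<xi>))\<^sup>2 * Re (w n \<xi>)) \<partial>lborel)"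
    by (rule nn_integral_liminf) measurable
  also have "\<dots> \<le> liminf (\<lambda>n::nat. ennreal (2 * pi) * sq g)" by (intro Liminf_mono always_eventually allI step)
  also have "\<dots> = ennreal (2 * pi) * sq g" by (rule Liminf_const) simp
  finally show ?thesis .
qed

lemma ft_diff:
  assumes "integrable lborel g" "integrable lborel h" shows "ft (\<lambda>t. g t - h t) \<xi> = ft g \<xi> - ft h \<xi>"
  unfolding ft_def left_diff_distrib
  by (rule Bochner_Integration.integral_diff[OF ft_integrable'[OF assms(1)] ft_integrable'[OF assms(2)]])

lemma sq_tail:
  assumes [measurable]: "f \<in> borel_measurable borel" and fin: "sq f < \<infinity>" and e: "0 < e"
  shows "\<exists>N::nat. sq (\<lambda>t. f t - f t * indicator {- real N..real N} t) \<le> ennreal e"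
proof -
  have "(\<lambda>N. \<integral>\<^sup>+t. ennreal ((norm (f t - f t * indicator {- real N..real N} t))\<^sup>2) \<partial>lborel) \<longlonglongrightarrow> (\<integral>\<^sup>+t. 0 \<partial>(lborel :: real measure))"
  proof (rule nn_integral_dominated_convergence)
    show "AE t in lborel. ennreal ((norm (f t - f t * indicator {- real N..real N} t))\<^sup>2) \<le> ennreal ((norm (f t))\<^sup>2)" for N
      by (intro AE_I2 ennreal_leI power_mono) (auto simp: indicator_def)
    show "(\<integral>\<^sup>+t. ennreal ((norm (f t))\<^sup>2) \<partial>lborel) < \<infinity>" using fin by (simp add: sq_def)
    show "AE t in lborel. (\<lambda>N. ennreal ((norm (f t - f t * indicator {- real N..real N} t))\<^sup>2)) \<longlonglongrightarrow> 0"
    proof (rule AE_I2)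
      fix t :: real
      obtain M :: nat where M: "\<bar>t\<bar> \<le> real M" using real_arch_simple by blast
      have "\<forall>\<^sub>F N in sequentially. ennreal ((norm (f t - f t * indicator {- real N..real N} t))\<^sup>2) = 0"
        using eventually_ge_at_top[of M]
      proof eventually_elim
        case (elim N)
        then have "\<bar>t\<bar> \<le> real N" using M by linarith
        then have "t \<in> {- real N..real N}" by auto
        then show ?case by simp
      qed
      then show "(\<lambda>N. ennreal ((norm (f t - f t * indicator {- real N..real N} t))\<^sup>2)) \<longlonglongrightarrow> 0" by (rule tendsto_eventually)
    qed
  qed measurable
  then have "\<forall>\<^sub>F N in sequentially. sq (\<lambda>t. f t - f t * indicator {- real N..real N} t) < ennreal e"
    unfolding sq_def[symmetric] by (intro order_tendstoD(2)) (use e in auto)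
  then obtain N where "sq (\<lambda>t. f t - f t * indicator {- real N..real N} t) < ennreal e" by (auto simp: eventually_sequentially)
  then show ?thesis by (intro exI[of _ N]) simp
qed

text \<open>For each increment \<delta> one has \<delta> \<le> 2^k \<delta>^2 + 2^(-k), so
  summability of the weighted squares gives absolute summability of the increments.\<close>

lemma fast_cauchy_convergent:
  fixes \<Phi> :: "nat \<Rightarrow> complex"
  assumes "(\<Sum>k. ennreal (2 ^ k * (norm (\<Phi> (Suc k) - \<Phi> k))\<^sup>2)) \<noteq> \<infinity>"
  shows "convergent \<Phi>"
proof -
  define \<delta> where "\<delta> k = norm (\<Phi> (Suc k) - \<Phi> k)" for k
  have s: "summable (\<lambda>k. 2 ^ k * (\<delta> k)\<^sup>2)" by (rule summable_suminf_not_top) (use assms in \<open>auto simp: \<delta>_def\<close>)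
  have "summable (\<lambda>k. 2 ^ k * (\<delta> k)\<^sup>2 + (1/2) ^ k)" by (intro summable_add s summable_geometric) simp
  then have "summable \<delta>"
  proof (rule summable_comparison_test'[where N = 0])
    fix k :: nat
    define S where "S = (2::real) ^ k"
    have S: "S > 0" by (simp add: S_def)
    have "0 \<le> (S * \<delta> k - 1)\<^sup>2 / S" using S by simp
    also have "\<dots> = S * (\<delta> k)\<^sup>2 - 2 * \<delta> k + 1 / S" using S by (simp add: power2_eq_square field_simps)
    finally have "\<delta> k \<le> S * (\<delta> k)\<^sup>2 + 1 / S" by (simp add: \<delta>_def) (smt (verit) norm_ge_zero)
    then show "norm (\<delta> k) \<le> 2 ^ k * (\<delta> k)\<^sup>2 + (1/2) ^ k" by (simp add: \<delta>_def S_def power_one_over)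
  qed
  then have "summable (\<lambda>k. \<Phi> (Suc k) - \<Phi> k)" unfolding \<delta>_def by (rule summable_norm_cancel)
  then have "(\<lambda>n. \<Sum>k<n. \<Phi> (Suc k) - \<Phi> k) \<longlonglongrightarrow> (\<Sum>k. \<Phi> (Suc k) - \<Phi> k)" by (rule summable_LIMSEQ)
  then have "(\<lambda>n. (\<Phi> n - \<Phi> 0) + \<Phi> 0) \<longlonglongrightarrow> (\<Sum>k. \<Phi> (Suc k) - \<Phi> k) + \<Phi> 0"
    unfolding sum_lessThan_telescope by (intro tendsto_intros)
  then show ?thesis by (auto intro: convergentI)
qed

text \<open>The \<open>L\<^sup>2\<close> Fourier transform, characterized weakly by the multiplication formula.\<close>

lemma ft_exists:
  assumes f[measurable]: "f \<in> borel_measurable borel" and fin: "sq f < \<infinity>"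
  shows "\<exists>F. F \<in> borel_measurable borel \<and> sq F < \<infinity>
    \<and> (\<forall>\<gamma>. integrable lborel \<gamma> \<longrightarrow> sq \<gamma> < \<infinity> \<longrightarrow> (\<integral>\<xi>. F \<xi> * \<gamma> \<xi> \<partial>lborel) = (\<integral>t. f t * ft \<gamma> t \<partial>lborel))"
proof -
  \<comment> \<open>Truncations with squared error at most 4^(-k): even with the weight 2^k the
    squared differences of their transforms stay summable, which gives convergence almost everywhere
    without passing to a subsequence.\<close>
  have "\<forall>k. \<exists>N::nat. sq (\<lambda>t. f t - f t * indicator {- real N..real N} t) \<le> ennreal ((1/4) ^ k)"
    by (intro allI sq_tail f fin) simp
  from choice[OF this] obtain N :: "nat \<Rightarrow> nat" where N': "\<forall>k. sq (\<lambda>t. f t - f t * indicator {- real (N k)..real (N k)} t) \<le> ennreal ((1/4) ^ k)"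
    by (elim exE)
  then have N: "sq (\<lambda>t. f t - f t * indicator {- real (N k)..real (N k)} t) \<le> ennreal ((1/4) ^ k)" for k by (rule spec)
  define fk where "fk k t = f t * indicator {- real (N k)..real (N k)} t" for k t
  have fkm[measurable]: "fk k \<in> borel_measurable borel" for k unfolding fk_def by measurable
  have tail: "sq (\<lambda>t. f t - fk k t) \<le> ennreal ((1/4) ^ k)" for k using N by (simp add: fk_def)
  have fki: "integrable lborel (fk k)" for k
    unfolding fk_def
  proof (rule integrable_mult_sq[OF f _ fin])
    have "(\<integral>\<^sup>+t. ennreal ((norm (indicator {- real (N k)..real (N k)} t :: complex))\<^sup>2) \<partial>lborel) = (\<integral>\<^sup>+t. indicator {- real (N k)..real (N k)} t \<partial>lborel)"
      by (intro nn_integral_cong) (simp add: indicator_def)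
    then show "sq (indicator {- real (N k)..real (N k)}) < \<infinity>" by (simp add: sq_def)
  qed measurable
  have fkle: "sq (fk k) \<le> sq f" for k
    unfolding sq_def fk_def by (intro nn_integral_mono ennreal_leI power_mono) (auto simp: indicator_def)
  define \<Phi> where "\<Phi> k = ft (fk k)" for k
  have \<Phi>m[measurable]: "\<Phi> k \<in> borel_measurable borel" for k unfolding \<Phi>_def by measurable
  have cau: "sq (\<lambda>\<xi>. \<Phi> j \<xi> - \<Phi> k \<xi>) \<le> ennreal (8 * pi * (1/4) ^ k)" if "k \<le> j" for j k
  proof -
    have "sq (\<lambda>\<xi>. \<Phi> j \<xi> - \<Phi> k \<xi>) = sq (ft (\<lambda>t. fk j t - fk k t))" 
    proof -
      have "ft (\<lambda>t. fk j t - fk k t) = (\<lambda>\<xi>. ft (fk j) \<xi> - ft (fk k) \<xi>)" by (rule ext, rule ft_diff[OF fki fki])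
      then show ?thesis unfolding \<Phi>_def by (simp only:)
    qed
    also have "\<dots> \<le> ennreal (2 * pi) * sq (\<lambda>t. fk j t - fk k t)" by (rule bessel) (use fki in simp)
    also have "\<dots> \<le> ennreal (2 * pi) * ennreal (4 * (1/4) ^ k)"
    proof (rule mult_left_mono)
    have "sq (\<lambda>t. fk j t - fk k t) = sq (\<lambda>t. (f t - fk k t) - (f t - fk j t))" by simp
    also have "\<dots> \<le> 2 * sq (\<lambda>t. f t - fk k t) + 2 * sq (\<lambda>t. f t - fk j t)" by (rule sq_diff_le) measurable
    also have "\<dots> \<le> 2 * ennreal ((1/4) ^ k) + 2 * ennreal ((1/4) ^ k)"
    proof (intro add_mono mult_left_mono tail)
      have "sq (\<lambda>t. f t - fk j t) \<le> ennreal ((1/4) ^ j)" by (rule tail)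
      also have "\<dots> \<le> ennreal ((1/4) ^ k)" by (intro ennreal_leI power_decreasing that) auto
      finally show "sq (\<lambda>t. f t - fk j t) \<le> ennreal ((1/4) ^ k)" .
    qed auto
    also have "\<dots> = ennreal (4 * (1/4) ^ k)"
    proof -
      have "2 * ennreal ((1/4) ^ k) + 2 * ennreal ((1/4) ^ k) = (2 + 2) * ennreal ((1/4) ^ k)" by (simp only: distrib_right)
      also have "(2 + 2 :: ennreal) = ennreal 4" by simp
      also have "ennreal 4 * ennreal ((1/4) ^ k) = ennreal (4 * (1/4) ^ k)" by (rule ennreal_mult[symmetric]) auto
      finally show ?thesis .
    qed
    finally show "sq (\<lambda>t. fk j t - fk k t) \<le> ennreal (4 * (1/4) ^ k)" .
    qed simp
    also have "ennreal (2 * pi) * ennreal (4 * (1/4) ^ k) = ennreal ((2 * pi) * (4 * (1/4) ^ k))" by (rule ennreal_mult[symmetric]) auto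
    also have "(2 * pi) * (4 * (1/4) ^ k) = 8 * pi * (1/4) ^ k" by algebra
    finally show ?thesis .
  qed
  have "(\<integral>\<^sup>+\<xi>. (\<Sum>k. ennreal (2 ^ k * (norm (\<Phi> (Suc k) \<xi> - \<Phi> k \<xi>))\<^sup>2)) \<partial>lborel) = (\<Sum>k. \<integral>\<^sup>+\<xi>. ennreal (2 ^ k * (norm (\<Phi> (Suc k) \<xi> - \<Phi> k \<xi>))\<^sup>2) \<partial>lborel)"
    by (rule nn_integral_suminf) measurable
  also have "\<dots> \<le> (\<Sum>k. ennreal (8 * pi * (1/2) ^ k))"
  proof (rule suminf_le)
    fix k
    have "(\<integral>\<^sup>+\<xi>. ennreal (2 ^ k * (norm (\<Phi> (Suc k) \<xi> - \<Phi> k \<xi>))\<^sup>2) \<partial>lborel) = ennreal (2 ^ k) * sq (\<lambda>\<xi>. \<Phi> (Suc k) \<xi> - \<Phi> k \<xi>)"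
      unfolding sq_def by (simp add: ennreal_mult nn_integral_cmult)
    also have "\<dots> \<le> ennreal (2 ^ k) * ennreal (8 * pi * (1/4) ^ k)" by (intro mult_left_mono cau) auto
    also have "\<dots> = ennreal (2 ^ k * (8 * pi * (1/4) ^ k))" by (rule ennreal_mult[symmetric]) auto
    also have "2 ^ k * (8 * pi * (1/4) ^ k) = 8 * pi * (1/2) ^ k" by (simp add: power_mult_distrib[symmetric])
    finally show "(\<integral>\<^sup>+\<xi>. ennreal (2 ^ k * (norm (\<Phi> (Suc k) \<xi> - \<Phi> k \<xi>))\<^sup>2) \<partial>lborel) \<le> ennreal (8 * pi * (1/2) ^ k)" .
  qed auto
  also have "\<dots> = ennreal (8 * pi * 2)"
    by (rule suminf_ennreal_eq) (use sums_mult[OF geometric_sums[of "1/2 :: real"], of "8 * pi"] in auto)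
  finally have "(\<integral>\<^sup>+\<xi>. (\<Sum>k. ennreal (2 ^ k * (norm (\<Phi> (Suc k) \<xi> - \<Phi> k \<xi>))\<^sup>2)) \<partial>lborel) < \<infinity>"
    by (rule le_less_trans) simp
  then have "(\<integral>\<^sup>+\<xi>. (\<Sum>k. ennreal (2 ^ k * (norm (\<Phi> (Suc k) \<xi> - \<Phi> k \<xi>))\<^sup>2)) \<partial>lborel) \<noteq> \<infinity>" by simp
  then have "AE \<xi> in lborel. (\<Sum>k. ennreal (2 ^ k * (norm (\<Phi> (Suc k) \<xi> - \<Phi> k \<xi>))\<^sup>2)) \<noteq> \<infinity>"
    by (intro nn_integral_PInf_AE) measurable
  then have conv: "AE \<xi> in lborel. (\<lambda>k. \<Phi> k \<xi>) \<longlonglongrightarrow> lim (\<lambda>k. \<Phi> k \<xi>)"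
  proof eventually_elim
    case (elim \<xi>)
    from fast_cauchy_convergent[of "\<lambda>k. \<Phi> k \<xi>", OF elim] show ?case by (simp only: convergent_LIMSEQ_iff)
  qed
  define F where "F \<xi> = lim (\<lambda>k. \<Phi> k \<xi>)" for \<xi>
  have Fm[measurable]: "F \<in> borel_measurable borel" unfolding F_def by measurable
  have err: "sq (\<lambda>\<xi>. F \<xi> - \<Phi> k \<xi>) \<le> ennreal (8 * pi * (1/4) ^ k)" for k
  proof -
    have "sq (\<lambda>\<xi>. F \<xi> - \<Phi> k \<xi>) = (\<integral>\<^sup>+\<xi>. liminf (\<lambda>j. ennreal ((norm (\<Phi> j \<xi> - \<Phi> k \<xi>))\<^sup>2)) \<partial>lborel)"
      unfolding sq_def
    proof (rule nn_integral_cong_AE)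
      show "AE \<xi> in lborel. ennreal ((norm (F \<xi> - \<Phi> k \<xi>))\<^sup>2) = liminf (\<lambda>j. ennreal ((norm (\<Phi> j \<xi> - \<Phi> k \<xi>))\<^sup>2))"
        using conv
      proof eventually_elim
        case (elim \<xi>)
        have "(\<lambda>j. ennreal ((norm (\<Phi> j \<xi> - \<Phi> k \<xi>))\<^sup>2)) \<longlonglongrightarrow> ennreal ((norm (F \<xi> - \<Phi> k \<xi>))\<^sup>2)"
          unfolding F_def by (intro tendsto_intros elim)
        then show ?case by (intro lim_imp_Liminf[symmetric]) auto
      qed
    qed
    also have "\<dots> \<le> liminf (\<lambda>j. \<integral>\<^sup>+\<xi>. ennreal ((norm (\<Phi> j \<xi> - \<Phi> k \<xi>))\<^sup>2) \<partial>lborel)" by (rule nn_integral_liminf) measurable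
    also have "\<dots> \<le> liminf (\<lambda>j::nat. ennreal (8 * pi * (1/4) ^ k))"
      unfolding sq_def[symmetric] by (intro Liminf_mono eventually_mono[OF eventually_ge_at_top[of k]] cau)
    also have "\<dots> = ennreal (8 * pi * (1/4) ^ k)" by (rule Liminf_const) simp
    finally show ?thesis .
  qed
  have \<Phi>fin: "sq (\<Phi> k) < \<infinity>" for k
  proof -
    have "sq (\<Phi> k) \<le> ennreal (2 * pi) * sq (fk k)" unfolding \<Phi>_def by (rule bessel[OF fki])
    also have "\<dots> \<le> ennreal (2 * pi) * sq f" by (intro mult_left_mono fkle) simp
    also have "\<dots> < \<infinity>" using fin by (simp add: ennreal_mult_less_top)
    finally show ?thesis .
  qed
  have errfin: "sq (\<lambda>\<xi>. F \<xi> - \<Phi> k \<xi>) < \<infinity>" for k by (rule le_less_trans[OF err]) simp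
  have tailfin: "sq (\<lambda>t. f t - fk k t) < \<infinity>" for k by (rule le_less_trans[OF tail]) simp
  have Ffin: "sq F < \<infinity>"
  proof -
    have "sq F = sq (\<lambda>\<xi>. (F \<xi> - \<Phi> 0 \<xi>) - (- \<Phi> 0 \<xi>))" by simp
    also have "\<dots> \<le> 2 * sq (\<lambda>\<xi>. F \<xi> - \<Phi> 0 \<xi>) + 2 * sq (\<lambda>\<xi>. - \<Phi> 0 \<xi>)" by (rule sq_diff_le) measurable
    also have "sq (\<lambda>\<xi>. - \<Phi> 0 \<xi>) = sq (\<Phi> 0)" by (simp add: sq_def)
    also have "2 * sq (\<lambda>\<xi>. F \<xi> - \<Phi> 0 \<xi>) + 2 * sq (\<Phi> 0) < \<infinity>"
      using errfin[of 0] \<Phi>fin[of 0] by (simp add: ennreal_mult_less_top)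
    finally show ?thesis .
  qed
  have "(\<integral>\<xi>. F \<xi> * \<gamma> \<xi> \<partial>lborel) = (\<integral>t. f t * ft \<gamma> t \<partial>lborel)" if \<gamma>: "integrable lborel \<gamma>" "sq \<gamma> < \<infinity>" for \<gamma>
  proof -
    have \<gamma>m[measurable]: "\<gamma> \<in> borel_measurable borel" using \<gamma>(1) by auto
    have hfin: "sq (ft \<gamma>) < \<infinity>"
      by (rule le_less_trans[OF bessel[OF \<gamma>(1)]]) (use \<gamma>(2) in \<open>simp add: ennreal_mult_less_top\<close>)
    define E where "E = (\<integral>\<xi>. F \<xi> * \<gamma> \<xi> \<partial>lborel) - (\<integral>t. f t * ft \<gamma> t \<partial>lborel)"
    define M where "M = ennreal (8 * pi) + sq \<gamma> + (1 + sq (ft \<gamma>))"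
    have "M < \<infinity>" using \<gamma>(2) hfin by (simp add: M_def)
    then obtain m where m: "0 \<le> m" "M = ennreal m" by (cases M) auto
    \<comment> \<open>The weight s = 2^k turns the errors 4^(-k) into 2^(-k) and puts the factor
      2^(-k) on the fixed test function and its transform.\<close>
    have bd: "norm E \<le> (1/2) ^ k * m" for k
    proof -
      have "(\<integral>\<xi>. (F \<xi> - \<Phi> k \<xi>) * \<gamma> \<xi> \<partial>lborel) = (\<integral>\<xi>. F \<xi> * \<gamma> \<xi> \<partial>lborel) - (\<integral>\<xi>. \<Phi> k \<xi> * \<gamma> \<xi> \<partial>lborel)"
        unfolding left_diff_distrib by (intro Bochner_Integration.integral_diff integrable_mult_sq Fm \<Phi>m \<gamma>m Ffin \<Phi>fin \<gamma>(2))
      moreover have "(\<integral>t. (f t - fk k t) * ft \<gamma> t \<partial>lborel) = (\<integral>t. f t * ft \<gamma> t \<partial>lborel) - (\<integral>t. fk k t * ft \<gamma> t \<partial>lborel)"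
        unfolding left_diff_distrib by (intro Bochner_Integration.integral_diff integrable_mult_sq f fkm ft_measurable \<gamma>m fin hfin le_less_trans[OF fkle fin])
      moreover have "(\<integral>\<xi>. \<Phi> k \<xi> * \<gamma> \<xi> \<partial>lborel) = (\<integral>t. fk k t * ft \<gamma> t \<partial>lborel)"
        unfolding \<Phi>_def by (rule ft_multiplication[OF fki \<gamma>(1)])
      ultimately have E: "E = (\<integral>\<xi>. (F \<xi> - \<Phi> k \<xi>) * \<gamma> \<xi> \<partial>lborel) - (\<integral>t. (f t - fk k t) * ft \<gamma> t \<partial>lborel)" by (simp add: E_def)
      have p2: "0 < (2::real) ^ k" by simp
      have q: "ennreal (2 ^ k) * ennreal (c * (1/4) ^ k) = ennreal ((1/2) ^ k) * ennreal c" if "0 \<le> c" for c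
      proof -
        have "(2::real) ^ k * (1/4) ^ k = (1/2) ^ k" by (simp flip: power_mult_distrib)
        moreover have "(2::real) ^ k * (c * (1/4) ^ k) = (2 ^ k * (1/4) ^ k) * c" by (simp only: mult_ac)
        ultimately have e: "(2::real) ^ k * (c * (1/4) ^ k) = (1/2) ^ k * c" by (simp only:)
        have "ennreal (2 ^ k) * ennreal (c * (1/4) ^ k) = ennreal (2 ^ k * (c * (1/4) ^ k))" by (rule ennreal_mult[symmetric]) (use that in auto)
        also have "\<dots> = ennreal ((1/2) ^ k) * ennreal c" unfolding e by (rule ennreal_mult) (use that in auto)
        finally show ?thesis .
      qed
      have "ennreal (norm E) \<le> ennreal (norm (\<integral>\<xi>. (F \<xi> - \<Phi> k \<xi>) * \<gamma> \<xi> \<partial>lborel) + norm (\<integral>t. (f t - fk k t) * ft \<gamma> t \<partial>lborel))"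
        unfolding E by (intro ennreal_leI norm_triangle_ineq4)
      also have "\<dots> = ennreal (norm (\<integral>\<xi>. (F \<xi> - \<Phi> k \<xi>) * \<gamma> \<xi> \<partial>lborel)) + ennreal (norm (\<integral>t. (f t - fk k t) * ft \<gamma> t \<partial>lborel))"
        by (rule ennreal_plus) auto
      also have "\<dots> \<le> (ennreal (2 ^ k) * sq (\<lambda>\<xi>. F \<xi> - \<Phi> k \<xi>) + ennreal (1 / 2 ^ k) * sq \<gamma>) + (ennreal (2 ^ k) * sq (\<lambda>t. f t - fk k t) + ennreal (1 / 2 ^ k) * sq (ft \<gamma>))"
        by (intro add_mono norm_integral_mult_sq errfin tailfin \<gamma>(2) hfin p2) measurable
      also have "\<dots> \<le> (ennreal (2 ^ k) * ennreal (8 * pi * (1/4) ^ k) + ennreal (1 / 2 ^ k) * sq \<gamma>) + (ennreal (2 ^ k) * ennreal (1 * (1/4) ^ k) + ennreal (1 / 2 ^ k) * sq (ft \<gamma>))"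
        using tail[of k] by (intro add_mono mult_left_mono err) auto
      also have "\<dots> = ennreal ((1/2) ^ k) * M"
      proof -
        have q1: "ennreal (2 ^ k) * ennreal (8 * pi * (1/4) ^ k) = ennreal ((1/2) ^ k) * ennreal (8 * pi)" by (rule q) simp
        have q2: "ennreal (2 ^ k) * ennreal (1 * (1/4) ^ k) = ennreal ((1/2) ^ k) * ennreal 1" by (rule q) simp
        have h: "1 / 2 ^ k = (1/2 :: real) ^ k" by (simp add: power_one_over)
        show ?thesis unfolding q1 q2 h M_def ennreal_1 by (simp only: distrib_left add.assoc)
      qed
      also have "\<dots> = ennreal ((1/2) ^ k * m)" unfolding m(2) by (rule ennreal_mult[symmetric]) (use m in auto)
      finally show ?thesis using m by (simp add: ennreal_le_iff)
    qed
    have "(\<lambda>k. (1/2) ^ k * m) \<longlonglongrightarrow> 0 * m" by (intro tendsto_intros LIMSEQ_power_zero) simp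
    then have "norm E \<le> 0 * m" by (rule LIMSEQ_le_const) (use bd in auto)
    then show ?thesis by (simp add: E_def)
  qed
  then show ?thesis using Fm Ffin by blast
qed

lemma real_distribution_density:
  fixes p :: "real \<Rightarrow> real"
  assumes p: "integrable lborel p" "\<And>x. 0 \<le> p x" "(\<integral>x. p x \<partial>lborel) = 1"
  shows "real_distribution (density lborel p)"
proof (intro real_distribution.intro prob_spaceI real_distribution_axioms.intro)
  have [measurable]: "p \<in> borel_measurable borel" using p(1) by auto
  have "(\<integral>\<^sup>+x. ennreal (p x) \<partial>lborel) = ennreal (\<integral>x. p x \<partial>lborel)" by (rule nn_integral_eq_integral) (use p in auto)
  then show "emeasure (density lborel p) (space (density lborel p)) = 1" using p(3) by (simp add: emeasure_density)
qed simp

text \<open>Frequency 0 shows that the positive and negative parts have the same mass. If it is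
  nonzero, both normalize to probability densities with equal characteristic functions, which Levy's
  uniqueness theorem identifies.\<close>

lemma real_ft_unique:
  fixes r :: "real \<Rightarrow> real"
  assumes r: "integrable lborel r" and z: "\<And>\<eta>. (\<integral>\<xi>. of_real (r \<xi>) * iexp (\<eta> * \<xi>) \<partial>lborel) = 0"
  shows "AE \<xi> in lborel. r \<xi> = 0"
proof -
  have [measurable]: "r \<in> borel_measurable borel" using r by auto
  define p q where "p \<xi> = max (r \<xi>) 0" and "q \<xi> = max (- r \<xi>) 0" for \<xi>
  have pq: "r \<xi> = p \<xi> - q \<xi>" "0 \<le> p \<xi>" "0 \<le> q \<xi>" for \<xi> by (auto simp: p_def q_def)
  have pi: "integrable lborel p" "integrable lborel q" using r unfolding p_def q_def by auto
  have [measurable]: "p \<in> borel_measurable borel" "q \<in> borel_measurable borel" unfolding p_def q_def by measurable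
  define M where "M = (\<integral>\<xi>. p \<xi> \<partial>lborel)"
  have "of_real (\<integral>\<xi>. r \<xi> \<partial>lborel) = (0 :: complex)" using z[of 0] by simp
  then have "(\<integral>\<xi>. r \<xi> \<partial>lborel) = 0" by (simp only: of_real_eq_0_iff)
  then have Mq: "M = (\<integral>\<xi>. q \<xi> \<partial>lborel)" unfolding pq(1) M_def using pi by simp
  show ?thesis
  proof (cases "M = 0")
    case True
    have "AE \<xi> in lborel. p \<xi> = 0" using True pi pq by (simp add: M_def integral_nonneg_eq_0_iff_AE)
    moreover have "AE \<xi> in lborel. q \<xi> = 0" using True Mq pi pq by (simp add: integral_nonneg_eq_0_iff_AE)
    ultimately show ?thesis by eventually_elim (simp add: pq(1))
  next
    case False
    then have M: "M > 0" using pq by (simp add: M_def less_le integral_nonneg_AE)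
    define p' q' where "p' \<xi> = p \<xi> / M" and "q' \<xi> = q \<xi> / M" for \<xi>
    have [measurable]: "p' \<in> borel_measurable borel" "q' \<in> borel_measurable borel" unfolding p'_def q'_def by measurable
    have p0: "0 \<le> p' \<xi>" "0 \<le> q' \<xi>" for \<xi> using pq M by (auto simp: p'_def q'_def)
    have pi': "integrable lborel p'" "integrable lborel q'" using pi unfolding p'_def q'_def by simp_all
    have d: "real_distribution (density lborel p')" "real_distribution (density lborel q')"
      by (intro real_distribution_density pi' p0; use M Mq in \<open>simp add: p'_def q'_def M_def[symmetric]\<close>)+
    have "char (density lborel p') \<eta> = char (density lborel q') \<eta>" for \<eta>
    proof -
      have i: "integrable lborel (\<lambda>\<xi>. u \<xi> *\<^sub>R iexp (\<eta> * \<xi>))" if "integrable lborel u" for u :: "real \<Rightarrow> real"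
        by (rule Bochner_Integration.integrable_bound[OF that]) (use that in auto)
      have c: "char (density lborel p') \<eta> = (\<integral>\<xi>. p' \<xi> *\<^sub>R iexp (\<eta> * \<xi>) \<partial>lborel)" "char (density lborel q') \<eta> = (\<integral>\<xi>. q' \<xi> *\<^sub>R iexp (\<eta> * \<xi>) \<partial>lborel)"
        unfolding char_def using p0 by (intro integral_density; simp)+
      have "char (density lborel p') \<eta> - char (density lborel q') \<eta> = (\<integral>\<xi>. p' \<xi> *\<^sub>R iexp (\<eta> * \<xi>) - q' \<xi> *\<^sub>R iexp (\<eta> * \<xi>) \<partial>lborel)"
        unfolding c by (rule Bochner_Integration.integral_diff[OF i[OF pi'(1)] i[OF pi'(2)], symmetric])
      also have "\<dots> = (\<integral>\<xi>. of_real (1 / M) * (of_real (r \<xi>) * iexp (\<eta> * \<xi>)) \<partial>lborel)"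
      proof (intro Bochner_Integration.integral_cong refl)
        fix \<xi>
        have "p' \<xi> *\<^sub>R iexp (\<eta> * \<xi>) - q' \<xi> *\<^sub>R iexp (\<eta> * \<xi>) = of_real (p' \<xi> - q' \<xi>) * iexp (\<eta> * \<xi>)"
          by (simp only: scaleR_conv_of_real of_real_diff left_diff_distrib)
        also have "p' \<xi> - q' \<xi> = (1 / M) * r \<xi>" by (simp add: p'_def q'_def pq(1) diff_divide_distrib)
        finally show "p' \<xi> *\<^sub>R iexp (\<eta> * \<xi>) - q' \<xi> *\<^sub>R iexp (\<eta> * \<xi>) = of_real (1 / M) * (of_real (r \<xi>) * iexp (\<eta> * \<xi>))"
          by (simp only: of_real_mult mult.assoc)
      qed
      also have "\<dots> = of_real (1 / M) * (\<integral>\<xi>. of_real (r \<xi>) * iexp (\<eta> * \<xi>) \<partial>lborel)" by (rule integral_mult_right_zero)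
      finally show ?thesis using z by simp
    qed
    then have "density lborel (\<lambda>x. ennreal (p' x)) = density lborel (\<lambda>x. ennreal (q' x))" by (intro Levy_uniqueness d ext)
    then have "AE \<xi> in lborel. ennreal (p' \<xi>) = ennreal (q' \<xi>)" by (subst (asm) sigma_finite_measure.density_unique_iff[OF lborel.sigma_finite_measure_axioms]) auto
    then show ?thesis
    proof eventually_elim
      case (elim \<xi>)
      then have "p' \<xi> = q' \<xi>" using p0 by simp
      then show ?case using M by (simp add: p'_def q'_def pq(1))
    qed
  qed
qed

text \<open>The conjugate function has the conjugate transform at the opposite frequency, so the
  real part inherits a vanishing transform. The imaginary part of u is the real part of -i
  u.\<close>

lemma complex_ft_unique:
  assumes u: "integrable lborel u" and z: "\<And>\<eta>. (\<integral>\<xi>. u \<xi> * iexp (\<eta> * \<xi>) \<partial>lborel) = 0"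
  shows "AE \<xi> in lborel. u \<xi> = 0"
proof -
  have re: "AE \<xi> in lborel. Re (w \<xi>) = 0" if w: "integrable lborel w" and z: "\<And>\<eta>. (\<integral>\<xi>. w \<xi> * iexp (\<eta> * \<xi>) \<partial>lborel) = 0" for w
  proof (rule real_ft_unique)
    show "integrable lborel (\<lambda>\<xi>. Re (w \<xi>))" using w by simp
    fix \<eta>
    have cw: "integrable lborel (\<lambda>\<xi>. cnj (w \<xi>))" by (rule integrable_bounded_linear[OF bounded_linear_cnj w])
    have "(\<integral>\<xi>. cnj (w \<xi>) * iexp (\<eta> * \<xi>) \<partial>lborel) = (\<integral>\<xi>. cnj (w \<xi> * iexp ((- \<eta>) * \<xi>)) \<partial>lborel)"
      by (intro Bochner_Integration.integral_cong refl) (simp add: exp_cnj)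
    also have "\<dots> = cnj (\<integral>\<xi>. w \<xi> * iexp ((- \<eta>) * \<xi>) \<partial>lborel)" by (rule Bochner_Integration.integral_cnj)
    finally have c: "(\<integral>\<xi>. cnj (w \<xi>) * iexp (\<eta> * \<xi>) \<partial>lborel) = 0" by (simp only: z complex_cnj_zero)
    have "(\<integral>\<xi>. of_real (Re (w \<xi>)) * iexp (\<eta> * \<xi>) \<partial>lborel) = (\<integral>\<xi>. (1/2) * (w \<xi> * iexp (\<eta> * \<xi>) + cnj (w \<xi>) * iexp (\<eta> * \<xi>)) \<partial>lborel)"
    proof (intro Bochner_Integration.integral_cong refl)
      fix \<xi>
      have "of_real (Re (w \<xi>)) = (1/2) * (w \<xi> + cnj (w \<xi>))" by (simp add: complex_add_cnj)
      then show "of_real (Re (w \<xi>)) * iexp (\<eta> * \<xi>) = (1/2) * (w \<xi> * iexp (\<eta> * \<xi>) + cnj (w \<xi>) * iexp (\<eta> * \<xi>))"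
        by (simp only: distrib_right mult.assoc)
    qed
    also have "\<dots> = (1/2) * (\<integral>\<xi>. w \<xi> * iexp (\<eta> * \<xi>) + cnj (w \<xi>) * iexp (\<eta> * \<xi>) \<partial>lborel)" by (rule integral_mult_right_zero)
    also have "(\<integral>\<xi>. w \<xi> * iexp (\<eta> * \<xi>) + cnj (w \<xi>) * iexp (\<eta> * \<xi>) \<partial>lborel) = 0"
      by (subst Bochner_Integration.integral_add[OF ft_integrable[OF w] ft_integrable[OF cw]]) (simp only: z c, simp)
    finally show "(\<integral>\<xi>. of_real (Re (w \<xi>)) * iexp (\<eta> * \<xi>) \<partial>lborel) = 0" by simp
  qed
  have "AE \<xi> in lborel. Re (u \<xi>) = 0" by (rule re[OF u z])
  moreover have "AE \<xi> in lborel. Re ((- \<i>) * u \<xi>) = 0"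
  proof (rule re)
    show "integrable lborel (\<lambda>\<xi>. (- \<i>) * u \<xi>)" using u by simp
    show "(\<integral>\<xi>. (- \<i>) * u \<xi> * iexp (\<eta> * \<xi>) \<partial>lborel) = 0" for \<eta>
      unfolding mult.assoc by (subst integral_mult_right_zero) (simp only: z, simp)
  qed
  ultimately show ?thesis by eventually_elim (simp add: complex_eq_iff)
qed

lemma sq_gau: "sq gau < \<infinity>"
proof -
  have "sq gau \<le> (\<integral>\<^sup>+x. ennreal (exp (- x\<^sup>2 / 2)) \<partial>lborel)"
    unfolding sq_def
  proof (intro nn_integral_mono ennreal_leI)
    fix x :: real
    have "(norm (gau x))\<^sup>2 = exp (- x\<^sup>2 / 2) * exp (- x\<^sup>2 / 2)" by (simp add: gau_def power2_eq_square)
    also have "\<dots> \<le> exp (- x\<^sup>2 / 2) * 1" by (intro mult_left_mono) auto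
    finally show "(norm (gau x))\<^sup>2 \<le> exp (- x\<^sup>2 / 2)" by simp
  qed
  then show ?thesis unfolding nn_gauss by (rule le_less_trans) simp
qed

text \<open>Multiplication by the Gaussian makes S integrable, so that uniqueness for integrable
  functions applies, and the Gaussian has no zeros.\<close>

lemma gauss_unique:
  assumes S[measurable]: "S \<in> borel_measurable borel" and "sq S < \<infinity>" and z: "\<And>\<eta>. (\<integral>\<xi>. S \<xi> * (gau \<xi> * iexp (\<eta> * \<xi>)) \<partial>lborel) = 0"
  shows "AE \<xi> in lborel. S \<xi> = 0"
proof -
  have "AE \<xi> in lborel. S \<xi> * gau \<xi> = 0"
    by (rule complex_ft_unique) (use integrable_mult_sq[OF S gau_measurable assms(2) sq_gau] z in \<open>simp_all add: mult.assoc\<close>)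
  then show ?thesis by eventually_elim (simp add: gau_def)
qed

lemma integral_lborel_shift: "(\<integral>x. f (x + c) \<partial>lborel) = (\<integral>x. (f x :: complex) \<partial>(lborel :: real measure))"
  using lborel_integral_real_affine[of 1 f c] by (simp add: add.commute)

lemma ft_shift: "ft (\<lambda>\<xi>. iexp (- (a * \<xi>)) * \<gamma> (\<xi> + \<beta>)) t = iexp (\<beta> * (t + a)) * ft \<gamma> (t + a)"
proof -
  have "iexp (\<beta> * (t + a)) * ft \<gamma> (t + a) = (\<integral>\<xi>. iexp (\<beta> * (t + a)) * (\<gamma> \<xi> * iexp (- ((t + a) * \<xi>))) \<partial>lborel)"
    unfolding ft_def by (rule integral_mult_right_zero[symmetric])
  also have "\<dots> = (\<integral>\<xi>. iexp (\<beta> * (t + a)) * (\<gamma> (\<xi> + \<beta>) * iexp (- ((t + a) * (\<xi> + \<beta>)))) \<partial>lborel)"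
    by (rule integral_lborel_shift[symmetric])
  also have "\<dots> = ft (\<lambda>\<xi>. iexp (- (a * \<xi>)) * \<gamma> (\<xi> + \<beta>)) t"
    unfolding ft_def
  proof (intro Bochner_Integration.integral_cong refl)
    fix \<xi>
    have "iexp (\<beta> * (t + a)) * iexp (- ((t + a) * (\<xi> + \<beta>))) = iexp (- (a * \<xi>)) * iexp (- (t * \<xi>))"
      unfolding iexp_add[symmetric] by (simp add: algebra_simps)
    then have "\<gamma> (\<xi> + \<beta>) * (iexp (\<beta> * (t + a)) * iexp (- ((t + a) * (\<xi> + \<beta>)))) = \<gamma> (\<xi> + \<beta>) * (iexp (- (a * \<xi>)) * iexp (- (t * \<xi>)))"
      by (rule arg_cong)
    moreover have "x * (y * z) = y * (x * z)" "x * y * z = y * (x * z)" for x y z :: complex by (simp_all only: mult_ac)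
    ultimately show "iexp (\<beta> * (t + a)) * (\<gamma> (\<xi> + \<beta>) * iexp (- ((t + a) * (\<xi> + \<beta>)))) = iexp (- (a * \<xi>)) * \<gamma> (\<xi> + \<beta>) * iexp (- (t * \<xi>))"
      by presburger
  qed
  finally show ?thesis ..
qed

lemma ft_gau: "ft gau t = of_real (sqrt (2 * pi)) * gau t"
  using gau_char[of "- t"] by (simp add: ft_def gau_def)

definition l2 :: "(real \<Rightarrow> complex) \<Rightarrow> bool" where "l2 u \<longleftrightarrow> u \<in> borel_measurable borel \<and> sq u < \<infinity>"

lemma sq_shift: "u \<in> borel_measurable borel \<Longrightarrow> sq (\<lambda>x. u (x + c)) = sq u"
  unfolding sq_def using nn_integral_real_affine[of "\<lambda>x. ennreal ((norm (u x))\<^sup>2)" 1 c] by (simp add: add.commute)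

lemma l2_shift: "l2 u \<Longrightarrow> l2 (\<lambda>x. u (x + c))"
  unfolding l2_def using sq_shift[of u c] by (auto intro: measurable_compose[rotated])

lemma l2_mult:
  assumes u: "l2 u" and g[measurable]: "g \<in> borel_measurable borel" and b: "\<And>x. norm (g x) \<le> M"
  shows "l2 (\<lambda>x. g x * u x)"
proof -
  have [measurable]: "u \<in> borel_measurable borel" using u by (simp add: l2_def)
  have "sq (\<lambda>x. g x * u x) \<le> (\<integral>\<^sup>+x. ennreal (M\<^sup>2) * ennreal ((norm (u x))\<^sup>2) \<partial>lborel)"
    unfolding sq_def
  proof (rule nn_integral_mono)
    fix x
    have "(norm (g x * u x))\<^sup>2 \<le> M\<^sup>2 * (norm (u x))\<^sup>2"
      unfolding norm_mult power_mult_distrib by (intro mult_right_mono power_mono b) auto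
    then show "ennreal ((norm (g x * u x))\<^sup>2) \<le> ennreal (M\<^sup>2) * ennreal ((norm (u x))\<^sup>2)"
      by (simp add: ennreal_mult'[symmetric] ennreal_leI)
  qed
  also have "\<dots> = ennreal (M\<^sup>2) * sq u" unfolding sq_def by (simp add: nn_integral_cmult)
  also have "\<dots> < \<infinity>" using u by (simp add: l2_def ennreal_mult_less_top)
  finally show ?thesis by (simp add: l2_def)
qed

lemma l2_add: assumes "l2 u" "l2 v" shows "l2 (\<lambda>x. u x + v x)"
proof -
  have [measurable]: "u \<in> borel_measurable borel" "v \<in> borel_measurable borel" using assms by (auto simp: l2_def)
  have "sq (\<lambda>x. u x + v x) = sq (\<lambda>x. u x - (- v x))" by simp
  also have "\<dots> \<le> 2 * sq u + 2 * sq (\<lambda>x. - v x)" by (rule sq_diff_le) measurable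
  also have "sq (\<lambda>x. - v x) = sq v" by (simp add: sq_def)
  also have "2 * sq u + 2 * sq v < \<infinity>" using assms by (simp add: l2_def ennreal_mult_less_top)
  finally show ?thesis by (simp add: l2_def)
qed

lemma l2_sum: "finite J \<Longrightarrow> (\<And>j. j \<in> J \<Longrightarrow> l2 (u j)) \<Longrightarrow> l2 (\<lambda>x. \<Sum>j\<in>J. u j x)"
  by (induction J rule: finite_induct) (auto intro!: l2_add simp: l2_def[of "\<lambda>x. 0"] sq_def)

text \<open>A relation between time-frequency shifts of \<open>f\<close> becomes the rotated relation for its transform.\<close>

lemma fourier_relation:
  assumes f: "l2 f" and J: "finite J"
    and rel: "AE t in lborel. (\<Sum>j\<in>J. c j * iexp (\<beta> j * t) * f (t - a j)) = 0"
  shows "\<exists>F. l2 F \<and> (AE \<xi> in lborel. (\<Sum>j\<in>J. c j * iexp (- (a j * (\<xi> - \<beta> j))) * F (\<xi> - \<beta> j)) = 0)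
     \<and> ((AE \<xi> in lborel. F \<xi> = 0) \<longrightarrow> (AE t in lborel. f t = 0))"
proof -
  obtain F where F: "l2 F" and pair: "\<And>\<gamma>. integrable lborel \<gamma> \<Longrightarrow> sq \<gamma> < \<infinity> \<Longrightarrow> (\<integral>\<xi>. F \<xi> * \<gamma> \<xi> \<partial>lborel) = (\<integral>t. f t * ft \<gamma> t \<partial>lborel)"
    using ft_exists[of f] f by (auto simp: l2_def)
  have [measurable]: "f \<in> borel_measurable borel" "F \<in> borel_measurable borel" using f F by (auto simp: l2_def)
  have l2i: "integrable lborel (\<lambda>x. u x * v x)" if "l2 u" "l2 v" for u v
    using that by (intro integrable_mult_sq) (auto simp: l2_def)
  have l2g: "l2 gau" unfolding l2_def using sq_gau gau_measurable by blast
  have gshift: "integrable lborel (\<lambda>x. gau (x + c))" for c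
    using lborel_integrable_real_affine[OF gau_integrable, of 1 c] by (simp add: add.commute)
  have main: "AE \<xi> in lborel. (\<Sum>j\<in>J. c j * iexp (- (a j * (\<xi> - \<beta> j))) * F (\<xi> - \<beta> j)) = 0"
  proof (rule gauss_unique)
    have t: "l2 (\<lambda>\<xi>. (c j * iexp (- (a j * (\<xi> - \<beta> j)))) * F (\<xi> - \<beta> j))" for j
      by (rule l2_mult[of _ _ "norm (c j)"]) (use l2_shift[OF F, of "- \<beta> j"] in \<open>simp_all add: norm_mult\<close>)
    have "l2 (\<lambda>\<xi>. \<Sum>j\<in>J. c j * iexp (- (a j * (\<xi> - \<beta> j))) * F (\<xi> - \<beta> j))" by (rule l2_sum[OF J t])
    then show "(\<lambda>\<xi>. \<Sum>j\<in>J. c j * iexp (- (a j * (\<xi> - \<beta> j))) * F (\<xi> - \<beta> j)) \<in> borel_measurable borel"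
      "sq (\<lambda>\<xi>. \<Sum>j\<in>J. c j * iexp (- (a j * (\<xi> - \<beta> j))) * F (\<xi> - \<beta> j)) < \<infinity>" by (auto simp: l2_def)
    fix \<eta>
    define \<gamma> where "\<gamma> \<xi> = gau \<xi> * iexp (\<eta> * \<xi>)" for \<xi>
    have \<gamma>l: "l2 \<gamma>" unfolding \<gamma>_def by (subst mult.commute, rule l2_mult[OF l2g, of _ 1]) auto
    have [measurable]: "\<gamma> \<in> borel_measurable borel" using \<gamma>l by (simp add: l2_def)
    have \<gamma>i: "integrable lborel \<gamma>" unfolding \<gamma>_def by (rule ft_integrable[OF gau_integrable])
    have hl: "l2 (ft \<gamma>)"
    proof -
      have "sq (ft \<gamma>) < \<infinity>" by (rule le_less_trans[OF bessel[OF \<gamma>i]]) (use \<gamma>l in \<open>simp add: l2_def ennreal_mult_less_top\<close>)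
      then show ?thesis by (simp add: l2_def)
    qed
    have piece: "(\<integral>\<xi>. (c j * iexp (- (a j * (\<xi> - \<beta> j))) * F (\<xi> - \<beta> j)) * \<gamma> \<xi> \<partial>lborel) = (\<integral>t. (c j * iexp (\<beta> j * t) * f (t - a j)) * ft \<gamma> t \<partial>lborel)" for j
    proof -
      \<comment> \<open>The time-frequency shift is moved onto the test function, whose transform is
        then shifted and modulated in the dual way.\<close>
      define \<gamma>' where "\<gamma>' \<xi> = iexp (- (a j * \<xi>)) * \<gamma> (\<xi> + \<beta> j)" for \<xi>
      have g'l: "l2 \<gamma>'" unfolding \<gamma>'_def by (rule l2_mult[OF l2_shift[OF \<gamma>l], of _ 1]) auto
      have g'i: "integrable lborel \<gamma>'"
      proof (rule Bochner_Integration.integrable_bound[OF gshift[of "\<beta> j"]])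
        show "\<gamma>' \<in> borel_measurable lborel" using g'l by (simp add: l2_def)
      qed (simp add: \<gamma>'_def \<gamma>_def norm_mult)
      have "(\<integral>\<xi>. (c j * iexp (- (a j * (\<xi> - \<beta> j))) * F (\<xi> - \<beta> j)) * \<gamma> \<xi> \<partial>lborel) = (\<integral>\<xi>. (c j * iexp (- (a j * ((\<xi> + \<beta> j) - \<beta> j))) * F ((\<xi> + \<beta> j) - \<beta> j)) * \<gamma> (\<xi> + \<beta> j) \<partial>lborel)"
        by (rule integral_lborel_shift[symmetric])
      also have "\<dots> = (\<integral>\<xi>. c j * (F \<xi> * \<gamma>' \<xi>) \<partial>lborel)" by (simp add: \<gamma>'_def mult_ac)
      also have "\<dots> = c j * (\<integral>t. f t * ft \<gamma>' t \<partial>lborel)" using pair[OF g'i] g'l by (simp add: l2_def)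
      also have "\<dots> = (\<integral>t. c j * (f t * ft \<gamma>' t) \<partial>lborel)" by simp
      also have "\<dots> = (\<integral>t. c j * (f (t + - a j) * ft \<gamma>' (t + - a j)) \<partial>lborel)" by (rule integral_lborel_shift[symmetric])
      also have "\<dots> = (\<integral>t. (c j * iexp (\<beta> j * t) * f (t - a j)) * ft \<gamma> t \<partial>lborel)"
      proof -
        have "ft \<gamma>' (t + - a j) = iexp (\<beta> j * t) * ft \<gamma> t" for t unfolding \<gamma>'_def ft_shift by simp
        then show ?thesis by (simp add: mult_ac)
      qed
      finally show ?thesis .
    qed
    have tf: "l2 (\<lambda>t. (c j * iexp (\<beta> j * t)) * f (t - a j))" for j
      by (rule l2_mult[of _ _ "norm (c j)"]) (use l2_shift[OF f, of "- a j"] in \<open>simp_all add: norm_mult\<close>)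
    have "(\<integral>\<xi>. (\<Sum>j\<in>J. c j * iexp (- (a j * (\<xi> - \<beta> j))) * F (\<xi> - \<beta> j)) * \<gamma> \<xi> \<partial>lborel) = (\<Sum>j\<in>J. \<integral>\<xi>. (c j * iexp (- (a j * (\<xi> - \<beta> j))) * F (\<xi> - \<beta> j)) * \<gamma> \<xi> \<partial>lborel)"
      unfolding sum_distrib_right by (rule Bochner_Integration.integral_sum) (rule l2i[OF t \<gamma>l])
    also have "\<dots> = (\<Sum>j\<in>J. \<integral>t. (c j * iexp (\<beta> j * t) * f (t - a j)) * ft \<gamma> t \<partial>lborel)" unfolding piece ..
    also have "\<dots> = (\<integral>t. (\<Sum>j\<in>J. c j * iexp (\<beta> j * t) * f (t - a j)) * ft \<gamma> t \<partial>lborel)"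
      unfolding sum_distrib_right by (rule Bochner_Integration.integral_sum[symmetric]) (rule l2i[OF tf hl])
    also have "\<dots> = 0"
      by (rule integral_eq_zero_AE) (use rel in eventually_elim, simp)
    finally show "(\<integral>\<xi>. (\<Sum>j\<in>J. c j * iexp (- (a j * (\<xi> - \<beta> j))) * F (\<xi> - \<beta> j)) * (gau \<xi> * iexp (\<eta> * \<xi>)) \<partial>lborel) = 0"
      unfolding \<gamma>_def .
  qed
  \<comment> \<open>The test functions are translated Gaussians: their transforms are modulated
    Gaussians, which \<open>gauss_unique\<close> needs.\<close>
  have ff: "AE t in lborel. f t = 0" if z: "AE \<xi> in lborel. F \<xi> = 0"
  proof (rule gauss_unique)
    show "f \<in> borel_measurable borel" "sq f < \<infinity>" using f by (auto simp: l2_def)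
    fix \<eta>
    define \<gamma> where "\<gamma> \<xi> = gau (\<xi> + \<eta>)" for \<xi>
    have fg: "ft \<gamma> t = iexp (\<eta> * t) * (of_real (sqrt (2 * pi)) * gau t)" for t
    proof -
      have "ft \<gamma> t = ft (\<lambda>\<xi>. iexp (- (0 * \<xi>)) * gau (\<xi> + \<eta>)) t" by (simp add: \<gamma>_def[abs_def])
      also have "\<dots> = iexp (\<eta> * (t + 0)) * ft gau (t + 0)" by (rule ft_shift)
      finally show ?thesis unfolding ft_gau by simp
    qed
    have p: "(\<integral>\<xi>. F \<xi> * \<gamma> \<xi> \<partial>lborel) = (\<integral>t. f t * ft \<gamma> t \<partial>lborel)"
    proof (rule pair)
      show "integrable lborel \<gamma>" unfolding \<gamma>_def[abs_def] by (rule gshift)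
      show "sq \<gamma> < \<infinity>" unfolding \<gamma>_def[abs_def] sq_shift[OF gau_measurable] by (rule sq_gau)
    qed
    have "(\<integral>\<xi>. F \<xi> * \<gamma> \<xi> \<partial>lborel) = 0" by (rule integral_eq_zero_AE) (use z in eventually_elim, simp)
    moreover have "(\<integral>t. f t * ft \<gamma> t \<partial>lborel) = (\<integral>t. of_real (sqrt (2 * pi)) * (f t * (gau t * iexp (\<eta> * t))) \<partial>lborel)"
      unfolding fg by (intro Bochner_Integration.integral_cong refl) (simp only: mult_ac)
    moreover have "\<dots> = of_real (sqrt (2 * pi)) * (\<integral>t. f t * (gau t * iexp (\<eta> * t)) \<partial>lborel)" by (rule integral_mult_right_zero)
    ultimately have "of_real (sqrt (2 * pi)) * (\<integral>t. f t * (gau t * iexp (\<eta> * t)) \<partial>lborel) = 0" using p by simp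
    then show "(\<integral>t. f t * (gau t * iexp (\<eta> * t)) \<partial>lborel) = 0" unfolding mult_eq_0_iff by simp
  qed
  show ?thesis by (intro exI[of _ F] conjI impI F main) (rule ff)
qed

section \<open>Independence of three time-frequency shifts\<close>

lemma AE_shift_zero:
  fixes f :: "real \<Rightarrow> complex"
  assumes [measurable]: "f \<in> borel_measurable borel" and "AE t in lborel. f (t - a) = 0"
  shows "AE t in lborel. f t = 0"
  using AE_lborel_shift[OF _ assms(2), of a] by simp

lemma two_translates_zero:
  fixes f Q :: "real \<Rightarrow> complex"
  assumes f: "l2 f" and Q[measurable]: "Q \<in> borel_measurable borel" and \<tau>: "0 < \<tau>"
    and per: "\<And>t m. norm (Q (t + real_of_int m * \<tau>)) = norm (Q t)" and nz: "AE t in lborel. Q t \<noteq> 0"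
    and c: "c0 \<noteq> 0" and a: "a \<noteq> a0"
    and rel: "AE t in lborel. Q t * f (t - a) + c0 * iexp (b * t) * f (t - a0) = 0"
  shows "AE t in lborel. f t = 0"
proof -
  have [measurable]: "f \<in> borel_measurable borel" using f by (simp add: l2_def)
  define h where "h t = ennreal ((norm (f (t - a)))\<^sup>2)" for t
  define p where "p t = ennreal ((norm (Q t))\<^sup>2)" for t
  have "AE t in lborel. h t = 0"
  proof (rule periodic_multiplier_zero[where \<tau> = \<tau> and p = p and C = "ennreal ((norm c0)\<^sup>2)" and d = "a0 - a"])
    show "h \<in> borel_measurable borel" "p \<in> borel_measurable borel" unfolding h_def p_def by measurable
    show "p (t + real_of_int m * \<tau>) = p t" for t m unfolding p_def per ..
    show "AE t in lborel. p t \<noteq> 0 \<and> p t \<noteq> top" using nz by eventually_elim (simp add: p_def)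
    show "ennreal ((norm c0)\<^sup>2) \<noteq> 0" using c by simp
    show "AE t in lborel. p t * h t = ennreal ((norm c0)\<^sup>2) * h (t - (a0 - a))"
      using rel
    proof eventually_elim
      case (elim t)
      then have "Q t * f (t - a) = - (c0 * iexp (b * t) * f (t - a0))" by (simp add: add_eq_0_iff2)
      then have "norm (Q t * f (t - a)) = norm (c0 * iexp (b * t) * f (t - a0))" by (simp only: norm_minus_cancel)
      then have "norm (Q t) * norm (f (t - a)) = norm c0 * norm (f (t - a0))" by (simp only: norm_mult norm_iexp mult_1_right)
      then have "(norm (Q t))\<^sup>2 * (norm (f (t - a)))\<^sup>2 = (norm c0)\<^sup>2 * (norm (f (t - a0)))\<^sup>2" by (simp only: power_mult_distrib[symmetric])
      moreover have "t - (a0 - a) - a = t - a0" by simp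
      ultimately show ?case unfolding p_def h_def by (simp only: ennreal_mult'[symmetric] zero_le_power2)
    qed
    have "(\<integral>\<^sup>+t. h t \<partial>lborel) = sq f" using sq_shift[of f "- a"] by (simp add: sq_def h_def)
    then show "(\<integral>\<^sup>+t. h t \<partial>lborel) < \<infinity>" using f by (simp add: l2_def)
  qed (use \<tau> a in auto)
  then have "AE t in lborel. f (t - a) = 0" by eventually_elim (simp add: h_def)
  then show ?thesis by (rule AE_shift_zero[rotated]) simp
qed

text \<open>A point (a, \<beta>) stands for translation by a followed by multiplication with exp(i
  \<beta> t): angular frequency and no symmetric phase. The constants of \<open>weyl_shift\<close>
  are absorbed into points and coefficients when the final count is made.\<close>

definition wrel :: "(real \<times> real \<Rightarrow> complex) \<Rightarrow> (real \<Rightarrow> complex) \<Rightarrow> (real \<times> real) set \<Rightarrow> bool" where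
  "wrel c f J \<longleftrightarrow> (AE t in lborel. (\<Sum>p\<in>J. c p * iexp (snd p * t) * f (t - fst p)) = 0)"

lemma zero_same_translate:
  assumes f: "l2 f" and J: "finite J" "J \<noteq> {}" and c: "\<And>p. p \<in> J \<Longrightarrow> c p \<noteq> 0" and a: "\<And>p. p \<in> J \<Longrightarrow> fst p = a" and rel: "wrel c f J"
  shows "AE t in lborel. f t = 0"
proof -
  have [measurable]: "f \<in> borel_measurable borel" using f by (simp add: l2_def)
  have "inj_on snd J" using a by (auto simp: inj_on_def prod_eq_iff)
  then have "AE t in lborel. (\<Sum>p\<in>J. c p * iexp (snd p * t)) \<noteq> 0" by (intro exp_sum_AE_nonzero J c)
  then have "AE t in lborel. f (t - a) = 0"
    using rel[unfolded wrel_def]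
  proof eventually_elim
    case (elim t)
    have "(\<Sum>p\<in>J. c p * iexp (snd p * t) * f (t - fst p)) = (\<Sum>p\<in>J. c p * iexp (snd p * t)) * f (t - a)"
      unfolding sum_distrib_right by (intro sum.cong refl) (simp add: a)
    then show ?case using elim by simp
  qed
  then show ?thesis by (rule AE_shift_zero[rotated]) simp
qed

lemma zero_two_points:
  assumes f: "l2 f" and ne: "fst p \<noteq> fst q" and c: "c p \<noteq> 0" "c q \<noteq> 0" and rel: "wrel c f {p, q}"
  shows "AE t in lborel. f t = 0"
proof -
  have pq: "p \<noteq> q" using ne by auto
  show ?thesis
  proof (rule two_translates_zero[OF f _ zero_less_one])
    show "(\<lambda>t. c p * iexp (snd p * t)) \<in> borel_measurable borel" by measurable
    show "AE t in lborel. c p * iexp (snd p * t) * f (t - fst p) + c q * iexp (snd q * t) * f (t - fst q) = 0"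
      using rel pq by (simp add: wrel_def)
  qed (use c ne in \<open>simp_all add: norm_mult\<close>)
qed

text \<open>The two points with a common translation act together as multiplication by Q. Up to a
  unimodular factor Q is c p + c q exp(i \<beta> t) with \<beta> the difference of frequencies, so
  its modulus has period 2 pi / \<bar>\<beta>\<bar> although Q itself need not.\<close>

lemma zero_three_points:
  assumes f: "l2 f" and pq: "p \<noteq> q" "fst p = fst q" and ne: "fst p \<noteq> fst r" and c: "c p \<noteq> 0" "c q \<noteq> 0" "c r \<noteq> 0" and rel: "wrel c f {p, q, r}"
  shows "AE t in lborel. f t = 0"
proof -
  define \<beta> where "\<beta> = snd q - snd p"
  have \<beta>: "\<beta> \<noteq> 0" using pq by (auto simp: \<beta>_def prod_eq_iff)
  define Q where "Q t = c p * iexp (snd p * t) + c q * iexp (snd q * t)" for t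
  have nQ: "norm (Q t) = norm (c p + c q * iexp (\<beta> * t))" for t
  proof -
    have "iexp (snd q * t) = iexp (snd p * t) * iexp (\<beta> * t)" unfolding iexp_add[symmetric] by (simp add: \<beta>_def algebra_simps)
    then have "Q t = iexp (snd p * t) * (c p + c q * iexp (\<beta> * t))" unfolding Q_def by (simp only: distrib_left mult_ac)
    then show ?thesis by (simp only: norm_mult norm_iexp mult_1_left)
  qed
  have inj: "inj_on snd {p, q}" using pq by (auto simp: inj_on_def prod_eq_iff)
  have "AE t in lborel. (\<Sum>x\<in>{p, q}. c x * iexp (snd x * t)) \<noteq> 0" by (rule exp_sum_AE_nonzero[OF _ _ inj]) (use c in auto)
  then have nz: "AE t in lborel. Q t \<noteq> 0" using pq by (simp add: Q_def)
  have pr: "p \<noteq> r" "q \<noteq> r" using ne pq by auto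
  show ?thesis
  proof (rule two_translates_zero[OF f _ _ _ nz c(3) ne])
    show "Q \<in> borel_measurable borel" unfolding Q_def by measurable
    show "0 < 2 * pi / \<bar>\<beta>\<bar>" using \<beta> by simp
    show "norm (Q (t + real_of_int m * (2 * pi / \<bar>\<beta>\<bar>))) = norm (Q t)" for t m
    proof -
      define s :: int where "s = (if \<beta> > 0 then m else - m)"
      have "\<beta> * (t + real_of_int m * (2 * pi / \<bar>\<beta>\<bar>)) = \<beta> * t + 2 * pi * of_int s"
        using \<beta> by (auto simp: s_def field_simps abs_if)
      moreover have "iexp (2 * pi * of_int s) = 1" using exp_integer_2pi[of "of_int s"] by (simp add: mult_ac)
      ultimately have "iexp (\<beta> * (t + real_of_int m * (2 * pi / \<bar>\<beta>\<bar>))) = iexp (\<beta> * t)" by (simp only: iexp_add mult_1_right)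
      then show ?thesis unfolding nQ by (simp only:)
    qed
    show "AE t in lborel. Q t * f (t - fst p) + c r * iexp (snd r * t) * f (t - fst r) = 0"
      using rel[unfolded wrel_def]
    proof eventually_elim
      case (elim t)
      then show ?case using pq(1) pr by (simp add: Q_def pq(2) distrib_right add.assoc)
    qed
  qed
qed

text \<open>Multiplication by exp(i \<kappa> t^2 / 2) shears (a, \<beta>) to (a, \<beta> + \<kappa>
  a), and the Fourier transform rotates this to (\<beta> + \<kappa> a, -a). Only unimodular factors
  enter the coefficients. Distinct translations stay distinct as frequencies, so the new
  coefficients can be indexed by the image points.\<close>

lemma chirp_fourier:
  assumes f: "l2 f" and J: "finite J" and rel: "wrel c f J" and inj: "inj_on fst J" and c: "\<And>p. p \<in> J \<Longrightarrow> c p \<noteq> 0"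
  shows "\<exists>F c'. l2 F \<and> wrel c' F ((\<lambda>p. (snd p + \<kappa> * fst p, - fst p)) ` J) \<and> (\<forall>p\<in>J. c' (snd p + \<kappa> * fst p, - fst p) \<noteq> 0)
    \<and> ((AE \<xi> in lborel. F \<xi> = 0) \<longrightarrow> (AE t in lborel. f t = 0))"
proof -
  have [measurable]: "f \<in> borel_measurable borel" using f by (simp add: l2_def)
  define g where "g t = iexp (\<kappa> * t\<^sup>2 / 2) * f t" for t
  have g: "l2 g" unfolding g_def by (rule l2_mult[OF f, of _ 1]) auto
  define \<beta> where "\<beta> p = snd p + \<kappa> * fst p" for p :: "real \<times> real"
  define d where "d p = c p * iexp (- (\<kappa> * (fst p)\<^sup>2 / 2))" for p
  have "AE t in lborel. (\<Sum>p\<in>J. d p * iexp (\<beta> p * t) * g (t - fst p)) = 0"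
    using rel[unfolded wrel_def]
  proof eventually_elim
    case (elim t)
    have "d p * iexp (\<beta> p * t) * g (t - fst p) = iexp (\<kappa> * t\<^sup>2 / 2) * (c p * iexp (snd p * t) * f (t - fst p))" for p
    proof -
      have "iexp (- (\<kappa> * (fst p)\<^sup>2 / 2)) * iexp (\<beta> p * t) * iexp (\<kappa> * (t - fst p)\<^sup>2 / 2) = iexp (\<kappa> * t\<^sup>2 / 2) * iexp (snd p * t)"
      proof -
        have e: "- (\<kappa> * (fst p)\<^sup>2 / 2) + \<beta> p * t + \<kappa> * (t - fst p)\<^sup>2 / 2 = \<kappa> * t\<^sup>2 / 2 + snd p * t"
          by (simp add: \<beta>_def power2_eq_square field_simps)
        show ?thesis unfolding iexp_add[symmetric] e ..
      qed
      then have "c p * f (t - fst p) * (iexp (- (\<kappa> * (fst p)\<^sup>2 / 2)) * iexp (\<beta> p * t) * iexp (\<kappa> * (t - fst p)\<^sup>2 / 2)) = c p * f (t - fst p) * (iexp (\<kappa> * t\<^sup>2 / 2) * iexp (snd p * t))"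
        by (simp only:)
      then show ?thesis unfolding d_def g_def by (simp only: mult_ac)
    qed
    then show ?case using elim by (simp only: sum_distrib_left[symmetric] mult_zero_right)
  qed
  from fourier_relation[OF g J this] obtain F where F: "l2 F"
    and Fr: "AE \<xi> in lborel. (\<Sum>p\<in>J. d p * iexp (- (fst p * (\<xi> - \<beta> p))) * F (\<xi> - \<beta> p)) = 0"
    and Fz: "(AE \<xi> in lborel. F \<xi> = 0) \<longrightarrow> (AE t in lborel. g t = 0)" by blast
  define \<phi> where "\<phi> p = (\<beta> p, - fst p)" for p
  have inj\<phi>: "inj_on \<phi> J" using inj by (auto simp: inj_on_def \<phi>_def)
  define c' where "c' = (\<lambda>q. (d (inv_into J \<phi> q)) * iexp (fst (inv_into J \<phi> q) * \<beta> (inv_into J \<phi> q)))"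
  have c': "c' (\<phi> p) = d p * iexp (fst p * \<beta> p)" if "p \<in> J" for p
    using inv_into_f_f[OF inj\<phi> that] by (simp add: c'_def)
  have "wrel c' F (\<phi> ` J)"
    unfolding wrel_def sum.reindex[OF inj\<phi>] o_def
    using Fr
  proof eventually_elim
    case (elim \<xi>)
    have "c' (\<phi> p) * iexp (snd (\<phi> p) * \<xi>) * F (\<xi> - fst (\<phi> p)) = d p * iexp (- (fst p * (\<xi> - \<beta> p))) * F (\<xi> - \<beta> p)" if "p \<in> J" for p
    proof -
      have "iexp (fst p * \<beta> p) * iexp (- fst p * \<xi>) = iexp (- (fst p * (\<xi> - \<beta> p)))"
        unfolding iexp_add[symmetric] by (simp add: algebra_simps)
      then show ?thesis unfolding c'[OF that] by (simp only: \<phi>_def fst_conv snd_conv mult.assoc)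
    qed
    then show ?case using elim by simp
  qed
  moreover have "c' (\<phi> p) \<noteq> 0" if "p \<in> J" for p unfolding c'[OF that] using c[OF that] by (simp add: d_def)
  moreover have "(AE t in lborel. f t = 0)" if "AE \<xi> in lborel. F \<xi> = 0"
    using Fz that by (auto elim!: eventually_mono simp: g_def)
  ultimately show ?thesis using F unfolding \<phi>_def \<beta>_def by blast
qed

text \<open>\<kappa> is minus the slope of the line through p and q, so the shear gives these points
  the same frequency, and the rotation turns it into a common translation. The third point may or
  may not share it.\<close>

lemma zero_distinct:
  assumes f: "l2 f" and d: "fst p \<noteq> fst q" "fst p \<noteq> fst r" "fst q \<noteq> fst r" and c: "c p \<noteq> 0" "c q \<noteq> 0" "c r \<noteq> 0" and rel: "wrel c f {p, q, r}"
  shows "AE t in lborel. f t = 0"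
proof -
  define \<kappa> where "\<kappa> = (snd p - snd q) / (fst q - fst p)"
  have eq: "snd p + \<kappa> * fst p = snd q + \<kappa> * fst q"
  proof -
    have "\<kappa> * (fst q - fst p) = snd p - snd q" using d by (simp add: \<kappa>_def)
    then show ?thesis by (simp add: algebra_simps)
  qed
  define \<phi> where "\<phi> x = (snd x + \<kappa> * fst x, - fst x)" for x :: "real \<times> real"
  have inj: "inj_on fst {p, q, r}" using d by (auto simp: inj_on_def)
  obtain F c' where F: "l2 F" and Fr: "wrel c' F (\<phi> ` {p, q, r})" and c': "\<forall>x\<in>{p, q, r}. c' (\<phi> x) \<noteq> 0"
    and Fz: "(AE \<xi> in lborel. F \<xi> = 0) \<longrightarrow> (AE t in lborel. f t = 0)"
    using chirp_fourier[OF f _ rel inj, of \<kappa>] c unfolding \<phi>_def by auto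
  have fe: "fst (\<phi> p) = fst (\<phi> q)" using eq by (simp add: \<phi>_def)
  have "AE \<xi> in lborel. F \<xi> = 0"
  proof (cases "fst (\<phi> p) = fst (\<phi> r)")
    case True
    show ?thesis by (rule zero_same_translate[OF F _ _ _ _ Fr, of "fst (\<phi> p)"]) (use True fe c' in auto)
  next
    case False
    show ?thesis by (rule zero_three_points[OF F _ fe False, of c']) (use c' Fr d in \<open>auto simp: \<phi>_def\<close>)
  qed
  then show ?thesis using Fz by blast
qed

theorem three_points_independent:
  assumes f: "l2 f" and J: "finite J" "J \<noteq> {}" "card J \<le> 3" and c: "\<And>p. p \<in> J \<Longrightarrow> c p \<noteq> 0" and rel: "wrel c f J"
  shows "AE t in lborel. f t = 0"
proof -
  have "card J \<noteq> 0" using J by simp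
  then consider "card J = 1" | "card J = 2" | "card J = 3" using J(3) by linarith
  then show ?thesis
  proof cases
    case 1
    then obtain p where "J = {p}" by (rule card_1_singletonE)
    then show ?thesis using zero_same_translate[OF f J(1,2) c _ rel, of "fst p"] by simp
  next
    case 2
    then obtain p q where pq: "J = {p, q}" "p \<noteq> q" by (auto simp: card_2_iff)
    show ?thesis
    proof (cases "fst p = fst q")
      case True
      show ?thesis by (rule zero_same_translate[OF f J(1,2) c _ rel, of "fst p"]) (use pq True in auto)
    next
      case False
      show ?thesis by (rule zero_two_points[OF f False]) (use pq c rel in auto)
    qed
  next
    case 3
    then obtain p q r where pqr: "J = {p, q, r}" "p \<noteq> q" "p \<noteq> r" "q \<noteq> r" by (auto simp: card_3_iff)
    have cn: "c p \<noteq> 0" "c q \<noteq> 0" "c r \<noteq> 0" using c pqr by auto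
    have perm: "{p, r, q} = {p, q, r}" "{q, r, p} = {p, q, r}" by auto
    consider "fst p = fst q" "fst p = fst r" | "fst p = fst q" "fst p \<noteq> fst r" | "fst p = fst r" "fst p \<noteq> fst q"
      | "fst q = fst r" "fst q \<noteq> fst p" | "fst p \<noteq> fst q" "fst p \<noteq> fst r" "fst q \<noteq> fst r" by fastforce
    then show ?thesis
    proof cases
      case 1
      show ?thesis by (rule zero_same_translate[OF f J(1,2) c _ rel, of "fst p"]) (use pqr 1 in auto)
    next
      case 2
      show ?thesis by (rule zero_three_points[OF f pqr(2) 2 cn]) (use rel pqr in simp)
    next
      case 3
      show ?thesis by (rule zero_three_points[OF f pqr(3) 3 cn(1,3,2)]) (use rel pqr in \<open>simp add: perm\<close>)
    next
      case 4
      show ?thesis by (rule zero_three_points[OF f pqr(4) 4 cn(2,3,1)]) (use rel pqr in \<open>simp add: perm\<close>)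
    next
      case 5
      show ?thesis by (rule zero_distinct[OF f 5 cn]) (use rel pqr in simp)
    qed
  qed
qed

lemma weyl_dependent_card:
  assumes f: "f \<in> L2_real" "\<not> L2_zero f" and \<Lambda>: "finite \<Lambda>" and dep: "weyl_dependent f \<Lambda>"
  shows "4 \<le> card \<Lambda>"
proof (rule ccontr)
  assume "\<not> 4 \<le> card \<Lambda>"
  then have card: "card \<Lambda> \<le> 3" by simp
  have [measurable]: "f \<in> borel_measurable borel" using f by (simp add: L2_real_def)
  have "l2 f"
  proof -
    have "integrable lborel (\<lambda>x. (cmod (f x))\<^sup>2)" using f by (simp add: L2_real_def)
    then have "sq f < \<infinity>" by (simp add: integrable_iff_bounded sq_def)
    then show ?thesis by (simp add: l2_def)
  qed
  obtain c where c: "\<exists>z\<in>\<Lambda>. c z \<noteq> 0" "AE t in lborel. (\<Sum>z\<in>\<Lambda>. c z * weyl_shift z f t) = 0"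
    using dep by (auto simp: weyl_dependent_def L2_zero_def)
  define \<phi> where "\<phi> z = (fst z, 2 * pi * snd z)" for z :: "real \<times> real"
  \<comment> \<open>Zero coefficients are discarded, because the independence result is stated for
    relations with nonzero coefficients only.\<close>
  define J where "J = {z \<in> \<Lambda>. c z \<noteq> 0}"
  \<comment> \<open>The phase exp(-i pi a b) of the symmetric normalization moves into the
    coefficient, and frequencies are rescaled by 2 pi.\<close>
  define d where "d q = (let z = (fst q, snd q / (2 * pi)) in c z * iexp (- (pi * snd z * fst z)))" for q :: "real \<times> real"
  have inj: "inj_on \<phi> J" by (auto simp: inj_on_def \<phi>_def prod_eq_iff)
  have d: "d (\<phi> z) = c z * iexp (- (pi * snd z * fst z))" for z by (simp add: d_def \<phi>_def)
  have "wrel d f (\<phi> ` J)"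
    unfolding wrel_def sum.reindex[OF inj] o_def
    using c(2)
  proof eventually_elim
    case (elim t)
    have "d (\<phi> z) * iexp (snd (\<phi> z) * t) * f (t - fst (\<phi> z)) = c z * weyl_shift z f t" for z
    proof -
      have "iexp (- (pi * snd z * fst z)) * iexp (2 * pi * snd z * t) = exp (\<i> * of_real (2 * pi * snd z * (t - fst z / 2)))"
        unfolding iexp_add[symmetric] by (simp add: algebra_simps)
      then show ?thesis unfolding d by (simp add: \<phi>_def weyl_shift_def case_prod_unfold mult.assoc[symmetric] del: of_real_mult of_real_minus)
    qed
    moreover have "(\<Sum>z\<in>J. c z * weyl_shift z f t) = (\<Sum>z\<in>\<Lambda>. c z * weyl_shift z f t)"
      by (rule sum.mono_neutral_left) (use \<Lambda> in \<open>auto simp: J_def\<close>)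
    ultimately show ?case using elim by simp
  qed
  moreover have "finite (\<phi> ` J)" "\<phi> ` J \<noteq> {}" using \<Lambda> c(1) by (auto simp: J_def)
  moreover have "card (\<phi> ` J) \<le> 3"
  proof -
    have "card J \<le> card \<Lambda>" by (rule card_mono[OF \<Lambda>]) (auto simp: J_def)
    then show ?thesis unfolding card_image[OF inj] using card by linarith
  qed
  moreover have "d q \<noteq> 0" if "q \<in> \<phi> ` J" for q using that by (auto simp: d J_def)
  ultimately have "AE t in lborel. f t = 0" using three_points_independent[OF \<open>l2 f\<close>] by blast
  then show False using f by (simp add: L2_zero_def)
qed

text \<open>Bounds on f and x f give the integrable majorant (A^2 + B^2) / (1 + x^2). By continuity
  a nonzero value persists on an interval, which has positive measure; so being nonzero as a
  function and being nonzero almost everywhere in the sense of square-integrable classes agree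
  here.\<close>

lemma schwartz_nonzero_L2:
  assumes f: "f \<in> schwartz_space" "f \<noteq> (\<lambda>_. 0)" shows "f \<in> L2_real" "\<not> L2_zero f"
proof -
  obtain D where D: "D 0 = f" "\<And>k x. (D k has_vector_derivative D (Suc k) x) (at x)" "\<And>j k. bounded (range (\<lambda>x. x ^ j *\<^sub>R D k x))"
    using f(1) by (auto simp: schwartz_space_def)
  have cont: "continuous_on UNIV f"
    using D(2)[of 0] unfolding D(1) by (auto intro!: continuous_at_imp_continuous_on has_vector_derivative_continuous)
  then have m[measurable]: "f \<in> borel_measurable borel" by (rule borel_measurable_continuous_onI)
  obtain A where A: "\<And>x. norm (f x) \<le> A" using D(3)[of 0 0] by (auto simp: D(1) bounded_iff)
  obtain B where B: "\<And>x. \<bar>x\<bar> * norm (f x) \<le> B" using D(3)[of 1 0] by (auto simp: D(1) bounded_iff)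
  have le: "(norm (f x))\<^sup>2 \<le> (A\<^sup>2 + B\<^sup>2) * inverse (1 + x\<^sup>2)" for x
  proof -
    have "(norm (f x))\<^sup>2 \<le> A\<^sup>2" by (intro power_mono A) simp
    moreover have "(\<bar>x\<bar> * norm (f x))\<^sup>2 \<le> B\<^sup>2" by (intro power_mono B) simp
    moreover have "(norm (f x))\<^sup>2 * (1 + x\<^sup>2) = (norm (f x))\<^sup>2 + (\<bar>x\<bar> * norm (f x))\<^sup>2"
      by (simp add: power_mult_distrib algebra_simps)
    ultimately have "(norm (f x))\<^sup>2 * (1 + x\<^sup>2) \<le> A\<^sup>2 + B\<^sup>2" by linarith
    moreover have "0 < 1 + x\<^sup>2" by (simp add: add_pos_nonneg)
    ultimately show ?thesis by (simp add: field_simps)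
  qed
  have "integrable lborel (\<lambda>x::real. inverse (1 + x\<^sup>2))"
    using integrable_inverse_1_plus_square by (simp add: set_integrable_def)
  then have "integrable lborel (\<lambda>x. (A\<^sup>2 + B\<^sup>2) * inverse (1 + x\<^sup>2))" by simp
  then have "integrable lborel (\<lambda>x. (norm (f x))\<^sup>2)"
    by (rule Bochner_Integration.integrable_bound) (use le in \<open>auto intro!: AE_I2 order_trans[OF _ abs_ge_self]\<close>)
  then show "f \<in> L2_real" by (simp add: L2_real_def)
  show "\<not> L2_zero f"
  proof
    assume "L2_zero f"
    then have ae: "AE x in lborel. f x = 0" by (simp add: L2_zero_def)
    have op: "open {x. f x \<noteq> 0}" by (intro open_Collect_neq cont continuous_on_const)
    obtain x where "f x \<noteq> 0" using f(2) by auto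
    then obtain e where e: "e > 0" "ball x e \<subseteq> {x. f x \<noteq> 0}" using op open_contains_ball by blast
    have "AE y in lborel. y \<notin> {x - e/2..x + e/2}"
      using ae
    proof eventually_elim
      case (elim y)
      then have "y \<notin> ball x e" using e(2) by blast
      then show ?case using e(1) by (auto simp: dist_real_def abs_if split: if_splits)
    qed
    then have "emeasure lborel {x - e/2..x + e/2} = 0"
      by (rule AE_iff_measurable[THEN iffD1, rotated 2]) auto
    then show False using e(1) by simp
  qed
qed

theorem corollary1p2: "N_star = 4 \<and> N_star_schwartz = 4"
proof
  obtain f \<Lambda> where f: "f \<in> schwartz_space" "f \<noteq> (\<lambda>_. 0)" and \<Lambda>: "finite \<Lambda>" "card \<Lambda> = 4" "weyl_dependent f \<Lambda>"
    using four_points_schwartz by blast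
  note fL = schwartz_nonzero_L2[OF f]
  show "N_star = 4" unfolding N_star_def min_dependent_card_def
  proof (rule cInf_eq_minimum)
    show "4 \<in> {card \<Lambda> |\<Lambda>. finite \<Lambda> \<and> (\<exists>f\<in>{f \<in> L2_real. \<not> L2_zero f}. weyl_dependent f \<Lambda>)}"
      by (intro CollectI exI[of _ \<Lambda>] conjI bexI[of _ f]) (use fL \<Lambda> in auto)
  next
    fix n assume "n \<in> {card \<Lambda> |\<Lambda>. finite \<Lambda> \<and> (\<exists>f\<in>{f \<in> L2_real. \<not> L2_zero f}. weyl_dependent f \<Lambda>)}"
    then show "4 \<le> n" using weyl_dependent_card by auto
  qed
  show "N_star_schwartz = 4" unfolding N_star_schwartz_def min_dependent_card_def
  proof (rule cInf_eq_minimum)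
    show "4 \<in> {card \<Lambda> |\<Lambda>. finite \<Lambda> \<and> (\<exists>f\<in>{f \<in> schwartz_space. f \<noteq> (\<lambda>_. 0)}. weyl_dependent f \<Lambda>)}"
      by (intro CollectI exI[of _ \<Lambda>] conjI bexI[of _ f]) (use f \<Lambda> in auto)
  next
    fix n assume "n \<in> {card \<Lambda> |\<Lambda>. finite \<Lambda> \<and> (\<exists>f\<in>{f \<in> schwartz_space. f \<noteq> (\<lambda>_. 0)}. weyl_dependent f \<Lambda>)}"
    then obtain \<Lambda>' g where g: "n = card \<Lambda>'" "finite \<Lambda>'" "g \<in> schwartz_space" "g \<noteq> (\<lambda>_. 0)" "weyl_dependent g \<Lambda>'" by auto
    show "4 \<le> n" unfolding g(1) by (rule weyl_dependent_card[OF schwartz_nonzero_L2[OF g(3,4)] g(2,5)])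
  qed
qed

end
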